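(* Let $\mathcal V\to\Delta^{*r}$ be an admissible unipotent variation of graded-polarized mixed Hodge structure (i.e. the induced variations of pure Hodge structure on the weight graded-quotients are constant), with lifted period map $F:U^r\to\mathcal M$ and associated nilpotent orbit $F_{nilp}(z)=e^{\sum_jz_jN_j}.F_\infty$. Then the period map and the nilpotent orbit satisfy the strong distance estimate with respect to the standard metric: there exist constants $\alpha\ge1$, $K$ and $\beta_1,\dots,\beta_r$ such that $$d(F(z),F_{nilp}(z))\le K\sum_{j=1}^ry_j^{\beta_j}e^{-2\pi y_j}$$ for all $z=x+iy\in U^r$ with $y_1\ge y_2\ge\cdots\ge y_r>\alpha$.
   Context: Classifying space. $V$ is a finite-dimensional real vector space, $W$ an increasing filtration of $V$, $\langle\,,\rangle_w$ a non-degenerate bilinear form on $Gr^W_w$ for each $w$ (symmetric for $w$ even, skew for $w$ odd), and $h^{p,q}_w$ given Hodge numbers. $\mathcal M$ is the set of decreasing filtrations $F$ of $V_{\mathbb C}$ such that $(F,W)$ is a mixed Hodge structure whose graded pieces are polarized Hodge structures (by $\langle\,,\rangle_w$) with Hodge numbers $h^{p,q}_w$. $\check{\mathcal M}\supset\mathcal M$ is the flag manifold of decreasing filtrations with $\dim F^pGr^W_w/F^{p+1}Gr^W_w=h^{p,w-p}_w$ and $\langle F^pGr^W_w,F^qGr^W_w\rangle_w=0$ for $p+q>w$. $G_{\mathbb C}$ is the group of $g\in GL(V_{\mathbb C})$ preserving $W$ and inducing an isometry on each $Gr^W_w$; $\mathfrak g_{\mathbb C}$ is its Lie algebra. Standard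 metric. A mixed Hodge structure $(F,W)$ determines Deligne's unique functorial bigrading $V_{\mathbb C}=\bigoplus I^{p,q}_{(F,W)}$ with $F^p=\bigoplus_{a\ge p}I^{a,b}$, $W_k=\bigoplus_{a+b\le k}I^{a,b}$, $I^{p,q}\equiv\overline{I^{q,p}}$ mod $\bigoplus_{r<p,s<q}I^{r,s}$; it induces $\mathfrak g_{\mathbb C}=\bigoplus\mathfrak g^{p,q}$. For $F\in\mathcal M$, $h_F$ is the hermitian inner product on $V_{\mathbb C}$ making the bigrading orthogonal with $h_F(u,v)=i^{p-q}\langle Gr(u),Gr(\bar v)\rangle_{p+q}$ for $u,v\in I^{p,q}$. $T_F\mathcal M$ is identified with $\bigoplus_{p<0,p+q\le0}\mathfrak g^{p,q}$ via $v\mapsto\frac{d}{dt}e^{tv}.F|_{t=0}$, and the standard metric is $h_F(\alpha,\beta)=\mathrm{Tr}(\alpha\beta^* )$, $\beta^*$ the adjoint with respect to $h_F$ on $V_{\mathbb C}$. $d$ is the associated Riemannian distance on $\mathcal M$. Period map. $U^r$ is the product of $r$ upper half-planes with coordinates $z_j=x_j+iy_j$, covering $\Delta^{*r}$ by $s_j=e^{2\pi iz_j}$. The variation, with unipotent monodromy $T_j=e^{N_j}$, gives a holomorphic horizontal map $F:U^r\to\mathcal M$ with $F(\dots,z_j+1,\dots)=T_j.F(z)$. Admissibility (Steenbrink–Zucker, Kashiwara) includes that $e^{-\sum_jz_jN_j}.F(z)$ extends to a holomorphic map $\Delta^r\to\check{\mathcal M}$ in $s$, with value $F_\infty$ at $s=0$,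 and that the relative weight filtrations of $W$ with respect to the $N_j$ exist. *)

theory Defs
  imports "HOL-Analysis.Analysis"
begin

text \<open>
  The real vector space is \<open>V = real^'n\<close>, with complexification \<open>complex^'n\<close>; endomorphisms are
  square matrices.  Filtrations are indexed by the integers.  Quotients are not formed as types: a
  subspace of \<open>Gr\<^sub>w = W w / W (w - 1)\<close> is represented by its preimage in \<open>W w\<close>, and a form on
  \<open>Gr\<^sub>w\<close> by a function \<open>S w\<close> of which only the restriction to \<open>W w\<close> matters.
\<close>

type_synonym 'n rfilt = "int \<Rightarrow> (real^'n) set"
type_synonym 'n cfilt = "int \<Rightarrow> (complex^'n) set"
type_synonym 'n forms = "int \<Rightarrow> real^'n \<Rightarrow> real^'n \<Rightarrow> real"
type_synonym 'n bigrading = "int \<Rightarrow> int \<Rightarrow> (complex^'n) set"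


subsection \<open>Linear algebra\<close>

definition re_vec :: "complex^'n \<Rightarrow> real^'n" where
  "re_vec u = (\<chi> i. Re (u $ i))"

definition im_vec :: "complex^'n \<Rightarrow> real^'n" where
  "im_vec u = (\<chi> i. Im (u $ i))"

definition cnj_vec :: "complex^'n \<Rightarrow> complex^'n" where
  "cnj_vec u = (\<chi> i. cnj (u $ i))"

definition complexify :: "(real^'n) set \<Rightarrow> (complex^'n) set" where
  "complexify A = {u. re_vec u \<in> A \<and> im_vec u \<in> A}"

text \<open>The complex-bilinear extension of a real bilinear form.\<close>
definition cform :: "(real^'n \<Rightarrow> real^'n \<Rightarrow> real) \<Rightarrow> complex^'n \<Rightarrow> complex^'n \<Rightarrow> complex" where
  "cform s u v = Complex (s (re_vec u) (re_vec v) - s (im_vec u) (im_vec v))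
                         (s (re_vec u) (im_vec v) + s (im_vec u) (re_vec v))"

abbreviation cmat :: "real^'n^'n \<Rightarrow> complex^'n^'n" where
  "cmat \<equiv> map_matrix complex_of_real"

definition mpow :: "'a::semiring_1^'n^'n \<Rightarrow> nat \<Rightarrow> 'a^'n^'n" where
  "mpow A k = ((**) A ^^ k) (mat 1)"

definition mexp :: "'a::real_normed_field^'n^'n \<Rightarrow> 'a^'n^'n" where
  "mexp A = (\<Sum>k. (1 / fact k) *\<^sub>R mpow A k)"

definition subspace_sum :: "(complex^'n) set \<Rightarrow> (complex^'n) set \<Rightarrow> (complex^'n) set" where
  "subspace_sum A B = {x + y | x y. x \<in> A \<and> y \<in> B}"


subsection \<open>Filtered space with graded polarization forms\<close>

definition finite_increasing_filtration :: "'n::finite rfilt \<Rightarrow> bool" where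
  "finite_increasing_filtration W \<longleftrightarrow>
     (\<forall>k. subspace (W k)) \<and> (\<forall>k l. k \<le> l \<longrightarrow> W k \<subseteq> W l) \<and>
     (\<exists>k. W k = {0}) \<and> (\<exists>k. W k = UNIV)"

definition finite_decreasing_filtration :: "'n::finite cfilt \<Rightarrow> bool" where
  "finite_decreasing_filtration F \<longleftrightarrow>
     (\<forall>p. vec.subspace (F p)) \<and> (\<forall>p q. p \<le> q \<longrightarrow> F q \<subseteq> F p) \<and>
     (\<exists>p. F p = UNIV) \<and> (\<exists>p. F p = {0})"

text \<open>
  The last clause says that the radical of \<open>S w\<close> on \<open>W w\<close> is exactly \<open>W (w - 1)\<close>, i.e. that the
  form descends to \<open>Gr\<^sub>w\<close> and is non-degenerate there.
\<close>
definition graded_forms :: "'n::finite rfilt \<Rightarrow> 'n forms \<Rightarrow> bool" where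
  "graded_forms W S \<longleftrightarrow> (\<forall>w.
     (\<forall>u\<in>W w. \<forall>u'\<in>W w. \<forall>v\<in>W w. \<forall>c.
        S w (u + u') v = S w u v + S w u' v \<and> S w (c *\<^sub>R u) v = c * S w u v \<and>
        S w v (u + u') = S w v u + S w v u' \<and> S w v (c *\<^sub>R u) = c * S w v u) \<and>
     (\<forall>u\<in>W w. \<forall>v\<in>W w. S w v u = (if even w then S w u v else - S w u v)) \<and>
     (\<forall>u\<in>W w. (\<forall>v\<in>W w. S w u v = 0) \<longleftrightarrow> u \<in> W (w - 1)))"


subsection \<open>Mixed Hodge structures and classifying spaces\<close>

text \<open>Preimage in \<open>W\<^sub>w\<close> (complexified) of \<open>F\<^sup>p Gr\<^sub>w\<close>.\<close>
definition FGr :: "'n rfilt \<Rightarrow> 'n cfilt \<Rightarrow> int \<Rightarrow> int \<Rightarrow> (complex^'n) set" where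
  "FGr W F p w = subspace_sum (F p \<inter> complexify (W w)) (complexify (W (w - 1)))"

text \<open>\<open>Gr\<^sub>w\<close> is the direct sum of \<open>F\<^sup>p\<close> and the conjugate of \<open>F\<^sup>w\<^sup>-\<^sup>p\<^sup>+\<^sup>1\<close>, for all \<open>p\<close> and \<open>w\<close>.\<close>
definition mixed_hodge_structure :: "'n::finite rfilt \<Rightarrow> 'n cfilt \<Rightarrow> bool" where
  "mixed_hodge_structure W F \<longleftrightarrow>
     finite_increasing_filtration W \<and> finite_decreasing_filtration F \<and>
     (\<forall>p w. subspace_sum (FGr W F p w) (cnj_vec ` FGr W F (w - p + 1) w) = complexify (W w) \<and>
            FGr W F p w \<inter> cnj_vec ` FGr W F (w - p + 1) w = complexify (W (w - 1)))"

definition bilinear_relation :: "'n::finite rfilt \<Rightarrow> 'n forms \<Rightarrow> 'n cfilt \<Rightarrow> bool" where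
  "bilinear_relation W S F \<longleftrightarrow>
     (\<forall>w p q. p + q > w \<longrightarrow> (\<forall>u\<in>FGr W F p w. \<forall>v\<in>FGr W F q w. cform (S w) u v = 0))"

definition graded_polarized :: "'n::finite rfilt \<Rightarrow> 'n forms \<Rightarrow> 'n cfilt \<Rightarrow> bool" where
  "graded_polarized W S F \<longleftrightarrow> bilinear_relation W S F \<and>
     (\<forall>p q. \<forall>u \<in> FGr W F p (p + q) \<inter> cnj_vec ` FGr W F q (p + q) - complexify (W (p + q - 1)).
        let c = \<i> powi (p - q) * cform (S (p + q)) u (cnj_vec u) in c \<in> \<real> \<and> Re c > 0)"

text \<open>\<open>hn p q\<close> is the Hodge number of type \<open>(p, q)\<close>, in weight \<open>p + q\<close>.\<close>
definition M_check :: "'n::finite rfilt \<Rightarrow> 'n forms \<Rightarrow> (int \<Rightarrow> int \<Rightarrow> nat) \<Rightarrow> 'n cfilt set" where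
  "M_check W S hn = {F. finite_decreasing_filtration F \<and> bilinear_relation W S F \<and>
     (\<forall>p w. vec.dim (FGr W F p w) = vec.dim (FGr W F (p + 1) w) + hn p (w - p))}"

definition classifying_space :: "'n::finite rfilt \<Rightarrow> 'n forms \<Rightarrow> (int \<Rightarrow> int \<Rightarrow> nat) \<Rightarrow> 'n cfilt set" where
  "classifying_space W S hn =
     {F \<in> M_check W S hn. mixed_hodge_structure W F \<and> graded_polarized W S F}"

definition filt_act :: "complex^'n^'n \<Rightarrow> 'n cfilt \<Rightarrow> 'n cfilt" where
  "filt_act g F = (\<lambda>p. (*v) g ` F p)"

definition G_C :: "'n rfilt \<Rightarrow> 'n forms \<Rightarrow> (complex^'n^'n) set" where
  "G_C W S = {g. invertible g \<and> (\<forall>w. (*v) g ` complexify (W w) = complexify (W w)) \<and>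
     (\<forall>w. \<forall>u\<in>complexify (W w). \<forall>v\<in>complexify (W w).
        cform (S w) (g *v u) (g *v v) = cform (S w) u v)}"

definition lie_G_C :: "'n rfilt \<Rightarrow> 'n forms \<Rightarrow> (complex^'n^'n) set" where
  "lie_G_C W S = {X. \<forall>t::real. mexp (t *\<^sub>R X) \<in> G_C W S}"


subsection \<open>Deligne bigrading and standard metric\<close>

definition is_deligne_bigrading :: "'n::finite rfilt \<Rightarrow> 'n cfilt \<Rightarrow> 'n bigrading \<Rightarrow> bool" where
  "is_deligne_bigrading W F I \<longleftrightarrow>
     (\<forall>p q. vec.subspace (I p q)) \<and>
     vec.span (\<Union>a b. I a b) = UNIV \<and>
     (\<forall>p q. I p q \<inter> vec.span (\<Union>(a, b) \<in> - {(p, q)}. I a b) = {0}) \<and>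
     (\<forall>p. F p = vec.span (\<Union>(a, b) \<in> {(a, b). a \<ge> p}. I a b)) \<and>
     (\<forall>k. complexify (W k) = vec.span (\<Union>(a, b) \<in> {(a, b). a + b \<le> k}. I a b)) \<and>
     (\<forall>p q. let R = vec.span (\<Union>(r, s) \<in> {(r, s). r < p \<and> s < q}. I r s)
            in subspace_sum (I p q) R = subspace_sum (cnj_vec ` I q p) R)"

text \<open>By Deligne, such a bigrading exists and is unique for every mixed Hodge structure.\<close>
definition deligne :: "'n::finite rfilt \<Rightarrow> 'n cfilt \<Rightarrow> 'n bigrading" where
  "deligne W F = (THE I. is_deligne_bigrading W F I)"

definition bigr_proj :: "'n bigrading \<Rightarrow> int \<Rightarrow> int \<Rightarrow> complex^'n \<Rightarrow> complex^'n" where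
  "bigr_proj I p q u =
     (THE x. x \<in> I p q \<and> u - x \<in> vec.span (\<Union>(a, b) \<in> - {(p, q)}. I a b))"

text \<open>The sum is over the finitely many nonzero components.\<close>
definition hodge_inner :: "'n rfilt \<Rightarrow> 'n forms \<Rightarrow> 'n cfilt \<Rightarrow> complex^'n \<Rightarrow> complex^'n \<Rightarrow> complex" where
  "hodge_inner W S F u v = (let I = deligne W F in
     \<Sum>(p, q) \<in> {(p, q). I p q \<noteq> {0}}.
       \<i> powi (p - q) * cform (S (p + q)) (bigr_proj I p q u) (cnj_vec (bigr_proj I p q v)))"

definition hodge_adjoint :: "'n rfilt \<Rightarrow> 'n forms \<Rightarrow> 'n cfilt \<Rightarrow> complex^'n^'n \<Rightarrow> complex^'n^'n" where
  "hodge_adjoint W S F B =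
     (THE B'. \<forall>u v. hodge_inner W S F (B *v u) v = hodge_inner W S F u (B' *v v))"

definition std_metric :: "'n rfilt \<Rightarrow> 'n forms \<Rightarrow> 'n cfilt \<Rightarrow> complex^'n^'n \<Rightarrow> complex^'n^'n \<Rightarrow> complex" where
  "std_metric W S F A B = trace (A ** hodge_adjoint W S F B)"

definition std_norm :: "'n rfilt \<Rightarrow> 'n forms \<Rightarrow> 'n cfilt \<Rightarrow> complex^'n^'n \<Rightarrow> real" where
  "std_norm W S F A = sqrt (Re (std_metric W S F A A))"

definition lie_component :: "'n rfilt \<Rightarrow> 'n forms \<Rightarrow> 'n cfilt \<Rightarrow> int \<Rightarrow> int \<Rightarrow> (complex^'n^'n) set" where
  "lie_component W S F p q = {X \<in> lie_G_C W S.
     \<forall>a b. \<forall>u \<in> deligne W F a b. X *v u \<in> deligne W F (a + p) (b + q)}"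

text \<open>
  The model of the tangent space at \<open>F\<close>.  The real span suffices, as the summands are complex
  subspaces.
\<close>
definition tangent_model :: "'n rfilt \<Rightarrow> 'n forms \<Rightarrow> 'n cfilt \<Rightarrow> (complex^'n^'n) set" where
  "tangent_model W S F =
     span (\<Union>(p, q) \<in> {(p, q). p < 0 \<and> p + q \<le> 0}. lie_component W S F p q)"


subsection \<open>Calculus on flag manifolds\<close>

text \<open>
  A flag manifold carries the quotient structure of a homogeneous space of the general linear group.
  Hence maps into it are holomorphic, or continuously differentiable, iff near each point \<open>x\<close> of the
  domain they have the form \<open>y \<mapsto> g y . \<Phi> x\<close> with \<open>g\<close> of that class, \<open>g x = 1\<close>; and
  two lifts of this form have the same velocity at \<open>x\<close> iff their derivatives differ by an element
  of the stabilizer algebra of \<open>\<Phi> x\<close>.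
\<close>
definition flag_lift :: "('a \<Rightarrow> 'n cfilt) \<Rightarrow> 'a set \<Rightarrow> 'a \<Rightarrow> ('a \<Rightarrow> complex^'n^'n) \<Rightarrow> bool" where
  "flag_lift \<Phi> A x g \<longleftrightarrow>
     g x = mat 1 \<and> (\<forall>y\<in>A. invertible (g y) \<and> \<Phi> y = filt_act (g y) (\<Phi> x))"

definition holomorphic_matrix_on :: "(complex^'r \<Rightarrow> complex^'n^'n) \<Rightarrow> (complex^'r) set \<Rightarrow> bool" where
  "holomorphic_matrix_on g A \<longleftrightarrow> (\<forall>z\<in>A. \<exists>D. (g has_derivative D) (at z) \<and>
     (\<forall>c v a b. D (c *s v) $ a $ b = c * D v $ a $ b))"

definition holomorphic_flag_map :: "(complex^'r \<Rightarrow> 'n::finite cfilt) \<Rightarrow> (complex^'r) set \<Rightarrow> bool" where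
  "holomorphic_flag_map \<Phi> U \<longleftrightarrow> (\<forall>z\<in>U. \<exists>A g. open A \<and> z \<in> A \<and> A \<subseteq> U \<and>
     flag_lift \<Phi> A z g \<and> holomorphic_matrix_on g A)"

text \<open>Griffiths transversality: the partial derivatives of \<open>\<Phi>\<^sup>p\<close> lie in \<open>\<Phi>\<^sup>p\<^sup>-\<^sup>1\<close>.\<close>
definition horizontal_flag_map :: "(complex^'r \<Rightarrow> 'n::finite cfilt) \<Rightarrow> (complex^'r) set \<Rightarrow> bool" where
  "horizontal_flag_map \<Phi> U \<longleftrightarrow> (\<forall>z\<in>U. \<forall>A g. open A \<and> z \<in> A \<and> A \<subseteq> U \<and>
     flag_lift \<Phi> A z g \<and> holomorphic_matrix_on g A \<longrightarrow>
     (\<forall>j p. \<forall>u \<in> \<Phi> z p. frechet_derivative g (at z) (axis j 1) *v u \<in> \<Phi> z (p - 1)))"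

definition C1_flag_path :: "(real \<Rightarrow> 'n::finite cfilt) \<Rightarrow> real \<Rightarrow> real \<Rightarrow> bool" where
  "C1_flag_path \<gamma> a b \<longleftrightarrow> (\<forall>t\<in>{a..b}. \<exists>e>0. \<exists>g g'.
     flag_lift \<gamma> ({a..b} \<inter> ball t e) t g \<and>
     (\<forall>s\<in>{a..b} \<inter> ball t e. (g has_vector_derivative g' s) (at s within {a..b})) \<and>
     continuous_on ({a..b} \<inter> ball t e) g')"

text \<open>The velocity of \<open>\<gamma>\<close> at time \<open>t\<close> equals that of \<open>s \<mapsto> e\<^sup>s\<^sup>X . \<gamma> t\<close> at \<open>s = 0\<close>.\<close>
definition flag_velocity :: "(real \<Rightarrow> 'n cfilt) \<Rightarrow> real \<Rightarrow> real \<Rightarrow> real \<Rightarrow> complex^'n^'n \<Rightarrow> bool" where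
  "flag_velocity \<gamma> a b t X \<longleftrightarrow> (\<exists>e>0. \<exists>g D.
     flag_lift \<gamma> ({a..b} \<inter> ball t e) t g \<and>
     (g has_vector_derivative D) (at t within {a..b}) \<and>
     (\<forall>p. \<forall>u \<in> \<gamma> t p. (X - D) *v u \<in> \<gamma> t p))"


subsection \<open>Riemannian distance\<close>

text \<open>Piecewise continuously differentiable paths, with their lengths in the standard metric.\<close>
inductive std_path_length ::
  "'n::finite rfilt \<Rightarrow> 'n forms \<Rightarrow> (int \<Rightarrow> int \<Rightarrow> nat) \<Rightarrow> 'n cfilt \<Rightarrow> 'n cfilt \<Rightarrow> real \<Rightarrow> bool"
  for W S hn where
  C1_piece: "a < b \<Longrightarrow> \<forall>t\<in>{a..b}. \<gamma> t \<in> classifying_space W S hn \<Longrightarrow> C1_flag_path \<gamma> a b \<Longrightarrow>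
     \<forall>t\<in>{a..b}. v t \<in> tangent_model W S (\<gamma> t) \<and> flag_velocity \<gamma> a b t (v t) \<Longrightarrow>
     std_path_length W S hn (\<gamma> a) (\<gamma> b) (integral {a..b} (\<lambda>t. std_norm W S (\<gamma> t) (v t)))"
| concat: "std_path_length W S hn F F' L \<Longrightarrow> std_path_length W S hn F' F'' L' \<Longrightarrow>
     std_path_length W S hn F F'' (L + L')"

text \<open>
  Extended-real valued: the distance is infinite if there is no path, in particular if one of the
  points does not lie in the classifying space.
\<close>
definition std_dist ::
  "'n::finite rfilt \<Rightarrow> 'n forms \<Rightarrow> (int \<Rightarrow> int \<Rightarrow> nat) \<Rightarrow> 'n cfilt \<Rightarrow> 'n cfilt \<Rightarrow> ereal" where
  "std_dist W S hn F F' = Inf {ereal L | L. std_path_length W S hn F F' L}"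


subsection \<open>Period maps\<close>

definition upper_half :: "(complex^'r) set" where
  "upper_half = {z. \<forall>j. Im (z $ j) > 0}"

definition polydisc :: "(complex^'r) set" where
  "polydisc = {s. \<forall>j. norm (s $ j) < 1}"

definition covering_map :: "complex^'r \<Rightarrow> complex^'r" where
  "covering_map z = (\<chi> j. exp (2 * of_real pi * \<i> * z $ j))"

definition lin_comb :: "('r::finite \<Rightarrow> real^'n^'n) \<Rightarrow> complex^'r \<Rightarrow> complex^'n^'n" where
  "lin_comb N z = (\<chi> a b. \<Sum>j\<in>UNIV. z $ j * complex_of_real (N j $ a $ b))"

text \<open>
  Lifted period map of a variation of graded-polarized mixed Hodge structure over the \<open>r\<close>-fold
  product of punctured discs, with unipotent monodromy logarithms \<open>N j\<close>.
\<close>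
definition period_map ::
  "'n rfilt \<Rightarrow> 'n forms \<Rightarrow> (int \<Rightarrow> int \<Rightarrow> nat) \<Rightarrow> ('r::finite \<Rightarrow> real^'n^'n) \<Rightarrow>
     (complex^'r \<Rightarrow> 'n cfilt) \<Rightarrow> bool" where
  "period_map W S hn N F \<longleftrightarrow>
     (\<forall>j. \<exists>k. mpow (N j) k = 0) \<and> (\<forall>i j. N i ** N j = N j ** N i) \<and>
     (\<forall>j. cmat (mexp (N j)) \<in> G_C W S) \<and>
     (\<forall>z\<in>upper_half. F z \<in> classifying_space W S hn) \<and>
     holomorphic_flag_map F upper_half \<and> horizontal_flag_map F upper_half \<and>
     (\<forall>z\<in>upper_half. \<forall>j. F (z + axis j 1) = filt_act (cmat (mexp (N j))) (F z))"

text \<open>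
  The variations induced on the weight-graded quotients are constant: the monodromy acts trivially
  there, and the induced filtrations do not depend on the point.
\<close>
definition unipotent_variation ::
  "'n rfilt \<Rightarrow> ('r::finite \<Rightarrow> real^'n^'n) \<Rightarrow> (complex^'r \<Rightarrow> 'n cfilt) \<Rightarrow> bool" where
  "unipotent_variation W N F \<longleftrightarrow>
     (\<forall>j w. \<forall>u\<in>W w. mexp (N j) *v u - u \<in> W (w - 1)) \<and>
     (\<forall>z\<in>upper_half. \<forall>z'\<in>upper_half. \<forall>p w. FGr W (F z) p w = FGr W (F z') p w)"

text \<open>
  \<open>YG l w\<close> is the preimage in \<open>W w\<close> of the filtration induced by \<open>Y\<close> on \<open>Gr\<^sub>w\<close>; the last two
  clauses say that \<open>N\<^sup>k\<close> is injective and surjective from degree \<open>w + k\<close> to degree \<open>w - k\<close> of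
  the grading of \<open>Gr\<^sub>w\<close> by \<open>Y\<close>.
\<close>
definition is_relative_weight_filtration :: "'n rfilt \<Rightarrow> real^'n^'n \<Rightarrow> 'n rfilt \<Rightarrow> bool" where
  "is_relative_weight_filtration W N Y \<longleftrightarrow>
     finite_increasing_filtration Y \<and> (\<forall>k. (*v) N ` Y k \<subseteq> Y (k - 2)) \<and>
     (let YG = (\<lambda>l w. {x + y | x y. x \<in> Y l \<inter> W w \<and> y \<in> W (w - 1)}) in
      \<forall>w. \<forall>k>0.
        (\<forall>u \<in> YG (w + int k) w.
           mpow N k *v u \<in> YG (w - int k - 1) w \<longrightarrow> u \<in> YG (w + int k - 1) w) \<and>
        (\<forall>v \<in> YG (w - int k) w.
           \<exists>u \<in> YG (w + int k) w. v - mpow N k *v u \<in> YG (w - int k - 1) w))"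

text \<open>\<open>\<Psi>\<close> is the extension over the polydisc of the untwisted period map; it is unique.\<close>
definition admissible_with_extension ::
  "'n rfilt \<Rightarrow> 'n forms \<Rightarrow> (int \<Rightarrow> int \<Rightarrow> nat) \<Rightarrow> ('r::finite \<Rightarrow> real^'n^'n) \<Rightarrow>
     (complex^'r \<Rightarrow> 'n cfilt) \<Rightarrow> (complex^'r \<Rightarrow> 'n cfilt) \<Rightarrow> bool" where
  "admissible_with_extension W S hn N F \<Psi> \<longleftrightarrow>
     (\<forall>s\<in>polydisc. \<Psi> s \<in> M_check W S hn) \<and> holomorphic_flag_map \<Psi> polydisc \<and>
     (\<forall>z\<in>upper_half. \<Psi> (covering_map z) = filt_act (mexp (lin_comb N (- z))) (F z)) \<and>
     (\<forall>j. \<exists>Y. is_relative_weight_filtration W (N j) Y)"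

definition nilpotent_orbit ::
  "('r::finite \<Rightarrow> real^'n^'n) \<Rightarrow> 'n cfilt \<Rightarrow> complex^'r \<Rightarrow> 'n cfilt" where
  "nilpotent_orbit N F_inf z = filt_act (mexp (lin_comb N z)) F_inf"

end

theory Submission
  imports Defs "HOL-Complex_Analysis.Cauchy_Integral_Formula"
begin

text \<open>
  Since the graded variations are constant, the monodromy logarithms act trivially on the graded
  quotients, the relative weight filtrations coincide with \<open>W\<close>, and \<open>N j\<close> maps \<open>W k\<close> into
  \<open>W (k - 2)\<close>.  The limit \<open>\<Psi> 0\<close> is a point of the classifying space, near which
  \<open>\<Psi> s = (1 + B s) . \<Psi> 0\<close> with \<open>B\<close> holomorphic and nilpotent, and horizontality makes \<open>N i\<close> a
  morphism of type \<open>(-1, -1)\<close> which commutes with \<open>B s\<close> as soon as \<open>s i = 0\<close>.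

  The path from the period map to the nilpotent orbit is composed of one segment for each index \<open>b\<close>,
  on which the coordinate \<open>s b\<close> is deformed to \<open>0\<close> while the coordinates before \<open>b\<close> are already
  \<open>0\<close>.  On this segment the \<open>N i\<close> with \<open>i < b\<close> and the real part of \<open>z\<close> transport the Deligne
  bigrading, so that the frames which compute the metric grow only polynomially in the largest of
  the remaining imaginary parts, \<open>y b\<close>, whereas the velocity is of size \<open>exp (- 2 \<pi> y b)\<close>.
\<close>


subsection \<open>Matrix algebra\<close>

text \<open>A single straight segment from \<open>B s\<close> to \<open>0\<close> would pair the
  growth of the metric, a power of the largest imaginary part, with a velocity governed by the
  smallest one, and no power of the smallest absorbs that. Removing the coordinates one at a time,
  largest imaginary part first, ties both factors to the same \<open>y b\<close>. The obstacle is
  then that the \<open>N i\<close> with \<open>i < b\<close> have unbounded \<open>y i\<close> and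
  must cost nothing. A general unipotent element does not transport the Deligne bigrading. Real
  elements do, and so do exponentials of endomorphisms all of whose types are negative in both
  indices, such as morphisms of type (-1,-1). Commutation with \<open>B s\<close> keeps
  \<open>N i\<close> such a morphism at the deformed point, so these factors become part of the
  frame and cancel. For the remaining factor an adapted frame is obtained by correcting an
  approximate one, weight by weight; nilpotency makes every series finite and every bound
  polynomial. In all these frames the hermitian form has the same matrix, because it sees only the
  graded quotients. Hence lengths reduce to entrywise bounds on frames and their inverses.\<close>

lemma mat_distrib_left: "A ** (B + C) = A ** B + A ** (C :: complex^'n::finite^'n)"
  and mat_distrib_right: "(A + B) ** C = A ** C + B ** (C :: complex^'n::finite^'n)"
  and mat_diff_left: "A ** (B - C) = A ** B - A ** (C :: complex^'n::finite^'n)"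
  and mat_diff_right: "(A - B) ** C = A ** C - B ** (C :: complex^'n::finite^'n)"
  and mat_minus_left: "(- A) ** B = - (A ** (B :: complex^'n::finite^'n))"
  and mat_minus_right: "A ** (- B) = - (A ** (B :: complex^'n::finite^'n))"
  by (simp_all add: vec_eq_iff matrix_matrix_mult_def sum.distrib sum_subtractf sum_negf algebra_simps)

lemmas mat_ring = mat_distrib_left mat_distrib_right mat_diff_left mat_diff_right
  mat_minus_left mat_minus_right

lemmas mat_assoc = matrix_mul_assoc[symmetric]

definition cnj_mat :: "complex^'n::finite^'m::finite \<Rightarrow> complex^'n^'m" where
  "cnj_mat A = map_matrix cnj A"

lemma cnj_mat_nth [simp]: "cnj_mat A $ i $ j = cnj (A $ i $ j)"
  by (simp add: cnj_mat_def map_matrix_def)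

lemma cnj_vec_nth [simp]: "cnj_vec u $ i = cnj (u $ i)"
  by (simp add: cnj_vec_def)

lemma cnj_mat_mult: "cnj_mat (A ** B) = cnj_mat A ** cnj_mat B"
  by (simp add: vec_eq_iff matrix_matrix_mult_def)

lemma cnj_mat_add: "cnj_mat (A + B) = cnj_mat A + cnj_mat B"
  and cnj_mat_diff: "cnj_mat (A - B) = cnj_mat A - cnj_mat B"
  and cnj_mat_uminus: "cnj_mat (- A) = - cnj_mat A"
  by (simp_all add: vec_eq_iff)

lemma cnj_mat_zero [simp]: "cnj_mat 0 = 0"
  by (simp add: vec_eq_iff)

lemma cnj_mat_one [simp]: "cnj_mat (mat 1) = mat 1"
  by (simp add: vec_eq_iff mat_def)

lemma cnj_mat_cnj_mat [simp]: "cnj_mat (cnj_mat A) = A"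
  by (simp add: vec_eq_iff)

lemma cnj_mat_cmat [simp]: "cnj_mat (cmat A) = cmat A"
  by (simp add: vec_eq_iff map_matrix_def)

lemma cnj_vec_mult: "cnj_vec (A *v x) = cnj_mat A *v cnj_vec x"
  by (simp add: vec_eq_iff matrix_vector_mult_def)

lemma cnj_vec_cnj_vec [simp]: "cnj_vec (cnj_vec u) = u"
  by (simp add: vec_eq_iff)

lemma cnj_vec_add: "cnj_vec (u + v) = cnj_vec u + cnj_vec v"
  and cnj_vec_diff: "cnj_vec (u - v) = cnj_vec u - cnj_vec v"
  by (simp_all add: vec_eq_iff)

lemma cnj_vec_scale: "cnj_vec (c *s u) = cnj c *s cnj_vec u"
  by (simp add: vec_eq_iff)

lemma cnj_vec_zero [simp]: "cnj_vec 0 = 0"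
  by (simp add: vec_eq_iff)

lemma scaleR_mat_mult:
  fixes A :: "complex^'n::finite^'n"
  shows "(c *\<^sub>R A) ** B = c *\<^sub>R (A ** B)" "A ** (c *\<^sub>R B) = c *\<^sub>R (A ** B)"
  by (simp_all add: vec_eq_iff matrix_matrix_mult_def scaleR_sum_right)

lemma sum_mat_mult:
  fixes A :: "complex^'n::finite^'n"
  shows "(\<Sum>i\<in>S. f i) ** A = (\<Sum>i\<in>S. f i ** A)" "A ** (\<Sum>i\<in>S. f i) = (\<Sum>i\<in>S. A ** f i)"
  by (induction S rule: infinite_finite_induct) (auto simp: mat_ring)

lemma matrix_mult_nth: "(A ** B) $ i $ j = (\<Sum>k\<in>UNIV. A $ i $ k * B $ k $ j)"
  by (simp add: matrix_matrix_mult_def)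

lemma matrix_column_nth:
  fixes A :: "complex^'n::finite^'m::finite"
  shows "(A *v axis j 1) $ i = A $ i $ j"
  by (simp add: matrix_vector_mult_def axis_def if_distrib cong: if_cong)

lemma commute_mult:
  fixes A B C :: "complex^'n::finite^'n"
  assumes "A ** B = B ** A" "A ** C = C ** A"
  shows "A ** (B ** C) = (B ** C) ** A"
  by (metis assms matrix_mul_assoc)

lemma left_inverse_unique:
  fixes A B C :: "complex^'n::finite^'n"
  assumes "A ** B = mat 1" "C ** A = mat 1"
  shows "B = C"
  by (metis assms matrix_mul_assoc matrix_mul_lid matrix_mul_rid)


subsection \<open>A submultiplicative matrix norm\<close>

text \<open>The entrywise sum is submultiplicative, invariant under conjugation and transposition,
  and does not grow when entries are deleted. The identity has norm \<open>CARD('n)\<close>, which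
  is the source of that factor in later constants.\<close>

definition mnorm :: "complex^'n::finite^'n \<Rightarrow> real" where
  "mnorm A = (\<Sum>i\<in>UNIV. \<Sum>j\<in>UNIV. cmod (A $ i $ j))"

lemma mnorm_nonneg [simp]: "0 \<le> mnorm A"
  by (simp add: mnorm_def sum_nonneg)

lemma mnorm_add: "mnorm (A + B) \<le> mnorm A + mnorm B"
  unfolding mnorm_def sum.distrib[symmetric]
  by (intro sum_mono) (simp add: norm_triangle_ineq)

lemma mnorm_uminus [simp]: "mnorm (- A) = mnorm A"
  by (simp add: mnorm_def)

lemma mnorm_diff: "mnorm (A - B) \<le> mnorm A + mnorm B"
  using mnorm_add[of A "- B"] by simp

lemma mnorm_zero [simp]: "mnorm 0 = 0"
  by (simp add: mnorm_def)

lemma mnorm_scaleR: "mnorm (c *\<^sub>R A) = \<bar>c\<bar> * mnorm A"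
  by (simp add: mnorm_def sum_distrib_left)

lemma mnorm_cnj [simp]: "mnorm (cnj_mat A) = mnorm A"
  by (simp add: mnorm_def)

lemma mnorm_entry: "cmod (A $ i $ j) \<le> mnorm A"
proof -
  have "cmod (A $ i $ j) \<le> (\<Sum>j\<in>UNIV. cmod (A $ i $ j))"
    by (rule member_le_sum) auto
  also have "\<dots> \<le> mnorm A"
    unfolding mnorm_def by (rule member_le_sum) (auto intro: sum_nonneg)
  finally show ?thesis .
qed

lemma mnorm_mult: "mnorm (A ** B) \<le> mnorm A * mnorm B"
proof -
  have "mnorm (A ** B) \<le> (\<Sum>i\<in>UNIV. \<Sum>j\<in>UNIV. \<Sum>k\<in>UNIV. cmod (A $ i $ k) * cmod (B $ k $ j))"
    unfolding mnorm_def matrix_mult_nth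
    by (intro sum_mono order_trans[OF norm_sum] order_eq_refl sum.cong refl norm_mult)
  also have "\<dots> = (\<Sum>i\<in>UNIV. \<Sum>k\<in>UNIV. cmod (A $ i $ k) * (\<Sum>j\<in>UNIV. cmod (B $ k $ j)))"
    unfolding sum_distrib_left by (intro sum.cong refl sum.swap)
  also have "\<dots> \<le> (\<Sum>i\<in>UNIV. \<Sum>k\<in>UNIV. cmod (A $ i $ k) * mnorm B)"
    unfolding mnorm_def
    by (intro sum_mono mult_left_mono member_le_sum) (auto intro: sum_nonneg)
  also have "\<dots> = mnorm A * mnorm B"
    by (simp add: mnorm_def sum_distrib_right)
  finally show ?thesis .
qed

lemma mnorm_mult_le: "mnorm A \<le> a \<Longrightarrow> mnorm B \<le> b \<Longrightarrow> mnorm (A ** B) \<le> a * b"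
  by (rule order_trans[OF mnorm_mult mult_mono]) (auto intro: order_trans[OF mnorm_nonneg])

lemma mnorm_sum: "mnorm (\<Sum>i\<in>S. f i) \<le> (\<Sum>i\<in>S. mnorm (f i))"
  by (induction S rule: infinite_finite_induct)
     (auto intro: order_trans[OF mnorm_add] simp: add_mono)

lemma mnorm_one: "mnorm (mat 1 :: complex^'n::finite^'n) = real CARD('n)"
  by (simp add: mnorm_def mat_def if_distrib cong: if_cong)

lemma mnorm_mono: "(\<And>i j. cmod (A $ i $ j) \<le> cmod (B $ i $ j)) \<Longrightarrow> mnorm A \<le> mnorm B"
  unfolding mnorm_def by (intro sum_mono) auto


subsection \<open>Powers and exponentials of nilpotent matrices\<close>

lemma mpow_0 [simp]: "mpow A 0 = mat 1"
  by (simp add: mpow_def)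

lemma mpow_Suc: "mpow A (Suc k) = A ** mpow A k"
  by (simp add: mpow_def)

lemma mpow_add: "mpow A (k + l) = mpow A k ** mpow (A :: 'a::semiring_1^'n::finite^'n) l"
  by (induction k) (auto simp: mpow_Suc matrix_mul_assoc)

lemma mpow_commute: "A ** B = B ** A \<Longrightarrow> A ** mpow B k = mpow B k ** (A :: complex^'n::finite^'n)"
  by (induction k) (auto simp: mpow_Suc intro: commute_mult)

lemma mpow_scaleR: "mpow (c *\<^sub>R A) k = c ^ k *\<^sub>R mpow (A :: complex^'n::finite^'n) k"
  by (induction k) (auto simp: mpow_Suc scaleR_mat_mult)

lemma mpow_zero_mono:
  assumes "mpow (A :: 'a::semiring_1^'n::finite^'n) m = 0" "m \<le> k"
  shows "mpow A k = 0"
proof -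
  have "mpow A k = mpow A m ** mpow A (k - m)"
    using assms(2) by (metis le_add_diff_inverse mpow_add)
  then show ?thesis
    using assms(1) by (simp add: matrix_matrix_mult_def vec_eq_iff)
qed

lemma mpow_cnj: "mpow (cnj_mat A) k = cnj_mat (mpow A k)"
  by (induction k) (auto simp: mpow_Suc cnj_mat_mult)

lemma cmat_mult: "cmat (A ** B) = cmat A ** cmat (B :: real^'n::finite^'n)"
  by (simp add: vec_eq_iff map_matrix_def matrix_matrix_mult_def)

lemma cmat_one [simp]: "cmat (mat 1 :: real^'n::finite^'n) = mat 1"
  by (simp add: vec_eq_iff map_matrix_def mat_def)

lemma mpow_cmat: "mpow (cmat A) k = cmat (mpow (A :: real^'n::finite^'n) k)"
  by (induction k) (auto simp: mpow_Suc cmat_mult)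

lemma mexp_finite:
  assumes "mpow A m = 0"
  shows "mexp A = (\<Sum>k<m. (1 / fact k) *\<^sub>R mpow A k)"
  unfolding mexp_def using mpow_zero_mono[OF assms]
  by (intro suminf_finite) auto

lemma mexp_0 [simp]: "mexp (0 :: complex^'n::finite^'n) = mat 1"
  using mexp_finite[of "0 :: complex^'n^'n" 1] by (simp add: mpow_Suc)

lemma mexp_cnj:
  assumes "mpow A m = 0"
  shows "mexp (cnj_mat A) = cnj_mat (mexp A)"
proof -
  have "mpow (cnj_mat A) m = 0" by (simp add: mpow_cnj assms)
  then show ?thesis
    by (simp add: mexp_finite[OF assms] mexp_finite vec_eq_iff mpow_cnj)
qed

lemma mexp_commute:
  fixes A B :: "complex^'n::finite^'n"
  assumes "A ** B = B ** A" "mpow B m = 0"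
  shows "A ** mexp B = mexp B ** A"
  by (simp add: mexp_finite[OF assms(2)] sum_mat_mult scaleR_mat_mult mpow_commute[OF assms(1)])

text \<open>The binomial theorem divided by \<open>fact k\<close>. Since
  \<open>X ** S X k = (k + 1) S X (k + 1)\<close>, the induction multiplies by \<open>A + B\<close>
  and never meets a binomial coefficient.\<close>

lemma exp_term_add:
  fixes A B :: "complex^'n::finite^'n"
  assumes c: "A ** B = B ** A"
  defines "S \<equiv> \<lambda>(X::complex^'n^'n) k. (1 / fact k) *\<^sub>R mpow X k"
  shows "S (A + B) k = (\<Sum>i\<le>k. S A i ** S B (k - i))"
proof (induction k)
  case 0
  then show ?case by (simp add: S_def)
next
  case (Suc k)
  have SS: "X ** S X k = real (Suc k) *\<^sub>R S X (Suc k)" for X k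
    by (simp add: S_def mpow_Suc scaleR_mat_mult field_simps del: of_nat_Suc)
  have cS: "B ** S A i = S A i ** B" for i
    by (simp add: S_def scaleR_mat_mult mpow_commute c)
  have "real (Suc k) *\<^sub>R S (A + B) (Suc k) = (A + B) ** (\<Sum>i\<le>k. S A i ** S B (k - i))"
    by (simp only: SS[symmetric] Suc.IH)
  also have "\<dots> = (\<Sum>i\<le>k. (A ** S A i) ** S B (k - i)) + (\<Sum>i\<le>k. S A i ** (B ** S B (k - i)))"
    by (simp add: mat_ring sum_mat_mult matrix_mul_assoc cS sum.distrib)
  also have "\<dots> = (\<Sum>i\<le>k. real (Suc i) *\<^sub>R (S A (Suc i) ** S B (k - i)))
               + (\<Sum>i\<le>k. real (Suc (k - i)) *\<^sub>R (S A i ** S B (Suc (k - i))))"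
    by (simp only: SS scaleR_mat_mult)
  also have "(\<Sum>i\<le>k. real (Suc i) *\<^sub>R (S A (Suc i) ** S B (k - i)))
           = (\<Sum>i\<le>Suc k. real i *\<^sub>R (S A i ** S B (Suc k - i)))"
    by (subst sum.atMost_Suc_shift) simp
  also have "(\<Sum>i\<le>k. real (Suc (k - i)) *\<^sub>R (S A i ** S B (Suc (k - i))))
           = (\<Sum>i\<le>Suc k. real (Suc k - i) *\<^sub>R (S A i ** S B (Suc k - i)))"
    by (auto simp: Suc_diff_le algebra_simps intro!: sum.cong)
  also have "(\<Sum>i\<le>Suc k. real i *\<^sub>R (S A i ** S B (Suc k - i)))
     + (\<Sum>i\<le>Suc k. real (Suc k - i) *\<^sub>R (S A i ** S B (Suc k - i)))
     = (\<Sum>i\<le>Suc k. real (Suc k) *\<^sub>R (S A i ** S B (Suc k - i)))"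
    unfolding sum.distrib[symmetric]
    by (intro sum.cong refl) (simp add: scaleR_left_distrib[symmetric] of_nat_diff)
  also have "\<dots> = real (Suc k) *\<^sub>R (\<Sum>i\<le>Suc k. S A i ** S B (Suc k - i))"
    by (simp only: scaleR_sum_right)
  finally show ?case by (simp del: of_nat_Suc sum.atMost_Suc)
qed

text \<open>The Cauchy product is taken entry by entry. Nilpotency makes all series finite, which
  settles absolute convergence.\<close>

lemma mexp_add:
  fixes A B :: "complex^'n::finite^'n"
  assumes c: "A ** B = B ** A" and A: "mpow A m = 0" and B: "mpow B m = 0" and AB: "mpow (A + B) m = 0"
  shows "mexp (A + B) = mexp A ** mexp B"
proof -
  define S where "S = (\<lambda>(X::complex^'n^'n) k. (1 / fact k) *\<^sub>R mpow X k)"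
  have sums: "(\<lambda>k. S X k $ i $ j) sums (mexp X $ i $ j)" if "mpow X m = 0" for X i j
  proof -
    have "(\<lambda>k. S X k $ i $ j) sums (\<Sum>k<m. S X k $ i $ j)"
      using mpow_zero_mono[OF that] by (intro sums_finite) (auto simp: S_def)
    then show ?thesis by (simp add: mexp_finite[OF that] S_def)
  qed
  have summ: "summable (\<lambda>k. norm (S X k $ i $ j))" if "mpow X m = 0" for X i j
    using mpow_zero_mono[OF that] by (intro summable_finite[of "{..<m}"]) (auto simp: S_def)
  have "mexp (A + B) $ i $ j = (mexp A ** mexp B) $ i $ j" for i j
  proof -
    have "(\<lambda>k. \<Sum>l\<in>UNIV. \<Sum>t\<le>k. S A t $ i $ l * S B (k - t) $ l $ j)
        sums (\<Sum>l\<in>UNIV. (\<Sum>k. S A k $ i $ l) * (\<Sum>k. S B k $ l $ j))"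
      by (intro sums_sum Cauchy_product_sums summ A B)
    also have "(\<Sum>l\<in>UNIV. (\<Sum>k. S A k $ i $ l) * (\<Sum>k. S B k $ l $ j)) = (mexp A ** mexp B) $ i $ j"
      by (simp add: matrix_mult_nth sums[OF A, THEN sums_unique, symmetric]
          sums[OF B, THEN sums_unique, symmetric])
    also have "(\<lambda>k. \<Sum>l\<in>UNIV. \<Sum>t\<le>k. S A t $ i $ l * S B (k - t) $ l $ j) = (\<lambda>k. S (A + B) k $ i $ j)"
      unfolding S_def exp_term_add[OF c]
      by (subst sum.swap) (simp add: matrix_mult_nth)
    finally show ?thesis using sums[OF AB, of i j] sums_unique2 by blast
  qed
  then show ?thesis by (simp add: vec_eq_iff)
qed

lemma mexp_inverse:
  fixes A :: "complex^'n::finite^'n"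
  assumes "mpow A m = 0"
  shows "mexp A ** mexp (- A) = mat 1"
proof -
  have "mpow (- A) m = 0"
    using mpow_scaleR[of "-1" A m] assms by simp
  moreover have "mpow (A + - A) (Suc m) = 0" by (simp add: mpow_Suc)
  ultimately show ?thesis
    using mexp_add[of A "- A" "Suc m"] assms mpow_zero_mono[of A m "Suc m"] mpow_zero_mono[of "-A" m "Suc m"]
    by (simp add: mat_ring)
qed

subsection \<open>Support patterns of matrices\<close>

text \<open>\<open>R i j\<close> admits the entry that sends the \<open>j\<close>-th basis vector to
  the \<open>i\<close>-th. A transitive \<open>R\<close> gives a subspace of matrices closed under
  products; this is how endomorphisms of prescribed Hodge types appear in coordinates.\<close>

definition supp :: "('n \<Rightarrow> 'n \<Rightarrow> bool) \<Rightarrow> complex^'n::finite^'n \<Rightarrow> bool" where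
  "supp R X \<longleftrightarrow> (\<forall>i j. X $ i $ j \<noteq> 0 \<longrightarrow> R i j)"

definition trunc :: "('n \<Rightarrow> 'n \<Rightarrow> bool) \<Rightarrow> complex^'n::finite^'n \<Rightarrow> complex^'n^'n" where
  "trunc R X = (\<chi> i j. if R i j then X $ i $ j else 0)"

definition coord :: "'n set \<Rightarrow> (complex^'n::finite) set" where
  "coord A = {x. \<forall>i. x $ i \<noteq> 0 \<longrightarrow> i \<in> A}"

lemma supp_mono: "supp R X \<Longrightarrow> (\<And>i j. R i j \<Longrightarrow> R' i j) \<Longrightarrow> supp R' X"
  by (auto simp: supp_def)

lemma supp_zero [simp]: "supp R 0"
  by (simp add: supp_def)

lemma supp_add: "supp R X \<Longrightarrow> supp R Y \<Longrightarrow> supp R (X + Y)"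
  by (auto simp: supp_def) (metis add.left_neutral)

lemma supp_uminus: "supp R X \<Longrightarrow> supp R (- X)"
  by (auto simp: supp_def)

lemma supp_diff: "supp R X \<Longrightarrow> supp R Y \<Longrightarrow> supp R (X - Y)"
  by (auto simp: supp_def) (metis cancel_comm_monoid_add_class.diff_cancel)

lemma supp_scaleR: "supp R X \<Longrightarrow> supp R (c *\<^sub>R X)"
  by (auto simp: supp_def)

lemma supp_sum: "(\<And>i. i \<in> S \<Longrightarrow> supp R (f i)) \<Longrightarrow> supp R (\<Sum>i\<in>S. f i)"
  by (induction S rule: infinite_finite_induct) (auto intro: supp_add)

lemma supp_cnj: "supp R X \<Longrightarrow> supp R (cnj_mat X)"
  by (auto simp: supp_def)

lemma supp_one: "(\<And>i. R i i) \<Longrightarrow> supp R (mat 1)"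
  by (auto simp: supp_def mat_def split: if_splits)

lemma supp_mult_gen:
  assumes "supp R X" "supp S Y" "\<And>i j k. R i k \<Longrightarrow> S k j \<Longrightarrow> T i j"
  shows "supp T (X ** Y)"
  unfolding supp_def
proof (intro allI impI)
  fix i j assume "(X ** Y) $ i $ j \<noteq> 0"
  then obtain k where "X $ i $ k * Y $ k $ j \<noteq> 0"
    unfolding matrix_mult_nth by (rule sum.not_neutral_contains_not_neutral)
  then have "R i k" "S k j" using assms(1,2) by (auto simp: supp_def)
  then show "T i j" by (rule assms(3))
qed

lemma supp_mult: "supp R X \<Longrightarrow> supp R Y \<Longrightarrow> transp R \<Longrightarrow> supp R (X ** Y)"
  by (rule supp_mult_gen[of R _ R]) (auto dest: transpD)

lemma supp_trunc: "supp S X \<Longrightarrow> supp (\<lambda>i j. R i j \<and> S i j) (trunc R X)"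
  by (auto simp: supp_def trunc_def split: if_splits)

lemma trunc_nth: "trunc R X $ i $ j = (if R i j then X $ i $ j else 0)"
  by (simp add: trunc_def)

lemma mnorm_trunc: "mnorm (trunc R X) \<le> mnorm X"
  by (rule mnorm_mono) (simp add: trunc_def)

lemma supp_disjoint: "supp R X \<Longrightarrow> supp S X \<Longrightarrow> (\<And>i j. R i j \<Longrightarrow> S i j \<Longrightarrow> False) \<Longrightarrow> X = 0"
  unfolding supp_def vec_eq_iff zero_index by blast

lemma subspace_coord [simp]: "vec.subspace (coord A)"
  unfolding vec.subspace_def coord_def by auto (metis add.left_neutral)

lemma coord_mono: "A \<subseteq> B \<Longrightarrow> coord A \<subseteq> coord B"
  by (auto simp: coord_def)

lemma coord_UNIV [simp]: "coord UNIV = UNIV"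
  by (simp add: coord_def)

lemma coord_empty [simp]: "coord {} = {0}"
  by (auto simp: coord_def vec_eq_iff)

lemma zero_in_coord [simp]: "0 \<in> coord A"
  by (auto simp: coord_def)

lemma coord_add: "x \<in> coord A \<Longrightarrow> y \<in> coord A \<Longrightarrow> x + y \<in> coord A"
  and coord_diff: "x \<in> coord A \<Longrightarrow> y \<in> coord A \<Longrightarrow> x - y \<in> coord A"
  using subspace_coord[of A] by (auto intro: vec.subspace_add vec.subspace_diff)

lemma axis_in_coord [simp]: "axis j 1 \<in> coord A \<longleftrightarrow> j \<in> A"
  by (auto simp: coord_def axis_def)

lemma coord_Int: "coord A \<inter> coord B = coord (A \<inter> B)"
  by (auto simp: coord_def)

lemma cnj_vec_coord: "x \<in> coord A \<Longrightarrow> cnj_vec x \<in> coord A"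
  by (auto simp: coord_def)

lemma supp_coord:
  assumes "supp R X" "x \<in> coord A" "\<And>i j. j \<in> A \<Longrightarrow> R i j \<Longrightarrow> i \<in> B"
  shows "X *v x \<in> coord B"
  unfolding coord_def
proof (clarify)
  fix i assume "(X *v x) $ i \<noteq> 0"
  then obtain j where "X $ i $ j * x $ j \<noteq> 0"
    unfolding matrix_vector_mult_def vec_lambda_beta by (rule sum.not_neutral_contains_not_neutral)
  then show "i \<in> B" using assms by (auto simp: supp_def coord_def)
qed

lemma coord_supp:
  assumes "\<And>j. X *v axis j 1 \<in> coord {i. R i j}"
  shows "supp R X"
  using assms by (auto simp: supp_def coord_def matrix_column_nth)

lemma span_coord_UN:
  "vec.span (\<Union>t\<in>T. (*v) (G::complex^'n::finite^'n) ` coord {i. d i = t}) = (*v) G ` coord {i. d i \<in> T}" (is "?L = ?R")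
proof
  show "?L \<subseteq> ?R"
  proof (rule vec.span_minimal)
    show "vec.subspace ?R" by (rule vec.subspace_image) simp
  qed (auto intro!: image_eqI simp: coord_def)
  show "?R \<subseteq> ?L"
  proof
    fix u assume "u \<in> ?R"
    then obtain x where x: "x \<in> coord {i. d i \<in> T}" "u = G *v x" by auto
    have ux: "x = (\<Sum>i\<in>{i. d i \<in> T}. x $ i *s axis i 1)"
      using x(1) by (auto simp: vec_eq_iff coord_def axis_def if_distrib[of "(*) _"] cong: if_cong)
    have "G *v (x $ i *s axis i 1) \<in> ?L" if "d i \<in> T" for i
    proof (rule vec.span_base, rule UN_I[OF that], rule imageI)
      show "x $ i *s axis i 1 \<in> coord {j. d j = d i}"
        by (auto simp: coord_def axis_def)
    qed
    moreover have "u = (\<Sum>i\<in>{i. d i \<in> T}. G *v (x $ i *s axis i 1))"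
      unfolding x(2) by (subst ux) (simp add: vec.sum)
    ultimately show "u \<in> ?L" by (auto intro: vec.span_sum)
  qed
qed

text \<open>An injective linear map of a finite-dimensional subspace into itself is onto.\<close>

lemma invertible_image_coord:
  fixes X Y :: "complex^'n::finite^'n"
  assumes "X ** Y = mat 1" "(*v) X ` S \<subseteq> S" "vec.subspace S"
  shows "(*v) X ` S = S"
proof -
  have YX: "Y ** X = mat 1" using assms(1) matrix_left_right_inverse by blast
  have "inj_on ((*v) X) S"
    by (rule inj_on_inverseI[where g = "(*v) Y"]) (simp add: matrix_vector_mul_assoc YX)
  then have "vec.dim ((*v) X ` S) = vec.dim S"
    using assms(3) by (intro vec.dim_image_eq) (auto simp: vec.span_eq_iff[THEN iffD2] matrix_vector_mul_linear_gen)
  then show ?thesis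
    using assms by (intro vec.subspace_dim_equal vec.subspace_image) auto
qed


subsection \<open>Bigraded coordinates\<close>

abbreviation wt :: "int \<times> int \<Rightarrow> int" where
  "wt t \<equiv> fst t + snd t"

text \<open>
  With respect to a basis indexed by \<open>'n\<close>, whose \<open>i\<close>-th vector has type \<open>d i\<close>, the matrix entry
  \<open>(i, j)\<close> has type \<open>d i - d j\<close> in the induced bigrading of endomorphisms.  The part of negative
  weight is the sum of \<open>plus_part\<close> and \<open>minus_part\<close>; its subspace \<open>lam\<close> is stable under conjugation.
\<close>
definition nilp :: "('n \<Rightarrow> int \<times> int) \<Rightarrow> nat \<Rightarrow> 'n \<Rightarrow> 'n \<Rightarrow> bool" where
  "nilp d n i j \<longleftrightarrow> wt (d i) + int n \<le> wt (d j)"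

definition plus_part :: "('n \<Rightarrow> int \<times> int) \<Rightarrow> 'n \<Rightarrow> 'n \<Rightarrow> bool" where
  "plus_part d i j \<longleftrightarrow> fst (d i) \<ge> fst (d j) \<and> wt (d i) < wt (d j)"

definition minus_part :: "('n \<Rightarrow> int \<times> int) \<Rightarrow> 'n \<Rightarrow> 'n \<Rightarrow> bool" where
  "minus_part d i j \<longleftrightarrow> fst (d i) < fst (d j) \<and> wt (d i) < wt (d j)"

definition lam :: "('n \<Rightarrow> int \<times> int) \<Rightarrow> 'n \<Rightarrow> 'n \<Rightarrow> bool" where
  "lam d i j \<longleftrightarrow> fst (d i) < fst (d j) \<and> snd (d i) < snd (d j)"

lemmas pattern_defs = nilp_def plus_part_def minus_part_def lam_def

lemma transp_patterns [simp]: "transp (nilp d n)" "transp (plus_part d)" "transp (minus_part d)" "transp (lam d)"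
  by (auto simp: transp_def pattern_defs)

text \<open>One more than the spread of the weights, so that the pattern
  \<open>nilp d (depth d)\<close> is empty.\<close>

definition depth :: "('n::finite \<Rightarrow> int \<times> int) \<Rightarrow> nat" where
  "depth d = nat (Max (range (\<lambda>i. wt (d i))) - Min (range (\<lambda>i. wt (d i)))) + 1"

lemma nilp_depth: "depth d \<le> n \<Longrightarrow> \<not> nilp d n i (j::'n::finite)"
proof
  assume *: "depth d \<le> n" "nilp d n i j"
  define M m where "M = Max (range (\<lambda>i. wt (d i)))" and "m = Min (range (\<lambda>i. wt (d i)))"
  have "wt (d j) \<le> M" unfolding M_def by (rule Max_ge) auto
  moreover have "m \<le> wt (d i)" unfolding m_def by (rule Min_le) auto
  moreover have "nat (M - m) + 1 \<le> n" using * by (simp add: depth_def M_def m_def)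
  ultimately show False using *(2) unfolding nilp_def by linarith
qed

lemma mpow_nilp: "supp (nilp d 1) X \<Longrightarrow> supp (nilp d k) (mpow X k)"
proof (induction k)
  case 0
  then show ?case by (auto intro: supp_one simp: nilp_def)
next
  case (Suc k)
  show ?case
    unfolding mpow_Suc
    by (rule supp_mult_gen[OF Suc.prems Suc.IH[OF Suc.prems]]) (auto simp: nilp_def)
qed

lemma mpow_depth:
  assumes "supp (nilp d 1) X" "depth d \<le> k"
  shows "mpow X k = 0"
  using mpow_nilp[OF assms(1), of k] nilp_depth[OF assms(2)] by (auto simp: supp_def vec_eq_iff)

lemma supp_mpow:
  assumes "supp R X" "transp R" "k > 0"
  shows "supp R (mpow X k)"
  using assms(3)
proof (induction k rule: nat_induct_non_zero)
  case (Suc k)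
  then show ?case unfolding mpow_Suc using assms by (intro supp_mult)
qed (simp add: mpow_Suc assms)

lemma supp_mexp:
  assumes "supp R X" "transp R" "mpow X m = 0"
  shows "supp R (mexp X - mat 1)"
proof -
  have "mexp X - mat 1 = (\<Sum>k<Suc m. (1 / fact k) *\<^sub>R mpow X k) - mat 1"
    by (subst mexp_finite[of X "Suc m"]) (auto simp: mpow_Suc assms(3))
  also have "\<dots> = (\<Sum>k<m. (1 / fact (Suc k)) *\<^sub>R mpow X (Suc k))"
    by (subst sum.lessThan_Suc_shift) simp
  finally show ?thesis
    using assms by (auto intro!: supp_sum supp_scaleR supp_mpow)
qed

lemma nil_geometric:
  fixes X :: "complex^'n::finite^'n"
  assumes "mpow X m = 0"
  defines "Y \<equiv> (\<Sum>k<m. (-1) ^ k *\<^sub>R mpow X k)"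
  shows "(mat 1 + X) ** Y = mat 1" "Y ** (mat 1 + X) = mat 1"
proof -
  have *: "(\<Sum>k<n. (-1) ^ k *\<^sub>R mpow X k) + X ** (\<Sum>k<n. (-1) ^ k *\<^sub>R mpow X k)
      = mat 1 + (-1) ^ (n + 1) *\<^sub>R mpow X n" for n
    by (induction n) (auto simp: mat_ring scaleR_mat_mult mpow_Suc algebra_simps)
  show "(mat 1 + X) ** Y = mat 1"
    using *[of m] assms(1) by (simp add: mat_ring Y_def)
  then show "Y ** (mat 1 + X) = mat 1"
    using matrix_left_right_inverse by blast
qed

text \<open>The Neumann series of \<open>mat 1 + X\<close> stops at \<open>depth d\<close>. The
  inverse is thus a polynomial in \<open>X\<close>, which preserves the pattern and bounds the norm
  polynomially.\<close>

lemma unipotent_inverse: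
  fixes h :: "complex^'n::finite^'n"
  assumes R: "supp R (h - mat 1)" "transp R" "\<And>i j. R i j \<Longrightarrow> nilp d 1 i j"
  obtains hi where "h ** hi = mat 1" "hi ** h = mat 1" "supp R (hi - mat 1)"
    "mnorm hi \<le> real (depth d) * (1 + real CARD('n)) ^ depth d * (1 + real CARD('n) + mnorm h) ^ depth d"
proof -
  define X where "X = h - mat 1"
  define m where "m = depth d"
  have m: "mpow X m = 0"
    unfolding m_def X_def by (rule mpow_depth[OF supp_mono[OF R(1,3)] order_refl])
  define Y where "Y = (\<Sum>k<m. (-1) ^ k *\<^sub>R mpow X k)"
  have h: "h = mat 1 + X" by (simp add: X_def)
  let ?n = "real CARD('n)"
  have pw: "mnorm (mpow X k) \<le> (1 + ?n) * (mnorm X) ^ k" for k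
  proof (induction k)
    case (Suc k)
    show ?case using mnorm_mult_le[OF order_refl[of "mnorm X"] Suc] by (simp add: mpow_Suc mult_ac)
  qed (simp add: mnorm_one)
  have m0: "m > 0" by (simp add: m_def depth_def)
  have "mnorm Y \<le> (\<Sum>k<m. mnorm (mpow X k))"
    unfolding Y_def by (rule order_trans[OF mnorm_sum]) (simp add: mnorm_scaleR)
  also have "\<dots> \<le> (\<Sum>k<m. (1 + ?n) ^ m * (1 + ?n + mnorm h) ^ m)"
  proof (rule sum_mono)
    fix k assume k: "k \<in> {..<m}"
    have "mnorm X \<le> 1 + ?n + mnorm h"
      using mnorm_diff[of h "mat 1"] by (simp add: X_def mnorm_one)
    then have "mnorm X ^ k \<le> (1 + ?n + mnorm h) ^ k"
      by (intro power_mono) auto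
    also have "\<dots> \<le> (1 + ?n + mnorm h) ^ m"
      using k by (intro power_increasing) auto
    finally have 1: "mnorm X ^ k \<le> (1 + ?n + mnorm h) ^ m" .
    have 2: "1 + ?n \<le> (1 + ?n) ^ m"
      using m0 by (intro self_le_power) auto
    show "mnorm (mpow X k) \<le> (1 + ?n) ^ m * (1 + ?n + mnorm h) ^ m"
      by (rule order_trans[OF pw mult_mono[OF 2 1]]) auto
  qed
  also have "\<dots> = real m * (1 + ?n) ^ m * (1 + ?n + mnorm h) ^ m" by simp
  finally have Yb: "mnorm Y \<le> real m * (1 + ?n) ^ m * (1 + ?n + mnorm h) ^ m" .
  have YY: "h ** Y = mat 1" "Y ** h = mat 1"
    using nil_geometric[OF m] by (simp_all add: h Y_def)
  have "Y - mat 1 = - (X ** Y)" using YY(1) by (simp add: h mat_ring algebra_simps)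
  also have "\<dots> = - X - X ** (Y - mat 1)" by (simp add: mat_ring)
  finally have rec: "Y - mat 1 = - X - X ** (Y - mat 1)" .
  have "Y - mat 1 = (\<Sum>k<m - 1. (-1) ^ Suc k *\<^sub>R mpow X (Suc k))"
  proof -
    obtain m' where m': "m = Suc m'" using m0 gr0_implies_Suc by blast
    show ?thesis unfolding Y_def m' by (subst sum.lessThan_Suc_shift) simp
  qed
  then have "supp R (Y - mat 1)"
    using R(1,2) unfolding X_def by (auto intro!: supp_sum supp_scaleR supp_mpow supp_uminus)
  then show ?thesis using that YY Yb by (simp add: m_def)
qed

subsection \<open>Polynomial bounds\<close>

lemma poly_bound_mult:
  fixes a b c c' y :: real
  assumes "a \<le> c * (1 + y) ^ m" "b \<le> c' * (1 + y) ^ m'" "0 \<le> b" "0 \<le> c" "0 \<le> y"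
  shows "a * b \<le> (c * c') * (1 + y) ^ (m + m')"
proof -
  have "a * b \<le> (c * (1 + y) ^ m) * (c' * (1 + y) ^ m')"
    using assms by (intro mult_mono) auto
  then show ?thesis by (simp add: power_add mult_ac)
qed

text \<open>The factor \<open>(1 + y) ^ m'\<close> is at least 1, so it also absorbs the summand 1
  in \<open>1 + b\<close>.\<close>

lemma poly_bound_compose:
  fixes a b c c' y :: real
  assumes "a \<le> c * (1 + b) ^ m" "b \<le> c' * (1 + y) ^ m'" "0 \<le> b" "0 \<le> c" "0 \<le> c'" "0 \<le> y"
  shows "a \<le> (c * (1 + c') ^ m) * (1 + y) ^ (m' * m)"
proof -
  have "1 \<le> (1 + y) ^ m'" using assms by (intro one_le_power) simp
  then have "1 + b \<le> (1 + c') * (1 + y) ^ m'"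
    using assms(2) unfolding distrib_right by linarith
  then have "(1 + b) ^ m \<le> ((1 + c') * (1 + y) ^ m') ^ m"
    using assms by (intro power_mono) auto
  then have "c * (1 + b) ^ m \<le> c * ((1 + c') * (1 + y) ^ m') ^ m"
    using assms by (intro mult_left_mono)
  also have "\<dots> = (c * (1 + c') ^ m) * (1 + y) ^ (m' * m)"
    by (simp add: power_mult_distrib power_mult)
  finally show ?thesis using assms(1) by linarith
qed

text \<open>\<open>c\<close> and \<open>m\<close> are fixed before \<open>h\<close>; the later
  estimates need this uniformity because \<open>h\<close> runs over an unbounded orbit.\<close>

lemma unipotent_inverse_bound:
  fixes R :: "'n::finite \<Rightarrow> 'n \<Rightarrow> bool"
  assumes "transp R" "\<And>i j. R i j \<Longrightarrow> nilp d 1 i j"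
  obtains c m where "0 \<le> c" "\<And>h. supp R (h - mat 1) \<Longrightarrow>
    \<exists>hi. h ** hi = mat 1 \<and> hi ** h = mat 1 \<and> supp R (hi - mat 1) \<and> mnorm hi \<le> c * (1 + mnorm h) ^ m"
proof
  let ?n = "real CARD('n)" and ?D = "depth d"
  let ?c = "real ?D * (1 + ?n) ^ ?D * (1 + ?n) ^ ?D"
  show "0 \<le> ?c" by simp
  fix h assume h: "supp R (h - mat 1)"
  obtain hi where hi: "h ** hi = mat 1" "hi ** h = mat 1" "supp R (hi - mat 1)"
    "mnorm hi \<le> real ?D * (1 + ?n) ^ ?D * (1 + ?n + mnorm h) ^ ?D"
    using unipotent_inverse[OF h assms] by metis
  have "1 + ?n + mnorm h \<le> (1 + ?n) * (1 + mnorm h)" by (simp add: algebra_simps)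
  then have "(1 + ?n + mnorm h) ^ ?D \<le> ((1 + ?n) * (1 + mnorm h)) ^ ?D"
    by (intro power_mono) auto
  then have "real ?D * (1 + ?n) ^ ?D * (1 + ?n + mnorm h) ^ ?D \<le> ?c * (1 + mnorm h) ^ ?D"
    by (simp add: power_mult_distrib mult_left_mono mult.assoc)
  then show "\<exists>hi. h ** hi = mat 1 \<and> hi ** h = mat 1 \<and> supp R (hi - mat 1) \<and> mnorm hi \<le> ?c * (1 + mnorm h) ^ ?D"
    using hi by force
qed


subsection \<open>Splitting a real structure\<close>

lemma mat_cancel: "A ** B = mat 1 \<Longrightarrow> A ** (B ** X) = (X :: complex^'n::finite^'n)"
  by (simp add: matrix_mul_assoc)

text \<open>\<open>M\<close> encodes a real structure on a bigraded space: the antilinear map taking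
  \<open>x\<close> to \<open>M *v cnj_vec x\<close> exchanges the types (p,q) and (q,p), and the
  second assumption makes it an involution.\<close>

locale graded_conj =
  fixes d :: "'n::finite \<Rightarrow> int \<times> int" and M :: "complex^'n^'n"
  assumes supp_M: "supp (\<lambda>i j. d i = prod.swap (d j)) M"
    and MM: "M ** cnj_mat M = mat 1"
begin

lemma MM': "cnj_mat M ** M = mat 1"
  using MM matrix_left_right_inverse by blast

text \<open>Complex conjugation of endomorphisms for the real structure given by \<open>M\<close>;
  note that \<open>cnj_mat M\<close> is the inverse of \<open>M\<close>.\<close>

definition sig :: "complex^'n^'n \<Rightarrow> complex^'n^'n" where
  "sig X = M ** cnj_mat X ** cnj_mat M"

lemma sig_add: "sig (X + Y) = sig X + sig Y" and sig_diff: "sig (X - Y) = sig X - sig Y"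
  by (simp_all add: sig_def cnj_mat_add cnj_mat_diff mat_ring)

lemma sig_one: "sig (mat 1) = mat 1"
  by (simp add: sig_def MM)

lemma supp_sig:
  assumes "supp R X"
    and "\<And>i j k l. d i = prod.swap (d k) \<Longrightarrow> R k l \<Longrightarrow> d l = prod.swap (d j) \<Longrightarrow> T i j"
  shows "supp T (sig X)"
  unfolding sig_def
proof (rule supp_mult_gen)
  show "supp (\<lambda>i l. \<exists>k. d i = prod.swap (d k) \<and> R k l) (M ** cnj_mat X)"
    by (rule supp_mult_gen[OF supp_M supp_cnj[OF assms(1)]]) auto
  show "supp (\<lambda>i j. d i = prod.swap (d j)) (cnj_mat M)"
    by (rule supp_cnj[OF supp_M])
qed (use assms(2) in auto)

text \<open>
  One step of the recursion improves the deviation from the pattern \<open>lam\<close> by one weight: the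
  \<open>plus_part\<close> part of the deviation is removed by \<open>f\<close>, and its \<open>minus_part\<close> part, which is minus the
  conjugate of the \<open>plus_part\<close> part because \<open>C\<close> is an involution, by the conjugate of \<open>f\<close>.
\<close>
lemma split_step:
  assumes n: "n \<ge> 1"
    and K: "supp (\<lambda>i j. lam d i j \<or> nilp d n i j) (K - mat 1)" "K ** sig K = mat 1"
    and X: "X = trunc (plus_part d) (K - mat 1)"
    and Xi: "Xi ** (mat 1 + X) = mat 1"
  shows "supp (\<lambda>i j. lam d i j \<or> nilp d (Suc n) i j) (Xi ** K ** sig (mat 1 + X) - mat 1)"
    and "supp (plus_part d) X"
proof -
  define L where "L = K - mat 1"
  define T where "T = (\<lambda>i j. lam d i j \<or> nilp d (Suc n) i j)"
  have Lsupp: "supp (\<lambda>i j. lam d i j \<or> nilp d n i j) L" using K(1) by (simp add: L_def)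
  have nil1: "nilp d 1 i j" if "lam d i j \<or> nilp d n i j" for i j
    using that n by (auto simp: pattern_defs)
  have L1: "supp (nilp d 1) L" by (rule supp_mono[OF Lsupp nil1])
  have Xs: "supp (\<lambda>i j. plus_part d i j \<and> nilp d n i j) X"
    unfolding X L_def[symmetric]
    by (rule supp_mono[OF supp_trunc[OF Lsupp]]) (auto simp: pattern_defs)
  then show "supp (plus_part d) X" by (rule supp_mono) auto
  have Xn: "supp (nilp d n) X" using Xs by (rule supp_mono) auto
  define Z where "Z = sig X"
  have Zs: "supp (\<lambda>i j. snd (d i) \<ge> snd (d j) \<and> nilp d n i j) Z"
    unfolding Z_def by (rule supp_sig[OF Xs]) (auto simp: pattern_defs prod.swap_def)
  have Zn: "supp (nilp d n) Z" using Zs by (rule supp_mono) auto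
  have add_nil: "supp (nilp d (Suc n)) (A ** B)" if "supp (nilp d n) A" "supp (nilp d 1) B" for A B
    by (rule supp_mult_gen[OF that]) (auto simp: nilp_def)
  have add_nil': "supp (nilp d (Suc n)) (A ** B)" if "supp (nilp d 1) A" "supp (nilp d n) B" for A B
    by (rule supp_mult_gen[OF that]) (auto simp: nilp_def)
  have Xn1: "supp (nilp d 1) X" and Zn1: "supp (nilp d 1) Z"
    using Xn Zn n by (auto elim!: supp_mono simp: nilp_def)
  have T_nil: "supp T A" if "supp (nilp d (Suc n)) A" for A
    using that by (rule supp_mono) (simp add: T_def)
  \<comment> \<open>The inverse is expanded past second order: everything beyond the linear term
    then has weight at most \<open>- (n + 1)\<close> and can be discarded.\<close>
  have XiX: "Xi = mat 1 - X + X ** X - X ** X ** X ** Xi"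
  proof -
    have Xi': "(mat 1 + X) ** Xi = mat 1" using Xi matrix_left_right_inverse by blast
    then have r: "Xi = mat 1 - X ** Xi" by (simp add: mat_ring algebra_simps)
    have "Xi = mat 1 - X ** (mat 1 - X ** (mat 1 - X ** Xi))"
      using r by metis
    then show ?thesis by (simp add: mat_ring matrix_mul_assoc algebra_simps)
  qed
  obtain Xi' where Xi': "(mat 1 + X) ** Xi' = mat 1" "supp (nilp d 1) (Xi' - mat 1)"
    using unipotent_inverse[of "nilp d 1" "mat 1 + X" d] Xn1 by auto
  have XiXi': "Xi = Xi'" using left_inverse_unique Xi' Xi by metis
  define V where "V = X ** X - X ** X ** X ** Xi"
  have Xi_nil: "supp (nilp d 0) Xi"
  proof -
    have "supp (nilp d 0) (mat 1 + (Xi' - mat 1))"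
      by (intro supp_add supp_one supp_mono[OF Xi'(2)]) (auto simp: nilp_def)
    then show ?thesis by (simp add: XiXi')
  qed
  have V: "supp (nilp d (Suc n)) V"
    unfolding V_def
  proof (rule supp_diff)
    show "supp (nilp d (Suc n)) (X ** X)" by (rule add_nil[OF Xn Xn1])
    have "supp (nilp d (Suc n)) (X ** X ** X)"
      by (rule supp_mult_gen[OF add_nil[OF Xn Xn1] Xn1]) (auto simp: nilp_def)
    then show "supp (nilp d (Suc n)) (X ** X ** X ** Xi)"
      by (rule supp_mult_gen[OF _ Xi_nil]) (auto simp: nilp_def)
  qed
  have "Xi = mat 1 - X + V" using XiX by (simp add: V_def algebra_simps)
  moreover have "K = mat 1 + L" by (simp add: L_def)
  ultimately have "Xi ** K ** sig (mat 1 + X) - mat 1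
     = (L - X + Z) + (L ** Z - X ** L - X ** Z - X ** L ** Z + V + V ** L + V ** Z + V ** L ** Z)"
    unfolding sig_add sig_one Z_def[symmetric]
    by (simp add: mat_ring matrix_mul_assoc)
  moreover have "supp T (L ** Z - X ** L - X ** Z - X ** L ** Z + V + V ** L + V ** Z + V ** L ** Z)"
  proof (rule T_nil, intro supp_add supp_diff)
    have lower: "supp (nilp d (Suc n)) (A ** B)" if "supp (nilp d (Suc n)) A" "supp (nilp d 1) B" for A B
      by (rule supp_mult_gen[OF that]) (auto simp: nilp_def)
    show "supp (nilp d (Suc n)) (L ** Z)" by (rule add_nil'[OF L1 Zn])
    show "supp (nilp d (Suc n)) (X ** L)" by (rule add_nil[OF Xn L1])
    show "supp (nilp d (Suc n)) (X ** Z)" by (rule add_nil[OF Xn Zn1])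
    show "supp (nilp d (Suc n)) (X ** L ** Z)" by (rule lower[OF add_nil[OF Xn L1] Zn1])
    show "supp (nilp d (Suc n)) V" by (rule V)
    show "supp (nilp d (Suc n)) (V ** L)" by (rule lower[OF V L1])
    show "supp (nilp d (Suc n)) (V ** Z)" by (rule lower[OF V Zn1])
    show "supp (nilp d (Suc n)) (V ** L ** Z)" by (rule lower[OF lower[OF V L1] Zn1])
  qed
  \<comment> \<open>Only these linear terms can have weight exactly \<open>-n\<close> outside
    \<open>lam\<close>. On \<open>plus_part\<close>, \<open>X\<close> cancels \<open>L\<close>; on
    the mirrored entries, \<open>Z\<close> does, which uses that \<open>K\<close> comes from an
    involution.\<close>
  moreover have "supp T (L - X + Z)"
    unfolding supp_def
  proof (intro allI impI)
    fix i j assume nz: "(L - X + Z) $ i $ j \<noteq> 0"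
    show "T i j"
    proof (rule ccontr)
      assume nT: "\<not> T i j"
      then have nl: "\<not> lam d i j" and nn: "\<not> nilp d (Suc n) i j" by (auto simp: T_def)
      have wtij: "wt (d i) < wt (d j)"
      proof (rule ccontr)
        assume "\<not> wt (d i) < wt (d j)"
        then have "\<not> nilp d 1 i j" by (auto simp: nilp_def)
        then have "L $ i $ j = 0" "X $ i $ j = 0" "Z $ i $ j = 0"
          using L1 Xn1 Zn1 by (auto simp: supp_def)
        with nz show False by simp
      qed
      show False
      proof (cases "plus_part d i j")
        case True
        then have "X $ i $ j = L $ i $ j" by (simp add: X L_def trunc_nth)
        moreover have "Z $ i $ j = 0"
        proof -
          have "\<not> snd (d j) \<le> snd (d i)" using True by (auto simp: plus_part_def)
          then show ?thesis using Zs unfolding supp_def by blast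
        qed
        ultimately show False using nz by simp
      next
        case np: False
        then have mn: "snd (d i) \<ge> snd (d j)" "fst (d i) < fst (d j)"
          using nl wtij by (auto simp: pattern_defs)
        have X0: "X $ i $ j = 0" using np by (simp add: X trunc_nth)
        \<comment> \<open>At a mirrored entry the involution gives \<open>L + sig L = 0\<close> up
          to a product that is already in \<open>T\<close>. Moreover \<open>sig L\<close> and
          \<open>Z = sig X\<close> agree there, since \<open>L - X\<close> has no entries in
          \<open>plus_part\<close>.\<close>
        have "(mat 1 + L) ** (mat 1 + sig L) = mat 1"
          using K(2) by (simp add: L_def sig_diff sig_one)
        then have "L + sig L + L ** sig L = 0"
          by (simp add: mat_ring algebra_simps)
        moreover have "(L ** sig L) $ i $ j = 0"
        proof -
          have sL: "supp (\<lambda>i j. lam d i j \<or> nilp d n i j) (sig L)"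
            by (rule supp_sig[OF Lsupp]) (auto simp: pattern_defs prod.swap_def)
          have "supp T (L ** sig L)"
            by (rule supp_mult_gen[OF Lsupp sL]) (use n in \<open>auto simp: T_def pattern_defs\<close>)
          then show ?thesis using nT by (auto simp: supp_def)
        qed
        moreover have "sig (L - X) $ i $ j = 0"
        proof -
          have LX: "supp (\<lambda>i j. (lam d i j \<or> nilp d n i j) \<and> \<not> plus_part d i j) (L - X)"
            using Lsupp by (auto simp: supp_def X L_def trunc_nth)
          have "supp (\<lambda>i j. \<not> (snd (d i) \<ge> snd (d j) \<and> wt (d i) < wt (d j))) (sig (L - X))"
            by (rule supp_sig[OF LX]) (auto simp: pattern_defs prod.swap_def)
          then show ?thesis using mn wtij by (auto simp: supp_def)
        qed
        ultimately have "L $ i $ j + Z $ i $ j = 0"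
          by (simp add: Z_def sig_diff vec_eq_iff) (metis add.right_neutral)
        then show False using nz X0 by simp
      qed
    qed
  qed
  ultimately show "supp (\<lambda>i j. lam d i j \<or> nilp d (Suc n) i j) (Xi ** K ** sig (mat 1 + X) - mat 1)"
    unfolding T_def by (simp add: supp_add)
qed

text \<open>Induction on the weight up to which the conjugation is normalized. The constants are
  chosen before \<open>C\<close>, and each step enlarges them polynomially.\<close>

lemma split_iterate:
  assumes "n \<ge> 1"
  shows "\<exists>c m. 0 \<le> c \<and> (\<forall>C. C ** cnj_mat C = mat 1 \<longrightarrow> supp (nilp d 1) (C - M) \<longrightarrow>
    (\<exists>f fi. f ** fi = mat 1 \<and> supp (plus_part d) (f - mat 1) \<and>
      supp (\<lambda>i j. lam d i j \<or> nilp d n i j) (fi ** C ** cnj_mat f ** cnj_mat M - mat 1) \<and>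
      mnorm f \<le> c * (1 + mnorm C) ^ m \<and> mnorm fi \<le> c * (1 + mnorm C) ^ m))"
  using assms
proof (induction n rule: nat_induct_at_least)
  case base
  have "\<exists>f fi. f ** fi = mat 1 \<and> supp (plus_part d) (f - mat 1) \<and>
      supp (\<lambda>i j. lam d i j \<or> nilp d 1 i j) (fi ** C ** cnj_mat f ** cnj_mat M - mat 1) \<and>
      mnorm f \<le> real CARD('n) * (1 + mnorm C) ^ 0 \<and> mnorm fi \<le> real CARD('n) * (1 + mnorm C) ^ 0"
    if C: "supp (nilp d 1) (C - M)" for C
  proof -
    have "supp (nilp d 1) ((C - M) ** cnj_mat M)"
      by (rule supp_mult_gen[OF C supp_cnj[OF supp_M]]) (auto simp: nilp_def)
    then have "supp (nilp d 1) (C ** cnj_mat M - mat 1)" by (simp add: mat_ring MM)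
    then show ?thesis
      by (intro exI[of _ "mat 1"] conjI) (auto simp: mnorm_one elim: supp_mono)
  qed
  then show ?case by (intro exI[of _ "real CARD('n)"] exI[of _ 0]) auto
next
  case (Suc n)
  obtain c m where c: "0 \<le> c" and IH: "\<And>C. C ** cnj_mat C = mat 1 \<Longrightarrow> supp (nilp d 1) (C - M) \<Longrightarrow>
    (\<exists>f fi. f ** fi = mat 1 \<and> supp (plus_part d) (f - mat 1) \<and>
      supp (\<lambda>i j. lam d i j \<or> nilp d n i j) (fi ** C ** cnj_mat f ** cnj_mat M - mat 1) \<and>
      mnorm f \<le> c * (1 + mnorm C) ^ m \<and> mnorm fi \<le> c * (1 + mnorm C) ^ m)"
    using Suc.IH by blast
  obtain c1 m1 where c1: "0 \<le> c1" and inv: "\<And>h. supp (plus_part d) (h - mat 1) \<Longrightarrow>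
    \<exists>hi. h ** hi = mat 1 \<and> hi ** h = mat 1 \<and> supp (plus_part d) (hi - mat 1) \<and> mnorm hi \<le> c1 * (1 + mnorm h) ^ m1"
    by (rule unipotent_inverse_bound[of "plus_part d" d]) (auto simp: pattern_defs)
  let ?n = "real CARD('n)"
  \<comment> \<open>\<open>cb\<close>, \<open>c2\<close> and \<open>c3\<close>, with the exponents
    \<open>mb\<close>, \<open>m2\<close> and \<open>m3\<close>, bound in turn
    \<open>mat 1 + X\<close>, its inverse, and the new frame together with its inverse.\<close>
  define cb where "cb = 2 * ?n + c * c * mnorm M"
  define mb where "mb = Suc (m + m)"
  define c2 where "c2 = c1 * (1 + cb) ^ m1"
  define m2 where "m2 = mb * m1"
  have cb0: "0 \<le> cb" using c by (simp add: cb_def)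
  have c20: "0 \<le> c2" using c1 cb0 by (simp add: c2_def)
  define c3 where "c3 = c * cb + c2 * c"
  define m3 where "m3 = (m + mb) + (m2 + m)"
  have *: "\<exists>f fi. f ** fi = mat 1 \<and> supp (plus_part d) (f - mat 1) \<and>
      supp (\<lambda>i j. lam d i j \<or> nilp d (Suc n) i j) (fi ** C ** cnj_mat f ** cnj_mat M - mat 1) \<and>
      mnorm f \<le> c3 * (1 + mnorm C) ^ m3 \<and> mnorm fi \<le> c3 * (1 + mnorm C) ^ m3"
    if C: "C ** cnj_mat C = mat 1" "supp (nilp d 1) (C - M)" for C
  proof -
    obtain f fi where f: "f ** fi = mat 1" "supp (plus_part d) (f - mat 1)"
      "supp (\<lambda>i j. lam d i j \<or> nilp d n i j) (fi ** C ** cnj_mat f ** cnj_mat M - mat 1)"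
      "mnorm f \<le> c * (1 + mnorm C) ^ m" "mnorm fi \<le> c * (1 + mnorm C) ^ m"
      using IH[OF C] by blast
    have f': "fi ** f = mat 1" using f(1) matrix_left_right_inverse by blast
    have cf: "cnj_mat f ** cnj_mat fi = mat 1" using f(1) by (simp flip: cnj_mat_mult)
    \<comment> \<open>The conjugation \<open>C\<close> read in the frame \<open>f\<close> and
      compared with \<open>M\<close>. That \<open>C\<close> is an involution becomes
      \<open>K ** sig K = mat 1\<close>.\<close>
    define K where "K = fi ** C ** cnj_mat f ** cnj_mat M"
    have "K ** sig K = mat 1"
      unfolding K_def sig_def
      by (simp add: cnj_mat_mult mat_assoc mat_cancel[OF MM'] mat_cancel[OF MM] mat_cancel[OF cf]
          mat_cancel[OF C(1)] mat_cancel[OF f(1)] MM f')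
    define X where "X = trunc (plus_part d) (K - mat 1)"
    have Xp: "supp (plus_part d) X"
      using supp_trunc[of "\<lambda>i j. True" "K - mat 1" "plus_part d"] by (simp add: X_def supp_def)
    then obtain Xi where Xi: "(mat 1 + X) ** Xi = mat 1" "Xi ** (mat 1 + X) = mat 1"
       "mnorm Xi \<le> c1 * (1 + mnorm (mat 1 + X)) ^ m1"
      using inv[of "mat 1 + X"] by auto
    have step: "supp (\<lambda>i j. lam d i j \<or> nilp d (Suc n) i j) (Xi ** K ** sig (mat 1 + X) - mat 1)"
      by (rule split_step(1)[OF Suc.hyps f(3)[folded K_def] \<open>K ** sig K = mat 1\<close> X_def Xi(2)])
    let ?y = "mnorm C"
    have Kb: "mnorm K \<le> c * c * mnorm M * (1 + ?y) ^ Suc (m + m)"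
    proof -
      have "mnorm K \<le> (c * (1 + ?y) ^ m) * (1 + ?y) * (c * (1 + ?y) ^ m) * mnorm M"
        unfolding K_def by (intro mnorm_mult_le f) (auto simp: f)
      then show ?thesis by (simp add: power_add mult_ac)
    qed
    have Xb: "mnorm (mat 1 + X) \<le> cb * (1 + ?y) ^ mb"
    proof -
      have "mnorm (mat 1 + X) \<le> ?n + mnorm (K - mat 1)"
        by (rule order_trans[OF mnorm_add]) (simp add: mnorm_one X_def mnorm_trunc)
      also have "mnorm (K - mat 1) \<le> mnorm K + ?n"
        using mnorm_diff[of K "mat 1"] by (simp add: mnorm_one)
      finally have "mnorm (mat 1 + X) \<le> 2 * ?n * 1 + mnorm K" by simp
      also have "\<dots> \<le> 2 * ?n * (1 + ?y) ^ Suc (m + m) + c * c * mnorm M * (1 + ?y) ^ Suc (m + m)"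
        by (intro add_mono mult_left_mono Kb) (auto intro!: one_le_power simp del: power_Suc)
      finally show ?thesis by (simp add: cb_def mb_def algebra_simps)
    qed
    have Xib: "mnorm Xi \<le> c2 * (1 + ?y) ^ m2"
      unfolding c2_def m2_def by (rule poly_bound_compose[OF Xi(3) Xb]) (auto simp: c1 cb0)
    define g where "g = f ** (mat 1 + X)"
    define gi where "gi = Xi ** fi"
    have b1: "mnorm g \<le> c * cb * (1 + ?y) ^ (m + mb)"
      unfolding g_def by (rule order_trans[OF mnorm_mult poly_bound_mult[OF f(4) Xb]]) (auto simp: c)
    have b2: "mnorm gi \<le> c2 * c * (1 + ?y) ^ (m2 + m)"
      unfolding gi_def by (rule order_trans[OF mnorm_mult poly_bound_mult[OF Xib f(5)]]) (auto simp: c20)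
    have e1: "c * cb * (1 + ?y) ^ (m + mb) \<le> c3 * (1 + ?y) ^ m3"
      unfolding c3_def m3_def using c cb0 c20
      by (intro mult_mono power_increasing) auto
    have e2: "c2 * c * (1 + ?y) ^ (m2 + m) \<le> c3 * (1 + ?y) ^ m3"
      unfolding c3_def m3_def using c cb0 c20
      by (intro mult_mono power_increasing) auto
    have "g ** gi = mat 1"
      unfolding g_def gi_def by (simp add: mat_assoc mat_cancel[OF Xi(1)] f(1))
    moreover have "supp (plus_part d) (g - mat 1)"
    proof -
      have e: "g - mat 1 = (f - mat 1) + X + (f - mat 1) ** X" by (simp add: g_def mat_ring)
      show ?thesis unfolding e using f(2) Xp by (auto intro!: supp_add supp_mult)
    qed
    moreover have "gi ** C ** cnj_mat g ** cnj_mat M = Xi ** K ** sig (mat 1 + X)"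
      unfolding g_def gi_def K_def sig_def
      by (simp add: cnj_mat_mult mat_assoc mat_cancel[OF MM'])
    ultimately show ?thesis
      using step order_trans[OF b1 e1] order_trans[OF b2 e2]
      by (intro exI[of _ g] exI[of _ gi] conjI) simp_all
  qed
  have "0 \<le> c3" using c cb0 c20 by (simp add: c3_def)
  then show ?case using * by blast
qed

text \<open>The coordinate form of the existence of Deligne's bigrading. The correction
  \<open>f\<close> lies in \<open>plus_part\<close>, hence preserves both filtrations. At weight
  \<open>depth d\<close> the alternative \<open>nilp\<close> of \<open>split_iterate\<close> is void
  and only \<open>lam\<close> remains.\<close>

lemma split_real_structure:
  obtains c m where "0 \<le> c" "\<And>C. C ** cnj_mat C = mat 1 \<Longrightarrow> supp (nilp d 1) (C - M) \<Longrightarrow>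
    \<exists>f fi. f ** fi = mat 1 \<and> supp (plus_part d) (f - mat 1) \<and>
      supp (lam d) (fi ** C ** cnj_mat f ** cnj_mat M - mat 1) \<and>
      mnorm f \<le> c * (1 + mnorm C) ^ m \<and> mnorm fi \<le> c * (1 + mnorm C) ^ m"
proof -
  have "depth d \<ge> 1" by (simp add: depth_def)
  from split_iterate[OF this] obtain c m where c: "0 \<le> c" and
    *: "\<And>C. C ** cnj_mat C = mat 1 \<Longrightarrow> supp (nilp d 1) (C - M) \<Longrightarrow>
    (\<exists>f fi. f ** fi = mat 1 \<and> supp (plus_part d) (f - mat 1) \<and>
      supp (\<lambda>i j. lam d i j \<or> nilp d (depth d) i j) (fi ** C ** cnj_mat f ** cnj_mat M - mat 1) \<and>
      mnorm f \<le> c * (1 + mnorm C) ^ m \<and> mnorm fi \<le> c * (1 + mnorm C) ^ m)"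
    by blast
  have "(\<lambda>i j. lam d i j \<or> nilp d (depth d) i j) = lam d"
    using nilp_depth[of d "depth d"] by (auto simp: fun_eq_iff)
  with * have "\<And>C. C ** cnj_mat C = mat 1 \<Longrightarrow> supp (nilp d 1) (C - M) \<Longrightarrow>
    (\<exists>f fi. f ** fi = mat 1 \<and> supp (plus_part d) (f - mat 1) \<and>
      supp (lam d) (fi ** C ** cnj_mat f ** cnj_mat M - mat 1) \<and>
      mnorm f \<le> c * (1 + mnorm C) ^ m \<and> mnorm fi \<le> c * (1 + mnorm C) ^ m)"
    by simp
  then show ?thesis by (rule that[OF c])
qed

end

subsection \<open>Deligne bigradings in adapted coordinates\<close>

text \<open>
  The columns of \<open>G\<close> form a basis adapted to the Deligne bigrading.  The complex conjugation reads
  \<open>Gi ** cnj_mat G\<close> in these coordinates, and the last assumption, that it is \<open>M\<close> up to the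
  pattern \<open>lam\<close>, encodes the congruence between \<open>I p q\<close> and the conjugate of \<open>I q p\<close>.
\<close>
locale adapted = graded_conj d M
  for d :: "'n::finite \<Rightarrow> int \<times> int" and M +
  fixes W :: "'n rfilt" and F :: "'n cfilt" and G Gi :: "complex^'n^'n"
  assumes GGi: "G ** Gi = mat 1"
    and F_eq: "F p = (*v) G ` coord {i. p \<le> fst (d i)}"
    and W_eq: "complexify (W k) = (*v) G ` coord {i. wt (d i) \<le> k}"
    and conj_eq: "supp (lam d) (Gi ** cnj_mat G ** cnj_mat M - mat 1)"
begin

lemma GiG: "Gi ** G = mat 1"
  using GGi matrix_left_right_inverse by blast

lemma Gi_G_vec [simp]: "Gi *v (G *v x) = x" "G *v (Gi *v x) = x"
  by (simp_all add: matrix_vector_mul_assoc GGi GiG)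

lemma in_image_iff: "u \<in> (*v) G ` A \<longleftrightarrow> Gi *v u \<in> A"
  using Gi_G_vec by (metis image_iff)

definition bigr :: "'n bigrading" where
  "bigr p q = (*v) G ` coord {i. d i = (p, q)}"

lemma bigr_iff: "u \<in> bigr p q \<longleftrightarrow> Gi *v u \<in> coord {i. d i = (p, q)}"
  by (simp add: bigr_def in_image_iff)

lemma span_bigr: "vec.span (\<Union>(a, b)\<in>T. bigr a b) = (*v) G ` coord {i. d i \<in> T}"
proof -
  have "(\<Union>(a, b)\<in>T. bigr a b) = (\<Union>t\<in>T. (*v) G ` coord {i. d i = t})"
    by (auto simp: bigr_def)
  then show ?thesis by (simp add: span_coord_UN)
qed

definition Lam :: "complex^'n^'n" where
  "Lam = Gi ** cnj_mat G ** cnj_mat M - mat 1"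

lemma supp_Lam: "supp (lam d) Lam"
  using conj_eq by (simp add: Lam_def)

lemma conj_coords: "Gi *v cnj_vec (G *v x) = M *v cnj_vec x + Lam *v (M *v cnj_vec x)"
proof -
  have "M + Lam ** M = Gi ** cnj_mat G"
    by (simp add: Lam_def mat_ring mat_assoc MM')
  then show ?thesis
    by (simp add: cnj_vec_mult matrix_vector_mul_assoc flip: matrix_vector_mult_add_rdistrib)
qed

lemma M_coord:
  "x \<in> coord A \<Longrightarrow> (\<And>i j. j \<in> A \<Longrightarrow> d i = prod.swap (d j) \<Longrightarrow> i \<in> B) \<Longrightarrow> M *v x \<in> coord B"
  by (rule supp_coord[OF supp_M])

lemma Lam_coord:
  "x \<in> coord {i. fst (d i) \<le> p \<and> snd (d i) \<le> q} \<Longrightarrow> Lam *v x \<in> coord {i. fst (d i) < p \<and> snd (d i) < q}"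
  by (rule supp_coord[OF supp_Lam]) (auto simp: lam_def)

text \<open>All conditions but the last are statements about coordinate subspaces. For the
  congruence, \<open>M\<close> exchanges the types (p,q) and (q,p), and \<open>Lam\<close> sends
  type (p,q) to types smaller in both indices.\<close>

lemma is_deligne_bigr: "is_deligne_bigrading W F bigr"
  unfolding is_deligne_bigrading_def
proof (intro conjI allI)
  show "vec.subspace (bigr p q)" for p q
    unfolding bigr_def by (rule vec.subspace_image) simp
  have "(\<Union>a b. bigr a b) = (\<Union>(a, b)\<in>UNIV. bigr a b)" by auto
  then show "vec.span (\<Union>a b. bigr a b) = UNIV"
    by (simp only: span_bigr) (auto simp: in_image_iff)
  show "bigr p q \<inter> vec.span (\<Union>(a, b)\<in>- {(p, q)}. bigr a b) = {0}" for p q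
  proof -
    have "coord {i. d i = (p, q)} \<inter> coord {i. d i \<in> - {(p, q)}} = {0}"
      by (auto simp: coord_def vec_eq_iff)
    then have "u = 0" if "Gi *v u \<in> coord {i. d i = (p, q)}" "Gi *v u \<in> coord {i. d i \<in> - {(p, q)}}" for u
      using that Gi_G_vec(2)[of u] by (metis IntI matrix_vector_mult_0_right singletonD)
    then have "v = 0" if "v \<in> bigr p q" "v \<in> (*v) G ` coord {i. d i \<in> - {(p, q)}}" for v
      using that unfolding bigr_iff in_image_iff by blast
    moreover have "0 \<in> bigr p q" "0 \<in> (*v) G ` coord {i. d i \<in> - {(p, q)}}"
      unfolding bigr_iff in_image_iff by simp_all
    ultimately show ?thesis
      unfolding span_bigr by blast
  qed
  show "F p = vec.span (\<Union>(a, b)\<in>{(a, b). p \<le> a}. bigr a b)" for p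
    unfolding span_bigr F_eq by (simp add: case_prod_unfold)
  show "complexify (W k) = vec.span (\<Union>(a, b)\<in>{(a, b). a + b \<le> k}. bigr a b)" for k
    unfolding span_bigr W_eq by (simp add: case_prod_unfold)
  show "let R = vec.span (\<Union>(r, s)\<in>{(r, s). r < p \<and> s < q}. bigr r s)
       in subspace_sum (bigr p q) R = subspace_sum (cnj_vec ` bigr q p) R" for p q
  proof -
    let ?A = "coord {i. d i = (p, q)}" and ?B = "coord {i. d i = (q, p)}"
    define R where "R = vec.span (\<Union>(r, s)\<in>{(r, s). r < p \<and> s < q}. bigr r s)"
    have R: "R = (*v) G ` coord {i. fst (d i) < p \<and> snd (d i) < q}" (is "_ = _ ` ?C")
      unfolding R_def span_bigr by (simp add: case_prod_unfold)
    have MA: "M *v cnj_vec x \<in> ?A" if "x \<in> ?B" for x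
      by (rule M_coord[OF cnj_vec_coord[OF that]]) auto
    have MB: "M *v cnj_vec x \<in> ?B" if "x \<in> ?A" for x
      by (rule M_coord[OF cnj_vec_coord[OF that]]) auto
    have LA: "Lam *v x \<in> ?C" if "x \<in> ?A" for x
      by (rule Lam_coord) (rule subsetD[OF coord_mono that], auto)
    have sub: "subspace_sum (bigr p q) R \<subseteq> subspace_sum (cnj_vec ` bigr q p) R"
    proof
      fix u assume "u \<in> subspace_sum (bigr p q) R"
      then obtain a c where a: "a \<in> ?A" and c: "c \<in> ?C" and u: "u = G *v a + G *v c"
        by (auto simp: subspace_sum_def bigr_def R)
      define b where "b = M *v cnj_vec a"
      have b: "b \<in> ?B" using MB[OF a] by (simp add: b_def)
      have "M *v cnj_vec b = a"
        by (simp add: b_def cnj_vec_mult matrix_vector_mul_assoc MM)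
      then have "Gi *v cnj_vec (G *v b) = a + Lam *v a" by (simp add: conj_coords)
      then have "cnj_vec (G *v b) = G *v (a + Lam *v a)" by (metis Gi_G_vec(2))
      then have "u = cnj_vec (G *v b) + G *v (c - Lam *v a)"
        by (simp add: u algebra_simps)
      moreover have "c - Lam *v a \<in> ?C" using c LA[OF a] by (rule coord_diff)
      ultimately show "u \<in> subspace_sum (cnj_vec ` bigr q p) R"
        using b by (auto simp: subspace_sum_def bigr_def R)
    qed
    have sub': "subspace_sum (cnj_vec ` bigr q p) R \<subseteq> subspace_sum (bigr p q) R"
    proof
      fix u assume "u \<in> subspace_sum (cnj_vec ` bigr q p) R"
      then obtain b c where b: "b \<in> ?B" and c: "c \<in> ?C" and u: "u = cnj_vec (G *v b) + G *v c"
        by (auto simp: subspace_sum_def bigr_def R)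
      define a where "a = M *v cnj_vec b"
      have a: "a \<in> ?A" using MA[OF b] by (simp add: a_def)
      have "Gi *v cnj_vec (G *v b) = a + Lam *v a" by (simp add: conj_coords a_def)
      then have "cnj_vec (G *v b) = G *v (a + Lam *v a)" by (metis Gi_G_vec(2))
      then have "u = G *v a + G *v (c + Lam *v a)"
        by (simp add: u algebra_simps)
      moreover have "c + Lam *v a \<in> ?C" using c LA[OF a] by (rule coord_add)
      ultimately show "u \<in> subspace_sum (bigr p q) R"
        using a by (auto simp: subspace_sum_def bigr_def R)
    qed
    show ?thesis using sub sub' by (simp add: R_def Let_def)
  qed
qed

section \<open>Functoriality and uniqueness of the Deligne bigrading\<close>

text \<open>A real map that shifts \<open>F\<close> by \<open>e\<close> and \<open>W\<close> by
  \<open>2 * e\<close> shifts the bigrading by \<open>(e, e)\<close>. The filtrations alone bound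
  the first index below and the weight above; conjugating these bounds and controlling the error
  terms by induction on \<open>p\<close> leaves one type. The case \<open>e = 0\<close> with the
  identity yields uniqueness, and \<open>e = -1\<close> handles monodromy logarithms.\<close>

lemma functorial:
  assumes I: "is_deligne_bigrading W F' I'"
    and N: "cnj_mat N = N"
    and NF: "\<And>p u. u \<in> F' p \<Longrightarrow> N *v u \<in> F (p + e)"
    and NW: "\<And>k u. u \<in> complexify (W k) \<Longrightarrow> N *v u \<in> complexify (W (k + 2 * e))"
    and fin: "F' p0 = UNIV"
    and u: "u \<in> I' p q"
  shows "N *v u \<in> bigr (p + e) (q + e)"
proof -
  define N' where "N' u = Gi *v (N *v u)" for u
  have N'_add: "N' (u + v) = N' u + N' v" for u v
    by (simp add: N'_def algebra_simps)
  have N'_scale: "N' (c *s u) = c *s N' u" for c u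
    by (simp add: N'_def vec.scale)
  have I'F: "u \<in> F' p \<and> u \<in> complexify (W (p + q))" if "u \<in> I' p q" for u p q
  proof -
    have "u \<in> (\<Union>(a, b)\<in>{(a, b). p \<le> a}. I' a b)" "u \<in> (\<Union>(a, b)\<in>{(a, b). a + b \<le> p + q}. I' a b)"
      using that by auto
    then show ?thesis
      using I by (auto simp: is_deligne_bigrading_def intro: vec.span_base)
  qed
  have crude: "N' u \<in> coord {i. p + e \<le> fst (d i) \<and> wt (d i) \<le> p + q + 2 * e}" if "u \<in> I' p q" for u p q
    using NF[of u p] NW[of u "p + q"] I'F[OF that]
    by (auto simp: F_eq W_eq in_image_iff N'_def coord_def)
  \<comment> \<open>This starts the induction on \<open>p\<close>: because \<open>F' p0\<close> is
    everything, the pieces with \<open>p < p0\<close> vanish.\<close>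
  have zero: "u = 0" if "u \<in> I' p q" "p < p0" for u p q
  proof -
    have "F' p0 \<subseteq> vec.span (\<Union>(a, b)\<in>- {(p, q)}. I' a b)"
    proof -
      have "F' p0 = vec.span (\<Union>(a, b)\<in>{(a, b). p0 \<le> a}. I' a b)"
        using I unfolding is_deligne_bigrading_def by blast
      also have "\<dots> \<subseteq> vec.span (\<Union>(a, b)\<in>- {(p, q)}. I' a b)"
        by (rule vec.span_mono) (use that(2) in \<open>auto intro!: bexI[of _ "(_, _)"]\<close>)
      finally show ?thesis .
    qed
    then show ?thesis using I that(1) fin unfolding is_deligne_bigrading_def by blast
  qed
  have decomp: "\<exists>w r. w \<in> I' q p \<and> u = cnj_vec w + r \<and>
      r \<in> vec.span (\<Union>(r, s)\<in>{(r, s). r < p \<and> s < q}. I' r s)" if "u \<in> I' p q" for u p q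
  proof -
    define R where "R = vec.span (\<Union>(r, s)\<in>{(r, s). r < p \<and> s < q}. I' r s)"
    have "u \<in> subspace_sum (I' p q) R"
      unfolding subspace_sum_def R_def
      by (intro CollectI exI[of _ u] exI[of _ 0] conjI that vec.span_zero) simp
    then have "u \<in> subspace_sum (cnj_vec ` I' q p) R"
      using I unfolding is_deligne_bigrading_def Let_def R_def by blast
    then show ?thesis by (auto simp: subspace_sum_def R_def)
  qed
  have span_N': "N' r \<in> coord A" if "r \<in> vec.span S" "\<And>v. v \<in> S \<Longrightarrow> N' v \<in> coord A" for r S A
    using that(1)
  proof (induction rule: vec.span_induct_alt)
    case base
    then show ?case by (simp add: N'_def)
  next
    case (step c x y)
    then show ?case
      using that(2) by (auto simp: N'_add N'_scale intro!: coord_add vec.subspace_scale)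
  qed
  have Ncnj: "N' (cnj_vec w) = M *v cnj_vec (N' w) + Lam *v (M *v cnj_vec (N' w))" for w
  proof -
    have "N *v cnj_vec w = cnj_vec (G *v N' w)" by (simp add: N'_def cnj_vec_mult N)
    then have "N' (cnj_vec w) = Gi *v cnj_vec (G *v N' w)" by (simp add: N'_def[of "cnj_vec w"])
    then show ?thesis by (simp add: conj_coords)
  qed
  \<comment> \<open>The upper bound on the first index is the conjugate of the bound on the second
    index that \<open>crude\<close> gives for \<open>w\<close>; the remainder \<open>r\<close> has
    smaller \<open>p\<close>.\<close>
  have step1: "N' u \<in> coord {i. fst (d i) = p + e \<and> snd (d i) \<le> q + e}" if "u \<in> I' p q" for u p q
    using that
  proof (induction "nat (p - p0 + 1)" arbitrary: u p q rule: less_induct)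
    case less
    show ?case
    proof (cases "p < p0")
      case True
      then show ?thesis using zero[OF less.prems] by (simp add: N'_def)
    next
      case False
      obtain w r where wr: "w \<in> I' q p" "u = cnj_vec w + r"
        "r \<in> vec.span (\<Union>(r, s)\<in>{(r, s). r < p \<and> s < q}. I' r s)"
        using decomp[OF less.prems] by blast
      let ?P = "{i. fst (d i) \<le> p + e}"
      have "N' r \<in> coord ?P"
      proof (rule span_N'[OF wr(3)])
        fix v assume "v \<in> (\<Union>(r, s)\<in>{(r, s). r < p \<and> s < q}. I' r s)"
        then obtain r s where rs: "r < p" "v \<in> I' r s" by auto
        show "N' v \<in> coord ?P"
          using less.hyps[of r v s] rs False by (auto simp: coord_def)
      qed
      moreover have "N' (cnj_vec w) \<in> coord ?P"
      proof -
        have "cnj_vec (N' w) \<in> coord {i. snd (d i) \<le> p + e}"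
          using crude[OF wr(1)] by (intro cnj_vec_coord) (auto simp: coord_def)
        then have "M *v cnj_vec (N' w) \<in> coord ?P"
          by (rule M_coord) (auto simp: prod.swap_def)
        moreover from this have "Lam *v (M *v cnj_vec (N' w)) \<in> coord ?P"
          by (rule supp_coord[OF supp_Lam]) (auto simp: lam_def)
        ultimately show ?thesis unfolding Ncnj by (intro coord_add)
      qed
      ultimately have "N' u \<in> coord ?P"
        unfolding wr(2) N'_add by (intro coord_add)
      then have "N' u \<in> coord (?P \<inter> {i. p + e \<le> fst (d i) \<and> wt (d i) \<le> p + q + 2 * e})"
        using crude[OF less.prems] unfolding coord_Int[symmetric] by (rule IntI)
      then show ?thesis
        by (rule subsetD[OF coord_mono, rotated]) auto
    qed
  qed
  \<comment> \<open>Now \<open>step1\<close> is applied to \<open>w\<close> and conjugated, which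
    fixes the second index. What \<open>Lam\<close> and \<open>r\<close> add has first index below
    \<open>p + e\<close>, and \<open>step1\<close> for \<open>u\<close> excludes it.\<close>
  have step2: "N' u \<in> coord {i. d i = (p + e, q + e)}" if "u \<in> I' p q" for u p q
    using that
  proof (induction "nat (p - p0 + 1)" arbitrary: u p q rule: less_induct)
    case less
    show ?case
    proof (cases "p < p0")
      case True
      then show ?thesis using zero[OF less.prems] by (simp add: N'_def)
    next
      case False
      obtain w r where wr: "w \<in> I' q p" "u = cnj_vec w + r"
        "r \<in> vec.span (\<Union>(r, s)\<in>{(r, s). r < p \<and> s < q}. I' r s)"
        using decomp[OF less.prems] by blast
      let ?P = "{i. d i = (p + e, q + e) \<or> fst (d i) < p + e \<or> snd (d i) = q + e \<and> fst (d i) \<le> p + e}"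
      have "N' r \<in> coord ?P"
      proof (rule span_N'[OF wr(3)])
        fix v assume "v \<in> (\<Union>(r, s)\<in>{(r, s). r < p \<and> s < q}. I' r s)"
        then obtain r s where rs: "r < p" "v \<in> I' r s" by auto
        show "N' v \<in> coord ?P"
          using less.hyps[of r v s] rs False by (auto simp: coord_def)
      qed
      moreover have "N' (cnj_vec w) \<in> coord ?P"
      proof -
        have "cnj_vec (N' w) \<in> coord {i. fst (d i) = q + e \<and> snd (d i) \<le> p + e}"
          using step1[OF wr(1)] by (rule cnj_vec_coord)
        then have 1: "M *v cnj_vec (N' w) \<in> coord {i. snd (d i) = q + e \<and> fst (d i) \<le> p + e}"
          by (rule M_coord) (auto simp: prod.swap_def)
        then have "Lam *v (M *v cnj_vec (N' w)) \<in> coord ?P"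
          by (rule supp_coord[OF supp_Lam]) (auto simp: lam_def)
        moreover have "M *v cnj_vec (N' w) \<in> coord ?P"
          using 1 by (rule subsetD[OF coord_mono, rotated]) auto
        ultimately show ?thesis unfolding Ncnj by (intro coord_add)
      qed
      ultimately have "N' u \<in> coord ?P"
        unfolding wr(2) N'_add by (intro coord_add)
      then have "N' u \<in> coord (?P \<inter> {i. fst (d i) = p + e \<and> snd (d i) \<le> q + e})"
        using step1[OF less.prems] unfolding coord_Int[symmetric] by (rule IntI)
      then show ?thesis
        by (rule subsetD[OF coord_mono, rotated]) (auto simp: prod_eq_iff)
    qed
  qed
  show ?thesis using step2[OF u] by (simp add: bigr_iff N'_def)
qed

text \<open>Functoriality of the identity gives one inclusion for each piece. As the pieces
  \<open>I p q\<close> also span, projecting a decomposition to type (p,q) gives the other.\<close>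

lemma deligne_eq:
  assumes "F p0 = UNIV"
  shows "deligne W F = bigr"
  unfolding deligne_def
proof (rule the_equality[where a = bigr])
  show "is_deligne_bigrading W F bigr" by (rule is_deligne_bigr)
  fix I assume I: "is_deligne_bigrading W F I"
  have sub: "I p q \<subseteq> bigr p q" for p q
    using functorial[OF I, of "mat 1" 0 p0 _ p q] assms by auto
  have "u \<in> I p q" if u: "u \<in> bigr p q" for u p q
  proof -
    define P where "P v = G *v (\<chi> i. if d i = (p, q) then (Gi *v v) $ i else 0)" for v
    have P_add: "P (v + w) = P v + P w" for v w
      unfolding P_def matrix_vector_right_distrib[symmetric]
      by (rule arg_cong[where f = "(*v) G"]) (auto simp: vec_eq_iff matrix_vector_right_distrib)
    have P_scale: "P (c *s v) = c *s P v" for c v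
      unfolding P_def vec.scale[symmetric]
      by (rule arg_cong[where f = "(*v) G"]) (auto simp: vec_eq_iff vec.scale)
    have PI: "P v \<in> I p q" if v: "v \<in> I a b" for v a b
    proof -
      have va: "Gi *v v \<in> coord {i. d i = (a, b)}" using subsetD[OF sub v] by (simp add: bigr_iff)
      show ?thesis
      proof (cases "(a, b) = (p, q)")
        case True
        then have "(\<chi> i. if d i = (p, q) then (Gi *v v) $ i else 0) = Gi *v v"
          using va by (auto simp: coord_def vec_eq_iff)
        then show ?thesis using True v by (simp add: P_def)
      next
        case False
        then have "(\<chi> i. if d i = (p, q) then (Gi *v v) $ i else 0) = 0"
          using va by (auto simp: coord_def vec_eq_iff)
        then show ?thesis
          using I by (simp add: P_def is_deligne_bigrading_def vec.subspace_0)
      qed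
    qed
    have sI: "vec.subspace (I p q)" using I by (simp add: is_deligne_bigrading_def)
    have "u \<in> vec.span (\<Union>a b. I a b)" using I by (simp add: is_deligne_bigrading_def)
    then have "P u \<in> I p q"
    proof (induction rule: vec.span_induct_alt)
      case base
      have "(\<chi> i. if d i = (p, q) then (Gi *v 0) $ i else 0) = (0 :: complex^'n)" by (simp add: vec_eq_iff)
      then show ?case using sI by (simp add: P_def vec.subspace_0)
    next
      case (step c x y)
      then show ?case
        using PI sI by (auto simp: P_add P_scale intro!: vec.subspace_add vec.subspace_scale)
    qed
    moreover have "P u = u"
    proof -
      have "(\<chi> i. if d i = (p, q) then (Gi *v u) $ i else 0) = Gi *v u"
        using u by (auto simp: bigr_iff coord_def vec_eq_iff)
      then show ?thesis by (simp add: P_def)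
    qed
    ultimately show ?thesis by simp
  qed
  then show "I = bigr" using sub by (intro ext) blast
qed

end

subsection \<open>Complexified filtrations\<close>

lemma re_vec_add: "re_vec (u + v) = re_vec u + re_vec v"
  and im_vec_add: "im_vec (u + v) = im_vec u + im_vec v"
  and re_vec_diff: "re_vec (u - v) = re_vec u - re_vec v"
  and im_vec_diff: "im_vec (u - v) = im_vec u - im_vec v"
  and re_vec_scale: "re_vec (c *s u) = Re c *\<^sub>R re_vec u - Im c *\<^sub>R im_vec u"
  and im_vec_scale: "im_vec (c *s u) = Re c *\<^sub>R im_vec u + Im c *\<^sub>R re_vec u"
  and re_vec_cnj: "re_vec (cnj_vec u) = re_vec u"
  and im_vec_cnj: "im_vec (cnj_vec u) = - im_vec u"
  and re_vec_zero: "re_vec 0 = 0" and im_vec_zero: "im_vec 0 = 0"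
  by (simp_all add: re_vec_def im_vec_def vec_eq_iff)

lemma complexify_subspace: "subspace A \<Longrightarrow> vec.subspace (complexify A)"
  by (auto simp: vec.subspace_def complexify_def re_vec_add im_vec_add re_vec_scale im_vec_scale
      re_vec_zero im_vec_zero
      intro: subspace_0 subspace_add subspace_diff subspace_scale)

lemma complexify_cnj: "subspace A \<Longrightarrow> u \<in> complexify A \<Longrightarrow> cnj_vec u \<in> complexify A"
  by (auto simp: complexify_def re_vec_cnj im_vec_cnj subspace_neg)

lemma complexify_mono: "A \<subseteq> B \<Longrightarrow> complexify A \<subseteq> complexify B"
  by (auto simp: complexify_def)

lemma complexify_zero: "complexify {0} = {0}"
proof -
  have "u = 0" if "re_vec u = 0" "im_vec u = 0" for u :: "complex^'n"
    using that by (simp add: vec_eq_iff re_vec_def im_vec_def complex_eq_iff)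
  then show ?thesis by (auto simp: complexify_def re_vec_zero im_vec_zero)
qed

lemma complexify_UNIV: "complexify UNIV = UNIV"
  by (auto simp: complexify_def)

lemma cnj_image_subspace:
  assumes "vec.subspace A"
  shows "vec.subspace (cnj_vec ` A)"
  unfolding vec.subspace_def
proof (intro conjI ballI allI)
  show "0 \<in> cnj_vec ` A"
    using vec.subspace_0[OF assms] by (metis cnj_vec_zero imageI)
  show "x + y \<in> cnj_vec ` A" if "x \<in> cnj_vec ` A" "y \<in> cnj_vec ` A" for x y
    using that vec.subspace_add[OF assms] by (auto simp flip: cnj_vec_add)
  show "c *s x \<in> cnj_vec ` A" if "x \<in> cnj_vec ` A" for c x
  proof -
    obtain a where a: "a \<in> A" "x = cnj_vec a" using \<open>x \<in> cnj_vec ` A\<close> by auto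
    have "c *s x = cnj_vec (cnj c *s a)" by (simp add: a cnj_vec_scale)
    then show ?thesis using vec.subspace_scale[OF assms a(1)] by auto
  qed
qed

lemma cnj_image_iff: "u \<in> cnj_vec ` A \<longleftrightarrow> cnj_vec u \<in> A"
  by (metis cnj_vec_cnj_vec image_iff)

lemma subspace_sum_subspace: "vec.subspace A \<Longrightarrow> vec.subspace B \<Longrightarrow> vec.subspace (subspace_sum A B)"
  unfolding subspace_sum_def by (rule vec.subspace_sums)

lemma in_subspace_sumI: "a \<in> A \<Longrightarrow> b \<in> B \<Longrightarrow> a + b \<in> subspace_sum A B"
  by (auto simp: subspace_sum_def)

lemma subspace_sum_left: "vec.subspace B \<Longrightarrow> A \<subseteq> subspace_sum A B"
  using vec.subspace_0 by (force simp: subspace_sum_def)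

lemma subspace_sum_right: "vec.subspace A \<Longrightarrow> B \<subseteq> subspace_sum A B"
  using vec.subspace_0 by (force simp: subspace_sum_def)

lemma subspace_sum_minimal: "vec.subspace C \<Longrightarrow> A \<subseteq> C \<Longrightarrow> B \<subseteq> C \<Longrightarrow> subspace_sum A B \<subseteq> C"
  using vec.subspace_add by (force simp: subspace_sum_def)

lemma subspace_sum_dim:
  "vec.subspace A \<Longrightarrow> vec.subspace B \<Longrightarrow>
    vec.dim (subspace_sum A B) + vec.dim (A \<inter> B) = vec.dim A + vec.dim (B :: (complex^'n::finite) set)"
  unfolding subspace_sum_def by (rule vec.dim_sums_Int)

locale filtered_space =
  fixes W :: "'n::finite rfilt"
  assumes W_filt: "finite_increasing_filtration W"
begin

abbreviation cW :: "int \<Rightarrow> (complex^'n) set" where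
  "cW k \<equiv> complexify (W k)"

lemma cW_subspace [simp]: "vec.subspace (cW k)"
  using W_filt by (intro complexify_subspace) (simp add: finite_increasing_filtration_def)

lemma cW_mono: "k \<le> l \<Longrightarrow> cW k \<subseteq> cW l"
  using W_filt by (intro complexify_mono) (simp add: finite_increasing_filtration_def)

lemma cW_pred: "u \<in> cW (k - 1) \<Longrightarrow> u \<in> cW k"
  using cW_mono[of "k - 1" k] by auto

lemma cW_cnj: "u \<in> cW k \<Longrightarrow> cnj_vec u \<in> cW k"
  using W_filt by (intro complexify_cnj) (simp_all add: finite_increasing_filtration_def)

lemmas cW_add = vec.subspace_add[OF cW_subspace]
lemmas cW_diff = vec.subspace_diff[OF cW_subspace]

lemma cW_bounds:
  obtains w0 w1 where "w0 \<le> w1" "\<And>k. k \<le> w0 \<Longrightarrow> cW k = {0}" "\<And>k. k \<ge> w1 \<Longrightarrow> cW k = UNIV"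
proof -
  obtain a b where ab: "W a = {0}" "W b = UNIV"
    using W_filt by (auto simp: finite_increasing_filtration_def)
  have 1: "cW k = {0}" if "k \<le> a" for k
    using cW_mono[OF that] ab(1) vec.subspace_0[OF cW_subspace[of k]] by (auto simp: complexify_zero)
  have 2: "cW k = UNIV" if "k \<ge> b" for k
    using cW_mono[OF that] ab(2) by (auto simp: complexify_UNIV)
  show ?thesis by (rule that[of "min a b" b]) (simp_all add: 1 2)
qed

text \<open>The endomorphisms that induce zero on the graded quotients. The unipotent elements
  moving points of the classifying space differ from the identity by such an endomorphism.\<close>

definition lowers :: "complex^'n^'n \<Rightarrow> bool" where
  "lowers X \<longleftrightarrow> (\<forall>k. \<forall>u\<in>cW k. X *v u \<in> cW (k - 1))"

lemma unip_cW:
  assumes "lowers (h - mat 1)" "u \<in> cW k"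
  shows "h *v u - u \<in> cW (k - 1)" "h *v u \<in> cW k"
proof -
  have "(h - mat 1) *v u \<in> cW (k - 1)" using assms by (auto simp: lowers_def)
  then show *: "h *v u - u \<in> cW (k - 1)" by (simp add: matrix_vector_mult_diff_rdistrib)
  have "(h *v u - u) + u \<in> cW k" by (rule cW_add[OF cW_pred[OF *] assms(2)])
  then show "h *v u \<in> cW k" by simp
qed

lemma FGr_subspace: "vec.subspace (F p) \<Longrightarrow> vec.subspace (FGr W F p w)"
  unfolding FGr_def by (intro subspace_sum_subspace vec.subspace_inter) auto

lemma cW_FGr: "vec.subspace (F p) \<Longrightarrow> cW (w - 1) \<subseteq> FGr W F p w"
  unfolding FGr_def by (intro subspace_sum_right vec.subspace_inter) auto

lemma FGr_cW: "FGr W F p w \<subseteq> cW w"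
  unfolding FGr_def by (rule subspace_sum_minimal) (auto intro: cW_pred)

lemma F_FGr: "u \<in> F p \<Longrightarrow> u \<in> cW w \<Longrightarrow> u \<in> FGr W F p w"
  using subspace_sum_left[OF cW_subspace[of "w - 1"], of "F p \<inter> cW w"] by (auto simp: FGr_def)

lemma FGr_mono: "F q \<subseteq> F p \<Longrightarrow> FGr W F q w \<subseteq> FGr W F p w"
  by (auto simp: FGr_def subspace_sum_def)

text \<open>\<open>h\<close> is the identity on each graded quotient, so replacing a representative
  \<open>x\<close> by \<open>h *v x\<close> only changes the part in
  \<open>cW (w - 1)\<close>.\<close>

lemma FGr_unip_subset:
  assumes "lowers (h - mat 1)"
  shows "FGr W F p w \<subseteq> FGr W (filt_act h F) p w"
proof
  fix u assume "u \<in> FGr W F p w"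
  then obtain x y where xy: "x \<in> F p" "x \<in> cW w" "y \<in> cW (w - 1)" "u = x + y"
    by (auto simp: FGr_def subspace_sum_def)
  have "u = h *v x + (y - (h *v x - x))" by (simp add: xy)
  moreover have "h *v x \<in> filt_act h F p" using xy by (simp add: filt_act_def)
  ultimately show "u \<in> FGr W (filt_act h F) p w"
    unfolding FGr_def using unip_cW[OF assms xy(2)] xy(3)
    by (metis (no_types, lifting) IntI cW_diff in_subspace_sumI)
qed

lemma filt_act_mult: "filt_act g (filt_act h F) = filt_act (g ** h) F"
  by (simp add: filt_act_def image_image matrix_vector_mul_assoc)

lemma filt_act_one [simp]: "filt_act (mat 1) F = F"
  by (simp add: filt_act_def)

lemma FGr_unip:
  assumes "lowers (h - mat 1)" "lowers (hi - mat 1)" "hi ** h = mat 1"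
  shows "FGr W (filt_act h F) p w = FGr W F p w"
proof
  have "FGr W (filt_act h F) p w \<subseteq> FGr W (filt_act hi (filt_act h F)) p w"
    by (rule FGr_unip_subset[OF assms(2)])
  then show "FGr W (filt_act h F) p w \<subseteq> FGr W F p w"
    by (simp add: filt_act_mult assms(3))
qed (rule FGr_unip_subset[OF assms(1)])

lemma filtration_filt_act:
  assumes "finite_decreasing_filtration F" "h ** hi = mat 1"
  shows "finite_decreasing_filtration (filt_act h F)"
proof -
  have "h *v (hi *v u) = u" for u by (simp add: matrix_vector_mul_assoc assms(2))
  then have "(*v) h ` UNIV = UNIV" by (metis surjI)
  moreover have "(*v) h ` {0} = {0}" by simp
  ultimately show ?thesis
    using assms(1) vec.subspace_image[of _ h] unfolding finite_decreasing_filtration_def filt_act_def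
    by (metis image_mono)
qed

end

text \<open>Apart from being a finite filtration, every condition on \<open>F\<close> is a condition
  on \<open>FGr W F\<close>. This keeps translated points inside the classifying space and later
  places the limit there.\<close>

lemma classifying_space_cong:
  assumes "F \<in> classifying_space W S hn" "finite_decreasing_filtration F'" "FGr W F' = FGr W F"
  shows "F' \<in> classifying_space W S hn"
proof -
  note eq = assms(3)
  have F: "F \<in> M_check W S hn" "mixed_hodge_structure W F" "graded_polarized W S F"
    using assms(1) by (simp_all add: classifying_space_def)
  have b: "bilinear_relation W S F' = bilinear_relation W S F"
    by (simp only: bilinear_relation_def eq)
  have "F' \<in> M_check W S hn"
    unfolding M_check_def mem_Collect_eq b eq
    using F(1)[unfolded M_check_def mem_Collect_eq] assms(2) by (elim conjE, intro conjI)
  moreover have "mixed_hodge_structure W F'"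
    unfolding mixed_hodge_structure_def eq
    using F(2)[unfolded mixed_hodge_structure_def] assms(2) by blast
  moreover have "graded_polarized W S F'"
    unfolding graded_polarized_def b eq
    using F(3)[unfolded graded_polarized_def] .
  ultimately show ?thesis by (simp add: classifying_space_def)
qed


subsection \<open>Adapted bases of mixed Hodge structures\<close>

lemma complement_basis:
  fixes S T :: "(complex^'n::finite) set"
  assumes "vec.subspace S" "vec.subspace T" "S \<subseteq> T"
  obtains B where "B \<subseteq> T" "finite B" "card B + vec.dim S = vec.dim T" "T \<subseteq> subspace_sum S (vec.span B)"
proof -
  obtain B0 where B0: "B0 \<subseteq> S" "vec.independent B0" "S \<subseteq> vec.span B0" "card B0 = vec.dim S"
    using vec.basis_exists by blast
  obtain B1 where B1: "B0 \<subseteq> B1" "B1 \<subseteq> T" "vec.independent B1" "T \<subseteq> vec.span B1"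
    using vec.maximal_independent_subset_extend[OF _ B0(2), of T] B0(1) assms(3) by blast
  have fin: "finite B1" using B1(3) vec.finiteI_independent by blast
  show ?thesis
  proof (rule that[of "B1 - B0"])
    have "card B1 = vec.dim T" using vec.dim_unique[OF B1(2,4,3)] by simp
    then show "card (B1 - B0) + vec.dim S = vec.dim T"
      using B0(4) B1(1) fin card_mono[OF fin B1(1)] by (simp add: card_Diff_subset finite_subset)
    have "B1 = B0 \<union> (B1 - B0)" using B1(1) by blast
    then have "vec.span B1 = vec.span (B0 \<union> (B1 - B0))" by (rule arg_cong)
    also have "\<dots> = subspace_sum (vec.span B0) (vec.span (B1 - B0))"
      unfolding subspace_sum_def by (rule vec.span_Un)
    also have "\<dots> \<subseteq> subspace_sum S (vec.span (B1 - B0))"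
      using vec.span_minimal[OF B0(1) assms(1)] by (auto simp: subspace_sum_def)
    finally show "T \<subseteq> subspace_sum S (vec.span (B1 - B0))" using B1(4) by blast
  qed (use B1 fin in auto)
qed

lemma telescope_int:
  fixes f g :: "int \<Rightarrow> nat"
  assumes "a \<le> b" "\<And>p. a \<le> p \<Longrightarrow> p < b \<Longrightarrow> f p = f (p + 1) + g p"
  shows "f a = f b + (\<Sum>p\<in>{a..<b}. g p)"
  using assms
proof (induction rule: int_ge_induct)
  case (step i)
  have "{a..<i + 1} = insert i {a..<i}" using step.hyps by auto
  then show ?case using step by (simp add: algebra_simps)
qed simp

lemma image_coord_span:
  "(*v) (Q :: complex^'n::finite^'n) ` coord A = vec.span ((\<lambda>i. Q *v axis i 1) ` A)"
proof -
  have "coord {i. i = t} = vec.span {axis t 1 :: complex^'n}" for t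
    unfolding vec.span_singleton
  proof (intro equalityI subsetI)
    fix x :: "complex^'n" assume "x \<in> coord {i. i = t}"
    then have "x = x $ t *s axis t 1" by (auto simp: coord_def axis_def vec_eq_iff)
    then show "x \<in> range (\<lambda>k. k *s axis t 1)" by blast
  qed (auto simp: coord_def axis_def split: if_splits)
  then have "(*v) Q ` coord {i. i = t} = vec.span {Q *v axis t 1}" for t
    using vec.span_image[of Q "{axis t 1}"] by simp
  then have "(\<Union>t\<in>A. (*v) Q ` coord {i. i = t}) = (\<Union>t\<in>A. vec.span {Q *v axis t 1})" by simp
  moreover have "vec.span (\<Union>t\<in>A. vec.span {Q *v axis t 1}) = vec.span ((\<lambda>i. Q *v axis i 1) ` A)"
  proof (rule vec.span_eq[THEN iffD2], intro conjI)
    show "(\<Union>t\<in>A. vec.span {Q *v axis t 1}) \<subseteq> vec.span ((\<lambda>i. Q *v axis i 1) ` A)"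
      by (intro UN_least vec.span_mono) auto
    show "(\<lambda>i. Q *v axis i 1) ` A \<subseteq> vec.span (\<Union>t\<in>A. vec.span {Q *v axis t 1})"
      by (auto intro!: vec.span_base bexI)
  qed
  ultimately show ?thesis
    using span_coord_UN[of Q "\<lambda>i. i" A] by simp
qed

context filtered_space
begin

context
  fixes F :: "'n cfilt"
  assumes mhs: "mixed_hodge_structure W F"
begin

lemma F_filt: "finite_decreasing_filtration F"
  using mhs by (simp add: mixed_hodge_structure_def)

lemma F_subspace [simp]: "vec.subspace (F p)"
  using F_filt by (simp add: finite_decreasing_filtration_def)

lemma F_mono: "p \<le> q \<Longrightarrow> F q \<subseteq> F p"
  using F_filt by (simp add: finite_decreasing_filtration_def)

text \<open>The preimage in \<open>cW (p + q)\<close> of the Hodge component of type (p,q) of the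
  graded quotient.\<close>

definition Hpq :: "int \<Rightarrow> int \<Rightarrow> (complex^'n) set" where
  "Hpq p q = FGr W F p (p + q) \<inter> cnj_vec ` FGr W F q (p + q)"

lemma Hpq_subspace: "vec.subspace (Hpq p q)"
  unfolding Hpq_def by (intro vec.subspace_inter cnj_image_subspace FGr_subspace) simp_all

lemma Hpq_cnj: "u \<in> Hpq p q \<Longrightarrow> cnj_vec u \<in> Hpq q p"
  by (auto simp: Hpq_def cnj_image_iff add.commute)

lemma cW_cnj_FGr: "cW (w - 1) \<subseteq> cnj_vec ` FGr W F p w"
proof
  fix u assume "u \<in> cW (w - 1)"
  then have "cnj_vec u \<in> FGr W F p w"
    using cW_cnj cW_FGr[where F = F and p = p and w = w, OF F_subspace] by blast
  then show "u \<in> cnj_vec ` FGr W F p w" by (simp add: cnj_image_iff)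
qed

lemma cW_Hpq: "cW (p + q - 1) \<subseteq> Hpq p q"
  unfolding Hpq_def using cW_FGr[of F p "p + q"] cW_cnj_FGr[of "p + q" q] by auto

lemma opposed:
  "subspace_sum (FGr W F p w) (cnj_vec ` FGr W F (w - p + 1) w) = cW w"
  "FGr W F p w \<inter> cnj_vec ` FGr W F (w - p + 1) w = cW (w - 1)"
  using mhs by (auto simp: mixed_hodge_structure_def)

text \<open>Opposedness at \<open>p + 1\<close> makes the conjugate of step \<open>w - p\<close> a
  complement of step \<open>p + 1\<close> in the graded quotient. Intersecting with step
  \<open>p\<close> leaves the component of type (p,w-p).\<close>

lemma FGr_split: "FGr W F p w = subspace_sum (FGr W F (p + 1) w) (Hpq p (w - p))"
proof
  have sub: "FGr W F (p + 1) w \<subseteq> FGr W F p w" by (rule FGr_mono) (rule F_mono, simp)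
  show "subspace_sum (FGr W F (p + 1) w) (Hpq p (w - p)) \<subseteq> FGr W F p w"
    by (rule subspace_sum_minimal[OF FGr_subspace sub]) (auto simp: Hpq_def)
  show "FGr W F p w \<subseteq> subspace_sum (FGr W F (p + 1) w) (Hpq p (w - p))"
  proof
    fix u assume u: "u \<in> FGr W F p w"
    then have "u \<in> subspace_sum (FGr W F (p + 1) w) (cnj_vec ` FGr W F (w - p) w)"
      using opposed(1)[of "p + 1" w] FGr_cW by fastforce
    then obtain a b where ab: "a \<in> FGr W F (p + 1) w" "b \<in> cnj_vec ` FGr W F (w - p) w" "u = a + b"
      by (auto simp: subspace_sum_def)
    have "u - a \<in> FGr W F p w"
      by (rule vec.subspace_diff[OF FGr_subspace u]) (use ab sub in auto)
    then have "b \<in> Hpq p (w - p)" using ab by (simp add: Hpq_def)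
    then show "u \<in> subspace_sum (FGr W F (p + 1) w) (Hpq p (w - p))"
      using ab by (auto intro: in_subspace_sumI)
  qed
qed

lemma FGr_Hpq: "FGr W F (p + 1) w \<inter> Hpq p (w - p) = cW (w - 1)"
proof
  show "FGr W F (p + 1) w \<inter> Hpq p (w - p) \<subseteq> cW (w - 1)"
    using opposed(2)[of "p + 1" w] by (auto simp: Hpq_def)
  show "cW (w - 1) \<subseteq> FGr W F (p + 1) w \<inter> Hpq p (w - p)"
    using cW_Hpq[of p "w - p"] cW_FGr[of F "p + 1" w] by auto
qed

lemma dim_FGr_Hpq:
  "vec.dim (FGr W F p w) + vec.dim (cW (w - 1)) = vec.dim (FGr W F (p + 1) w) + vec.dim (Hpq p (w - p))"
  using subspace_sum_dim[of "FGr W F (p + 1) w" "Hpq p (w - p)"]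
  by (simp add: FGr_subspace Hpq_subspace FGr_Hpq flip: FGr_split)

lemma Hpq_F:
  assumes "u \<in> Hpq p q"
  obtains x y where "x \<in> F p \<inter> Hpq p q" "y \<in> cW (p + q - 1)" "u = x + y"
proof -
  obtain x y where xy: "x \<in> F p" "y \<in> cW (p + q - 1)" "u = x + y"
    using assms by (auto simp: Hpq_def FGr_def subspace_sum_def)
  have "u - y \<in> Hpq p q"
    using assms cW_Hpq[of p q] xy by (intro vec.subspace_diff[OF Hpq_subspace]) auto
  then show ?thesis using that[of x y] xy by simp
qed

text \<open>The representatives of the Hodge component are taken inside \<open>F p\<close>, so that
  they will be compatible with both filtrations at once. Their number is the Hodge number.\<close>

lemma Hpq_basis:
  obtains B where "B \<subseteq> F p \<inter> Hpq p q" "finite B"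
    "Hpq p q \<subseteq> subspace_sum (vec.span B) (cW (p + q - 1))"
    "vec.dim (FGr W F p (p + q)) = vec.dim (FGr W F (p + 1) (p + q)) + card B"
proof -
  let ?T = "F p \<inter> Hpq p q" and ?S = "F p \<inter> cW (p + q - 1)"
  have sT: "vec.subspace ?T" and sS: "vec.subspace ?S" and ST: "?S \<subseteq> ?T"
    using cW_Hpq[of p q] by (auto intro!: vec.subspace_inter Hpq_subspace)
  obtain B where B: "B \<subseteq> ?T" "finite B" "card B + vec.dim ?S = vec.dim ?T" "?T \<subseteq> subspace_sum ?S (vec.span B)"
    using complement_basis[OF sS sT ST] by blast
  have "Hpq p q = subspace_sum ?T (cW (p + q - 1))"
  proof
    show "Hpq p q \<subseteq> subspace_sum ?T (cW (p + q - 1))"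
    proof
      fix u assume "u \<in> Hpq p q"
      then obtain x y where "x \<in> ?T" "y \<in> cW (p + q - 1)" "u = x + y" by (rule Hpq_F)
      then show "u \<in> subspace_sum ?T (cW (p + q - 1))" by (simp add: in_subspace_sumI)
    qed
    show "subspace_sum ?T (cW (p + q - 1)) \<subseteq> Hpq p q"
      using cW_Hpq[of p q] by (intro subspace_sum_minimal Hpq_subspace) auto
  qed
  moreover have "?T \<inter> cW (p + q - 1) = ?S" using cW_Hpq[of p q] by auto
  ultimately have "vec.dim (Hpq p q) + vec.dim ?S = vec.dim ?T + vec.dim (cW (p + q - 1))"
    using subspace_sum_dim[OF sT cW_subspace[of "p + q - 1"]] by simp
  then have "vec.dim (Hpq p q) = card B + vec.dim (cW (p + q - 1))" using B(3) by simp
  then have dims: "vec.dim (FGr W F p (p + q)) = vec.dim (FGr W F (p + 1) (p + q)) + card B"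
    using dim_FGr_Hpq[of p "p + q"] by simp
  have "Hpq p q \<subseteq> subspace_sum (vec.span B) (cW (p + q - 1))"
  proof
    fix u assume "u \<in> Hpq p q"
    then obtain x y where xy: "x \<in> ?T" "y \<in> cW (p + q - 1)" "u = x + y" by (rule Hpq_F)
    then obtain s b where sb: "s \<in> ?S" "b \<in> vec.span B" "x = s + b"
      using B(4) by (auto simp: subspace_sum_def)
    have u: "u = b + (s + y)" using xy sb by simp
    have "s + y \<in> cW (p + q - 1)" using xy sb by (intro cW_add) auto
    then show "u \<in> subspace_sum (vec.span B) (cW (p + q - 1))"
      unfolding u by (rule in_subspace_sumI[OF sb(2)])
  qed
  then show ?thesis using that B dims by blast
qed

text \<open>A first approximation to an adapted frame: \<open>F\<close> and \<open>W\<close> are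
  already coordinate filtrations, but the conjugation equals \<open>M\<close> only modulo lower
  weight. \<open>split_real_structure\<close> removes the discrepancy.\<close>

lemma adapted_basis:
  obtains d :: "'n \<Rightarrow> int \<times> int" and M Q Qi where
    "graded_conj d M" "Q ** Qi = mat 1"
    "\<And>p. F p = (*v) Q ` coord {i. p \<le> fst (d i)}"
    "\<And>k. cW k = (*v) Q ` coord {i. wt (d i) \<le> k}"
    "supp (nilp d 1) (Qi ** cnj_mat Q - M)"
proof -
  have "\<forall>p q. \<exists>B. B \<subseteq> F p \<inter> Hpq p q \<and> finite B \<and>
    Hpq p q \<subseteq> subspace_sum (vec.span B) (cW (p + q - 1)) \<and>
    vec.dim (FGr W F p (p + q)) = vec.dim (FGr W F (p + 1) (p + q)) + card B"
  proof (intro allI)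
    fix p q
    show "\<exists>B. B \<subseteq> F p \<inter> Hpq p q \<and> finite B \<and>
      Hpq p q \<subseteq> subspace_sum (vec.span B) (cW (p + q - 1)) \<and>
      vec.dim (FGr W F p (p + q)) = vec.dim (FGr W F (p + 1) (p + q)) + card B"
      by (rule Hpq_basis[of p q]) blast
  qed
  then obtain B where B: "\<And>p q. B p q \<subseteq> F p \<inter> Hpq p q" "\<And>p q. finite (B p q)"
    "\<And>p q. Hpq p q \<subseteq> subspace_sum (vec.span (B p q)) (cW (p + q - 1))"
    "\<And>p q. vec.dim (FGr W F p (p + q)) = vec.dim (FGr W F (p + 1) (p + q)) + card (B p q)"
    unfolding choice_iff by blast
  obtain w0 w1 where w: "w0 \<le> w1" "\<And>k. k \<le> w0 \<Longrightarrow> cW k = {0}" "\<And>k. k \<ge> w1 \<Longrightarrow> cW k = UNIV"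
    using cW_bounds by blast
  obtain P0' P1 where P': "F P0' = UNIV" "F P1 = {0}"
    using F_filt by (auto simp: finite_decreasing_filtration_def)
  define P0 where "P0 = min P0' P1"
  have P0: "F p = UNIV" if "p \<le> P0" for p using F_mono[of p P0'] that P'(1) by (auto simp: P0_def)
  have P1: "F p = {0}" if "p \<ge> P1" for p
    using F_mono[OF that] P'(2) vec.subspace_0[OF F_subspace[of p]] by auto
  have FGr_P0: "FGr W F p w = cW w" if "p \<le> P0" for p w
    using FGr_cW[of F p w] F_FGr[of _ F p w] P0[OF that] by auto
  have FGr_P1: "FGr W F p w = cW (w - 1)" if "p \<ge> P1" for p w
    using P1[OF that] vec.subspace_0[OF cW_subspace[of w]] by (auto simp: FGr_def subspace_sum_def)
  have B_empty: "B p q = {}" if out: "\<not> (P0 \<le> p \<and> p < P1 \<and> w0 < p + q \<and> p + q \<le> w1)" for p q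
  proof -
    have "FGr W F p (p + q) = FGr W F (p + 1) (p + q)"
    proof -
      consider "p < P0" | "P1 \<le> p" | "p + q \<le> w0" | "w1 < p + q" using out by linarith
      then show ?thesis
      proof cases
        case 1 then show ?thesis by (simp add: FGr_P0)
      next
        case 2 then show ?thesis by (simp add: FGr_P1)
      next
        case 3
        then have "FGr W F p (p + q) \<subseteq> {0}" "FGr W F (p + 1) (p + q) \<subseteq> {0}"
          using FGr_cW w(2) by blast+
        moreover have "0 \<in> FGr W F p (p + q)" "0 \<in> FGr W F (p + 1) (p + q)"
          using vec.subspace_0[OF FGr_subspace] by auto
        ultimately show ?thesis by blast
      next
        case 4
        then have "cW (p + q - 1) = UNIV" using w(3) by simp
        then show ?thesis using cW_FGr[of F p "p + q"] cW_FGr[of F "p + 1" "p + q"] by auto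
      qed
    qed
    then have "card (B p q) = 0" using B(4)[of p q] by simp
    then show ?thesis using B(2) by simp
  qed
  define T where "T = (\<lambda>(p, w). (p, w - p)) ` ({P0..<P1} \<times> {w0 + 1..<w1 + 1})"
  have T: "(p, q) \<in> T" if "b \<in> B p q" for p q b
  proof -
    have "P0 \<le> p \<and> p < P1 \<and> w0 < p + q \<and> p + q \<le> w1" using B_empty[of p q] that by blast
    then show ?thesis unfolding T_def by (intro image_eqI[of _ _ "(p, p + q)"]) auto
  qed
  define I where "I = (SIGMA t:T. B (fst t) (snd t))"
  \<comment> \<open>Two telescoping sums, over \<open>p\<close> within a weight and then over the
    weights. Once the family is known to span, this count makes \<open>Q\<close> a surjective square
    matrix, hence invertible.\<close>
  have "card I = CARD('n)"
  proof -
    have "card I = (\<Sum>t\<in>T. card (B (fst t) (snd t)))"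
      unfolding I_def by (rule card_SigmaI) (auto simp: T_def B(2))
    also have "\<dots> = (\<Sum>(p, w)\<in>{P0..<P1} \<times> {w0 + 1..<w1 + 1}. card (B p (w - p)))"
      unfolding T_def by (subst sum.reindex) (auto simp: inj_on_def case_prod_unfold)
    also have "\<dots> = (\<Sum>w\<in>{w0 + 1..<w1 + 1}. \<Sum>p\<in>{P0..<P1}. card (B p (w - p)))"
      by (simp add: sum.cartesian_product[symmetric] sum.swap[of _ "{P0..<P1}"])
    also have "\<dots> = (\<Sum>w\<in>{w0 + 1..<w1 + 1}. vec.dim (cW w) - vec.dim (cW (w - 1)))"
    proof (rule sum.cong[OF refl])
      fix w
      have "vec.dim (FGr W F P0 w) = vec.dim (FGr W F P1 w) + (\<Sum>p\<in>{P0..<P1}. card (B p (w - p)))"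
      proof (rule telescope_int)
        show "vec.dim (FGr W F p w) = vec.dim (FGr W F (p + 1) w) + card (B p (w - p))" for p
          using B(4)[of p "w - p"] by (simp del: One_nat_def)
      qed (simp add: P0_def)
      then show "(\<Sum>p\<in>{P0..<P1}. card (B p (w - p))) = vec.dim (cW w) - vec.dim (cW (w - 1))"
        by (simp add: FGr_P0 FGr_P1)
    qed
    also have "\<dots> = CARD('n)"
    proof -
      define D where "D k = CARD('n) - vec.dim (cW (k - 1))" for k
      have dimle: "vec.dim (cW k) \<le> CARD('n)" for k
        by (rule dim_subset_UNIV_cart_gen)
      have "D (w0 + 1) = D (w1 + 1) + (\<Sum>w\<in>{w0 + 1..<w1 + 1}. vec.dim (cW w) - vec.dim (cW (w - 1)))"
        using vec.dim_subset[OF cW_mono] dimle w(1) by (intro telescope_int) (auto simp: D_def)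
      then show ?thesis using w by (simp add: D_def card_cart_basis)
    qed
    finally show ?thesis .
  qed
  moreover have "finite I" unfolding I_def T_def by (auto simp: B(2))
  ultimately obtain e :: "'n \<Rightarrow> _" where e: "bij_betw e UNIV I"
    using finite_same_card_bij[of "UNIV :: 'n set" I] by auto
  define d where "d i = fst (e i)" for i
  define v where "v i = snd (e i)" for i
  define Q where "Q = (\<chi> k i. v i $ k)"
  have Qv: "Q *v axis i 1 = v i" for i
    by (simp add: Q_def vec_eq_iff matrix_column_nth)
  have vB: "v i \<in> B (fst (d i)) (snd (d i))" for i
  proof -
    have "e i \<in> I" using bij_betwE[OF e] by blast
    then show ?thesis unfolding d_def v_def I_def by (cases "e i") auto
  qed
  have vF: "v i \<in> F (fst (d i))" and vH: "v i \<in> Hpq (fst (d i)) (snd (d i))" for i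
    using vB[of i] B(1) by blast+
  have vW: "v i \<in> cW (wt (d i))" for i
    using vH[of i] FGr_cW by (auto simp: Hpq_def)
  have Bv: "\<exists>i. b = v i \<and> d i = (p, q)" if "b \<in> B p q" for b p q
  proof -
    have "((p, q), b) \<in> I" using that T by (auto simp: I_def)
    then have "((p, q), b) \<in> range e" using e by (simp add: bij_betw_def)
    then obtain i where "e i = ((p, q), b)" by (metis imageE)
    then show ?thesis unfolding d_def v_def by (intro exI[of _ i]) simp
  qed
  \<comment> \<open>Peel off a vector of \<open>F (p + 1)\<close> and a combination of
    \<open>B p (k - p)\<close>. The rest has lower weight and still lies in \<open>F p\<close>,
    because the basis vectors were chosen there.\<close>
  have span: "F p \<inter> cW k \<subseteq> vec.span (\<Union>(a, b)\<in>{(a, b). p \<le> a \<and> a + b \<le> k}. B a b)" for p k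
  proof (induction "nat (k - w0) + nat (P1 - p)" arbitrary: p k rule: less_induct)
    case less
    let ?U = "\<lambda>p k. \<Union>(a, b)\<in>{(a, b). p \<le> a \<and> a + b \<le> k}. B a b"
    show ?case
    proof (cases "k \<le> w0 \<or> P1 \<le> p")
      case True
      then show ?thesis using w(2)[of k] P1[of p] vec.span_zero by auto
    next
      case False
      have IH1: "F (p + 1) \<inter> cW k \<subseteq> vec.span (?U p k)"
        by (rule order_trans[OF less.hyps[of k "p + 1"] vec.span_mono[OF UN_mono]]) (use False in auto)
      have IH2: "F p \<inter> cW (k - 1) \<subseteq> vec.span (?U p k)"
        by (rule order_trans[OF less.hyps[of "k - 1" p] vec.span_mono[OF UN_mono]]) (use False in auto)
      have Bpk: "vec.span (B p (k - p)) \<subseteq> vec.span (?U p k)"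
        by (intro vec.span_mono subsetI UN_I[of "(p, k - p)"]) auto
      show ?thesis
      proof
        fix u assume u: "u \<in> F p \<inter> cW k"
        then have "u \<in> subspace_sum (FGr W F (p + 1) k) (Hpq p (k - p))"
          using F_FGr[of u F p k] FGr_split by blast
        then obtain a h where ah: "a \<in> FGr W F (p + 1) k" "h \<in> Hpq p (k - p)" "u = a + h"
          by (auto simp: subspace_sum_def)
        obtain x y' where x: "x \<in> F (p + 1)" "x \<in> cW k" "y' \<in> cW (k - 1)" "a = x + y'"
          using ah(1) by (auto simp: FGr_def subspace_sum_def)
        obtain j y where j: "j \<in> vec.span (B p (k - p))" "y \<in> cW (k - 1)" "h = j + y"
          using ah(2) B(3)[of p "k - p"] by (auto simp: subspace_sum_def)
        have "vec.span (B p (k - p)) \<subseteq> F p"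
          using B(1)[of p "k - p"] by (intro vec.span_minimal) auto
        then have jF: "j \<in> F p" using j by blast
        have xF: "x \<in> F p" using x(1) F_mono[of p "p + 1"] by auto
        have "u - x - j = y + y'" using ah x j by simp
        moreover have "u - x - j \<in> F p" using u xF jF by (auto intro!: vec.subspace_diff)
        ultimately have yy: "y + y' \<in> F p \<inter> cW (k - 1)" using x j by (auto intro: cW_add)
        have "u = j + (x + (y + y'))" using ah x j by simp
        also have "\<dots> \<in> vec.span (?U p k)"
          by (rule vec.span_add[OF _ vec.span_add]) (use j(1) Bpk IH1 IH2 yy x in blast)+
        finally show "u \<in> vec.span (?U p k)" .
      qed
    qed
  qed
  have span_v: "vec.span (\<Union>(a, b)\<in>{(a, b). P a b}. B a b) \<subseteq> (*v) Q ` coord {i. P (fst (d i)) (snd (d i))}" for P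
    unfolding image_coord_span Qv
  proof (rule vec.span_mono, clarify)
    fix x a b assume "x \<in> B a b" "P a b"
    then show "x \<in> v ` {i. P (fst (d i)) (snd (d i))}" using Bv[of x a b] by force
  qed
  have F_eq: "F p = (*v) Q ` coord {i. p \<le> fst (d i)}" for p
  proof
    have "F p \<subseteq> F p \<inter> cW w1" using w(3) by auto
    also have "\<dots> \<subseteq> vec.span (\<Union>(a, b)\<in>{(a, b). p \<le> a \<and> a + b \<le> w1}. B a b)" by (rule span)
    also have "\<dots> \<subseteq> vec.span (\<Union>(a, b)\<in>{(a, b). p \<le> a}. B a b)" by (intro vec.span_mono) auto
    also have "\<dots> \<subseteq> (*v) Q ` coord {i. p \<le> fst (d i)}" by (rule span_v)
    finally show "F p \<subseteq> (*v) Q ` coord {i. p \<le> fst (d i)}" .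
    show "(*v) Q ` coord {i. p \<le> fst (d i)} \<subseteq> F p"
      unfolding image_coord_span Qv using vF F_mono by (intro vec.span_minimal) force+
  qed
  have W_eq: "cW k = (*v) Q ` coord {i. wt (d i) \<le> k}" for k
  proof
    have "cW k \<subseteq> F P0 \<inter> cW k" using P0 by auto
    also have "\<dots> \<subseteq> vec.span (\<Union>(a, b)\<in>{(a, b). P0 \<le> a \<and> a + b \<le> k}. B a b)" by (rule span)
    also have "\<dots> \<subseteq> vec.span (\<Union>(a, b)\<in>{(a, b). a + b \<le> k}. B a b)" by (intro vec.span_mono) auto
    also have "\<dots> \<subseteq> (*v) Q ` coord {i. wt (d i) \<le> k}" by (rule span_v)
    finally show "cW k \<subseteq> (*v) Q ` coord {i. wt (d i) \<le> k}" .
    show "(*v) Q ` coord {i. wt (d i) \<le> k} \<subseteq> cW k"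
      unfolding image_coord_span Qv using vW cW_mono by (intro vec.span_minimal) force+
  qed
  have "(*v) Q ` UNIV = UNIV"
  proof -
    have "range ((*v) Q) = (*v) Q ` coord {i. wt (d i) \<le> Max (range (\<lambda>i. wt (d i)))}"
      by (rule arg_cong[where f = "(`) ((*v) Q)"]) (auto simp: coord_def)
    moreover have "cW w1 \<subseteq> (*v) Q ` UNIV" unfolding W_eq by (intro image_mono) simp
    ultimately show ?thesis using w(3) by auto
  qed
  then obtain Qi where Qi: "Q ** Qi = mat 1"
    using matrix_right_invertible_surjective by blast
  have QiQ: "Qi ** Q = mat 1" using Qi matrix_left_right_inverse by blast
  define C where "C = Qi ** cnj_mat Q"
  have Cs: "supp (\<lambda>i j. d i = prod.swap (d j) \<or> nilp d 1 i j) C"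
  proof (rule coord_supp)
    fix j
    obtain p q where pq: "d j = (p, q)" by (cases "d j")
    have "C *v axis j 1 = Qi *v (cnj_mat Q *v cnj_vec (axis j 1))"
      by (simp add: C_def matrix_vector_mul_assoc[symmetric])
         (rule arg_cong[where f = "(*v) _"], rule arg_cong[where f = "(*v) _"], simp add: vec_eq_iff axis_def)
    also have "\<dots> = Qi *v cnj_vec (v j)" by (simp add: Qv flip: cnj_vec_mult)
    finally have Cj: "C *v axis j 1 = Qi *v cnj_vec (v j)" .
    have "cnj_vec (v j) \<in> Hpq q p" using vH[of j] pq by (auto intro: Hpq_cnj)
    then obtain a b where ab: "a \<in> vec.span (B q p)" "b \<in> cW (q + p - 1)" "cnj_vec (v j) = a + b"
      using B(3) by (fastforce simp: subspace_sum_def)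
    have "vec.span (B q p) \<subseteq> vec.span (\<Union>(a, b)\<in>{(a, b). a = q \<and> b = p}. B a b)"
      by (intro vec.span_mono) auto
    also have "\<dots> \<subseteq> (*v) Q ` coord {i. fst (d i) = q \<and> snd (d i) = p}" by (rule span_v)
    finally obtain a' where a': "a' \<in> coord {i. fst (d i) = q \<and> snd (d i) = p}" "a = Q *v a'" using ab(1) by blast
    obtain b' where b': "b' \<in> coord {i. wt (d i) \<le> q + p - 1}" "b = Q *v b'" using ab(2) W_eq by blast
    have "C *v axis j 1 = a' + b'"
      by (simp add: Cj ab(3) a'(2) b'(2) matrix_vector_right_distrib matrix_vector_mul_assoc QiQ)
    also have "\<dots> \<in> coord {i. d i = prod.swap (d j) \<or> nilp d 1 i j}"
      using a'(1) b'(1) by (intro coord_add; elim subsetD[OF coord_mono, rotated]) (auto simp: pq nilp_def prod_eq_iff)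
    finally show "C *v axis j 1 \<in> coord {i. d i = prod.swap (d j) \<or> nilp d 1 i j}" .
  qed
  \<comment> \<open>\<open>M\<close> is the weight-preserving part of the conjugation. The error in
    \<open>M ** cnj_mat M = mat 1\<close> has weight zero by the pattern of \<open>M\<close> and
    negative weight because \<open>C\<close> is an involution, so it vanishes.\<close>
  define M where "M = trunc (\<lambda>i j. d i = prod.swap (d j)) C"
  define U where "U = C - M"
  have Ms: "supp (\<lambda>i j. d i = prod.swap (d j)) M"
    by (auto simp: supp_def M_def trunc_nth)
  have Us: "supp (nilp d 1) U"
    using Cs by (auto simp: supp_def U_def M_def trunc_nth)
  have CC: "C ** cnj_mat C = mat 1"
  proof -
    have "cnj_mat Q ** cnj_mat Qi = mat 1" using Qi by (simp flip: cnj_mat_mult)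
    then show ?thesis by (simp add: C_def cnj_mat_mult mat_assoc mat_cancel QiQ)
  qed
  have "M ** cnj_mat M - mat 1 = 0"
  proof (rule supp_disjoint)
    have "M ** cnj_mat M - mat 1 = - (M ** cnj_mat U + U ** cnj_mat M + U ** cnj_mat U)"
      using CC by (simp add: U_def cnj_mat_diff mat_ring algebra_simps)
    moreover have "supp (nilp d 1) (M ** cnj_mat U)"
      by (rule supp_mult_gen[OF Ms supp_cnj[OF Us]]) (auto simp: nilp_def)
    moreover have "supp (nilp d 1) (U ** cnj_mat M)"
      by (rule supp_mult_gen[OF Us supp_cnj[OF Ms]]) (auto simp: nilp_def)
    moreover have "supp (nilp d 1) (U ** cnj_mat U)"
      by (rule supp_mult[OF Us supp_cnj[OF Us]]) simp
    ultimately show "supp (nilp d 1) (M ** cnj_mat M - mat 1)"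
      by (metis supp_add supp_uminus)
    show "supp (\<lambda>i j. wt (d i) = wt (d j)) (M ** cnj_mat M - mat 1)"
      by (intro supp_diff supp_one supp_mult_gen[OF Ms supp_cnj[OF Ms]]) auto
  qed (auto simp: nilp_def)
  then have "graded_conj d M"
    using Ms by unfold_locales auto
  then show ?thesis
    using that Qi F_eq W_eq Us by (simp add: U_def C_def)
qed

end

end

subsection \<open>Translating adapted coordinates by unipotent elements\<close>

lemma unipotent_coord:
  assumes "f ** fi = mat 1" "supp R (f - mat 1)" "\<And>i j. R i j \<Longrightarrow> j \<in> A \<Longrightarrow> i \<in> A"
  shows "(*v) f ` coord A = coord A"
proof (rule invertible_image_coord[OF assms(1) _ subspace_coord])
  show "(*v) f ` coord A \<subseteq> coord A"
  proof clarify
    fix x :: "complex^'a" assume x: "x \<in> coord A"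
    have "x + (f - mat 1) *v x \<in> coord A"
      by (rule coord_add[OF x supp_coord[OF assms(2) x]]) (use assms(3) in blast)
    then show "f *v x \<in> coord A" by (simp add: matrix_vector_mult_diff_rdistrib)
  qed
qed

text \<open>\<open>h\<close> carries the reference filtration to \<open>F\<close> and
  \<open>f\<close> corrects the real structure. The former preserves the weight flag and the latter
  both flags, so only the congruence for the conjugation matrix \<open>C\<close> of the frame
  \<open>Q ** h\<close> has to be supplied.\<close>

lemma adaptedI:
  fixes Q Qi C f fi h hi :: "complex^'n::finite^'n"
  assumes gc: "graded_conj d M" and Q: "Q ** Qi = mat 1" and h: "h ** hi = mat 1" "supp (nilp d 1) (h - mat 1)"
    and W_eq: "\<And>k. complexify (W k) = (*v) Q ` coord {i. wt (d i) \<le> k}"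
    and F_eq: "\<And>p. F p = (*v) (Q ** h) ` coord {i. p \<le> fst (d i)}"
    and f: "f ** fi = mat 1" "supp (plus_part d) (f - mat 1)"
    and C: "C = hi ** (Qi ** cnj_mat Q) ** cnj_mat h"
      "supp (lam d) (fi ** C ** cnj_mat f ** cnj_mat M - mat 1)"
  shows "adapted d M W F (Q ** (h ** f)) ((fi ** hi) ** Qi)"
proof -
  interpret graded_conj d M by (rule gc)
  show ?thesis
  proof
    show "Q ** (h ** f) ** (fi ** hi ** Qi) = mat 1"
      by (simp add: mat_assoc mat_cancel[OF f(1)] mat_cancel[OF h(1)] Q)
    have fF: "(*v) f ` coord {i. p \<le> fst (d i)} = coord {i. p \<le> fst (d i)}" for p
      by (rule unipotent_coord[OF f]) (auto simp: plus_part_def)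
    have fW: "(*v) f ` coord {i. wt (d i) \<le> k} = coord {i. wt (d i) \<le> k}" for k
      by (rule unipotent_coord[OF f]) (auto simp: plus_part_def)
    have hW: "(*v) h ` coord {i. wt (d i) \<le> k} = coord {i. wt (d i) \<le> k}" for k
      by (rule unipotent_coord[OF h]) (auto simp: nilp_def)
    have img: "(*v) (A ** B) ` X = (*v) A ` (*v) B ` X" for A B :: "complex^'n^'n" and X
      by (simp add: image_image matrix_vector_mul_assoc)
    show "F p = (*v) (Q ** (h ** f)) ` coord {i. p \<le> fst (d i)}" for p
      unfolding F_eq img fF ..
    show "complexify (W k) = (*v) (Q ** (h ** f)) ` coord {i. wt (d i) \<le> k}" for k
      unfolding W_eq img fW hW ..
    have "fi ** hi ** Qi ** cnj_mat (Q ** (h ** f)) ** cnj_mat M = fi ** C ** cnj_mat f ** cnj_mat M"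
      by (simp add: C(1) cnj_mat_mult mat_assoc)
    then show "supp (lam d) (fi ** hi ** Qi ** cnj_mat (Q ** (h ** f)) ** cnj_mat M - mat 1)"
      using C(2) by simp
  qed
qed

lemma (in filtered_space) adapted_exists:
  assumes "mixed_hodge_structure W F"
  obtains d :: "'n \<Rightarrow> int \<times> int" and M G Gi where "adapted d M W F G Gi"
proof -
  obtain d :: "'n \<Rightarrow> int \<times> int" and M Q Qi where Q: "graded_conj d M" "Q ** Qi = mat 1"
    "\<And>p. F p = (*v) Q ` coord {i. p \<le> fst (d i)}"
    "\<And>k. cW k = (*v) Q ` coord {i. wt (d i) \<le> k}"
    "supp (nilp d 1) (Qi ** cnj_mat Q - M)"
    using adapted_basis[OF assms] by blast
  interpret graded_conj d M by (rule Q(1))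
  obtain c m where "0 \<le> c" and split: "\<And>C. C ** cnj_mat C = mat 1 \<Longrightarrow> supp (nilp d 1) (C - M) \<Longrightarrow>
    \<exists>f fi. f ** fi = mat 1 \<and> supp (plus_part d) (f - mat 1) \<and>
      supp (lam d) (fi ** C ** cnj_mat f ** cnj_mat M - mat 1) \<and>
      mnorm f \<le> c * (1 + mnorm C) ^ m \<and> mnorm fi \<le> c * (1 + mnorm C) ^ m"
    using split_real_structure by blast
  have QiQ: "Qi ** Q = mat 1" using Q(2) matrix_left_right_inverse by blast
  have cQ: "cnj_mat Q ** cnj_mat Qi = mat 1" using Q(2) by (simp flip: cnj_mat_mult)
  have "(Qi ** cnj_mat Q) ** cnj_mat (Qi ** cnj_mat Q) = mat 1"
    by (simp add: cnj_mat_mult mat_assoc mat_cancel[OF cQ] QiQ)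
  from split[OF this Q(5)] obtain f fi where f: "f ** fi = mat 1" "supp (plus_part d) (f - mat 1)"
      "supp (lam d) (fi ** (Qi ** cnj_mat Q) ** cnj_mat f ** cnj_mat M - mat 1)"
    by blast
  have "adapted d M W F (Q ** (mat 1 ** f)) ((fi ** mat 1) ** Qi)"
    by (rule adaptedI[OF Q(1,2) _ _ Q(4) _ f(1,2) _ f(3)]) (simp_all add: Q(3))
  then show ?thesis by (rule that)
qed

context adapted
begin

lemma C0_involution: "(Gi ** cnj_mat G) ** cnj_mat (Gi ** cnj_mat G) = mat 1"
proof -
  have "cnj_mat G ** cnj_mat Gi = mat 1" using GGi by (simp flip: cnj_mat_mult)
  then show ?thesis by (simp add: cnj_mat_mult mat_assoc mat_cancel GiG)
qed

lemma C0_eq: "Gi ** cnj_mat G = M + Lam ** M"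
  by (simp add: Lam_def mat_ring mat_assoc MM')

text \<open>\<open>G ** h\<close> carries the right filtrations but is usually not adapted, since
  \<open>h\<close> is not real. Its conjugation matrix is still \<open>M\<close> modulo lower
  weight, so a correction \<open>f\<close> bounded polynomially in \<open>h\<close> makes it
  adapted, and \<open>g\<close> is \<open>h ** f\<close>.\<close>

lemma translate:
  obtains c m where "0 \<le> c" "\<And>h hi. h ** hi = mat 1 \<Longrightarrow> supp (nilp d 1) (h - mat 1) \<Longrightarrow>
    \<exists>g gi. g ** gi = mat 1 \<and> supp (nilp d 1) (g - mat 1) \<and>
      adapted d M W (filt_act (G ** h ** Gi) F) (G ** g) (gi ** Gi) \<and>
      mnorm g \<le> c * (1 + mnorm h) ^ m \<and> mnorm gi \<le> c * (1 + mnorm h) ^ m"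
proof -
  obtain c m where c: "0 \<le> c" and split: "\<And>C. C ** cnj_mat C = mat 1 \<Longrightarrow> supp (nilp d 1) (C - M) \<Longrightarrow>
    \<exists>f fi. f ** fi = mat 1 \<and> supp (plus_part d) (f - mat 1) \<and>
      supp (lam d) (fi ** C ** cnj_mat f ** cnj_mat M - mat 1) \<and>
      mnorm f \<le> c * (1 + mnorm C) ^ m \<and> mnorm fi \<le> c * (1 + mnorm C) ^ m"
    using split_real_structure by blast
  obtain c1 m1 where c1: "0 \<le> c1" and inv: "\<And>h. supp (nilp d 1) (h - mat 1) \<Longrightarrow>
    \<exists>hi. h ** hi = mat 1 \<and> hi ** h = mat 1 \<and> supp (nilp d 1) (hi - mat 1) \<and> mnorm hi \<le> c1 * (1 + mnorm h) ^ m1"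
    by (rule unipotent_inverse_bound[of "nilp d 1" d]) auto
  define C0 where "C0 = Gi ** cnj_mat G"
  define a where "a = mnorm C0"
  have a: "0 \<le> a" by (simp add: a_def)
  define c2 where "c2 = c * (1 + c1 * a) ^ m"
  define m2 where "m2 = (m1 + 1) * m"
  define c3 where "c3 = c2 + c2 * c1"
  define m3 where "m3 = (1 + m2) + (m2 + m1)"
  have c2: "0 \<le> c2" using c c1 a by (simp add: c2_def)
  have c3: "0 \<le> c3" using c2 c1 by (simp add: c3_def)
  show ?thesis
  proof (rule that[of c3 m3])
    fix h hi assume h: "h ** hi = mat 1" "supp (nilp d 1) (h - mat 1)"
    let ?y = "mnorm h"
    obtain hi' where hi': "hi' ** h = mat 1" "supp (nilp d 1) (hi' - mat 1)" "mnorm hi' \<le> c1 * (1 + ?y) ^ m1"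
      using inv[OF h(2)] by blast
    have hieq: "hi' = hi" using left_inverse_unique[OF h(1) hi'(1)] by simp
    define C where "C = hi ** C0 ** cnj_mat h"
    have ch: "cnj_mat h ** cnj_mat hi = mat 1" using h(1) by (simp flip: cnj_mat_mult)
    have hih: "hi ** h = mat 1" using hi'(1) hieq by simp
    have CC: "C ** cnj_mat C = mat 1"
      unfolding C_def
      by (simp add: cnj_mat_mult mat_assoc mat_cancel[OF ch] mat_cancel[OF C0_involution[folded C0_def]] hih)
    have wM: "supp (nilp d 0) M" by (rule supp_mono[OF supp_M]) (auto simp: nilp_def)
    have LM: "supp (nilp d 1) (Lam ** M)"
      by (rule supp_mult_gen[OF supp_Lam supp_M]) (auto simp: lam_def nilp_def)
    have w0: "supp (nilp d 0) X" if "supp (nilp d 1) X" for X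
      using that by (rule supp_mono) (auto simp: nilp_def)
    have C0w: "supp (nilp d 0) C0"
      unfolding C0_def C0_eq by (intro supp_add wM w0 LM)
    have hw: "supp (nilp d 0) (cnj_mat h)"
    proof -
      have "supp (nilp d 0) (mat 1 + (h - mat 1))"
        by (intro supp_add supp_one w0 h) (auto simp: nilp_def)
      then show ?thesis by (simp add: supp_cnj)
    qed
    have CMe: "C - M = (C0 - M) + (hi - mat 1) ** (C0 ** cnj_mat h) + C0 ** cnj_mat (h - mat 1)"
      by (simp add: C_def mat_ring cnj_mat_diff mat_assoc)
    have "supp (nilp d 1) (C0 - M)" using LM by (simp add: C0_def C0_eq)
    moreover have "supp (nilp d 1) ((hi - mat 1) ** (C0 ** cnj_mat h))"
      by (rule supp_mult_gen[OF hi'(2)[unfolded hieq] supp_mult[OF C0w hw]]) (auto simp: nilp_def)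
    moreover have "supp (nilp d 1) (C0 ** cnj_mat (h - mat 1))"
      by (rule supp_mult_gen[OF C0w supp_cnj[OF h(2)]]) (auto simp: nilp_def)
    ultimately have CM: "supp (nilp d 1) (C - M)" unfolding CMe by (intro supp_add)
    obtain f fi where f: "f ** fi = mat 1" "supp (plus_part d) (f - mat 1)"
      "supp (lam d) (fi ** C ** cnj_mat f ** cnj_mat M - mat 1)"
      "mnorm f \<le> c * (1 + mnorm C) ^ m" "mnorm fi \<le> c * (1 + mnorm C) ^ m"
      using split[OF CC CM] by blast
    have ad: "adapted d M W (filt_act (G ** h ** Gi) F) (G ** (h ** f)) ((fi ** hi) ** Gi)"
    proof (rule adaptedI[OF graded_conj_axioms GGi h W_eq _ f(1,2) _ f(3)])
      show "filt_act (G ** h ** Gi) F p = (*v) (G ** h) ` coord {i. p \<le> fst (d i)}" for p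
        unfolding filt_act_def F_eq image_image matrix_vector_mul_assoc
        by (simp add: mat_assoc GiG)
    qed (simp add: C_def C0_def)
    have "mnorm C \<le> (c1 * (1 + ?y) ^ m1) * a * (1 + ?y)"
      unfolding C_def a_def by (intro mnorm_mult_le) (use hi'(3) hieq in auto)
    then have Cb: "mnorm C \<le> (c1 * a) * (1 + ?y) ^ (m1 + 1)"
      by (simp add: mult_ac)
    have fb: "mnorm f \<le> c2 * (1 + ?y) ^ m2"
      unfolding c2_def m2_def by (rule poly_bound_compose[OF f(4) Cb]) (use c c1 a in auto)
    have fib: "mnorm fi \<le> c2 * (1 + ?y) ^ m2"
      unfolding c2_def m2_def by (rule poly_bound_compose[OF f(5) Cb]) (use c c1 a in auto)
    have "mnorm (h ** f) \<le> 1 * c2 * (1 + ?y) ^ (1 + m2)"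
      by (rule order_trans[OF mnorm_mult poly_bound_mult]) (use fb in auto)
    also have "\<dots> \<le> c3 * (1 + ?y) ^ m3"
      unfolding c3_def m3_def using c1 c2 by (intro mult_mono power_increasing) auto
    finally have b1: "mnorm (h ** f) \<le> c3 * (1 + ?y) ^ m3" .
    have "mnorm (fi ** hi) \<le> c2 * c1 * (1 + ?y) ^ (m2 + m1)"
      by (rule order_trans[OF mnorm_mult poly_bound_mult]) (use fib hi'(3) hieq c2 in auto)
    also have "\<dots> \<le> c3 * (1 + ?y) ^ m3"
      unfolding c3_def m3_def using c1 c2 by (intro mult_mono power_increasing) auto
    finally have b2: "mnorm (fi ** hi) \<le> c3 * (1 + ?y) ^ m3" .
    have hf: "h ** f - mat 1 = (h - mat 1) + (f - mat 1) + (h - mat 1) ** (f - mat 1)"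
      by (simp add: mat_ring)
    have "supp (nilp d 1) (f - mat 1)"
      using f(2) by (rule supp_mono) (auto simp: pattern_defs)
    then have "supp (nilp d 1) (h ** f - mat 1)"
      unfolding hf using h(2) by (intro supp_add supp_mult transp_patterns)
    moreover have "h ** f ** (fi ** hi) = mat 1"
      by (simp add: mat_assoc mat_cancel[OF f(1)] h(1))
    ultimately show "\<exists>g gi. g ** gi = mat 1 \<and> supp (nilp d 1) (g - mat 1) \<and>
      adapted d M W (filt_act (G ** h ** Gi) F) (G ** g) (gi ** Gi) \<and>
      mnorm g \<le> c3 * (1 + mnorm h) ^ m3 \<and> mnorm gi \<le> c3 * (1 + mnorm h) ^ m3"
      using ad b1 b2 by blast
  qed (rule c3)
qed

end


subsection \<open>Unipotent elements act on the classifying space\<close>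

context filtered_space
begin

lemma lowers_add: "lowers A \<Longrightarrow> lowers B \<Longrightarrow> lowers (A + B)"
  by (auto simp: lowers_def matrix_vector_mult_add_rdistrib intro: cW_add)

lemma lowers_zero [simp]: "lowers 0"
  using vec.subspace_0[OF cW_subspace] by (simp add: lowers_def)

lemma lowers_scaleR: "lowers A \<Longrightarrow> lowers (c *\<^sub>R A)"
proof -
  assume A: "lowers A"
  have "(c *\<^sub>R A) *v u = complex_of_real c *s (A *v u)" for u
    by (simp add: vec_eq_iff matrix_vector_mult_def sum_distrib_left) (simp add: scaleR_conv_of_real mult.assoc)
  then show ?thesis using A vec.subspace_scale[OF cW_subspace] by (simp add: lowers_def)
qed

lemma lowers_sum: "(\<And>i. i \<in> I \<Longrightarrow> lowers (f i)) \<Longrightarrow> lowers (\<Sum>i\<in>I. f i)"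
  by (induction I rule: infinite_finite_induct) (auto intro: lowers_add)

lemma lowers_mult: "lowers A \<Longrightarrow> lowers B \<Longrightarrow> lowers (A ** B)"
  by (auto simp: lowers_def cW_pred simp flip: matrix_vector_mul_assoc)

lemma lowers_mpow: "lowers X \<Longrightarrow> k > 0 \<Longrightarrow> lowers (mpow X k)"
proof (induction k)
  case (Suc k)
  then show ?case by (cases "k = 0") (auto simp: mpow_Suc intro: lowers_mult)
qed simp

text \<open>One exponent, the length of the weight filtration, serves all \<open>X\<close>.\<close>

lemma lowers_nilpotent:
  obtains m where "\<And>X. lowers X \<Longrightarrow> mpow X m = 0"
proof -
  obtain w0 w1 where w: "w0 \<le> w1" "\<And>k. k \<le> w0 \<Longrightarrow> cW k = {0}" "\<And>k. k \<ge> w1 \<Longrightarrow> cW k = UNIV"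
    using cW_bounds by blast
  have "mpow X (nat (w1 - w0)) = 0" if X: "lowers X" for X
  proof -
    have "mpow X k *v u \<in> cW (w1 - int k)" for k u
    proof (induction k)
      case 0
      then show ?case using w(3) by simp
    next
      case (Suc k)
      then have "X *v (mpow X k *v u) \<in> cW (w1 - int k - 1)" using X by (auto simp: lowers_def)
      then show ?case by (simp add: mpow_Suc matrix_vector_mul_assoc algebra_simps)
    qed
    from this[of "nat (w1 - w0)"] have "mpow X (nat (w1 - w0)) *v u = 0" for u
      using w(1,2) by simp
    then show ?thesis by (metis matrix_eq matrix_vector_mult_0)
  qed
  then show ?thesis by (rule that)
qed

lemma lowers_mexp:
  assumes "lowers X"
  shows "lowers (mexp X - mat 1)"
proof -
  obtain m where m: "mpow X m = 0" using lowers_nilpotent assms by blast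
  have "mexp X - mat 1 = (\<Sum>k<Suc m. (1 / fact k) *\<^sub>R mpow X k) - mat 1"
    by (subst mexp_finite[of X "Suc m"]) (auto simp: mpow_Suc m)
  also have "\<dots> = (\<Sum>k<m. (1 / fact (Suc k)) *\<^sub>R mpow X (Suc k))"
    by (subst sum.lessThan_Suc_shift) simp
  finally show ?thesis
    using assms by (auto intro!: lowers_sum lowers_scaleR lowers_mpow)
qed

lemma lowers_mexp_inverse:
  assumes "lowers X"
  shows "mexp X ** mexp (- X) = mat 1" "lowers (- X)"
proof -
  obtain m where m: "mpow X m = 0" using lowers_nilpotent assms by blast
  show "mexp X ** mexp (- X) = mat 1" by (rule mexp_inverse[OF m])
  show "lowers (- X)" using lowers_scaleR[OF assms, of "-1"] by simp
qed

lemma unip_image_cW: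
  assumes "lowers (h - mat 1)" "h ** hi = mat 1"
  shows "(*v) h ` cW k = cW k"
  by (rule invertible_image_coord[OF assms(2) _ cW_subspace]) (use unip_cW(2)[OF assms(1)] in blast)

end

locale polarized_space = filtered_space W for W :: "'n::finite rfilt" +
  fixes S :: "'n forms"
  assumes forms: "graded_forms W S"
begin

lemma re_im_W: "u \<in> cW w \<Longrightarrow> re_vec u \<in> W w \<and> im_vec u \<in> W w"
  by (simp add: complexify_def)

lemma W_subspace: "subspace (W w)"
  using W_filt by (simp add: finite_increasing_filtration_def)

lemma S_bilinear:
  assumes "u \<in> W w" "u' \<in> W w" "v \<in> W w"
  shows "S w (u + u') v = S w u v + S w u' v" "S w v (u + u') = S w v u + S w v u'"
  using forms assms unfolding graded_forms_def by blast+

lemma S_scale: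
  assumes "u \<in> W w" "v \<in> W w"
  shows "S w (c *\<^sub>R u) v = c * S w u v" "S w v (c *\<^sub>R u) = c * S w v u"
  using forms assms unfolding graded_forms_def by blast+

lemma S_diff:
  assumes "u \<in> W w" "u' \<in> W w" "v \<in> W w"
  shows "S w (u - u') v = S w u v - S w u' v" "S w v (u - u') = S w v u - S w v u'"
  using S_bilinear(1,2)[of u w "(-1) *\<^sub>R u'" v] S_scale[of u' w v "-1"] assms
    subspace_neg[OF W_subspace, of u'] by auto

lemma S_radical:
  assumes "u \<in> W (w - 1)" "v \<in> W w"
  shows "S w u v = 0" "S w v u = 0"
proof -
  have u: "u \<in> W w" using assms(1) W_filt unfolding finite_increasing_filtration_def
    by (metis (no_types, opaque_lifting) diff_le_eq less_add_one order_less_imp_le subsetD)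
  show 0: "S w u v = 0" using forms assms u unfolding graded_forms_def by blast
  have "S w v u = (if even w then S w u v else - S w u v)"
    using forms assms u unfolding graded_forms_def by blast
  then show "S w v u = 0" using 0 by simp
qed

lemma cform_add:
  assumes "u \<in> cW w" "u' \<in> cW w" "v \<in> cW w"
  shows "cform (S w) (u + u') v = cform (S w) u v + cform (S w) u' v"
    "cform (S w) v (u + u') = cform (S w) v u + cform (S w) v u'"
  using re_im_W[OF assms(1)] re_im_W[OF assms(2)] re_im_W[OF assms(3)]
  by (simp_all add: cform_def re_vec_add im_vec_add S_bilinear complex_eq_iff)

lemma cform_scale:
  assumes "u \<in> cW w" "v \<in> cW w"
  shows "cform (S w) (c *s u) v = c * cform (S w) u v" "cform (S w) v (c *s u) = c * cform (S w) v u"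
  using re_im_W[OF assms(1)] re_im_W[OF assms(2)] subspace_scale[OF W_subspace]
  by (simp_all add: cform_def re_vec_scale im_vec_scale S_bilinear S_scale S_diff complex_eq_iff algebra_simps)

lemma cform_radical:
  assumes "u \<in> cW (w - 1)" "v \<in> cW w"
  shows "cform (S w) u v = 0" "cform (S w) v u = 0"
  using re_im_W[OF assms(1)] re_im_W[OF assms(2)]
  by (simp_all add: cform_def S_radical complex_eq_iff)

lemma cform_cong:
  assumes "u \<in> cW w" "v \<in> cW w" "u' - u \<in> cW (w - 1)" "v' - v \<in> cW (w - 1)"
  shows "cform (S w) u' v' = cform (S w) u v"
proof -
  have "v' - v \<in> cW w" "u' - u \<in> cW w" using assms by (auto intro: cW_pred)
  then have "v' \<in> cW w" using cW_add[of "v' - v" w v] assms by simp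
  have "cform (S w) u' v' = cform (S w) (u + (u' - u)) v'" by simp
  also have "\<dots> = cform (S w) u v'"
    using assms \<open>v' \<in> cW w\<close> \<open>u' - u \<in> cW w\<close> by (simp only: cform_add cform_radical add_0_right)
  also have "\<dots> = cform (S w) u (v + (v' - v))" by simp
  also have "\<dots> = cform (S w) u v"
    using assms \<open>v' - v \<in> cW w\<close> by (simp only: cform_add cform_radical add_0_right)
  finally show ?thesis .
qed

lemma unip_G_C:
  assumes "lowers (h - mat 1)" "h ** hi = mat 1"
  shows "h \<in> G_C W S"
  unfolding G_C_def
proof (intro CollectI conjI allI ballI)
  show "invertible h" using assms(2) matrix_left_right_inverse by (auto simp: invertible_def)
  show "(*v) h ` cW w = cW w" for w by (rule unip_image_cW[OF assms])
  show "cform (S w) (h *v u) (h *v v) = cform (S w) u v" if "u \<in> cW w" "v \<in> cW w" for w u v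
    using that unip_cW[OF assms(1)] by (intro cform_cong) auto
qed

text \<open>A map acting as the identity on the graded quotients preserves any forms given there. So
  for weight-lowering endomorphisms membership in \<open>lie_component\<close> is only a question of
  Hodge type.\<close>

lemma lowers_lie_G_C: "lowers X \<Longrightarrow> X \<in> lie_G_C W S"
  unfolding lie_G_C_def
  using unip_G_C[OF lowers_mexp lowers_mexp_inverse(1)] lowers_scaleR by blast

end

subsection \<open>The standard metric in adapted coordinates\<close>

locale polarized_coords = polarized_space W S + adapted d M W F G Gi
  for W :: "'n::finite rfilt" and S and d :: "'n \<Rightarrow> int \<times> int" and M F G Gi +
  assumes pol: "graded_polarized W S F"
    and filt: "finite_decreasing_filtration F"
begin

definition P :: "int \<times> int \<Rightarrow> complex^'n^'n" where
  "P t = (\<chi> i j. if i = j \<and> d i = t then 1 else 0)"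

lemma P_nth: "(P t *v x) $ i = (if d i = t then x $ i else 0)"
  by (simp add: P_def matrix_vector_mult_def if_distrib if_distribR cong: if_cong)

lemma P_coord: "P t *v x \<in> coord {i. d i = t}"
  by (auto simp: coord_def P_nth)

lemma G_wt: "x \<in> coord {i. wt (d i) \<le> k} \<Longrightarrow> G *v x \<in> cW k"
  by (auto simp: W_eq)

lemma GP_cW: "G *v (P t *v x) \<in> cW (wt t)"
  by (rule G_wt) (auto simp: coord_def P_nth)

lemma GP_cnj_cW: "cnj_vec (G *v (P t *v x)) \<in> cW (wt t)"
  by (rule cW_cnj[OF GP_cW])

lemma bigr_FGr: 
  assumes x: "x \<in> coord {i. d i = (p, q)}"
  shows "G *v x \<in> FGr W F p (p + q) \<inter> cnj_vec ` FGr W F q (p + q)"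
proof
  have "G *v x \<in> F p" unfolding F_eq by (rule imageI) (use x in \<open>auto simp: coord_def\<close>)
  moreover have "G *v x \<in> cW (p + q)" by (rule G_wt) (use x in \<open>auto simp: coord_def\<close>)
  ultimately show "G *v x \<in> FGr W F p (p + q)" by (rule F_FGr)
  define y where "y = M *v cnj_vec x"
  have y: "y \<in> coord {i. d i = (q, p)}"
    unfolding y_def by (rule M_coord[OF cnj_vec_coord[OF x]]) auto
  have "cnj_vec (G *v x) = G *v y + G *v (Lam *v y)"
    using conj_coords[of x] by (metis Gi_G_vec(2) matrix_vector_right_distrib y_def)
  moreover have "G *v y \<in> F q" unfolding F_eq by (rule imageI) (use y in \<open>auto simp: coord_def\<close>)
  moreover have "G *v y \<in> cW (p + q)" by (rule G_wt) (use y in \<open>auto simp: coord_def\<close>)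
  moreover have "G *v (Lam *v y) \<in> cW (p + q - 1)"
    by (rule G_wt, rule supp_coord[OF supp_Lam y]) (auto simp: lam_def)
  ultimately have "cnj_vec (G *v x) \<in> FGr W F q (p + q)"
    unfolding FGr_def by (simp add: in_subspace_sumI)
  then show "G *v x \<in> cnj_vec ` FGr W F q (p + q)" by (simp add: cnj_image_iff)
qed

definition ci :: "int \<times> int \<Rightarrow> complex" where
  "ci t = \<i> powi (fst t - snd t)"

definition hterm :: "int \<times> int \<Rightarrow> complex^'n \<Rightarrow> complex^'n \<Rightarrow> complex" where
  "hterm t x y = ci t * cform (S (wt t)) (G *v (P t *v x)) (cnj_vec (G *v (P t *v y)))"

text \<open>The Hodge inner product of the reference point \<open>F\<close> in the coordinates of
  its frame \<open>G\<close>.\<close>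

definition hform :: "complex^'n \<Rightarrow> complex^'n \<Rightarrow> complex" where
  "hform x y = (\<Sum>t\<in>range d. hterm t x y)"

lemma hform_add:
  "hform (x + x') y = hform x y + hform x' y" "hform y (x + x') = hform y x + hform y x'"
  by (simp_all add: hform_def hterm_def matrix_vector_right_distrib cnj_vec_add
      cform_add[OF GP_cW GP_cW GP_cnj_cW] cform_add[OF GP_cnj_cW GP_cnj_cW GP_cW]
      distrib_left sum.distrib)

lemma hform_scale:
  "hform (c *s x) y = c * hform x y" "hform y (c *s x) = cnj c * hform y x"
  by (simp_all add: hform_def hterm_def vec.scale cnj_vec_scale
      cform_scale[OF GP_cW GP_cnj_cW] cform_scale[OF GP_cnj_cW GP_cW]
      sum_distrib_left mult_ac)

lemma hform_pos:
  assumes "x \<noteq> 0"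
  shows "Re (hform x x) > 0"
proof -
  have pos: "Re (hterm t x x) > 0" if ne: "P t *v x \<noteq> 0" for t
  proof -
    obtain p q where t: "t = (p, q)" by (cases t)
    let ?u = "G *v (P t *v x)"
    have "?u \<notin> cW (p + q - 1)"
    proof
      assume "?u \<in> cW (p + q - 1)"
      then have "P t *v x \<in> coord {i. wt (d i) \<le> p + q - 1} \<inter> coord {i. d i = t}"
        using P_coord W_eq in_image_iff by auto
      also have "\<dots> = {0}"
        unfolding coord_Int t by (subst coord_empty[symmetric], rule arg_cong[where f = coord]) auto
      finally show False using ne by simp
    qed
    moreover have "?u \<in> FGr W F p (p + q) \<inter> cnj_vec ` FGr W F q (p + q)"
      using P_coord[of t x] unfolding t by (rule bigr_FGr)
    ultimately show ?thesis
      using pol unfolding graded_polarized_def Let_def by (simp add: hterm_def ci_def t)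
  qed
  have nonneg: "Re (hterm t x x) \<ge> 0" for t
  proof (cases "P t *v x = 0")
    case True
    then show ?thesis
      using vec.subspace_0[OF cW_subspace] by (simp add: hterm_def cform_radical(1))
  next
    case False
    then show ?thesis using pos[OF False] by simp
  qed
  obtain i where i: "x $ i \<noteq> 0" using assms by (auto simp: vec_eq_iff)
  have "P (d i) *v x \<noteq> 0" using i P_nth[of "d i" x i] by auto
  then have "0 < (\<Sum>t\<in>range d. Re (hterm t x x))"
    using pos nonneg by (intro sum_pos2[of _ "d i"]) auto
  then show ?thesis by (simp add: hform_def)
qed

definition Hm :: "complex^'n^'n" where
  "Hm = (\<chi> i j. hform (axis i 1) (axis j 1))"

lemma vec_axis_sum: "x = (\<Sum>i\<in>UNIV. x $ i *s axis i (1::complex))"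
  by (auto simp: vec_eq_iff axis_def if_distrib[of "(*) _"] cong: if_cong)

lemma hform_Hm: "hform x y = (\<Sum>i\<in>UNIV. x $ i * (Hm *v cnj_vec y) $ i)"
proof -
  have l: "hform (\<Sum>i\<in>I. f i) y = (\<Sum>i\<in>I. hform (f i) y)" if "finite I" for I :: "'n set" and f y
    using that by (induction I) (use hform_scale(1)[of 0 0 y] in \<open>auto simp: hform_add\<close>)
  have r: "hform y (\<Sum>i\<in>I. f i) = (\<Sum>i\<in>I. hform y (f i))" if "finite I" for I :: "'n set" and f y
    using that by (induction I) (use hform_scale(2)[of y 0 0] in \<open>auto simp: hform_add\<close>)
  have "hform x y = hform (\<Sum>i\<in>UNIV. x $ i *s axis i 1) (\<Sum>j\<in>UNIV. y $ j *s axis j 1)"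
    using vec_axis_sum[of x] vec_axis_sum[of y] by simp
  also have "\<dots> = (\<Sum>i\<in>UNIV. hform (x $ i *s axis i 1) (\<Sum>j\<in>UNIV. y $ j *s axis j 1))"
    by (rule l) simp
  also have "\<dots> = (\<Sum>i\<in>UNIV. \<Sum>j\<in>UNIV. hform (x $ i *s axis i 1) (y $ j *s axis j 1))"
    by (intro sum.cong refl r) simp
  also have "\<dots> = (\<Sum>i\<in>UNIV. \<Sum>j\<in>UNIV. x $ i * (cnj (y $ j) * hform (axis i 1) (axis j 1)))"
    by (simp add: hform_scale mult.left_commute)
  finally show ?thesis
    by (simp add: matrix_vector_mult_def Hm_def sum_distrib_left mult_ac)
qed

lemma Hm_invertible:
  obtains Hi where "Hi ** Hm = mat 1" "Hm ** Hi = mat 1"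
proof -
  have "y = 0" if "Hm *v y = 0" for y
  proof (rule ccontr)
    assume "y \<noteq> 0"
    then have "cnj_vec y \<noteq> 0" by (metis cnj_vec_cnj_vec cnj_vec_zero)
    then have "Re (hform (cnj_vec y) (cnj_vec y)) > 0" by (rule hform_pos)
    then show False using that by (simp add: hform_Hm)
  qed
  then obtain Hi where "Hi ** Hm = mat 1"
    using matrix_left_invertible_ker[of Hm] by blast
  then show ?thesis using that matrix_left_right_inverse by blast
qed

text \<open>The inner product depends on the components only through their classes in the graded
  quotients, and \<open>g\<close> acts trivially there. So every frame \<open>G ** g\<close> of this
  kind turns the metric of its point into the same \<open>hform\<close>.\<close>

lemma hodge_inner_eq:
  assumes ad: "adapted d M W F' (G ** g) G'i" and g: "supp (nilp d 1) (g - mat 1)"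
    and F': "F' p0 = UNIV"
  shows "hodge_inner W S F' u v = hform (G'i *v u) (G'i *v v)"
proof -
  define G' where "G' = G ** g"
  interpret A: adapted d M W F' G' G'i unfolding G'_def by (rule ad)
  have del: "deligne W F' = A.bigr" by (rule A.deligne_eq[where ?p0.0 = p0]) (rule F')
  have proj: "bigr_proj A.bigr p q u = G' *v (P (p, q) *v (G'i *v u))" for p q u
    unfolding bigr_proj_def
  proof (rule the_equality)
    let ?x = "G' *v (P (p, q) *v (G'i *v u))"
    have "G'i *v (u - ?x) \<in> coord {i. d i \<in> - {(p, q)}}"
      by (auto simp: coord_def P_nth matrix_vector_mult_diff_distrib)
    then show "?x \<in> A.bigr p q \<and> u - ?x \<in> vec.span (\<Union>(a, b)\<in>- {(p, q)}. A.bigr a b)"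
      unfolding A.span_bigr A.in_image_iff A.bigr_iff using P_coord by simp
    fix x assume x: "x \<in> A.bigr p q \<and> u - x \<in> vec.span (\<Union>(a, b)\<in>- {(p, q)}. A.bigr a b)"
    then have 1: "G'i *v x \<in> coord {i. d i = (p, q)}" and 2: "G'i *v (u - x) \<in> coord {i. d i \<in> - {(p, q)}}"
      unfolding A.span_bigr A.in_image_iff A.bigr_iff by auto
    have "P (p, q) *v (G'i *v u) = G'i *v x"
      using 1 2 by (auto simp: vec_eq_iff P_nth coord_def matrix_vector_mult_diff_distrib)
    then show "x = ?x" by simp
  qed
  have index: "{(p, q). A.bigr p q \<noteq> {0}} = range d"
  proof -
    have "A.bigr p q \<noteq> {0} \<longleftrightarrow> (p, q) \<in> range d" for p q
    proof
      assume "A.bigr p q \<noteq> {0}"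
      moreover have "0 \<in> A.bigr p q" by (simp add: A.bigr_iff)
      ultimately obtain u where u: "u \<in> A.bigr p q" "u \<noteq> 0" by blast
      define x where "x = G'i *v u"
      have "x \<in> coord {i. d i = (p, q)}" using u by (simp add: A.bigr_iff x_def)
      moreover have "x \<noteq> 0"
        using u(2) A.Gi_G_vec(2)[of u] unfolding x_def by (metis matrix_vector_mult_0_right)
      ultimately show "(p, q) \<in> range d" unfolding coord_def vec_eq_iff zero_index
        by (metis (mono_tags, lifting) mem_Collect_eq rangeI)
    next
      assume "(p, q) \<in> range d"
      then obtain i where "d i = (p, q)" by auto
      then have "G' *v axis i 1 \<in> A.bigr p q" unfolding A.bigr_iff by simp
      moreover have "G' *v axis i 1 \<noteq> 0"
        by (metis A.Gi_G_vec(1) axis_eq_0_iff matrix_vector_mult_0_right zero_neq_one)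
      ultimately show "A.bigr p q \<noteq> {0}" by blast
    qed
    then show ?thesis by auto
  qed
  have coeff: "cform (S (wt t)) (G' *v (P t *v x)) (cnj_vec (G' *v (P t *v y)))
     = cform (S (wt t)) (G *v (P t *v x)) (cnj_vec (G *v (P t *v y)))" for t x y
  proof (rule cform_cong)
    have diff: "G' *v (P t *v x) - G *v (P t *v x) \<in> cW (wt t - 1)" for x
    proof -
      have "G' *v (P t *v x) - G *v (P t *v x) = G *v ((g - mat 1) *v (P t *v x))"
        by (simp add: G'_def matrix_vector_mult_diff_distrib matrix_vector_mult_diff_rdistrib
            flip: matrix_vector_mul_assoc)
      also have "\<dots> \<in> cW (wt t - 1)"
        by (rule G_wt, rule supp_coord[OF g P_coord]) (auto simp: nilp_def)
      finally show ?thesis .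
    qed
    show "G' *v (P t *v x) - G *v (P t *v x) \<in> cW (wt t - 1)" by (rule diff)
    show "cnj_vec (G' *v (P t *v y)) - cnj_vec (G *v (P t *v y)) \<in> cW (wt t - 1)"
      using cW_cnj[OF diff] by (simp add: cnj_vec_diff)
  qed (rule GP_cW GP_cnj_cW)+
  show ?thesis
    unfolding hodge_inner_def Let_def del proj index hform_def hterm_def ci_def
    by (rule sum.cong[OF refl]) (simp add: case_prod_unfold coeff)
qed

text \<open>In the frame the hermitian form is fixed, so the standard norm of \<open>X\<close> is at
  most a fixed multiple of the entrywise norm of its matrix \<open>b\<close>; \<open>c\<close>
  depends only on the Gram matrix \<open>Hm\<close>.\<close>

lemma std_norm_bound:
  obtains c where "0 \<le> c" "\<And>F' g G'i p0 X. adapted d M W F' (G ** g) G'i \<Longrightarrow>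
    supp (nilp d 1) (g - mat 1) \<Longrightarrow> F' p0 = UNIV \<Longrightarrow>
    std_norm W S F' X \<le> c * mnorm (G'i ** X ** (G ** g))"
proof -
  obtain Hi where Hi: "Hi ** Hm = mat 1" "Hm ** Hi = mat 1" by (rule Hm_invertible)
  show ?thesis
  proof (rule that[of "sqrt (mnorm Hi * mnorm Hm)"])
    fix F' g G'i p0 X
    assume A: "adapted d M W F' (G ** g) G'i" "supp (nilp d 1) (g - mat 1)" "F' p0 = UNIV"
    define G' where "G' = G ** g"
    interpret A: adapted d M W F' G' G'i unfolding G'_def by (rule A(1))
    define b where "b = G'i ** X ** G'"
    \<comment> \<open>The adjoint of \<open>b\<close> for the Gram matrix \<open>Hm\<close>, as
      dictated by \<open>Hm ** cnj_mat b' = transpose b ** Hm\<close>.\<close>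
    define b' where "b' = cnj_mat (Hi ** transpose b ** Hm)"
    define Y where "Y = G' ** b' ** G'i"
    have inner: "hodge_inner W S F' u v = hform (G'i *v u) (G'i *v v)" for u v
      by (rule hodge_inner_eq[OF A])
    have Xb: "G'i *v (X *v u) = b *v (G'i *v u)" for u
      by (simp add: b_def matrix_vector_mul_assoc mat_assoc A.GGi)
    have adj: "hform (b *v x) y = hform x (b' *v y)" for x y
    proof -
      have tr: "(transpose b *v z) $ i = (\<Sum>j\<in>UNIV. b $ j $ i * z $ j)" for z i
        unfolding transpose_def matrix_vector_mult_def vec_lambda_beta ..
      have "Hm *v cnj_vec (b' *v y) = transpose b *v (Hm *v cnj_vec y)"
        by (simp add: b'_def cnj_vec_mult matrix_vector_mul_assoc mat_assoc mat_cancel[OF Hi(2)] del: transpose_matrix_vector)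
      then have "hform x (b' *v y) = (\<Sum>i\<in>UNIV. x $ i * (transpose b *v (Hm *v cnj_vec y)) $ i)"
        by (simp only: hform_Hm)
      also have "\<dots> = (\<Sum>i\<in>UNIV. \<Sum>j\<in>UNIV. x $ i * (b $ j $ i * (Hm *v cnj_vec y) $ j))"
        by (simp only: tr sum_distrib_left)
      also have "\<dots> = (\<Sum>j\<in>UNIV. \<Sum>i\<in>UNIV. x $ i * (b $ j $ i * (Hm *v cnj_vec y) $ j))"
        by (rule sum.swap)
      also have "\<dots> = (\<Sum>j\<in>UNIV. (b *v x) $ j * (Hm *v cnj_vec y) $ j)"
        unfolding matrix_vector_mult_def[of b] vec_lambda_beta sum_distrib_right
        by (intro sum.cong refl) (simp add: mult_ac)
      also have "\<dots> = hform (b *v x) y" by (simp only: hform_Hm)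
      finally show ?thesis by simp
    qed
    have nondeg: "y = y'" if "\<And>x. hform x y = hform x y'" for y y'
    proof (rule ccontr)
      assume "y \<noteq> y'"
      then have "Re (hform (y - y') (y - y')) > 0" by (intro hform_pos) simp
      moreover have "hform (y - y') (y - y' + y') = hform (y - y') y'" using that by simp
      ultimately show False unfolding hform_add by simp
    qed
    have "hodge_adjoint W S F' X = Y"
      unfolding hodge_adjoint_def inner
    proof (rule the_equality)
      show "\<forall>u v. hform (G'i *v (X *v u)) (G'i *v v) = hform (G'i *v u) (G'i *v (Y *v v))"
        by (simp add: Xb adj Y_def flip: matrix_vector_mul_assoc)
      fix Y' assume Y': "\<forall>u v. hform (G'i *v (X *v u)) (G'i *v v) = hform (G'i *v u) (G'i *v (Y' *v v))"
      have "G'i *v (Y' *v v) = b' *v (G'i *v v)" for v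
      proof (rule nondeg)
        fix x
        show "hform x (G'i *v (Y' *v v)) = hform x (b' *v (G'i *v v))"
          using Y'[rule_format, of "G' *v x" v] by (simp add: Xb adj)
      qed
      then have "Y' *v v = Y *v v" for v
        by (metis A.Gi_G_vec(2) Y_def matrix_vector_mul_assoc)
      then show "Y' = Y" by (simp add: matrix_eq)
    qed
    then have "std_metric W S F' X X = trace (X ** Y)" by (simp add: std_metric_def)
    also have "X ** Y = G' ** (b ** b' ** G'i)"
      by (simp add: Y_def b_def mat_assoc mat_cancel[OF A.GGi])
    also have "trace \<dots> = trace (b ** b')"
      by (subst trace_mul_sym) (simp add: mat_assoc A.GiG)
    finally have "std_metric W S F' X X = trace (b ** b')" .
    moreover have "Re (trace (b ** b')) \<le> mnorm (b ** b')"
    proof -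
      have "Re (trace (b ** b')) \<le> (\<Sum>i\<in>UNIV. cmod ((b ** b') $ i $ i))"
        unfolding trace_def Re_sum by (intro sum_mono complex_Re_le_cmod)
      also have "\<dots> \<le> mnorm (b ** b')"
        unfolding mnorm_def by (intro sum_mono member_le_sum) auto
      finally show ?thesis .
    qed
    moreover have "mnorm (b ** b') \<le> mnorm b * (mnorm Hi * mnorm b * mnorm Hm)"
    proof -
      have "mnorm (transpose b) = mnorm b"
        by (simp add: mnorm_def transpose_def) (rule sum.swap)
      then have "mnorm b' \<le> mnorm Hi * mnorm b * mnorm Hm"
        unfolding b'_def mnorm_cnj by (intro mnorm_mult_le) auto
      then show ?thesis by (intro mnorm_mult_le) auto
    qed
    ultimately have "Re (std_metric W S F' X X) \<le> (mnorm Hi * mnorm Hm) * (mnorm b)\<^sup>2"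
      by (simp add: power2_eq_square mult_ac)
    then have "std_norm W S F' X \<le> sqrt ((mnorm Hi * mnorm Hm) * (mnorm b)\<^sup>2)"
      unfolding std_norm_def by (rule real_sqrt_le_mono)
    also have "\<dots> = sqrt (mnorm Hi * mnorm Hm) * mnorm b" by (simp add: real_sqrt_mult)
    finally show "std_norm W S F' X \<le> sqrt (mnorm Hi * mnorm Hm) * mnorm (G'i ** X ** (G ** g))"
      by (simp add: b_def G'_def)
  qed simp
qed

end


subsection \<open>Tangent vectors\<close>

text \<open>Interpreted at the moving points of a path, while \<open>polarized_coords\<close> fixes
  the reference point whose form \<open>hform\<close> measures all tangent vectors.\<close>

locale polarized_adapted = polarized_space W S + adapted d M W F G Gi
  for W :: "'n::finite rfilt" and S and d :: "'n \<Rightarrow> int \<times> int" and M F G Gi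
begin

lemma lowers_iff: "lowers X \<longleftrightarrow> supp (nilp d 1) (Gi ** X ** G)"
proof
  assume X: "lowers X"
  show "supp (nilp d 1) (Gi ** X ** G)"
  proof (rule coord_supp)
    fix j
    have "G *v axis j 1 \<in> cW (wt (d j))" unfolding W_eq by (rule imageI) simp
    then have "X *v (G *v axis j 1) \<in> cW (wt (d j) - 1)" using X by (simp add: lowers_def)
    then have "Gi *v (X *v (G *v axis j 1)) \<in> coord {i. wt (d i) \<le> wt (d j) - 1}"
      unfolding W_eq in_image_iff .
    also have "{i. wt (d i) \<le> wt (d j) - 1} = {i. nilp d 1 i j}" by (auto simp: nilp_def)
    finally show "(Gi ** X ** G) *v axis j 1 \<in> coord {i. nilp d 1 i j}"
      by (simp add: matrix_vector_mul_assoc mat_assoc)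
  qed
next
  assume X: "supp (nilp d 1) (Gi ** X ** G)"
  show "lowers X"
    unfolding lowers_def
  proof (intro allI ballI)
    fix k u assume "u \<in> cW k"
    then have "Gi *v u \<in> coord {i. wt (d i) \<le> k}" unfolding W_eq in_image_iff .
    then have "(Gi ** X ** G) *v (Gi *v u) \<in> coord {i. wt (d i) \<le> k - 1}"
      by (rule supp_coord[OF X]) (auto simp: nilp_def)
    then show "X *v u \<in> cW (k - 1)"
      unfolding W_eq in_image_iff by (simp add: matrix_vector_mul_assoc mat_assoc GGi)
  qed
qed

text \<open>The components preserving or raising the first index stabilize \<open>F\<close>.
  Deleting them yields the representative of the velocity \<open>D\<close> in
  \<open>tangent_model\<close>.\<close>

definition tproj :: "complex^'n^'n \<Rightarrow> complex^'n^'n" where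
  "tproj D = G ** trunc (\<lambda>i j. fst (d i) < fst (d j)) (Gi ** D ** G) ** Gi"

text \<open>Sort the matrix entries by their type \<open>d i - d j\<close>. Each class is a Lie
  algebra component: the truncation makes its first index negative, and \<open>lowers D\<close>
  makes its weight negative.\<close>

lemma tproj_tangent:
  assumes D: "lowers D" and F: "F p0 = UNIV"
  shows "tproj D \<in> tangent_model W S F"
proof -
  define b where "b = Gi ** D ** G"
  have b: "supp (nilp d 1) b" using D unfolding b_def lowers_iff .
  define T where "T = (\<lambda>(i, j). d i - d j) ` {(i, j). wt (d i) < wt (d j) \<and> fst (d i) < fst (d j)}"
  define X where "X t = G ** trunc (\<lambda>i j. d i - d j = t) b ** Gi" for t
  have "trunc (\<lambda>i j. fst (d i) < fst (d j)) b = (\<Sum>t\<in>T. trunc (\<lambda>i j. d i - d j = t) b)"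
  proof -
    have "(\<Sum>t\<in>T. trunc (\<lambda>i j. d i - d j = t) b) $ i $ j = trunc (\<lambda>i j. fst (d i) < fst (d j)) b $ i $ j" for i j
    proof -
      have "(\<Sum>t\<in>T. trunc (\<lambda>i j. d i - d j = t) b) $ i $ j = (\<Sum>t\<in>T. if d i - d j = t then b $ i $ j else 0)"
        by (simp add: trunc_nth)
      also have "\<dots> = (if d i - d j \<in> T then b $ i $ j else 0)"
        by (subst sum.delta') (auto simp: T_def)
      also have "\<dots> = trunc (\<lambda>i j. fst (d i) < fst (d j)) b $ i $ j"
      proof (cases "fst (d i) < fst (d j) \<and> b $ i $ j \<noteq> 0")
        case True
        then have "nilp d 1 i j" using b by (auto simp: supp_def)
        then have "d i - d j \<in> T"
          unfolding T_def using True by (intro image_eqI[of _ _ "(i, j)"]) (auto simp: nilp_def)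
        then show ?thesis using True by (simp add: trunc_nth)
      next
        case False
        have "fst t < 0" if "t \<in> T" for t using that by (auto simp: T_def)
        from this[of "d i - d j"] False show ?thesis by (auto simp: trunc_nth)
      qed
      finally show ?thesis .
    qed
    then show ?thesis by (simp add: vec_eq_iff)
  qed
  then have "tproj D = (\<Sum>t\<in>T. X t)"
    by (simp add: tproj_def b_def[symmetric] X_def sum_mat_mult)
  moreover have "X t \<in> (\<Union>(p, q)\<in>{(p, q). p < 0 \<and> p + q \<le> 0}. lie_component W S F p q)" if t: "t \<in> T" for t
  proof -
    obtain p q where pq: "t = (p, q)" by (cases t)
    have sp: "p < 0" "p + q \<le> 0" using t by (auto simp: T_def pq minus_prod_def)
    have GX: "Gi ** X t ** G = trunc (\<lambda>i j. d i - d j = t) b"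
      by (simp add: X_def mat_assoc mat_cancel[OF GiG] GiG)
    have "supp (nilp d 1) (Gi ** X t ** G)"
      unfolding GX using b by (auto simp: supp_def trunc_nth)
    then have lie: "X t \<in> lie_G_C W S" by (intro lowers_lie_G_C) (simp add: lowers_iff)
    have "X t *v u \<in> bigr (a + p) (b' + q)" if u: "u \<in> bigr a b'" for a b' u
    proof -
      have "Gi *v (X t *v u) = trunc (\<lambda>i j. d i - d j = t) b *v (Gi *v u)"
        by (simp add: GX[symmetric] matrix_vector_mul_assoc mat_assoc GGi)
      also have "\<dots> \<in> coord {i. d i = (a + p, b' + q)}"
      proof (rule supp_coord)
        show "supp (\<lambda>i j. d i - d j = t) (trunc (\<lambda>i j. d i - d j = t) b)"
          by (auto simp: supp_def trunc_nth)
        show "Gi *v u \<in> coord {i. d i = (a, b')}" using u by (simp add: bigr_iff)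
      qed (auto simp: pq minus_prod_def prod_eq_iff)
      finally show ?thesis by (simp add: bigr_iff)
    qed
    then have "X t \<in> lie_component W S F p q"
      using lie by (simp add: lie_component_def deligne_eq[OF F])
    then show ?thesis using sp by auto
  qed
  ultimately show ?thesis
    unfolding tangent_model_def by (auto intro!: span_sum intro: span_base)
qed

lemma tproj_stabilizer:
  assumes "u \<in> F p"
  shows "(tproj D - D) *v u \<in> F p"
proof -
  let ?b = "Gi ** D ** G"
  have "tproj D - D = G ** (trunc (\<lambda>i j. fst (d i) < fst (d j)) ?b - ?b) ** Gi"
    by (simp add: tproj_def mat_ring mat_assoc mat_cancel[OF GGi] GGi)
  then have "Gi *v ((tproj D - D) *v u) = (trunc (\<lambda>i j. fst (d i) < fst (d j)) ?b - ?b) *v (Gi *v u)"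
    by (simp add: matrix_vector_mul_assoc mat_assoc mat_cancel[OF GiG])
  also have "\<dots> \<in> coord {i. p \<le> fst (d i)}"
  proof (rule supp_coord)
    show "supp (\<lambda>i j. fst (d i) \<ge> fst (d j)) (trunc (\<lambda>i j. fst (d i) < fst (d j)) ?b - ?b)"
      by (auto simp: supp_def trunc_nth)
    show "Gi *v u \<in> coord {i. p \<le> fst (d i)}" using assms unfolding F_eq in_image_iff .
  qed auto
  finally show ?thesis unfolding F_eq in_image_iff .
qed

lemma mnorm_tproj: "mnorm (Gi ** tproj D ** G) \<le> mnorm (Gi ** D ** G)"
  by (simp add: tproj_def mat_assoc mat_cancel[OF GiG] GiG) (simp add: mnorm_trunc)

end

subsection \<open>Lengths of segments in the unipotent group\<close>

context polarized_coords
begin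

sublocale polarized_adapted ..

lemma lowers_coords: "supp (nilp d 1) X \<Longrightarrow> lowers (G ** X ** Gi)"
  unfolding lowers_iff by (simp add: mat_assoc mat_cancel[OF GiG] GiG)

lemma unip_coords:
  assumes "supp (nilp d 1) (h - mat 1)"
  shows "lowers (G ** h ** Gi - mat 1)"
proof -
  have "G ** h ** Gi - mat 1 = G ** (h - mat 1) ** Gi" by (simp add: mat_ring GGi)
  then show ?thesis using lowers_coords[OF assms] by simp
qed

lemma classifying_translate:
  assumes F: "F \<in> classifying_space W S hn" and h: "supp (nilp d 1) (h - mat 1)"
  shows "filt_act (G ** h ** Gi) F \<in> classifying_space W S hn"
proof -
  obtain hi where hi: "h ** hi = mat 1" "hi ** h = mat 1" "supp (nilp d 1) (hi - mat 1)"
    using unipotent_inverse[OF h, of d] by auto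
  have e1: "(G ** hi ** Gi) ** (G ** h ** Gi) = mat 1" "(G ** h ** Gi) ** (G ** hi ** Gi) = mat 1"
    by (simp_all add: mat_assoc mat_cancel[OF GiG] mat_cancel[OF hi(1)] mat_cancel[OF hi(2)] GGi)
  have "FGr W (filt_act (G ** h ** Gi) F) = FGr W F"
    by (intro ext FGr_unip[OF unip_coords[OF h] unip_coords[OF hi(3)] e1(1)])
  then show ?thesis
    by (rule classifying_space_cong[OF F filtration_filt_act[OF filt e1(2)]])
qed

text \<open>\<open>e\<close> acts on the left of an affine segment of unipotent matrices. The frames
  are chosen separately at each time, since a pointwise bound \<open>B\<close> on the velocity in
  them already bounds the length; \<open>c\<close> comes from \<open>std_norm_bound\<close>.\<close>

lemma segment_length:
  obtains c where "0 \<le> c" "\<And>e A0 A1 B hn. F \<in> classifying_space W S hn \<Longrightarrow>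
    supp (nilp d 1) (e - mat 1) \<Longrightarrow> supp (nilp d 1) A0 \<Longrightarrow> supp (nilp d 1) A1 \<Longrightarrow>
    (\<And>t::real. t \<in> {0..1} \<Longrightarrow> \<exists>g gi Hi. adapted d M W
        (filt_act (G ** (e ** (mat 1 + A0 + t *\<^sub>R (A1 - A0))) ** Gi) F) (G ** g) (gi ** Gi) \<and>
      supp (nilp d 1) (g - mat 1) \<and> (e ** (mat 1 + A0 + t *\<^sub>R (A1 - A0))) ** Hi = mat 1 \<and>
      mnorm (gi ** (e ** (A1 - A0) ** Hi) ** g) \<le> B) \<Longrightarrow>
    \<exists>L. std_path_length W S hn (filt_act (G ** (e ** (mat 1 + A0)) ** Gi) F)
        (filt_act (G ** (e ** (mat 1 + A1)) ** Gi) F) L \<and> L \<le> c * B"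
proof -
  obtain c where c: "0 \<le> c" and norm_bound: "\<And>F' g G'i p0 X. adapted d M W F' (G ** g) G'i \<Longrightarrow>
    supp (nilp d 1) (g - mat 1) \<Longrightarrow> F' p0 = UNIV \<Longrightarrow>
    std_norm W S F' X \<le> c * mnorm (G'i ** X ** (G ** g))"
    using std_norm_bound by blast
  show ?thesis
  proof (rule that[OF c])
    fix e A0 A1 :: "complex^'n^'n" and B hn
    assume F: "F \<in> classifying_space W S hn"
      and e: "supp (nilp d 1) (e - mat 1)" and A0: "supp (nilp d 1) A0" and A1: "supp (nilp d 1) A1"
      and ex: "\<And>t::real. t \<in> {0..1} \<Longrightarrow> \<exists>g gi Hi. adapted d M W
        (filt_act (G ** (e ** (mat 1 + A0 + t *\<^sub>R (A1 - A0))) ** Gi) F) (G ** g) (gi ** Gi) \<and>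
      supp (nilp d 1) (g - mat 1) \<and> (e ** (mat 1 + A0 + t *\<^sub>R (A1 - A0))) ** Hi = mat 1 \<and>
      mnorm (gi ** (e ** (A1 - A0) ** Hi) ** g) \<le> B"
    define H where "H t = e ** (mat 1 + A0 + t *\<^sub>R (A1 - A0))" for t :: real
    define \<gamma> where "\<gamma> t = filt_act (G ** H t ** Gi) F" for t
    have "\<forall>t\<in>{0..1}. \<exists>g gi Hi. adapted d M W (\<gamma> t) (G ** g) (gi ** Gi) \<and>
      supp (nilp d 1) (g - mat 1) \<and> H t ** Hi = mat 1 \<and> mnorm (gi ** (e ** (A1 - A0) ** Hi) ** g) \<le> B"
      using ex unfolding \<gamma>_def H_def by blast
    then obtain g gi Hi where g: "\<And>t. t \<in> {0..1} \<Longrightarrow> adapted d M W (\<gamma> t) (G ** g t) (gi t ** Gi)"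
      "\<And>t. t \<in> {0..1} \<Longrightarrow> supp (nilp d 1) (g t - mat 1)"
      "\<And>t. t \<in> {0..1} \<Longrightarrow> H t ** Hi t = mat 1"
      "\<And>t. t \<in> {0..1} \<Longrightarrow> mnorm (gi t ** (e ** (A1 - A0) ** Hi t) ** g t) \<le> B"
      unfolding bchoice_iff by blast
    have HiH: "Hi t ** H t = mat 1" if "t \<in> {0..1}" for t
      using g(3)[OF that] matrix_left_right_inverse by blast
    have nilH: "supp (nilp d 1) (H t - mat 1)" for t
    proof -
      have A: "supp (nilp d 1) (A0 + t *\<^sub>R (A1 - A0))"
        using A0 A1 by (intro supp_add supp_scaleR supp_diff)
      have eq: "H t - mat 1 = (e - mat 1) + (A0 + t *\<^sub>R (A1 - A0)) + (e - mat 1) ** (A0 + t *\<^sub>R (A1 - A0))"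
        by (simp add: H_def mat_ring add.assoc)
      show ?thesis
        unfolding eq by (intro supp_add[OF supp_add[OF e A] supp_mult[OF e A]] transp_patterns)
    qed
    have cls: "\<gamma> t \<in> classifying_space W S hn" for t
      unfolding \<gamma>_def by (rule classifying_translate[OF F nilH])
    define D where "D t = G ** (e ** (A1 - A0) ** Hi t) ** Gi" for t
    define lift where "lift t s = G ** (H s ** Hi t) ** Gi" for t s
    \<comment> \<open>The lift based at time \<open>t\<close> is affine in \<open>s\<close>, so its
      derivative is the constant \<open>D t\<close> and continuous differentiability is
      immediate.\<close>
    have lift_eq: "lift t s = G ** (e ** (mat 1 + A0) ** Hi t) ** Gi + s *\<^sub>R D t" for t s
      by (simp add: lift_def H_def D_def mat_ring scaleR_mat_mult scaleR_diff_right mat_assoc)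
    have lift_der: "(lift t has_vector_derivative D t) (at s within X)" for t s X
      unfolding lift_eq[abs_def]
      by (rule has_vector_derivative_eq_rhs, (rule derivative_intros)+) simp
    have flift: "flag_lift \<gamma> X t (lift t)" if t: "t \<in> {0..1}" and X: "X \<subseteq> {0..1}" for t X
      unfolding flag_lift_def
    proof (intro conjI ballI)
      show "lift t t = mat 1" by (simp add: lift_def g(3)[OF t] GGi)
      fix s assume s: "s \<in> X"
      then have s': "s \<in> {0..1}" using X by blast
      have inv: "lift t s ** lift s t = mat 1" "lift s t ** lift t s = mat 1"
        unfolding lift_def
        by (simp_all add: mat_assoc mat_cancel[OF GiG] mat_cancel[OF HiH[OF t]] mat_cancel[OF HiH[OF s']]
            mat_cancel[OF g(3)[OF s']] mat_cancel[OF g(3)[OF t]] GGi)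
      then show "invertible (lift t s)" unfolding invertible_def by blast
      have "lift t s ** (G ** H t ** Gi) = G ** H s ** Gi"
        by (simp add: lift_def mat_assoc mat_cancel[OF GiG] mat_cancel[OF HiH[OF t]])
      then show "\<gamma> s = filt_act (lift t s) (\<gamma> t)"
        unfolding \<gamma>_def filt_act_mult by simp
    qed
    have full: "\<exists>p0. \<gamma> t p0 = UNIV" for t
      using cls[of t] by (auto simp: classifying_space_def M_check_def finite_decreasing_filtration_def)
    have pa: "polarized_adapted W S d M (\<gamma> t) (G ** g t) (gi t ** Gi)" if "t \<in> {0..1}" for t
      using g(1)[OF that] polarized_space_axioms by (rule polarized_adapted.intro[rotated])
    define v where "v t = polarized_adapted.tproj d (G ** g t) (gi t ** Gi) (D t)" for t
    have lowD: "lowers (D t)" if t: "t \<in> {0..1}" for t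
    proof -
      obtain Hi' where Hi': "H t ** Hi' = mat 1" "supp (nilp d 1) (Hi' - mat 1)"
        using unipotent_inverse[OF nilH[of t], of d] by auto
      have "Hi' = Hi t" by (rule left_inverse_unique[OF Hi'(1) HiH[OF t]])
      have "e ** (A1 - A0) ** Hi t = (A1 - A0) + (e - mat 1) ** (A1 - A0) + (A1 - A0) ** (Hi t - mat 1)
         + (e - mat 1) ** (A1 - A0) ** (Hi t - mat 1)"
        by (simp add: mat_ring mat_assoc)
      moreover have "supp (nilp d 1) \<dots>"
      proof -
        note A = supp_diff[OF A1 A0] and h = Hi'(2)[unfolded \<open>Hi' = Hi t\<close>]
        have eA: "supp (nilp d 1) ((e - mat 1) ** (A1 - A0))" by (rule supp_mult[OF e A]) simp
        have "supp (nilp d 1) ((A1 - A0) ** (Hi t - mat 1))" by (rule supp_mult[OF A h]) simp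
        moreover have "supp (nilp d 1) ((e - mat 1) ** (A1 - A0) ** (Hi t - mat 1))"
          by (rule supp_mult[OF eA h]) simp
        ultimately show ?thesis using A eA by (intro supp_add)
      qed
      ultimately show ?thesis unfolding D_def by (intro lowers_coords) simp
    qed
    have "std_path_length W S hn (\<gamma> 0) (\<gamma> 1) (integral {0..1} (\<lambda>t. std_norm W S (\<gamma> t) (v t)))"
    proof (rule std_path_length.C1_piece)
      show "\<forall>t\<in>{0..1}. \<gamma> t \<in> classifying_space W S hn" using cls by blast
      show "C1_flag_path \<gamma> 0 1"
        unfolding C1_flag_path_def
      proof
        fix t :: real assume t: "t \<in> {0..1}"
        show "\<exists>e>0. \<exists>g g'. flag_lift \<gamma> ({0..1} \<inter> ball t e) t g \<and>
           (\<forall>s\<in>{0..1} \<inter> ball t e. (g has_vector_derivative g' s) (at s within {0..1})) \<and>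
           continuous_on ({0..1} \<inter> ball t e) g'"
          by (intro exI[of _ 1] exI[of _ "lift t"] exI[of _ "\<lambda>_. D t"] conjI ballI flift[OF t] lift_der) auto
      qed
      show "\<forall>t\<in>{0..1}. v t \<in> tangent_model W S (\<gamma> t) \<and> flag_velocity \<gamma> 0 1 t (v t)"
      proof
        fix t :: real assume t: "t \<in> {0..1}"
        interpret A: polarized_adapted W S d M "\<gamma> t" "G ** g t" "gi t ** Gi" by (rule pa[OF t])
        obtain p0 where p0: "\<gamma> t p0 = UNIV" using full by blast
        have "v t \<in> tangent_model W S (\<gamma> t)"
          unfolding v_def by (rule A.tproj_tangent[OF lowD[OF t] p0])
        moreover have "flag_velocity \<gamma> 0 1 t (v t)"
          unfolding flag_velocity_def v_def
          by (intro exI[of _ 1] exI[of _ "lift t"] exI[of _ "D t"] conjI allI ballI flift[OF t] lift_der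
              A.tproj_stabilizer) auto
        ultimately show "v t \<in> tangent_model W S (\<gamma> t) \<and> flag_velocity \<gamma> 0 1 t (v t)" ..
      qed
    qed simp
    moreover have "integral {0..1} (\<lambda>t. std_norm W S (\<gamma> t) (v t)) \<le> c * B"
    proof -
      have bound: "std_norm W S (\<gamma> t) (v t) \<le> c * B" if t: "t \<in> {0..1}" for t
      proof -
        interpret A: polarized_adapted W S d M "\<gamma> t" "G ** g t" "gi t ** Gi" by (rule pa[OF t])
        obtain p0 where p0: "\<gamma> t p0 = UNIV" using full by blast
        have "std_norm W S (\<gamma> t) (v t) \<le> c * mnorm ((gi t ** Gi) ** v t ** (G ** g t))"
          by (rule norm_bound[OF g(1)[OF t] g(2)[OF t] p0])
        also have "mnorm ((gi t ** Gi) ** v t ** (G ** g t)) \<le> mnorm ((gi t ** Gi) ** D t ** (G ** g t))"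
          unfolding v_def by (rule A.mnorm_tproj)
        also have "(gi t ** Gi) ** D t ** (G ** g t) = gi t ** (e ** (A1 - A0) ** Hi t) ** g t"
          by (simp add: D_def mat_assoc mat_cancel[OF GiG])
        also have "mnorm \<dots> \<le> B" by (rule g(4)[OF t])
        finally show ?thesis using c by (simp add: mult_left_mono)
      qed
      have "0 \<le> B" using order_trans[OF mnorm_nonneg g(4)[of 0]] by simp
      show ?thesis
      proof (cases "(\<lambda>t. std_norm W S (\<gamma> t) (v t)) integrable_on {0..1}")
        case True
        then have "integral {0..1} (\<lambda>t. std_norm W S (\<gamma> t) (v t)) \<le> integral {0..1} (\<lambda>t::real. c * B)"
          by (intro integral_le bound) auto
        then show ?thesis by simp
      next
        \<comment> \<open>The default value of \<open>integral\<close> for a non-integrable function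
          is 0, which is at most \<open>c * B\<close>.\<close>
        case False
        then show ?thesis using c \<open>0 \<le> B\<close> by (simp add: not_integrable_integral)
      qed
    qed
    moreover have "\<gamma> 0 = filt_act (G ** (e ** (mat 1 + A0)) ** Gi) F"
      "\<gamma> 1 = filt_act (G ** (e ** (mat 1 + A1)) ** Gi) F"
      by (simp_all add: \<gamma>_def H_def)
    ultimately show "\<exists>L. std_path_length W S hn (filt_act (G ** (e ** (mat 1 + A0)) ** Gi) F)
        (filt_act (G ** (e ** (mat 1 + A1)) ** Gi) F) L \<and> L \<le> c * B"
      by auto
  qed
qed

end


subsection \<open>Commuting nilpotent endomorphisms\<close>

lemma lin_comb_mult:
  "X ** lin_comb N z ** Y = (\<chi> a b. \<Sum>j\<in>UNIV. z $ j * (X ** cmat (N j) ** Y) $ a $ b)"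
proof -
  have "(X ** lin_comb N z ** Y) $ a $ b = (\<Sum>j\<in>UNIV. z $ j * (X ** cmat (N j) ** Y) $ a $ b)" for a b
  proof -
    have "(X ** lin_comb N z ** Y) $ a $ b
       = (\<Sum>l\<in>UNIV. \<Sum>k\<in>UNIV. \<Sum>j\<in>UNIV. z $ j * (X $ a $ k * cmat (N j) $ k $ l * Y $ l $ b))"
      by (simp add: matrix_mult_nth lin_comb_def map_matrix_def sum_distrib_left sum_distrib_right mult_ac)
    also have "\<dots> = (\<Sum>l\<in>UNIV. \<Sum>j\<in>UNIV. \<Sum>k\<in>UNIV. z $ j * (X $ a $ k * cmat (N j) $ k $ l * Y $ l $ b))"
      by (intro sum.cong refl sum.swap)
    also have "\<dots> = (\<Sum>j\<in>UNIV. \<Sum>l\<in>UNIV. \<Sum>k\<in>UNIV. z $ j * (X $ a $ k * cmat (N j) $ k $ l * Y $ l $ b))"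
      by (rule sum.swap)
    finally show ?thesis by (simp add: matrix_mult_nth sum_distrib_left sum_distrib_right mult_ac)
  qed
  then show ?thesis by (simp add: vec_eq_iff)
qed

lemma lin_comb_commute:
  assumes "\<And>j. z $ j \<noteq> 0 \<Longrightarrow> X ** cmat (N j) = cmat (N j) ** X"
  shows "X ** lin_comb N z = lin_comb N z ** X"
proof -
  have "z $ j * (X ** cmat (N j) ** mat 1) $ a $ b = z $ j * (mat 1 ** cmat (N j) ** X) $ a $ b" for j a b
    using assms[of j] by (cases "z $ j = 0") simp_all
  then have "X ** lin_comb N z ** mat 1 = mat 1 ** lin_comb N z ** X"
    unfolding lin_comb_mult by presburger
  then show ?thesis by simp
qed

lemma lin_comb_supp:
  assumes "\<And>j. z $ j \<noteq> 0 \<Longrightarrow> supp R (X ** cmat (N j) ** Y)"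
  shows "supp R (X ** lin_comb N z ** Y)"
  unfolding lin_comb_mult supp_def vec_lambda_beta
proof (intro allI impI)
  fix a b assume "(\<Sum>j\<in>UNIV. z $ j * (X ** cmat (N j) ** Y) $ a $ b) \<noteq> 0"
  then obtain j where "z $ j * (X ** cmat (N j) ** Y) $ a $ b \<noteq> 0"
    by (rule sum.not_neutral_contains_not_neutral)
  then show "R a b" using assms[of j] by (auto simp: supp_def)
qed

lemma lin_comb_add: "lin_comb N (z + w) = lin_comb N z + lin_comb N w"
  by (simp add: lin_comb_def vec_eq_iff algebra_simps sum.distrib)

lemma lin_comb_uminus: "lin_comb N (- z) = - lin_comb N z"
  by (simp add: lin_comb_def vec_eq_iff sum_negf)

lemma lin_comb_cnj: "cnj_mat (lin_comb N z) = lin_comb N (cnj_vec z)"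
  by (simp add: lin_comb_def vec_eq_iff)

lemma mnorm_lin_comb: "mnorm (X ** lin_comb N z ** Y) \<le> (\<Sum>j\<in>UNIV. cmod (z $ j) * mnorm (X ** cmat (N j) ** Y))"
proof -
  have "mnorm (X ** lin_comb N z ** Y) \<le> (\<Sum>a\<in>UNIV. \<Sum>b\<in>UNIV. \<Sum>j\<in>UNIV. cmod (z $ j) * cmod ((X ** cmat (N j) ** Y) $ a $ b))"
    unfolding lin_comb_mult mnorm_def vec_lambda_beta
    by (intro sum_mono order_trans[OF norm_sum] order_eq_refl sum.cong refl norm_mult)
  also have "\<dots> = (\<Sum>a\<in>UNIV. \<Sum>j\<in>UNIV. \<Sum>b\<in>UNIV. cmod (z $ j) * cmod ((X ** cmat (N j) ** Y) $ a $ b))"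
    by (intro sum.cong refl sum.swap)
  also have "\<dots> = (\<Sum>j\<in>UNIV. \<Sum>a\<in>UNIV. \<Sum>b\<in>UNIV. cmod (z $ j) * cmod ((X ** cmat (N j) ** Y) $ a $ b))"
    by (rule sum.swap)
  also have "\<dots> = (\<Sum>j\<in>UNIV. cmod (z $ j) * mnorm (X ** cmat (N j) ** Y))"
    by (simp add: mnorm_def sum_distrib_left)
  finally show ?thesis .
qed

lemma mexp_conjugate:
  assumes "Gi ** G = mat 1" "G ** Gi = mat 1" "mpow X m = 0"
  shows "mexp (Gi ** X ** G) = Gi ** mexp X ** (G :: complex^'n::finite^'n)"
proof -
  have pw: "mpow (Gi ** X ** G) k = Gi ** mpow X k ** G" for k
  proof (induction k)
    case (Suc k)
    then show ?case by (simp add: mpow_Suc mat_assoc mat_cancel[OF assms(2)])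
  qed (simp add: assms(1))
  have "mpow (Gi ** X ** G) m = 0" by (simp add: pw assms(3))
  then show ?thesis
    by (simp add: mexp_finite[OF assms(3)] mexp_finite pw sum_mat_mult scaleR_mat_mult)
qed

lemma mexp_bound:
  obtains c where "0 \<le> c" "\<And>X :: complex^'n::finite^'n. mpow X m = 0 \<Longrightarrow> mnorm (mexp X) \<le> c * (1 + mnorm X) ^ m"
proof (rule that[of "real m * (1 + real CARD('n))"])
  fix X :: "complex^'n^'n" assume X: "mpow X m = 0"
  let ?n = "real CARD('n)"
  have pw: "mnorm (mpow X k) \<le> (1 + ?n) * (mnorm X) ^ k" for k
  proof (induction k)
    case (Suc k)
    show ?case using mnorm_mult_le[OF order_refl[of "mnorm X"] Suc] by (simp add: mpow_Suc mult_ac)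
  qed (simp add: mnorm_one)
  have "mnorm (mexp X) \<le> (\<Sum>k<m. mnorm ((1 / fact k) *\<^sub>R mpow X k))"
    unfolding mexp_finite[OF X] by (rule mnorm_sum)
  also have "\<dots> \<le> (\<Sum>k<m. (1 + ?n) * (1 + mnorm X) ^ m)"
  proof (rule sum_mono)
    fix k assume k: "k \<in> {..<m}"
    have "mnorm ((1 / fact k) *\<^sub>R mpow X k) \<le> 1 * mnorm (mpow X k)"
      unfolding mnorm_scaleR by (intro mult_right_mono) (auto simp: fact_ge_1 divide_le_eq)
    also have "\<dots> \<le> (1 + ?n) * mnorm X ^ k" using pw by simp
    also have "\<dots> \<le> (1 + ?n) * (1 + mnorm X) ^ m"
    proof (intro mult_left_mono)
      have "mnorm X ^ k \<le> (1 + mnorm X) ^ k" by (intro power_mono) auto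
      also have "\<dots> \<le> (1 + mnorm X) ^ m" using k by (intro power_increasing) auto
      finally show "mnorm X ^ k \<le> (1 + mnorm X) ^ m" .
    qed simp
    finally show "mnorm ((1 / fact k) *\<^sub>R mpow X k) \<le> (1 + ?n) * (1 + mnorm X) ^ m" .
  qed
  finally show "mnorm (mexp X) \<le> real m * (1 + ?n) * (1 + mnorm X) ^ m" by simp
qed simp

text \<open>The case \<open>e = -1\<close> of \<open>functorial\<close>, from the bigrading of
  \<open>F\<close> to itself, read on the columns of the frame.\<close>

lemma (in adapted) morphism_supp:
  assumes X: "cnj_mat X = X"
    and XF: "\<And>p u. u \<in> F p \<Longrightarrow> X *v u \<in> F (p - 1)"
    and XW: "\<And>k u. u \<in> complexify (W k) \<Longrightarrow> X *v u \<in> complexify (W (k - 2))"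
    and fin: "F p0 = UNIV"
  shows "supp (\<lambda>i j. d j = (fst (d i) + 1, snd (d i) + 1)) (Gi ** X ** G)"
proof (rule coord_supp)
  fix j
  have "G *v axis j 1 \<in> bigr (fst (d j)) (snd (d j))" by (simp add: bigr_iff)
  then have "X *v (G *v axis j 1) \<in> bigr (fst (d j) + (-1)) (snd (d j) + (-1))"
    by (rule functorial[OF is_deligne_bigr X _ _ fin, rotated 2]) (use XF XW in auto)
  then have "Gi *v (X *v (G *v axis j 1)) \<in> coord {i. d i = (fst (d j) - 1, snd (d j) - 1)}"
    by (simp add: bigr_iff)
  also have "{i. d i = (fst (d j) - 1, snd (d j) - 1)} = {i. d j = (fst (d i) + 1, snd (d i) + 1)}"
    by (auto simp: prod_eq_iff)
  finally show "(Gi ** X ** G) *v axis j 1 \<in> coord {i. d j = (fst (d i) + 1, snd (d i) + 1)}"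
    by (simp add: matrix_vector_mul_assoc mat_assoc)
qed

section \<open>Exponentials of the monodromy cone in adapted coordinates\<close>

locale orbit_coords = polarized_coords W S d M F G Gi
  for W :: "'n::finite rfilt" and S and d :: "'n \<Rightarrow> int \<times> int" and M F G Gi +
  fixes N :: "'r::{finite,linorder} \<Rightarrow> real^'n^'n"
  assumes N_comm: "N i ** N j = N j ** N i"
    and N_W: "u \<in> cW k \<Longrightarrow> cmat (N j) *v u \<in> cW (k - 2)"
    and N_F: "u \<in> F p \<Longrightarrow> cmat (N j) *v u \<in> F (p - 1)"
begin

lemma F_top: obtains p0 where "F p0 = UNIV"
  using filt by (auto simp: finite_decreasing_filtration_def)

definition n :: "'r \<Rightarrow> complex^'n^'n" where
  "n j = Gi ** cmat (N j) ** G"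

lemma cN_comm: "cmat (N i) ** cmat (N j) = cmat (N j) ** cmat (N i)"
  by (simp add: N_comm flip: cmat_mult)

lemma n_supp: "supp (\<lambda>i j. d j = (fst (d i) + 1, snd (d i) + 1)) (n l)"
proof -
  obtain p0 where p0: "F p0 = UNIV" by (rule F_top)
  show ?thesis unfolding n_def by (rule morphism_supp[OF cnj_mat_cmat N_F N_W p0])
qed

definition nn :: "complex^('r::{finite,linorder}) \<Rightarrow> complex^'n^'n" where
  "nn z = Gi ** lin_comb N z ** G"

lemma nn_supp: "supp (\<lambda>i j. d j = (fst (d i) + 1, snd (d i) + 1)) (nn z)"
  unfolding nn_def by (rule lin_comb_supp) (use n_supp in \<open>simp add: n_def\<close>)

lemma nn_axis: "nn (axis i 1) = n i"
  by (simp add: nn_def n_def lin_comb_mult axis_def vec_eq_iff if_distrib[where f = "\<lambda>x. x * _"] cong: if_cong)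

lemma nn_nil: "supp (nilp d 1) (nn z)"
  using nn_supp by (rule supp_mono) (auto simp: nilp_def)

lemma mpow_nn: "mpow (nn z) (depth d) = 0"
  by (rule mpow_depth[OF nn_nil order_refl])

lemma nn_add: "nn (z + w) = nn z + nn w"
  by (simp add: nn_def lin_comb_add mat_ring)

lemma nn_uminus: "nn (- z) = - nn z"
  by (simp add: nn_def lin_comb_uminus mat_ring)

lemma nn_comm: "nn z ** nn w = nn w ** nn z"
proof -
  have "cmat (N j) ** lin_comb N w = lin_comb N w ** cmat (N j)" for j
    by (rule lin_comb_commute) (rule cN_comm)
  then have "lin_comb N w ** lin_comb N z = lin_comb N z ** lin_comb N w"
    by (intro lin_comb_commute) simp
  then show ?thesis
    by (simp add: nn_def mat_assoc mat_cancel[OF GGi]) (simp add: matrix_mul_assoc)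
qed

definition E :: "complex^('r::{finite,linorder}) \<Rightarrow> complex^'n^'n" where
  "E z = mexp (nn z)"

lemma E_add: "E (z + w) = E z ** E w"
  unfolding E_def nn_add
  by (rule mexp_add[OF nn_comm mpow_nn mpow_nn]) (simp add: mpow_nn flip: nn_add)

lemma E_inv: "E z ** E (- z) = mat 1"
  unfolding E_def nn_uminus by (rule mexp_inverse[OF mpow_nn])

lemma E_inv': "E (- z) ** E z = mat 1"
  using E_inv matrix_left_right_inverse by blast

lemma E_unip: "supp (nilp d 1) (E z - mat 1)"
  unfolding E_def by (rule supp_mexp[OF nn_nil transp_patterns(1) mpow_nn])

lemma lin_comb_nn: "lin_comb N z = G ** nn z ** Gi"
  by (simp add: nn_def mat_assoc mat_cancel[OF GGi] GGi)

lemma mpow_lin_comb: "mpow (lin_comb N z) (depth d) = 0"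
proof -
  have "mpow (G ** nn z ** Gi) k = G ** mpow (nn z) k ** Gi" for k
  proof (induction k)
    case (Suc k)
    then show ?case by (simp add: mpow_Suc mat_assoc mat_cancel[OF GiG])
  qed (simp add: GGi)
  then show ?thesis by (simp add: lin_comb_nn mpow_nn)
qed

lemma E_eq: "E z = Gi ** mexp (lin_comb N z) ** G"
  unfolding E_def nn_def by (rule mexp_conjugate[OF GiG GGi mpow_lin_comb])

lemma mexp_eq: "mexp (lin_comb N z) = G ** E z ** Gi"
  by (simp add: E_eq mat_assoc mat_cancel[OF GGi] GGi)

text \<open>Because the \<open>N j\<close> are real, moving the conjugation past \<open>E w\<close>
  conjugates the parameter: real parameters commute with it, and purely imaginary ones change
  sign.\<close>

lemma C0_E: "(Gi ** cnj_mat G) ** cnj_mat (E w) = E (cnj_vec w) ** (Gi ** cnj_mat G)"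
proof -
  have cG: "cnj_mat G ** cnj_mat Gi = mat 1" using GGi by (simp flip: cnj_mat_mult)
  show ?thesis
    by (simp add: E_eq cnj_mat_mult mat_assoc mat_cancel[OF cG] mat_cancel[OF GGi]
        lin_comb_cnj flip: mexp_cnj[OF mpow_lin_comb])
qed

text \<open>
  The real part of \<open>z\<close> acts by real matrices, and the part of the imaginary part which
  commutes with \<open>A\<close> by morphisms of type \<open>(-1, -1)\<close>; both transport the bigrading.  Only
  the coordinates from \<open>b\<close> on contribute to the growth.
\<close>
lemma orbit_frame:
  fixes \<kappa> :: real
  assumes "0 \<le> \<kappa>"
  obtains C k where "0 \<le> C" "\<And>b z A. (\<And>j. b \<le> j \<Longrightarrow> 0 \<le> Im (z $ j) \<and> Im (z $ j) \<le> Im (z $ b)) \<Longrightarrow>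
    1 \<le> Im (z $ b) \<Longrightarrow> supp (nilp d 1) A \<Longrightarrow> mnorm A \<le> \<kappa> \<Longrightarrow>
    (\<And>i. i < b \<Longrightarrow> A ** n i = n i ** A) \<Longrightarrow>
    \<exists>g gi Hi. adapted d M W (filt_act (G ** (E z ** (mat 1 + A)) ** Gi) F) (G ** g) (gi ** Gi) \<and>
      supp (nilp d 1) (g - mat 1) \<and> (E z ** (mat 1 + A)) ** Hi = mat 1 \<and>
      (\<forall>\<delta>. mnorm (gi ** (E z ** \<delta> ** Hi) ** g) \<le> C * Im (z $ b) ^ k * mnorm \<delta>)"
proof -
  obtain p0 where p0: "F p0 = UNIV" by (rule F_top)
  obtain cm where cm: "0 \<le> cm" "\<And>X :: complex^'n^'n. mpow X (depth d) = 0 \<Longrightarrow> mnorm (mexp X) \<le> cm * (1 + mnorm X) ^ depth d"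
    using mexp_bound by blast
  obtain ct mt where ct: "0 \<le> ct" and trans: "\<And>h hi. h ** hi = mat 1 \<Longrightarrow> supp (nilp d 1) (h - mat 1) \<Longrightarrow>
    \<exists>g gi. g ** gi = mat 1 \<and> supp (nilp d 1) (g - mat 1) \<and>
      adapted d M W (filt_act (G ** h ** Gi) F) (G ** g) (gi ** Gi) \<and>
      mnorm g \<le> ct * (1 + mnorm h) ^ mt \<and> mnorm gi \<le> ct * (1 + mnorm h) ^ mt"
    using translate by blast
  obtain ci mi where ci: "0 \<le> ci" and inv: "\<And>h. supp (nilp d 1) (h - mat 1) \<Longrightarrow>
    \<exists>hi. h ** hi = mat 1 \<and> hi ** h = mat 1 \<and> supp (nilp d 1) (hi - mat 1) \<and> mnorm hi \<le> ci * (1 + mnorm h) ^ mi"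
    by (rule unipotent_inverse_bound[of "nilp d 1" d]) auto
  define D where "D = depth d"
  define \<nu> where "\<nu> = (\<Sum>j\<in>UNIV. mnorm (n j))"
  define e0 where "e0 = cm * (1 + \<nu>) ^ D"
  define na where "na = real CARD('n) + \<kappa>"
  define c1 where "c1 = ct * (1 + e0 * na) ^ mt"
  define ai where "ai = ci * (1 + na) ^ mi"
  define C where "C = c1 * e0 * ai * e0 * c1"
  define k where "k = D * mt + D + D + D * mt"
  have \<nu>: "0 \<le> \<nu>" by (simp add: \<nu>_def sum_nonneg)
  have e0: "0 \<le> e0" using cm \<nu> by (simp add: e0_def)
  have na: "0 \<le> na" using assms by (simp add: na_def)
  have c1: "0 \<le> c1" using ct e0 na by (simp add: c1_def)
  have ai: "0 \<le> ai" using ci na by (simp add: ai_def)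
  show ?thesis
  proof (rule that[of C k])
    show "0 \<le> C" using c1 e0 ai by (simp add: C_def)
    fix b z A
    assume yb: "\<And>j. b \<le> j \<Longrightarrow> 0 \<le> Im (z $ j) \<and> Im (z $ j) \<le> Im (z $ b)"
      and y1: "1 \<le> Im (z $ b)" and A: "supp (nilp d 1) A" and A\<kappa>: "mnorm A \<le> \<kappa>"
      and comm: "\<And>i. i < b \<Longrightarrow> A ** n i = n i ** A"
    define y where "y = Im (z $ b)"
    define zx :: "complex^('r::{finite,linorder})" where "zx = (\<chi> j. of_real (Re (z $ j)))"
    define z1 :: "complex^('r::{finite,linorder})" where "z1 = (\<chi> j. if j < b then \<i> * of_real (Im (z $ j)) else 0)"
    define z2 :: "complex^('r::{finite,linorder})" where "z2 = (\<chi> j. if j < b then 0 else \<i> * of_real (Im (z $ j)))"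
    \<comment> \<open>The three summands are the real part, the imaginary part before
      \<open>b\<close>, and the imaginary part from \<open>b\<close> on. Only the third is bounded
      by \<open>y\<close>.\<close>
    have z: "z = zx + z1 + z2"
      by (auto simp: vec_eq_iff zx_def z1_def z2_def complex_eq_iff)
    have cx: "cnj_vec zx = zx" and c1': "cnj_vec z1 = - z1"
      by (auto simp: vec_eq_iff zx_def z1_def)
    have bz2: "mnorm (E w) \<le> e0 * y ^ D" if w: "w = z2 \<or> w = - z2" for w
    proof -
      have "mnorm (nn w) \<le> (\<Sum>j\<in>UNIV. cmod (w $ j) * mnorm (n j))"
        unfolding nn_def n_def by (rule mnorm_lin_comb)
      also have "\<dots> \<le> (\<Sum>j\<in>UNIV. y * mnorm (n j))"
      proof (intro sum_mono mult_right_mono mnorm_nonneg)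
        fix j
        show "cmod (w $ j) \<le> y"
          using w yb[of j] y1 by (auto simp: z2_def y_def norm_mult not_less)
      qed
      also have "\<dots> = \<nu> * y" by (simp add: \<nu>_def mult.commute flip: sum_distrib_left)
      finally have "1 + mnorm (nn w) \<le> (1 + \<nu>) * y" using y1 by (simp add: y_def algebra_simps)
      then have "(1 + mnorm (nn w)) ^ D \<le> ((1 + \<nu>) * y) ^ D" by (intro power_mono) auto
      then have "cm * (1 + mnorm (nn w)) ^ D \<le> cm * ((1 + \<nu>) * y) ^ D" using cm by (intro mult_left_mono)
      then show ?thesis
        using cm(2)[OF mpow_nn, of w] by (simp add: E_def e0_def D_def power_mult_distrib mult.assoc)
    qed
    have Ab: "mnorm (mat 1 + A) \<le> na"
      using mnorm_add[of "mat 1" A] A\<kappa> by (simp add: na_def mnorm_one)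
    obtain Ai where Ai: "(mat 1 + A) ** Ai = mat 1" "Ai ** (mat 1 + A) = mat 1" "mnorm Ai \<le> ci * (1 + mnorm (mat 1 + A)) ^ mi"
      using inv[of "mat 1 + A"] A by auto
    have Aib: "mnorm Ai \<le> ai"
    proof -
      have "(1 + mnorm (mat 1 + A)) ^ mi \<le> (1 + na) ^ mi" using Ab by (intro power_mono) auto
      then show ?thesis using Ai(3) ci unfolding ai_def by (meson mult_left_mono order_trans)
    qed
    \<comment> \<open>The factor that needs a corrected frame; unlike \<open>E zx\<close> and
      \<open>E z1\<close> it is bounded polynomially in \<open>y\<close>.\<close>
    define h where "h = E z2 ** (mat 1 + A)"
    define hi where "hi = Ai ** E (- z2)"
    have hhi: "h ** hi = mat 1"
      by (simp add: h_def hi_def mat_assoc mat_cancel[OF Ai(1)] E_inv)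
    have hnil: "supp (nilp d 1) (h - mat 1)"
    proof -
      have eq: "h - mat 1 = (E z2 - mat 1) + A + (E z2 - mat 1) ** A" by (simp add: h_def mat_ring)
      show ?thesis unfolding eq
        by (intro supp_add[OF supp_add[OF E_unip A] supp_mult[OF E_unip A]] transp_patterns)
    qed
    obtain g2 g2i where g2: "g2 ** g2i = mat 1" "supp (nilp d 1) (g2 - mat 1)"
      "adapted d M W (filt_act (G ** h ** Gi) F) (G ** g2) (g2i ** Gi)"
      "mnorm g2 \<le> ct * (1 + mnorm h) ^ mt" "mnorm g2i \<le> ct * (1 + mnorm h) ^ mt"
      using trans[OF hhi hnil] by blast
    have g2': "g2i ** g2 = mat 1" using g2(1) matrix_left_right_inverse by blast
    have hb: "ct * (1 + mnorm h) ^ mt \<le> c1 * y ^ (D * mt)"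
    proof -
      have "mnorm h \<le> (e0 * y ^ D) * na"
        unfolding h_def by (intro mnorm_mult_le bz2 Ab) simp
      moreover have "1 \<le> y ^ D" using y1 by (simp add: y_def)
      ultimately have "1 + mnorm h \<le> (1 + e0 * na) * y ^ D" by (simp add: algebra_simps)
      then have "(1 + mnorm h) ^ mt \<le> ((1 + e0 * na) * y ^ D) ^ mt" by (intro power_mono) auto
      then have "ct * (1 + mnorm h) ^ mt \<le> ct * ((1 + e0 * na) * y ^ D) ^ mt" using ct by (intro mult_left_mono)
      then show ?thesis by (simp add: c1_def power_mult_distrib power_mult mult.assoc)
    qed
    have g2b: "mnorm g2 \<le> c1 * y ^ (D * mt)" and g2ib: "mnorm g2i \<le> c1 * y ^ (D * mt)"
      using g2(4,5) hb by linarith+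
    define F2 where "F2 = filt_act (G ** h ** Gi) F"
    interpret A2: adapted d M W F2 "G ** g2" "g2i ** Gi" unfolding F2_def by (rule g2(3))
    \<comment> \<open>\<open>E zx\<close> and \<open>E z1\<close> are put in front of the frame of
      \<open>F2\<close> without correction. It remains to see that the result is adapted.\<close>
    define g where "g = E zx ** E z1 ** g2"
    define gi where "gi = g2i ** E (- z1) ** E (- zx)"
    define Hi where "Hi = Ai ** E (- z2) ** E (- z1) ** E (- zx)"
    have Ez: "E z = E zx ** E z1 ** E z2" unfolding z E_add ..
    have ggi: "g ** gi = mat 1"
      by (simp add: g_def gi_def mat_assoc mat_cancel[OF g2(1)] mat_cancel[OF E_inv] E_inv)
    have EHi: "(E z ** (mat 1 + A)) ** Hi = mat 1"
      by (simp add: Ez Hi_def mat_assoc mat_cancel[OF Ai(1)] mat_cancel[OF E_inv] E_inv)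
    have gnil: "supp (nilp d 1) (g - mat 1)"
    proof -
      have mult: "supp (nilp d 1) (X ** Y - mat 1)" if "supp (nilp d 1) (X - mat 1)" "supp (nilp d 1) (Y - mat 1)"
        for X Y :: "complex^'n^'n"
      proof -
        have eq: "X ** Y - mat 1 = (X - mat 1) + (Y - mat 1) + (X - mat 1) ** (Y - mat 1)" by (simp add: mat_ring)
        show ?thesis unfolding eq
          by (intro supp_add[OF supp_add[OF that] supp_mult[OF that]] transp_patterns)
      qed
      show ?thesis unfolding g_def by (intro mult E_unip g2)
    qed
    have hF2: "F2 p = (*v) (G ** h) ` coord {i. p \<le> fst (d i)}" for p
      unfolding F2_def filt_act_def F_eq image_image matrix_vector_mul_assoc
      by (simp add: mat_assoc GiG)
    \<comment> \<open>For \<open>i < b\<close>, \<open>n i\<close> commutes with both factors of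
      \<open>h\<close>. Hence \<open>N i\<close> shifts \<open>F2\<close> as it shifts
      \<open>F\<close>, and being real it is a morphism of type (-1,-1) at \<open>F2\<close>
      too.\<close>
    have N_F2: "cmat (N i) *v u \<in> F2 (p - 1)" if i: "i < b" and u: "u \<in> F2 p" for i u p
    proof -
      obtain x where x: "x \<in> coord {i. p \<le> fst (d i)}" "u = (G ** h) *v x" using u hF2 by blast
      have "n i ** h = h ** n i"
      proof -
        have "n i ** nn z2 = nn z2 ** n i"
          using nn_comm[of "axis i 1" z2] by (simp add: nn_axis)
        then have "n i ** E z2 = E z2 ** n i"
          unfolding E_def by (rule mexp_commute[OF _ mpow_nn])
        then show ?thesis
          unfolding h_def by (rule commute_mult) (use comm[OF i] in \<open>simp add: mat_ring\<close>)
      qed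
      moreover have "cmat (N i) ** G = G ** n i"
        by (simp add: n_def mat_assoc mat_cancel[OF GGi])
      ultimately have "cmat (N i) ** (G ** h) = (G ** h) ** n i"
        by (metis matrix_mul_assoc)
      then have "cmat (N i) *v u = (G ** h) *v (n i *v x)"
        by (simp add: x(2) matrix_vector_mul_assoc)
      moreover have "n i *v x \<in> coord {j. p - 1 \<le> fst (d j)}"
        by (rule supp_coord[OF n_supp x(1)]) auto
      ultimately show ?thesis unfolding hF2 by blast
    qed
    obtain p2 where p2: "F2 p2 = UNIV"
    proof
      have "(G ** h ** Gi) *v ((G ** hi ** Gi) *v u) = u" for u
        by (simp add: matrix_vector_mul_assoc mat_assoc mat_cancel[OF GiG] mat_cancel[OF hhi] GGi)
      then show "F2 p0 = UNIV" unfolding F2_def filt_act_def p0 by (metis surjI)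
    qed
    define X where "X = (g2i ** Gi) ** lin_comb N (- z1) ** (G ** g2)"
    have Xlam: "supp (lam d) X"
      unfolding X_def
    proof (rule lin_comb_supp)
      fix j assume "(- z1) $ j \<noteq> 0"
      then have j: "j < b" by (auto simp: z1_def split: if_splits)
      show "supp (lam d) (g2i ** Gi ** cmat (N j) ** (G ** g2))"
        by (rule supp_mono[OF A2.morphism_supp[OF cnj_mat_cmat N_F2[OF j] N_W p2]]) (auto simp: lam_def)
    qed
    have X0: "mpow X D = 0"
      unfolding D_def by (rule mpow_depth[OF supp_mono[OF Xlam] order_refl]) (auto simp: lam_def nilp_def)
    have Y: "mexp X = g2i ** E (- z1) ** g2"
      unfolding X_def
      by (subst mexp_conjugate[OF A2.GiG A2.GGi mpow_lin_comb]) (simp add: mexp_eq mat_assoc mat_cancel[OF GiG] GiG)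
    have Ylam: "supp (lam d) (mexp X - mat 1)" by (rule supp_mexp[OF Xlam transp_patterns(4) X0])
    define Q where "Q = g2i ** Gi ** cnj_mat (G ** g2) ** cnj_mat M"
    have Qlam: "supp (lam d) (Q - mat 1)" using A2.conj_eq by (simp add: Q_def)
    \<comment> \<open>The real factor \<open>E zx\<close> drops out. The imaginary one contributes
      \<open>E (- z1)\<close> twice, from the inverse frame and from its own conjugate. In the frame
      of \<open>F2\<close> each copy is \<open>mexp X\<close>, unipotent in the pattern
      \<open>lam\<close>, so the congruence survives.\<close>
    have "gi ** Gi ** cnj_mat (G ** g) ** cnj_mat M
      = gi ** ((Gi ** cnj_mat G) ** cnj_mat (E zx)) ** cnj_mat (E z1) ** cnj_mat g2 ** cnj_mat M"
      by (simp add: g_def cnj_mat_mult mat_assoc)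
    also have "\<dots> = gi ** E zx ** ((Gi ** cnj_mat G) ** cnj_mat (E z1)) ** cnj_mat g2 ** cnj_mat M"
      unfolding C0_E[of zx, unfolded cx] by (simp add: mat_assoc)
    also have "\<dots> = g2i ** E (- z1) ** E (- z1) ** (Gi ** cnj_mat G) ** cnj_mat g2 ** cnj_mat M"
      unfolding C0_E[of z1, unfolded c1'] by (simp add: gi_def mat_assoc mat_cancel[OF E_inv'])
    also have "\<dots> = mexp X ** (mexp X ** Q)"
      unfolding Y by (simp add: Q_def cnj_mat_mult mat_assoc mat_cancel[OF g2(1)])
    finally have conj: "gi ** Gi ** cnj_mat (G ** g) ** cnj_mat M = mexp X ** (mexp X ** Q)" .
    have mult: "supp (lam d) (X ** Y - mat 1)" if "supp (lam d) (X - mat 1)" "supp (lam d) (Y - mat 1)"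
      for X Y :: "complex^'n^'n"
    proof -
      have eq: "X ** Y - mat 1 = (X - mat 1) + (Y - mat 1) + (X - mat 1) ** (Y - mat 1)" by (simp add: mat_ring)
      show ?thesis unfolding eq
        by (intro supp_add[OF supp_add[OF that] supp_mult[OF that]] transp_patterns)
    qed
    have "adapted d M W (filt_act (G ** (E z ** (mat 1 + A)) ** Gi) F) (G ** g) (gi ** Gi)"
    proof
      show "G ** g ** (gi ** Gi) = mat 1"
        by (simp add: mat_assoc mat_cancel[OF ggi] GGi)
      have img: "(*v) (A ** B) ` X = (*v) A ` (*v) B ` X" for A B :: "complex^'n^'n" and X
        by (simp add: image_image matrix_vector_mul_assoc)
      have hg2: "(*v) h ` coord {i. p \<le> fst (d i)} = (*v) g2 ` coord {i. p \<le> fst (d i)}" for p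
      proof -
        have "(*v) Gi ` ((*v) (G ** h) ` coord {i. p \<le> fst (d i)}) = (*v) Gi ` ((*v) (G ** g2) ` coord {i. p \<le> fst (d i)})"
          using hF2[of p] A2.F_eq[of p] by simp
        then show ?thesis by (simp add: image_image matrix_vector_mul_assoc matrix_mul_assoc GiG)
      qed
      show "filt_act (G ** (E z ** (mat 1 + A)) ** Gi) F p = (*v) (G ** g) ` coord {i. p \<le> fst (d i)}" for p
      proof -
        have "filt_act (G ** (E z ** (mat 1 + A)) ** Gi) F p
          = (*v) (G ** E zx ** E z1) ` (*v) h ` coord {i. p \<le> fst (d i)}"
          unfolding filt_act_def F_eq image_image matrix_vector_mul_assoc Ez h_def
          by (simp add: mat_assoc GiG)
        then show ?thesis
          unfolding hg2 by (simp add: image_image matrix_vector_mul_assoc g_def mat_assoc)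
      qed
      show "complexify (W k) = (*v) (G ** g) ` coord {i. wt (d i) \<le> k}" for k
      proof -
        have "(*v) g ` coord {i. wt (d i) \<le> k} = coord {i. wt (d i) \<le> k}"
          by (rule unipotent_coord[OF ggi gnil]) (auto simp: nilp_def)
        then show ?thesis unfolding W_eq img by simp
      qed
      show "supp (lam d) (gi ** Gi ** cnj_mat (G ** g) ** cnj_mat M - mat 1)"
        unfolding conj by (intro mult Ylam Qlam)
    qed
    moreover have "mnorm (gi ** (E z ** \<delta> ** Hi) ** g) \<le> C * Im (z $ b) ^ k * mnorm \<delta>" for \<delta>
    proof -
      \<comment> \<open>\<open>E zx\<close> and \<open>E z1\<close> stand outermost in
        \<open>E z\<close> and cancel against the frame. The exponents of the surviving factors add
        up to \<open>k\<close>.\<close>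
      have "gi ** (E z ** \<delta> ** Hi) ** g = g2i ** E z2 ** \<delta> ** Ai ** E (- z2) ** g2"
        by (simp add: gi_def g_def Ez Hi_def mat_assoc mat_cancel[OF E_inv'])
      also have "mnorm \<dots> \<le> (c1 * y ^ (D * mt)) * (e0 * y ^ D) * mnorm \<delta> * ai * (e0 * y ^ D) * (c1 * y ^ (D * mt))"
        by (intro mnorm_mult_le g2ib g2b bz2 Aib order_refl) auto
      also have "\<dots> = C * y ^ k * mnorm \<delta>"
        by (simp add: C_def k_def power_add mult_ac)
      finally show ?thesis by (simp add: y_def)
    qed
    ultimately show "\<exists>g gi Hi. adapted d M W (filt_act (G ** (E z ** (mat 1 + A)) ** Gi) F) (G ** g) (gi ** Gi) \<and>
      supp (nilp d 1) (g - mat 1) \<and> (E z ** (mat 1 + A)) ** Hi = mat 1 \<and>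
      (\<forall>\<delta>. mnorm (gi ** (E z ** \<delta> ** Hi) ** g) \<le> C * Im (z $ b) ^ k * mnorm \<delta>)"
      using gnil EHi by blast
  qed
qed

end

subsection \<open>Monodromy logarithms\<close>

text \<open>A filtration of the algebra generated by \<open>X\<close>, modulo whose next step
  \<open>mexp X - mat 1\<close> and \<open>X\<close> have equal powers; it serves to recover
  \<open>X\<close> from its exponential without the logarithm series.\<close>

definition pow_span :: "complex^'n::finite^'n \<Rightarrow> nat \<Rightarrow> (complex^'n^'n) set" where
  "pow_span X k = span {mpow X i | i. k \<le> i}"

lemma pow_span_mult:
  assumes "A \<in> pow_span X k" "B \<in> pow_span X l"
  shows "A ** B \<in> pow_span X (k + l)"
  using assms(1) unfolding pow_span_def
proof (induction rule: span_induct_alt)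
  case base
  then show ?case by (simp add: span_zero)
next
  case (step c Y Z)
  then obtain i where i: "Y = mpow X i" "k \<le> i" by blast
  have "mpow X i ** B \<in> span {mpow X i | i. k + l \<le> i}"
    using assms(2) unfolding pow_span_def
  proof (induction rule: span_induct_alt)
    case base
    then show ?case by (simp add: span_zero)
  next
    case (step c' Y' Z')
    then obtain j where j: "Y' = mpow X j" "l \<le> j" by blast
    have "mpow X (i + j) \<in> span {mpow X i | i. k + l \<le> i}"
      using i j by (intro span_base) auto
    then show ?case
      using step.IH by (simp add: mat_ring scaleR_mat_mult j(1) mpow_add span_add span_scale)
  qed
  then show ?case using step.IH by (simp add: mat_ring scaleR_mat_mult i(1) span_add span_scale)
qed

lemma pow_span_mono: "k \<le> l \<Longrightarrow> pow_span X l \<subseteq> pow_span X k"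
  unfolding pow_span_def by (intro span_mono) auto

lemma mexp_pow_span:
  assumes "mpow X m = 0"
  shows "mexp X - mat 1 - X \<in> pow_span X 2"
proof -
  have "mexp X = (\<Sum>k<Suc (Suc m). (1 / fact k) *\<^sub>R mpow X k)"
    by (rule mexp_finite) (simp add: mpow_Suc assms)
  also have "\<dots> = mat 1 + (X + (\<Sum>k<m. (1 / fact (Suc (Suc k))) *\<^sub>R mpow X (Suc (Suc k))))"
    by (subst sum.lessThan_Suc_shift, subst sum.lessThan_Suc_shift) (simp add: mpow_Suc)
  finally have e: "mexp X - mat 1 - X = (\<Sum>k<m. (1 / fact (Suc (Suc k))) *\<^sub>R mpow X (Suc (Suc k)))"
    by simp
  show ?thesis
    unfolding e pow_span_def by (intro span_sum span_scale span_base) (auto intro: exI[of _ "Suc (Suc _)"])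
qed

lemma mpow_mexp_pow_span:
  assumes "mpow X m = 0"
  shows "mpow (mexp X - mat 1) k - mpow X k \<in> pow_span X (Suc k)"
proof (induction k)
  case 0
  then show ?case by (simp add: pow_span_def span_zero)
next
  case (Suc k)
  define R where "R = mexp X - mat 1"
  have RX: "R - X \<in> pow_span X 2" using mexp_pow_span[OF assms] by (simp add: R_def)
  have pk: "mpow X k \<in> pow_span X k" for k unfolding pow_span_def by (intro span_base) auto
  have X1: "X \<in> pow_span X 1" using pk[of 1] by (simp add: mpow_Suc)
  have "(R - X) + X \<in> pow_span X 1"
    using RX X1 pow_span_mono[of 1 2 X] unfolding pow_span_def by (intro span_add) auto
  then have R1: "R \<in> pow_span X 1" by simp
  have "mpow R (Suc k) - mpow X (Suc k) = R ** (mpow R k - mpow X k) + (R - X) ** mpow X k"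
    by (simp add: mpow_Suc mat_ring)
  moreover have "R ** (mpow R k - mpow X k) \<in> pow_span X (Suc (Suc k))"
    using pow_span_mult[OF R1 Suc[folded R_def]] by simp
  moreover have "(R - X) ** mpow X k \<in> pow_span X (Suc (Suc k))"
    using pow_span_mult[OF RX pk[of k]] by (simp add: numeral_2_eq_2)
  ultimately show ?case unfolding R_def[symmetric] by (simp add: pow_span_def span_add)
qed

context filtered_space
begin

text \<open>Downward induction on \<open>k\<close>, starting from the vanishing powers:
  \<open>mpow X k\<close> differs from a power of \<open>mexp X - mat 1\<close> by higher powers of
  \<open>X\<close>, which are already known to lower the weight.\<close>

lemma lowers_log:
  assumes X: "mpow X m = 0" and R: "lowers (mexp X - mat 1)"
  shows "lowers X"
proof -
  have "lowers (mpow X k)" if "1 \<le> k" "m \<le> k + j" for k j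
    using that
  proof (induction j arbitrary: k)
    case 0
    then show ?case using mpow_zero_mono[OF X, of k] by simp
  next
    case (Suc j)
    have "lowers Y" if "Y \<in> pow_span X (Suc k)" for Y
      using that unfolding pow_span_def
    proof (induction rule: span_induct_alt)
      case (step c Y Z)
      then obtain i where "Y = mpow X i" "Suc k \<le> i" by blast
      then show ?case using Suc.IH[of i] Suc.prems step.IH by (intro lowers_add lowers_scaleR) auto
    qed simp
    then have "lowers (mpow (mexp X - mat 1) k - mpow X k)"
      using mpow_mexp_pow_span[OF X] by blast
    then have "lowers (mpow (mexp X - mat 1) k + (-1) *\<^sub>R (mpow (mexp X - mat 1) k - mpow X k))"
      by (intro lowers_add lowers_scaleR lowers_mpow R) (use Suc.prems in auto)
    then show ?case by simp
  qed
  from this[of 1 m] show ?thesis by (simp add: mpow_Suc)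
qed

end

lemma re_im_cmat: "re_vec (cmat A *v u) = A *v re_vec u" "im_vec (cmat A *v u) = A *v im_vec u"
  by (simp_all add: re_vec_def im_vec_def vec_eq_iff matrix_vector_mult_def map_matrix_def)

lemma mexp_cmat:
  assumes "mpow (A :: real^'n::finite^'n) m = 0"
  shows "mexp (cmat A) = cmat (mexp A)"
proof -
  have "mpow (cmat A) m = 0" unfolding mpow_cmat assms by (simp add: vec_eq_iff map_matrix_def)
  then have "mexp (cmat A) = (\<Sum>k<m. (1 / fact k) *\<^sub>R cmat (mpow A k))"
    by (simp add: mexp_finite mpow_cmat)
  also have "\<dots> = cmat (mexp A)"
    unfolding mexp_finite[OF assms]
    by (simp add: vec_eq_iff map_matrix_def) (simp add: scaleR_conv_of_real)
  finally show ?thesis .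
qed

context filtered_space
begin

text \<open>
  If \<open>N\<close> acts trivially on the graded quotients, the isomorphism conditions force the relative
  weight filtration to be \<open>W\<close> itself.
\<close>
lemma relative_weight_trivial:
  assumes Y: "is_relative_weight_filtration W N Y"
    and N: "\<And>w u. u \<in> W w \<Longrightarrow> N *v u \<in> W (w - 1)"
    and u: "u \<in> W k"
  shows "N *v u \<in> W (k - 2)"
proof -
  have Wsub: "subspace (W w)" for w using W_filt by (simp add: finite_increasing_filtration_def)
  have Wmono: "W a \<subseteq> W b" if "a \<le> b" for a b using W_filt that by (simp add: finite_increasing_filtration_def)
  have Ysub: "subspace (Y w)" for w
    using Y by (simp add: is_relative_weight_filtration_def finite_increasing_filtration_def)
  have Ymono: "Y a \<subseteq> Y b" if "a \<le> b" for a b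
    using Y that by (simp add: is_relative_weight_filtration_def finite_increasing_filtration_def)
  define YG where "YG l w = {x + y | x y. x \<in> Y l \<inter> W w \<and> y \<in> W (w - 1)}" for l w
  have inj: "\<forall>u\<in>YG (w + int k) w. mpow N k *v u \<in> YG (w - int k - 1) w \<longrightarrow> u \<in> YG (w + int k - 1) w"
    and sur: "\<forall>v\<in>YG (w - int k) w. \<exists>u\<in>YG (w + int k) w. v - mpow N k *v u \<in> YG (w - int k - 1) w"
    if "k > 0" for w k
    using Y that unfolding is_relative_weight_filtration_def Let_def YG_def by blast+
  have NY: "N *v x \<in> Y (l - 2)" if "x \<in> Y l" for x l
    using Y that unfolding is_relative_weight_filtration_def by blast
  have YG_W: "YG l w \<subseteq> W w" for l w
    using Wmono[of "w - 1" w] subspace_add[OF Wsub[of w]] by (auto simp: YG_def)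
  have W_YG: "W (w - 1) \<subseteq> YG l w" for l w
    using subspace_0[OF Ysub] subspace_0[OF Wsub] by (force simp: YG_def)
  have YG_add: "a + b \<in> YG l w" if a: "a \<in> YG l w" and b: "b \<in> W (w - 1)" for a b l w
  proof -
    obtain x y where "x \<in> Y l \<inter> W w" "y \<in> W (w - 1)" "a = x + y" using a by (auto simp: YG_def)
    then show ?thesis using b subspace_add[OF Wsub] unfolding YG_def
      by (intro CollectI exI[of _ x] exI[of _ "y + b"]) (auto simp: add.assoc)
  qed
  have Npow: "mpow N k *v u \<in> W (w - 1)" if "k > 0" "u \<in> W w" for k u w
    using that(1)
  proof (induction k rule: nat_induct_non_zero)
    case 1
    then show ?case using N[OF that(2)] by (simp add: mpow_Suc)
  next
    case (Suc k)
    then show ?case using N[of "mpow N k *v u" "w - 1"] Wmono[of "w - 1 - 1" "w - 1"]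
      by (auto simp: mpow_Suc simp flip: matrix_vector_mul_assoc)
  qed
  obtain y1 where y1: "Y y1 = UNIV" and y0: "\<exists>y0. Y y0 = {0}"
    using Y by (auto simp: is_relative_weight_filtration_def finite_increasing_filtration_def)
  obtain y0 where y0: "Y y0 = {0}" using y0 by blast
  \<comment> \<open>On the graded quotient of weight \<open>w\<close> all positive powers of
    \<open>N\<close> vanish, so injectivity forces every class above degree \<open>w\<close> one
    degree down; start where \<open>Y\<close> is everything and descend.\<close>
  have top: "W w \<subseteq> YG w w" for w
  proof -
    have step: "W w \<subseteq> YG (w + int k) w" if "W w \<subseteq> YG (w + int (Suc k)) w" for k
    proof
      fix u assume "u \<in> W w"
      then have "u \<in> YG (w + int (Suc k)) w" "mpow N (Suc k) *v u \<in> YG (w - int (Suc k) - 1) w"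
        using that Npow[of "Suc k" u w] W_YG by blast+
      then have "u \<in> YG (w + int (Suc k) - 1) w" using inj[of "Suc k" w] by blast
      then show "u \<in> YG (w + int k) w" by (simp add: algebra_simps)
    qed
    define K where "K = nat (y1 - w)"
    have "W w \<subseteq> YG (w + int (K - j)) w" for j
    proof (induction j)
      case 0
      have "Y y1 \<subseteq> Y (w + int K)" by (rule Ymono) (simp add: K_def)
      then have "Y (w + int K) = UNIV" using y1 by auto
      then show ?case using subspace_0[OF Wsub] by (force simp: YG_def)
    next
      case (Suc j)
      show ?case
      proof (cases "K - j = 0")
        case False
        then have "K - j = Suc (K - Suc j)" by simp
        then show ?thesis using step[of "K - Suc j"] Suc by simp
      qed (use Suc in simp)
    qed
    from this[of K] show ?thesis by simp
  qed
  \<comment> \<open>Dually, surjectivity of the zero map pushes every class of degree below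
    \<open>w\<close> further down, until \<open>Y\<close> is zero.\<close>
  have bot: "YG (w - 1) w \<subseteq> W (w - 1)" for w
  proof -
    have step: "YG (w - 1) w \<subseteq> YG (w - 1 - int j) w" for j
    proof (induction j)
      case (Suc j)
      have "YG (w - 1 - int j) w \<subseteq> YG (w - 1 - int (Suc j)) w"
      proof
        fix v assume "v \<in> YG (w - 1 - int j) w"
        then obtain u where u: "u \<in> YG (w + int (Suc j)) w"
          "v - mpow N (Suc j) *v u \<in> YG (w - int (Suc j) - 1) w"
          using sur[of "Suc j" w] by (auto simp: algebra_simps)
        have "mpow N (Suc j) *v u \<in> W (w - 1)" using u(1) YG_W by (intro Npow) auto
        from YG_add[OF u(2) this] show "v \<in> YG (w - 1 - int (Suc j)) w" by (simp add: algebra_simps)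
      qed
      then show ?case using Suc by blast
    qed simp
    define j where "j = nat (w - y0)"
    have "Y (w - 1 - int j) \<subseteq> {0}" using Ymono[of "w - 1 - int j" y0] y0 by (simp add: j_def)
    then have "YG (w - 1 - int j) w \<subseteq> W (w - 1)" by (auto simp: YG_def)
    then show ?thesis using step by blast
  qed
  obtain a0 a1 where a: "W a0 = {0}" "W a1 = UNIV"
    using W_filt by (auto simp: finite_increasing_filtration_def)
  have WY: "W w \<subseteq> Y w" for w
  proof (cases "w \<le> a0")
    case True
    then show ?thesis using Wmono[OF True] a(1) subspace_0[OF Ysub] by auto
  next
    case False
    have "W (a0 + int j) \<subseteq> Y (a0 + int j)" for j
    proof (induction j)
      case 0
      then show ?case using a(1) subspace_0[OF Ysub] by auto
    next
      case (Suc j)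
      show ?case
      proof
        fix u assume "u \<in> W (a0 + int (Suc j))"
        then obtain x y where xy: "x \<in> Y (a0 + int (Suc j))" "y \<in> W (a0 + int (Suc j) - 1)" "u = x + y"
          using top[of "a0 + int (Suc j)"] by (auto simp: YG_def)
        then have "y \<in> Y (a0 + int j)" using Suc by (auto simp: algebra_simps)
        then have "y \<in> Y (a0 + int (Suc j))" using Ymono[of "a0 + int j" "a0 + int (Suc j)"] by auto
        then show "u \<in> Y (a0 + int (Suc j))" using xy subspace_add[OF Ysub] by simp
      qed
    qed
    from this[of "nat (w - a0)"] False show ?thesis by simp
  qed
  have YW: "Y w \<subseteq> W w" for w
  proof
    fix u assume u: "u \<in> Y w"
    have "u \<in> W (w + int (nat (a1 - w) - j))" for j
    proof (induction j)
      case 0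
      have "W a1 \<subseteq> W (w + int (nat (a1 - w) - 0))" by (rule Wmono) simp
      then show ?case using a(2) by auto
    next
      case (Suc j)
      define w' where "w' = w + int (nat (a1 - w) - j)"
      show ?case
      proof (cases "nat (a1 - w) - j = 0")
        case False
        then have w': "w' - 1 = w + int (nat (a1 - w) - Suc j)" by (simp add: w'_def)
        have "u \<in> Y (w' - 1)" using Ymono[of w "w' - 1"] u w' by auto
        then have "u \<in> YG (w' - 1) w'"
          using Suc subspace_0[OF Wsub] unfolding YG_def w'_def[symmetric]
          by (intro CollectI exI[of _ u] exI[of _ 0]) auto
        then have "u \<in> W (w' - 1)" using bot by blast
        then show ?thesis by (simp only: w')
      qed (use Suc in simp)
    qed
    from this[of "nat (a1 - w)"] show "u \<in> W w" by simp
  qed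
  show ?thesis using NY[of u k] WY YW u by blast
qed


subsection \<open>Limits of filtrations with constant graded quotients\<close>

lemma M_check_dim_FGr:
  assumes "F \<in> M_check W S hn" "F' \<in> M_check W S hn"
  shows "vec.dim (FGr W F p w) = vec.dim (FGr W F' p w)"
proof -
  have ff: "finite_decreasing_filtration F" "finite_decreasing_filtration F'"
    using assms by (simp_all add: M_check_def)
  obtain a b where ab: "F a = {0}" "F' b = {0}"
    using ff by (auto simp: finite_decreasing_filtration_def)
  define P where "P = max a b"
  have rec: "vec.dim (FGr W F p w) = vec.dim (FGr W F (p + 1) w) + hn p (w - p)"
    "vec.dim (FGr W F' p w) = vec.dim (FGr W F' (p + 1) w) + hn p (w - p)" for p
    using assms unfolding M_check_def mem_Collect_eq by blast+
  have z: "F p = {0}" "F' p = {0}" if "P \<le> p" for p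
  proof -
    have "F p \<subseteq> {0}" "F' p \<subseteq> {0}" "0 \<in> F p" "0 \<in> F' p"
      using ff that ab vec.subspace_0 unfolding finite_decreasing_filtration_def P_def
      by (metis max.bounded_iff)+
    then show "F p = {0}" "F' p = {0}" by auto
  qed
  have top: "FGr W F p w = FGr W F' p w" if "P \<le> p" for p
    using z[OF that] by (simp add: FGr_def)
  have "vec.dim (FGr W F p w) = vec.dim (FGr W F' p w)" if "nat (P - p) = k" for k p
    using that
  proof (induction k arbitrary: p)
    case 0
    then show ?case using top[of p] by simp
  next
    case (Suc k)
    then have "nat (P - (p + 1)) = k" by simp
    then show ?case using Suc.IH[of "p + 1"] rec[of p] by linarith
  qed
  then show ?thesis by blast
qed

text \<open>The Hodge numbers determine the dimension of \<open>F p\<close> inside each weight step,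
  by induction on the weight. \<open>FGr_limit\<close> uses this to compare the members of a
  sequence with its limit.\<close>

lemma M_check_dim_F:
  assumes "F \<in> M_check W S hn" "F' \<in> M_check W S hn"
  shows "vec.dim (F p \<inter> cW w) = vec.dim (F' p \<inter> cW w)"
proof -
  have rec: "vec.dim (F p \<inter> cW w) + vec.dim (cW (w - 1)) = vec.dim (FGr W F p w) + vec.dim (F p \<inter> cW (w - 1))"
    if F: "F \<in> M_check W S hn" for F w
  proof -
    have s: "vec.subspace (F p)" using F by (simp add: M_check_def finite_decreasing_filtration_def)
    have "F p \<inter> cW w \<inter> cW (w - 1) = F p \<inter> cW (w - 1)" using cW_mono[of "w - 1" w] by auto
    then show ?thesis
      using subspace_sum_dim[of "F p \<inter> cW w" "cW (w - 1)"] s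
      by (simp add: FGr_def vec.subspace_inter)
  qed
  obtain w0 w1 where "w0 \<le> w1" and w0: "\<And>k. k \<le> w0 \<Longrightarrow> cW k = {0}" and "\<And>k. w1 \<le> k \<Longrightarrow> cW k = UNIV"
    using cW_bounds by blast
  have zero: "0 \<in> F p" "0 \<in> F' p"
    using assms vec.subspace_0 by (auto simp: M_check_def finite_decreasing_filtration_def)
  have "vec.dim (F p \<inter> cW w) = vec.dim (F' p \<inter> cW w)" if "nat (w - w0) = k" for k w
    using that
  proof (induction k arbitrary: w)
    case 0
    then show ?case using w0[of w] zero by simp
  next
    case (Suc k)
    then have "nat ((w - 1) - w0) = k" by simp
    from Suc.IH[OF this] show ?case
      using rec[OF assms(1), of w] rec[OF assms(2), of w] M_check_dim_FGr[OF assms, of p w] by linarith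
  qed
  then show ?thesis by blast
qed

end

lemma vec_subspace_real: "vec.subspace A \<Longrightarrow> subspace (A :: (complex^'n::finite) set)"
proof -
  assume A: "vec.subspace A"
  have "c *\<^sub>R x = complex_of_real c *s x" for c and x :: "complex^'n"
    by (simp add: vec_eq_iff) (simp add: scaleR_conv_of_real)
  then show ?thesis
    using A by (auto simp: subspace_def vec.subspace_def)
qed

lemma tendsto_matrix_vector:
  fixes g :: "'a \<Rightarrow> complex^'n::finite^'n"
  assumes "(g \<longlongrightarrow> A) net" "(x \<longlongrightarrow> y) net"
  shows "((\<lambda>k. g k *v x k) \<longlongrightarrow> A *v y) net"
  unfolding matrix_vector_mult_def
  by (intro tendsto_vec_lambda tendsto_sum tendsto_mult tendsto_vec_nth assms)

context filtered_space
begin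

text \<open>Translates of a fixed filtration approach it and induce constant graded filtrations.
  Compactness shows that the limit induces a smaller or equal one, and equality follows because all
  points of \<open>M_check\<close> have the same dimensions.\<close>

lemma FGr_limit:
  fixes g :: "nat \<Rightarrow> complex^'n^'n"
  assumes F0: "F0 \<in> M_check W S hn" and Fs: "\<And>k. filt_act (g k) F0 \<in> M_check W S hn"
    and inv: "\<And>k. invertible (g k)" and g: "g \<longlonglongrightarrow> mat 1"
    and \<Phi>: "\<And>k p w. FGr W (filt_act (g k) F0) p w = \<Phi> p w"
  shows "FGr W F0 p w = \<Phi> p w"
proof -
  have sF0: "vec.subspace (F0 p)" for p using F0 by (simp add: M_check_def finite_decreasing_filtration_def)
  have sFs: "vec.subspace (filt_act (g k) F0 p)" for k p
    using Fs[of k] by (simp add: M_check_def finite_decreasing_filtration_def)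
  have s\<Phi>: "vec.subspace (\<Phi> p w)" for p w
    using FGr_subspace[where F = "filt_act (g 0) F0" and p = p and w = w, OF sFs] \<Phi> by simp
  have "F0 p \<inter> cW w \<subseteq> \<Phi> p w"
  proof (rule ccontr)
    assume nsub: "\<not> F0 p \<inter> cW w \<subseteq> \<Phi> p w"
    define T0 where "T0 = F0 p \<inter> cW w"
    define T1 where "T1 = T0 \<inter> \<Phi> p w"
    have sT0: "vec.subspace T0" and sT1: "vec.subspace T1"
      unfolding T0_def T1_def by (intro vec.subspace_inter sF0 s\<Phi> cW_subspace)+
    have T1F: "T1 \<subseteq> F0 p" by (auto simp: T1_def T0_def)
    have less: "vec.dim T1 < vec.dim T0"
    proof (rule ccontr)
      assume "\<not> vec.dim T1 < vec.dim T0"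
      then have "T1 = T0" by (intro vec.subspace_dim_equal sT0 sT1) (auto simp: T1_def)
      then show False using nsub by (auto simp: T1_def T0_def)
    qed
    obtain B where B: "B \<subseteq> F0 p" "finite B" "card B + vec.dim T1 = vec.dim (F0 p)"
      "F0 p \<subseteq> subspace_sum T1 (vec.span B)"
      using complement_basis[OF sT1 sF0 T1F] by blast
    define T2 where "T2 = vec.span B"
    have sT2: "vec.subspace T2" by (simp add: T2_def)
    have T2F: "T2 \<subseteq> F0 p" unfolding T2_def by (rule vec.span_minimal[OF B(1) sF0])
    have dT2: "vec.dim T2 \<le> card B" unfolding T2_def by (simp add: vec.dim_le_card'[OF B(2)])
    have "vec.dim (F0 p) \<le> vec.dim (subspace_sum T1 T2)"
      by (rule vec.dim_subset) (use B(4) in \<open>simp add: T2_def\<close>)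
    then have dims: "vec.dim (T1 \<inter> T2) = 0" "vec.dim T2 + vec.dim T1 \<ge> vec.dim (F0 p)"
      using subspace_sum_dim[OF sT1 sT2] B(3) dT2 by linarith+
    then have T12: "T1 \<inter> T2 = {0}"
      using vec.subspace_0[OF sT1] vec.subspace_0[OF sT2] vec.dim_eq_0[of "T1 \<inter> T2"] by auto
    \<comment> \<open>By dimension, the vectors of \<open>F0 p\<close> that \<open>g k\<close> moves
      into \<open>cW w\<close> meet the complement \<open>T2\<close> of \<open>T1\<close>. A limit
      of such unit vectors lies in both \<open>T1\<close> and \<open>T2\<close>, which is the
      contradiction.\<close>
    have "\<exists>x. x \<in> T2 \<and> norm x = 1 \<and> g k *v x \<in> \<Phi> p w \<inter> cW w" for k
    proof -
      obtain gi where gi: "g k ** gi = mat 1" "gi ** g k = mat 1"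
        using inv[of k] by (auto simp: invertible_def)
      define K where "K = {x \<in> F0 p. g k *v x \<in> cW w}"
      have img: "(*v) (g k) ` K = filt_act (g k) F0 p \<inter> cW w"
        by (auto simp: K_def filt_act_def)
      have Keq: "K = (*v) gi ` (filt_act (g k) F0 p \<inter> cW w)"
        unfolding img[symmetric] image_image matrix_vector_mul_assoc by (simp add: gi)
      have sK: "vec.subspace K"
        unfolding Keq by (intro vec.subspace_image vec.subspace_inter sFs cW_subspace)
      have "vec.dim ((*v) (g k) ` K) \<le> vec.dim K" by (rule vec.dim_image_le) (rule matrix_vector_mul_linear_gen)
      then have "vec.dim T0 \<le> vec.dim K"
        unfolding img T0_def using M_check_dim_F[OF F0 Fs[of k], of p w] by simp
      moreover have "vec.dim (subspace_sum K T2) \<le> vec.dim (F0 p)"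
        by (intro vec.dim_subset subspace_sum_minimal sF0 T2F) (auto simp: K_def)
      ultimately have "vec.dim (K \<inter> T2) \<noteq> 0"
        using subspace_sum_dim[OF sK sT2] dims(2) less by linarith
      then obtain x where x: "x \<in> K" "x \<in> T2" "x \<noteq> 0"
        using vec.dim_eq_0[of "K \<inter> T2"] by auto
      define c where "c = inverse (norm x)"
      have "g k *v (c *\<^sub>R x) \<in> filt_act (g k) F0 p \<inter> cW w"
      proof -
        have "c *\<^sub>R x \<in> K" using vec_subspace_real[OF sK] x by (simp add: subspace_scale)
        then show ?thesis using img by blast
      qed
      then have "g k *v (c *\<^sub>R x) \<in> \<Phi> p w \<inter> cW w"
        using F_FGr \<Phi>[of k p w] by blast
      moreover have "c *\<^sub>R x \<in> T2" using vec_subspace_real[OF sT2] x by (simp add: subspace_scale)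
      moreover have "norm (c *\<^sub>R x) = 1" using x by (simp add: c_def)
      ultimately show ?thesis by blast
    qed
    then obtain x where x: "\<And>k. x k \<in> T2" "\<And>k. norm (x k) = 1" "\<And>k. g k *v x k \<in> \<Phi> p w \<inter> cW w"
      by metis
    have "compact (sphere (0 :: complex^'n) 1)" by (rule compact_sphere)
    moreover have "\<forall>k. x k \<in> sphere 0 1" using x(2) by simp
    ultimately obtain l r where lr: "l \<in> sphere 0 1" "strict_mono r" "(x \<circ> r) \<longlonglongrightarrow> l"
      unfolding compact_def by blast
    have l2: "l \<in> T2"
      by (rule closed_sequentially[OF closed_subspace[OF vec_subspace_real[OF sT2]] _ lr(3)])
         (simp add: x(1))
    have lim: "(\<lambda>k. g (r k) *v x (r k)) \<longlonglongrightarrow> mat 1 *v l"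
      using lr LIMSEQ_subseq_LIMSEQ[OF g lr(2)] by (intro tendsto_matrix_vector) (simp_all add: o_def)
    have cl: "closed (\<Phi> p w \<inter> cW w)"
      by (intro closed_subspace vec_subspace_real vec.subspace_inter s\<Phi> cW_subspace)
    have "mat 1 *v l \<in> \<Phi> p w \<inter> cW w"
      by (rule closed_sequentially[OF cl _ lim]) (rule x(3))
    then have "l \<in> T1 \<inter> T2" using l2 T2F by (auto simp: T1_def T0_def)
    then show False using T12 lr(1) by simp
  qed
  moreover have "cW (w - 1) \<subseteq> \<Phi> p w" using cW_FGr[where F = "filt_act (g 0) F0" and p = p and w = w, OF sFs] \<Phi> by simp
  ultimately have "FGr W F0 p w \<subseteq> \<Phi> p w"
    unfolding FGr_def by (intro subspace_sum_minimal s\<Phi>)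
  moreover have "vec.dim (FGr W F0 p w) = vec.dim (\<Phi> p w)"
    using M_check_dim_FGr[OF F0 Fs[of 0], of p w] \<Phi> by simp
  ultimately show ?thesis
    by (intro vec.subspace_dim_equal FGr_subspace sF0 s\<Phi>) auto
qed

end

subsection \<open>Holomorphic functions of several variables\<close>

definition chol :: "(complex^'r::finite \<Rightarrow> complex) \<Rightarrow> (complex^'r \<Rightarrow> complex) \<Rightarrow> complex^'r \<Rightarrow> bool" where
  "chol f D s \<longleftrightarrow> (f has_derivative D) (at s) \<and> (\<forall>c v. D (c *s v) = c * D v)"

lemma has_derivative_vec:
  fixes f :: "'a::euclidean_space \<Rightarrow> 'b::real_normed_vector^'m::finite"
  assumes "\<And>i. ((\<lambda>x. f x $ i) has_derivative (\<lambda>v. D v $ i)) (at s)"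
  shows "(f has_derivative D) (at s)"
  unfolding has_derivative_def
proof
  have lin: "bounded_linear (\<lambda>v. D v $ i)" for i
    using assms by (rule has_derivative_bounded_linear)
  have "linear D"
    by (rule linearI) (simp_all add: vec_eq_iff linear_add[OF bounded_linear.linear[OF lin]]
        linear_scale[OF bounded_linear.linear[OF lin]])
  then show "bounded_linear D" by (simp add: linear_conv_bounded_linear)
  show "((\<lambda>y. ((f y - f (netlimit (at s))) - D (y - netlimit (at s))) /\<^sub>R norm (y - netlimit (at s))) \<longlongrightarrow> 0) (at s)"
    by (rule vec_tendstoI) (use assms in \<open>simp add: has_derivative_def\<close>)
qed

lemma has_derivative_nth:
  assumes "(f has_derivative D) net"
  shows "((\<lambda>x. f x $ i) has_derivative (\<lambda>v. D v $ i)) net"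
  by (rule bounded_linear.has_derivative[OF bounded_linear_vec_nth assms])

lemma holomorphic_matrix_chol:
  assumes "holomorphic_matrix_on g A"
  obtains D where "\<And>z a b. z \<in> A \<Longrightarrow> chol (\<lambda>s. g s $ a $ b) (\<lambda>v. D z v $ a $ b) z"
    "\<And>z. z \<in> A \<Longrightarrow> (g has_derivative D z) (at z)"
proof -
  have "\<forall>z\<in>A. \<exists>D. (g has_derivative D) (at z) \<and> (\<forall>c v a b. D (c *s v) $ a $ b = c * D v $ a $ b)"
    using assms by (simp add: holomorphic_matrix_on_def)
  then obtain D where D: "\<And>z. z \<in> A \<Longrightarrow> (g has_derivative D z) (at z)"
    "\<And>z c v a b. z \<in> A \<Longrightarrow> D z (c *s v) $ a $ b = c * D z v $ a $ b"
    unfolding bchoice_iff by blast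
  show ?thesis
    by (rule that[of D]) (auto simp: chol_def intro!: has_derivative_nth D)
qed

lemma holomorphic_matrixI:
  assumes "\<And>z a b. z \<in> A \<Longrightarrow> chol (\<lambda>s. g s $ a $ b) (\<lambda>v. D z v $ a $ b) z"
  shows "holomorphic_matrix_on g A" "\<And>z. z \<in> A \<Longrightarrow> (g has_derivative D z) (at z)"
proof -
  show *: "(g has_derivative D z) (at z)" if "z \<in> A" for z
    using assms[OF that] by (intro has_derivative_vec) (simp add: chol_def)
  show "holomorphic_matrix_on g A"
    unfolding holomorphic_matrix_on_def
  proof
    fix z assume z: "z \<in> A"
    show "\<exists>D. (g has_derivative D) (at z) \<and> (\<forall>c v a b. D (c *s v) $ a $ b = c * D v $ a $ b)"
      using *[OF z] assms[OF z] by (intro exI[of _ "D z"]) (simp add: chol_def)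
  qed
qed

lemma chol_const: "chol (\<lambda>_. c) (\<lambda>_. 0) s"
  by (simp add: chol_def)

lemma chol_const_ex: "\<exists>D. chol (\<lambda>_. c) D s"
  using chol_const by blast

lemma chol_add: "chol f D s \<Longrightarrow> chol g D' s \<Longrightarrow> chol (\<lambda>x. f x + g x) (\<lambda>v. D v + D' v) s"
  by (auto simp: chol_def distrib_left intro: has_derivative_add)

lemma chol_diff: "chol f D s \<Longrightarrow> chol g D' s \<Longrightarrow> chol (\<lambda>x. f x - g x) (\<lambda>v. D v - D' v) s"
  by (auto simp: chol_def right_diff_distrib intro: has_derivative_diff)

lemma chol_mult:
  assumes f: "chol f D s" and g: "chol g D' s"
  shows "chol (\<lambda>x. f x * g x) (\<lambda>v. f s * D' v + D v * g s) s"
  unfolding chol_def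
proof (intro conjI allI)
  show "((\<lambda>x. f x * g x) has_derivative (\<lambda>v. f s * D' v + D v * g s)) (at s)"
    by (rule has_derivative_mult) (use f g in \<open>simp_all add: chol_def\<close>)
  fix c v
  have e: "D (c *s v) = c * D v" "D' (c *s v) = c * D' v" using f g unfolding chol_def by blast+
  show "f s * D' (c *s v) + D (c *s v) * g s = c * (f s * D' v + D v * g s)"
    unfolding e by (simp add: algebra_simps)
qed

lemma chol_sum: "(\<And>i. i \<in> I \<Longrightarrow> chol (f i) (D i) s) \<Longrightarrow> chol (\<lambda>x. \<Sum>i\<in>I. f i x) (\<lambda>v. \<Sum>i\<in>I. D i v) s"
  by (auto simp: chol_def sum_distrib_left intro: has_derivative_sum)

lemma chol_prod_ex: "finite I \<Longrightarrow> (\<And>i. i \<in> I \<Longrightarrow> \<exists>D. chol (f i) D s) \<Longrightarrow> \<exists>D. chol (\<lambda>x. \<Prod>i\<in>I. f i x) D s"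
proof (induction I rule: finite_induct)
  case empty
  then show ?case using chol_const[of 1 s] by auto
next
  case (insert i I)
  obtain D where D: "chol (f i) D s" using insert.prems[of i] by blast
  obtain D' where D': "chol (\<lambda>x. \<Prod>i\<in>I. f i x) D' s" using insert.IH insert.prems by blast
  show ?case
    unfolding prod.insert[OF insert.hyps] by (rule exI, rule chol_mult[OF D D'])
qed

lemma chol_sum_ex:
  assumes "\<And>i. i \<in> I \<Longrightarrow> \<exists>D. chol (f i) D s"
  shows "\<exists>D. chol (\<lambda>x. \<Sum>i\<in>I. f i x) D s"
proof -
  have "\<forall>i\<in>I. \<exists>D. chol (f i) D s" using assms by blast
  then obtain D where D: "\<forall>i\<in>I. chol (f i) (D i) s" unfolding bchoice_iff ..
  show ?thesis by (rule exI, rule chol_sum[of I f D]) (use D in blast)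
qed

lemma chol_det_ex:
  fixes A :: "complex^'r::finite \<Rightarrow> complex^'n::finite^'n"
  assumes "\<And>i j. \<exists>D. chol (\<lambda>x. A x $ i $ j) D s"
  shows "\<exists>D. chol (\<lambda>x. det (A x)) D s"
  unfolding det_def
proof (rule chol_sum_ex)
  fix p
  have "\<exists>D. chol (\<lambda>x. \<Prod>i\<in>UNIV. A x $ i $ p i) D s"
    by (rule chol_prod_ex) (use assms in auto)
  then obtain D where "chol (\<lambda>x. \<Prod>i\<in>UNIV. A x $ i $ p i) D s" by blast
  from chol_mult[OF chol_const this]
  show "\<exists>D. chol (\<lambda>x. of_int (sign p) * (\<Prod>i\<in>UNIV. A x $ i $ p i)) D s" by blast
qed

lemma chol_divide_ex:
  assumes "\<exists>D. chol f D s" "\<exists>D. chol g D s" "g s \<noteq> 0"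
  shows "\<exists>D. chol (\<lambda>x. f x / g x) D s"
proof -
  obtain D D' where D: "chol f D s" "chol g D' s" using assms by blast
  have "((\<lambda>x. inverse (g x)) has_derivative (\<lambda>v. - (inverse (g s) * D' v * inverse (g s)))) (at s)"
    using D(2) assms(3) unfolding chol_def by (intro Deriv.has_derivative_inverse) auto
  then have "chol (\<lambda>x. inverse (g x)) (\<lambda>v. - (inverse (g s) * D' v * inverse (g s))) s"
    using D(2) by (simp add: chol_def)
  from chol_mult[OF D(1) this] show ?thesis by (auto simp: divide_inverse)
qed

lemma chol_continuous: "chol f D s \<Longrightarrow> continuous (at s) f"
  using has_derivative_continuous unfolding chol_def by blast

text \<open>A polydisc rather than a ball, so that setting coordinates to zero or moving a single
  one stays inside.\<close>

definition polybox :: "real \<Rightarrow> (complex^'r::finite) set" where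
  "polybox e = {s. \<forall>k. cmod (s $ k) < e}"

lemma polybox_in_open:
  assumes "open U" "(0::complex^'r::finite) \<in> U"
  obtains e where "0 < e" "closure (polybox e) \<subseteq> U" "bounded (polybox e :: (complex^'r) set)"
proof -
  obtain r where r: "0 < r" "ball 0 r \<subseteq> U" using assms openE by blast
  define e where "e = r / (2 * (real CARD('r) + 1))"
  have "polybox e \<subseteq> cball (0::complex^'r) (r / 2)"
  proof
    fix s :: "complex^'r" assume s: "s \<in> polybox e"
    have "norm s \<le> (\<Sum>k\<in>UNIV. cmod (s $ k))" unfolding norm_vec_def by (rule L2_set_le_sum) simp
    also have "\<dots> \<le> (\<Sum>k\<in>(UNIV::'r set). e)" using s by (intro sum_mono) (auto simp: polybox_def less_imp_le)
    also have "\<dots> \<le> r / 2" using r(1) by (simp add: e_def field_simps)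
    finally show "s \<in> cball 0 (r / 2)" by simp
  qed
  then have c: "closure (polybox e) \<subseteq> cball (0::complex^'r) (r / 2)" by (simp add: closure_minimal)
  also have "\<dots> \<subseteq> ball 0 r" using r(1) by auto
  finally have "closure (polybox e) \<subseteq> U" using r(2) by blast
  moreover have "bounded (polybox e :: (complex^'r) set)"
    by (rule bounded_subset[OF bounded_cball]) (use c closure_subset in blast)
  ultimately show ?thesis using that[of e] r(1) by (simp add: e_def)
qed

lemma axis_line:
  assumes "chol f D (s + \<sigma> *s axis i 1)"
  shows "((\<lambda>\<tau>. f (s + \<tau> *s axis i 1)) has_field_derivative D (axis i 1)) (at \<sigma>)"
proof -
  have bl: "bounded_linear (\<lambda>\<tau>::complex. \<tau> *s axis i 1 :: complex^'a)"
    by (rule linear_conv_bounded_linear[THEN iffD1], rule linearI) (auto simp: vec_eq_iff algebra_simps)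
  have "((\<lambda>\<tau>. s + \<tau> *s axis i 1) has_derivative (\<lambda>\<tau>. \<tau> *s axis i 1)) (at \<sigma>)"
    using has_derivative_add[OF has_derivative_const bounded_linear.has_derivative[OF bl has_derivative_ident]] by simp
  moreover have "(f has_derivative D) (at (s + \<sigma> *s axis i 1))" using assms unfolding chol_def by blast
  ultimately have "((\<lambda>\<tau>. f (s + \<tau> *s axis i 1)) has_derivative (\<lambda>\<tau>. D (\<tau> *s axis i 1))) (at \<sigma>)"
    by (rule has_derivative_compose)
  moreover have "(\<lambda>\<tau>. D (\<tau> *s axis i 1)) = (*) (D (axis i 1))"
    using assms by (auto simp: chol_def mult.commute)
  ultimately show ?thesis by (simp add: has_field_derivative_def)
qed

text \<open>Compactness bounds \<open>f\<close> on a larger polydisc, the one-variable Cauchy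
  inequality along coordinate lines bounds the partial derivatives on a smaller one, and the mean
  value inequality gives the Lipschitz bound. Radius \<open>e2 / 3\<close> keeps closed discs of
  radius \<open>e\<close> along coordinate lines inside the larger polydisc.\<close>

lemma chol_bounds:
  fixes f :: "complex^'r::finite \<Rightarrow> complex"
  assumes U: "open U" "0 \<in> U" and f: "\<And>s. s \<in> U \<Longrightarrow> chol f (D s) s"
  obtains e C where "0 < e" "0 \<le> C" "polybox e \<subseteq> U" "\<And>s. s \<in> polybox e \<Longrightarrow> cmod (f s) \<le> C"
    "\<And>s i. s \<in> polybox e \<Longrightarrow> cmod (D s (axis i 1)) \<le> C"
    "\<And>s s' b. s \<in> polybox e \<Longrightarrow> s' \<in> polybox e \<Longrightarrow> (\<And>k. k \<noteq> b \<Longrightarrow> s $ k = s' $ k) \<Longrightarrow>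
      cmod (f s - f s') \<le> C * cmod (s $ b - s' $ b)"
proof -
  obtain e2 where e2: "0 < e2" "closure (polybox e2) \<subseteq> U" "bounded (polybox e2 :: (complex^'r) set)"
    by (rule polybox_in_open[OF U])
  define e where "e = e2 / 3"
  have e: "0 < e" using e2(1) by (simp add: e_def)
  have "compact (f ` closure (polybox e2))"
  proof (rule compact_continuous_image)
    show "continuous_on (closure (polybox e2)) f"
      using e2(2) f by (intro continuous_at_imp_continuous_on) (blast intro: chol_continuous)
    show "compact (closure (polybox e2 :: (complex^'r) set))" using e2(3) by (simp add: compact_closure)
  qed
  then obtain B where B: "0 < B" "\<And>s. s \<in> closure (polybox e2) \<Longrightarrow> cmod (f s) \<le> B"
    using compact_imp_bounded bounded_pos by (metis imageI)
  have B': "cmod (f s) \<le> B" "s \<in> U" if "s \<in> polybox e2" for s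
    using that B(2) e2(2) closure_subset by blast+
  have "e < e2" using e by (simp add: e_def)
  then have sub: "polybox e \<subseteq> polybox e2" by (auto simp: polybox_def intro: less_trans)
  have line: "s + \<tau> *s axis i 1 \<in> polybox e2" if "s \<in> polybox e" "cmod \<tau> \<le> e" for s \<tau> i
  proof -
    have "cmod (s $ k + \<tau> * axis i 1 $ k) < e2" for k
    proof -
      have "cmod (s $ k + \<tau> * axis i 1 $ k) \<le> cmod (s $ k) + cmod \<tau>"
        by (rule order_trans[OF norm_triangle_ineq]) (auto simp: axis_def norm_mult)
      also have "\<dots> < e + e" using that by (intro add_less_le_mono) (auto simp: polybox_def)
      also have "\<dots> < e2" using e by (simp add: e_def)
      finally show ?thesis .
    qed
    then show ?thesis by (simp add: polybox_def)
  qed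
  have deriv_bound: "cmod (D s (axis i 1)) \<le> B / e" if s: "s \<in> polybox e" for s i
  proof -
    define \<phi> where "\<phi> \<tau> = f (s + \<tau> *s axis i 1)" for \<tau>
    have der: "(\<phi> has_field_derivative D (s + \<tau> *s axis i 1) (axis i 1)) (at \<tau>)" if "cmod \<tau> \<le> e" for \<tau>
      unfolding \<phi>_def by (rule axis_line[OF f[OF B'(2)[OF line[OF s that]]]])
    have "norm ((deriv ^^ 1) \<phi> 0) \<le> fact 1 * B / e ^ 1"
    proof (rule Cauchy_inequality)
      show "\<phi> holomorphic_on ball 0 e"
        unfolding holomorphic_on_open[OF open_ball]
      proof
        fix \<tau> :: complex assume "\<tau> \<in> ball 0 e"
        then show "\<exists>f'. (\<phi> has_field_derivative f') (at \<tau>)" using der[of \<tau>] by auto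
      qed
      show "continuous_on (cball 0 e) \<phi>"
        using der by (intro continuous_at_imp_continuous_on ballI DERIV_isCont) auto
      show "norm (\<phi> x) \<le> B" if "norm (0 - x) = e" for x
        unfolding \<phi>_def using that by (intro B'(1) line s) auto
    qed (rule e)
    moreover have "deriv \<phi> 0 = D s (axis i 1)" using der[of 0] e by (simp add: DERIV_imp_deriv)
    ultimately show ?thesis by simp
  qed
  define C where "C = B + B / e"
  show ?thesis
  proof (rule that[of e C])
    show "0 < e" by (rule e)
    show "0 \<le> C" using B(1) e by (simp add: C_def)
    show "polybox e \<subseteq> U" using sub B'(2) by blast
    show "cmod (f s) \<le> C" if "s \<in> polybox e" for s
    proof -
      have "cmod (f s) \<le> B" using sub that by (intro B'(1)) blast
      moreover have "0 \<le> B / e" using B(1) e by simp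
      ultimately show ?thesis by (simp add: C_def)
    qed
    have BC: "B / e \<le> C" using B(1) by (simp add: C_def)
    show "cmod (D s (axis i 1)) \<le> C" if "s \<in> polybox e" for s i
      using deriv_bound[OF that, of i] BC by linarith
    fix s s' :: "complex^'r" and b
    assume s: "s \<in> polybox e" and s': "s' \<in> polybox e" and eq: "\<And>k. k \<noteq> b \<Longrightarrow> s $ k = s' $ k"
    define \<sigma> where "\<sigma> = s $ b - s' $ b"
    have s_eq: "s = s' + \<sigma> *s axis b 1" using eq by (auto simp: vec_eq_iff axis_def \<sigma>_def)
    have seg: "s' + \<tau> *s axis b 1 \<in> polybox e" if t: "\<tau> \<in> closed_segment 0 \<sigma>" for \<tau>
    proof -
      obtain u where u: "0 \<le> u" "u \<le> 1" "\<tau> = u *\<^sub>R \<sigma>" using t by (auto simp: closed_segment_def)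
      have "cmod ((s' + \<tau> *s axis b 1) $ k) < e" for k
      proof (cases "k = b")
        case True
        have "(s' + \<tau> *s axis b 1) $ k = (1 - u) *\<^sub>R s' $ b + u *\<^sub>R s $ b"
          by (simp add: True u(3) \<sigma>_def algebra_simps)
        also have "\<dots> \<in> ball 0 e"
          using s s' u by (intro convexD[OF convex_ball]) (auto simp: polybox_def)
        finally show ?thesis by simp
      next
        case False
        then show ?thesis using s' by (simp add: polybox_def axis_def)
      qed
      then show ?thesis by (simp add: polybox_def)
    qed
    have "norm (f (s' + \<sigma> *s axis b 1) - f (s' + 0 *s axis b 1)) \<le> C * norm (\<sigma> - 0)"
    proof (rule field_differentiable_bound[where S = "closed_segment 0 \<sigma>"])
      fix \<tau> assume t: "\<tau> \<in> closed_segment 0 \<sigma>"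
      show "((\<lambda>\<tau>. f (s' + \<tau> *s axis b 1)) has_field_derivative D (s' + \<tau> *s axis b 1) (axis b 1)) (at \<tau> within closed_segment 0 \<sigma>)"
        by (rule has_field_derivative_at_within, rule axis_line, rule f, rule B'(2)) (use seg[OF t] sub in blast)
      show "cmod (D (s' + \<tau> *s axis b 1) (axis b 1)) \<le> C"
        using deriv_bound[OF seg[OF t], of b] BC by linarith
    qed auto
    then have "norm (f s - f (s' + 0 *s axis b 1)) \<le> C * norm (\<sigma> - 0)"
      unfolding s_eq[symmetric] .
    then show "cmod (f s - f s') \<le> C * cmod (s $ b - s' $ b)"
      unfolding \<sigma>_def by simp
  qed
qed


subsection \<open>A holomorphic chart of the flag manifold\<close>

lemma coord_subset_image_eq:
  assumes X: "X ** Xi = mat 1" and Y: "Y ** Yi = mat 1"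
    and sub: "(*v) X ` coord A \<subseteq> (*v) (Y :: complex^'n::finite^'n) ` coord A"
  shows "(*v) X ` coord A = (*v) Y ` coord A"
proof -
  have YiY: "Yi ** Y = mat 1" using Y matrix_left_right_inverse by blast
  have img: "(*v) (P ** Q) ` S = (*v) P ` (*v) Q ` S" for P Q :: "complex^'n^'n" and S
    by (simp add: image_image matrix_vector_mul_assoc)
  have "(*v) (Yi ** X) ` coord A = coord A"
  proof (rule invertible_image_coord)
    show "Yi ** X ** (Xi ** Y) = mat 1" by (simp add: mat_assoc mat_cancel[OF X] YiY)
    have "(*v) (Yi ** X) ` coord A \<subseteq> (*v) Yi ` (*v) Y ` coord A"
      unfolding img by (rule image_mono[OF sub])
    then show "(*v) (Yi ** X) ` coord A \<subseteq> coord A"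
      by (simp add: YiY flip: img)
  qed simp
  then have "(*v) Y ` (*v) (Yi ** X) ` coord A = (*v) Y ` coord A" by simp
  then show ?thesis by (simp add: matrix_mul_assoc Y flip: img)
qed

text \<open>
  Column \<open>j\<close> of \<open>mat 1 + B s\<close> is the vector of \<open>g s ` coord {fst \<ge> a}\<close>, with
  \<open>a = fst (d j)\<close>, which agrees with \<open>axis j 1\<close> in the coordinates with \<open>fst \<ge> a\<close>.
\<close>
lemma flag_chart:
  fixes g :: "complex^'r::finite \<Rightarrow> complex^'n::finite^'n" and d :: "'n \<Rightarrow> int \<times> int"
  assumes U: "open U" "0 \<in> U"
    and g: "\<And>s i j. s \<in> U \<Longrightarrow> \<exists>D. chol (\<lambda>s. g s $ i $ j) D s"
    and g0: "g 0 = mat 1" and inv: "\<And>s. s \<in> U \<Longrightarrow> invertible (g s)"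
  obtains U' B where "open U'" "0 \<in> U'" "U' \<subseteq> U" "B 0 = 0"
    "\<And>s i j. s \<in> U' \<Longrightarrow> \<exists>D. chol (\<lambda>s. B s $ i $ j) D s"
    "\<And>s. s \<in> U' \<Longrightarrow> supp (\<lambda>i j. fst (d i) < fst (d j)) (B s)"
    "\<And>s p. s \<in> U' \<Longrightarrow> (*v) (mat 1 + B s) ` coord {i. p \<le> fst (d i)} = (*v) (g s) ` coord {i. p \<le> fst (d i)}"
proof -
  \<comment> \<open>The block of \<open>g s\<close> on indices with \<open>a \<le> fst\<close>,
    completed by the identity. Cramer's rule then expresses the normalized column as a quotient of
    holomorphic functions wherever the determinant is nonzero, in particular near
    \<open>0\<close>.\<close>
  define Mx where "Mx a s = (\<chi> k l. if a \<le> fst (d k) \<and> a \<le> fst (d l) then g s $ k $ l else if k = l then 1 else 0)" for a s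
  define x where "x j s = (\<chi> k. det (\<chi> i l. if l = k then axis j 1 $ i else Mx (fst (d j)) s $ i $ l) / det (Mx (fst (d j)) s))" for j s
  define B where "B s = (\<chi> i j. (g s *v x j s) $ i - (if i = j then 1 else 0))" for s
  have Mx_chol: "\<exists>D. chol (\<lambda>s. Mx a s $ k $ l) D s" if "s \<in> U" for a k l s
    
  proof (cases "a \<le> fst (d k) \<and> a \<le> fst (d l)")
    case True
    then show ?thesis using g[OF that, of k l] by (simp add: Mx_def)
  next
    case False
    then have "(\<lambda>s. Mx a s $ k $ l) = (\<lambda>s. if k = l then 1 else 0)" by (auto simp: Mx_def)
    then show ?thesis by (simp only: chol_const_ex)
  qed
  have det_chol: "\<exists>D. chol (\<lambda>s. det (Mx a s)) D s" if "s \<in> U" for a s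
    using Mx_chol[OF that] by (rule chol_det_ex)
  define U' where "U' = (\<Inter>j. {s \<in> U. det (Mx (fst (d j)) s) \<noteq> 0})"
  have "open {s \<in> U. det (Mx a s) \<noteq> 0}" for a
  proof -
    have "continuous_on U (\<lambda>s. det (Mx a s))"
      using det_chol by (intro continuous_at_imp_continuous_on) (blast intro: chol_continuous)
    then have "open (U \<inter> (\<lambda>s. det (Mx a s)) -` (- {0}))"
      using U(1) by (intro continuous_open_preimage) auto
    moreover have "U \<inter> (\<lambda>s. det (Mx a s)) -` (- {0}) = {s \<in> U. det (Mx a s) \<noteq> 0}" by auto
    ultimately show ?thesis by simp
  qed
  then have openU': "open U'" unfolding U'_def by (intro open_INT) auto
  have M0: "Mx a 0 = mat 1" for a by (auto simp: Mx_def g0 mat_def vec_eq_iff)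
  have 0: "0 \<in> U'" using U(2) by (simp add: U'_def M0)
  have sub: "U' \<subseteq> U" by (auto simp: U'_def)
  have Mx_x: "Mx (fst (d j)) s *v x j s = axis j 1" if "s \<in> U'" for s j
  proof -
    have "det (Mx (fst (d j)) s) \<noteq> 0" using that by (auto simp: U'_def)
    then show ?thesis using cramer[of "Mx (fst (d j)) s" "x j s" "axis j 1"] by (simp add: x_def)
  qed
  have x_coord: "x j s \<in> coord {k. fst (d j) \<le> fst (d k)}" if "s \<in> U'" for s j
    unfolding coord_def
  proof (clarify, rule ccontr)
    fix k assume k: "x j s $ k \<noteq> 0" "\<not> fst (d j) \<le> fst (d k)"
    have "(Mx (fst (d j)) s *v x j s) $ k = x j s $ k"
      using k(2) by (simp add: matrix_vector_mult_def Mx_def if_distrib[where f = "\<lambda>x. x * _"] cong: if_cong)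
    moreover have "k \<noteq> j" using k(2) by auto
    ultimately show False using k(1) by (simp add: Mx_x[OF that] axis_def)
  qed
  have gx: "(g s *v x j s) $ k = axis j 1 $ k" if s: "s \<in> U'" and k: "fst (d j) \<le> fst (d k)" for s j k
  proof -
    have "(Mx (fst (d j)) s *v x j s) $ k = (g s *v x j s) $ k"
      unfolding matrix_vector_mult_def vec_lambda_beta
    proof (rule sum.cong[OF refl])
      fix l
      show "Mx (fst (d j)) s $ k $ l * x j s $ l = g s $ k $ l * x j s $ l"
        using x_coord[OF s, of j] k by (cases "x j s $ l = 0") (auto simp: coord_def Mx_def)
    qed
    then show ?thesis by (simp add: Mx_x[OF s])
  qed
  have Bsupp: "supp (\<lambda>i j. fst (d i) < fst (d j)) (B s)" if "s \<in> U'" for s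
    unfolding supp_def
  proof (intro allI impI, rule ccontr)
    fix i j assume ij: "B s $ i $ j \<noteq> 0" "\<not> fst (d i) < fst (d j)"
    then have "(g s *v x j s) $ i = axis j 1 $ i" by (intro gx[OF that]) simp
    then show False using ij(1) by (simp add: B_def axis_def)
  qed
  have col: "(mat 1 + B s) *v axis j 1 = g s *v x j s" for s j
    by (simp add: vec_eq_iff matrix_column_nth B_def mat_def)
  show ?thesis
  proof (rule that[OF openU' 0 sub])
    show "B 0 = 0"
    proof -
      have "x j 0 = axis j 1" for j using Mx_x[OF 0, of j] by (simp add: M0)
      then show ?thesis by (simp add: B_def g0 vec_eq_iff axis_def)
    qed
    show "\<exists>D. chol (\<lambda>s. B s $ i $ j) D s" if s: "s \<in> U'" for s i j
    proof -
      have sU: "s \<in> U" using s sub by blast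
      have xk: "\<exists>D. chol (\<lambda>s. x j s $ k) D s" for k
        unfolding x_def vec_lambda_beta
      proof (intro chol_divide_ex chol_det_ex)
        show "\<exists>D. chol (\<lambda>s. (\<chi> i l. if l = k then axis j 1 $ i else Mx (fst (d j)) s $ i $ l) $ i $ l) D s" for i l
          using Mx_chol[OF sU] by (cases "l = k") (auto intro: chol_const_ex)
        show "\<exists>D. chol (\<lambda>s. Mx (fst (d j)) s $ i $ l) D s" for i l by (rule Mx_chol[OF sU])
        show "det (Mx (fst (d j)) s) \<noteq> 0" using s by (auto simp: U'_def)
      qed
      have "\<exists>D. chol (\<lambda>s. \<Sum>k\<in>UNIV. g s $ i $ k * x j s $ k) D s"
        by (rule chol_sum_ex) (use g[OF sU] xk chol_mult in blast)
      then obtain D where "chol (\<lambda>s. \<Sum>k\<in>UNIV. g s $ i $ k * x j s $ k) D s" by blast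
      from chol_diff[OF this chol_const[of "if i = j then 1 else 0"]] show ?thesis
        by (auto simp: B_def matrix_vector_mult_def)
    qed
    show "supp (\<lambda>i j. fst (d i) < fst (d j)) (B s)" if "s \<in> U'" for s by (rule Bsupp[OF that])
    fix s p assume s: "s \<in> U'"
    obtain Xi where Xi: "(mat 1 + B s) ** Xi = mat 1"
    proof -
      have "supp (\<lambda>i j. fst (d i) < fst (d j)) ((mat 1 + B s) - mat 1)" using Bsupp[OF s] by simp
      then show ?thesis
        by (rule unipotent_inverse[of _ _ "\<lambda>i. (fst (d i), 0)"]) (auto simp: transp_def nilp_def intro: that)
    qed
    obtain Yi where Yi: "g s ** Yi = mat 1" using inv s sub by (auto simp: invertible_def)
    show "(*v) (mat 1 + B s) ` coord {i. p \<le> fst (d i)} = (*v) (g s) ` coord {i. p \<le> fst (d i)}"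
    proof (rule coord_subset_image_eq[OF Xi Yi])
      show "(*v) (mat 1 + B s) ` coord {i. p \<le> fst (d i)} \<subseteq> (*v) (g s) ` coord {i. p \<le> fst (d i)}"
        unfolding image_coord_span[of "mat 1 + B s"] col
      proof (rule vec.span_minimal)
        show "(\<lambda>i. g s *v x i s) ` {i. p \<le> fst (d i)} \<subseteq> (*v) (g s) ` coord {i. p \<le> fst (d i)}"
        proof (clarify, rule imageI)
          fix j assume "p \<le> fst (d j)"
          then show "x j s \<in> coord {i. p \<le> fst (d i)}"
            using x_coord[OF s, of j] by (auto simp: coord_def)
        qed
        show "vec.subspace ((*v) (g s) ` coord {i. p \<le> fst (d i)})" by (rule vec.subspace_image) simp
      qed
    qed
  qed
qed

text \<open>The chart controls only the first index; constancy on the graded quotients adds that the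
  weight drops. This is proved for the inverse \<open>L\<close> of \<open>mat 1 + B\<close>, by
  induction on the weight of the column.\<close>

lemma (in polarized_coords) chart_nil:
  assumes B: "supp (\<lambda>i j. fst (d i) < fst (d j)) B"
    and eq: "\<And>p w. FGr W (filt_act (G ** (mat 1 + B) ** Gi) F) p w = FGr W F p w"
  shows "supp (minus_part d) B"
proof -
  have B': "supp (\<lambda>i j. fst (d i) < fst (d j)) ((mat 1 + B) - mat 1)" using B by simp
  obtain L where L: "(mat 1 + B) ** L = mat 1" "L ** (mat 1 + B) = mat 1"
    "supp (\<lambda>i j. fst (d i) < fst (d j)) (L - mat 1)"
    by (rule unipotent_inverse[OF B', of "\<lambda>i. (fst (d i), 0)"]) (auto simp: transp_def nilp_def)
  have F'_eq: "filt_act (G ** (mat 1 + B) ** Gi) F p = (*v) (G ** (mat 1 + B)) ` coord {i. p \<le> fst (d i)}" for p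
    unfolding filt_act_def F_eq image_image matrix_vector_mul_assoc by (simp add: mat_assoc GiG)
  define m where "m = Min (range (\<lambda>i. wt (d i)))"
  have nil: "wt (d i) < wt (d j)" if "(L - mat 1) $ i $ j \<noteq> 0" for i j
    using that
  proof (induction "nat (wt (d j) - m)" arbitrary: i j rule: less_induct)
    case less
    define a w where "a = fst (d j)" and "w = wt (d j)"
    have "G *v axis j 1 \<in> F a" unfolding F_eq by (rule imageI) (simp add: a_def)
    moreover have "G *v axis j 1 \<in> cW w" by (rule G_wt) (simp add: w_def)
    ultimately have "G *v axis j 1 \<in> FGr W (filt_act (G ** (mat 1 + B) ** Gi) F) a w"
      unfolding eq by (rule F_FGr)
    then obtain x y where xy: "x \<in> filt_act (G ** (mat 1 + B) ** Gi) F a" "y \<in> cW (w - 1)" "G *v axis j 1 = x + y"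
      by (auto simp: FGr_def subspace_sum_def)
    obtain x' where x': "x' \<in> coord {i. a \<le> fst (d i)}" "x = (G ** (mat 1 + B)) *v x'"
      using xy(1) unfolding F'_eq by blast
    obtain y' where y': "y' \<in> coord {i. wt (d i) \<le> w - 1}" "y = G *v y'" using xy(2) W_eq by blast
    have "axis j 1 = (mat 1 + B) *v x' + y'"
    proof -
      have "Gi *v (G *v axis j 1) = Gi *v (x + y)" by (simp only: xy(3))
      then show ?thesis by (simp add: x'(2) y'(2) matrix_vector_right_distrib matrix_vector_mul_assoc matrix_mul_assoc GiG)
    qed
    then have "L *v axis j 1 = L *v ((mat 1 + B) *v x' + y')" by simp
    then have Lj: "L *v axis j 1 = x' + L *v y'"
      by (simp add: matrix_vector_right_distrib matrix_vector_mul_assoc L(2))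
    have Ly: "L *v y' \<in> coord {i. wt (d i) \<le> w - 1}"
    proof -
      have "(L - mat 1) *v y' \<in> coord {i. wt (d i) \<le> w - 1}"
        unfolding coord_def
      proof clarify
        fix i assume "((L - mat 1) *v y') $ i \<noteq> 0"
        then obtain k where k: "(L - mat 1) $ i $ k * y' $ k \<noteq> 0"
          unfolding matrix_vector_mult_def vec_lambda_beta by (rule sum.not_neutral_contains_not_neutral)
        then have wk: "wt (d k) \<le> w - 1" using y'(1) by (auto simp: coord_def)
        have "m \<le> wt (d k)" unfolding m_def by (rule Min_le) auto
        then have "nat (wt (d k) - m) < nat (wt (d j) - m)" using wk by (simp add: w_def)
        then have "wt (d i) < wt (d k)" using less.hyps[of k i] k by auto
        then show "wt (d i) \<le> w - 1" using wk by linarith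
      qed
      from coord_add[OF this y'(1)] show ?thesis by (simp add: matrix_vector_mult_diff_rdistrib)
    qed
    have Lz: "(L *v axis j 1) $ i = axis j 1 $ i" if "a \<le> fst (d i)" for i
    proof -
      have "\<not> fst (d i) < fst (d j)" using that by (simp add: a_def)
      then have "(L - mat 1) $ i $ j = 0" using L(3) unfolding supp_def by blast
      moreover have "axis j 1 $ i = (mat 1 :: complex^'n^'n) $ i $ j" by (auto simp: axis_def mat_def)
      ultimately show ?thesis by (simp add: matrix_column_nth)
    qed
    \<comment> \<open>The entry sits in a row with \<open>fst (d i) < a\<close>, where
      \<open>x'\<close> vanishes. It is therefore an entry of \<open>L *v y'\<close>, which has
      weight at most \<open>w - 1\<close> by the induction hypothesis.\<close>
    show "wt (d i) < wt (d j)"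
    proof (rule ccontr)
      assume "\<not> wt (d i) < wt (d j)"
      then have 0: "(L *v y') $ i = 0" using Ly by (auto simp: coord_def w_def)
      have ia: "fst (d i) < a" using L(3) less.prems by (auto simp: supp_def a_def)
      then have "x' $ i = 0" using x'(1) by (auto simp: coord_def)
      then have "(L *v axis j 1) $ i = 0" using 0 by (simp add: Lj)
      moreover have "i \<noteq> j" using ia by (auto simp: a_def)
      ultimately show False using less.prems by (simp add: matrix_column_nth mat_def)
    qed
  qed
  have "supp (nilp d 1) (L - mat 1)" 
    unfolding supp_def nilp_def
  proof (intro allI impI)
    fix i j assume "(L - mat 1) $ i $ j \<noteq> 0"
    from nil[OF this] show "wt (d i) + int 1 \<le> wt (d j)" by simp
  qed
  then obtain Li where Li: "L ** Li = mat 1" "supp (nilp d 1) (Li - mat 1)"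
    using unipotent_inverse[of "nilp d 1" L d] by auto
  have "Li = mat 1 + B" by (rule left_inverse_unique[OF Li(1) L(1)])
  then have Bn: "supp (nilp d 1) B" using Li(2) by simp
  show ?thesis
    unfolding supp_def minus_part_def
  proof (intro allI impI conjI)
    fix i j assume ij: "B $ i $ j \<noteq> 0"
    show "fst (d i) < fst (d j)" using B ij by (auto simp: supp_def)
    have "nilp d 1 i j" using Bn ij by (auto simp: supp_def)
    then show "wt (d i) < wt (d j)" by (simp add: nilp_def)
  qed
qed

subsection \<open>Extension of the period map at the puncture\<close>

lemma lin_comb_vec: "lin_comb N z *v u = (\<Sum>j\<in>UNIV. z $ j *s (cmat (N j) *v u))"
proof -
  have "(lin_comb N z *v u) $ a = (\<Sum>j\<in>UNIV. z $ j *s (cmat (N j) *v u)) $ a" for a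
  proof -
    have "(lin_comb N z *v u) $ a = (\<Sum>b\<in>UNIV. \<Sum>j\<in>UNIV. z $ j * (cmat (N j) $ a $ b * u $ b))"
      by (simp add: matrix_vector_mult_def lin_comb_def map_matrix_def sum_distrib_right mult.assoc)
    also have "\<dots> = (\<Sum>j\<in>UNIV. \<Sum>b\<in>UNIV. z $ j * (cmat (N j) $ a $ b * u $ b))" by (rule sum.swap)
    finally show ?thesis by (simp add: matrix_vector_mult_def sum_distrib_left)
  qed
  then show ?thesis by (simp add: vec_eq_iff)
qed

locale unipotent_admissible = polarized_space W S
  for W :: "'n::finite rfilt" and S +
  fixes hn and N :: "'r::{finite,linorder} \<Rightarrow> real^'n^'n" and F \<Psi> :: "complex^('r::{finite,linorder}) \<Rightarrow> 'n cfilt"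
  assumes period: "period_map W S hn N F"
    and unip: "unipotent_variation W N F"
    and adm: "admissible_with_extension W S hn N F \<Psi>"
begin

lemma N_nilpotent: "\<exists>k. mpow (N j) k = 0" and N_commute: "N i ** N j = N j ** N i"
  and F_cls: "z \<in> upper_half \<Longrightarrow> F z \<in> classifying_space W S hn"
  and F_hor: "horizontal_flag_map F upper_half"
  using period unfolding period_map_def by blast+

lemma FGr_const: "z \<in> upper_half \<Longrightarrow> z' \<in> upper_half \<Longrightarrow> FGr W (F z) p w = FGr W (F z') p w"
  using unip unfolding unipotent_variation_def by blast

lemma lowers_N: "lowers (cmat (N j))"
proof -
  obtain m where m: "mpow (N j) m = 0" using N_nilpotent by blast
  have "mpow (cmat (N j)) m = 0" unfolding mpow_cmat m by (simp add: vec_eq_iff map_matrix_def)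
  moreover have "lowers (mexp (cmat (N j)) - mat 1)"
    unfolding lowers_def mexp_cmat[OF m]
  proof (intro allI ballI)
    fix k u assume u: "u \<in> cW k"
    have "mexp (N j) *v v - v \<in> W (k - 1)" if "v \<in> W k" for v
      using unip that unfolding unipotent_variation_def by blast
    then show "(cmat (mexp (N j)) - mat 1) *v u \<in> cW (k - 1)"
      using u by (simp add: complexify_def matrix_vector_mult_diff_rdistrib re_vec_diff im_vec_diff re_im_cmat)
  qed
  ultimately show ?thesis by (rule lowers_log)
qed

text \<open>Unipotency of the variation gives a drop by one in weight; the relative weight
  filtration, forced to equal \<open>W\<close>, turns it into a drop by two.\<close>

lemma N_W2:
  assumes "u \<in> cW k"
  shows "cmat (N j) *v u \<in> cW (k - 2)"
proof -
  have real: "N j *v v \<in> W (w - 1)" if v: "v \<in> W w" for v w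
  proof -
    define u where "u = (\<chi> i. complex_of_real (v $ i))"
    have re: "re_vec u = v" and im: "im_vec u = 0" by (simp_all add: u_def re_vec_def im_vec_def vec_eq_iff)
    have "u \<in> cW w" using v subspace_0[OF W_subspace] by (simp add: complexify_def re im)
    then have "cmat (N j) *v u \<in> cW (w - 1)" using lowers_N[of j] by (auto simp: lowers_def)
    then show ?thesis by (simp add: complexify_def re_im_cmat re)
  qed
  obtain Y where "is_relative_weight_filtration W (N j) Y"
    using adm unfolding admissible_with_extension_def by blast
  from relative_weight_trivial[OF this real] show ?thesis
    using assms by (simp add: complexify_def re_im_cmat)
qed

lemma lowers_lin_comb: "lowers (lin_comb N z)"
  unfolding lowers_def lin_comb_vec
  using lowers_N by (auto simp: lowers_def intro!: vec.subspace_sum vec.subspace_scale)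

definition T :: "complex^('r::{finite,linorder}) \<Rightarrow> complex^'n^'n" where
  "T z = mexp (lin_comb N z)"

lemma T_inv: "T z ** T (- z) = mat 1" "T (- z) ** T z = mat 1"
  unfolding T_def lin_comb_uminus
  using lowers_mexp_inverse(1)[OF lowers_lin_comb] matrix_left_right_inverse by blast+

lemma T_unip: "lowers (T z - mat 1)"
  unfolding T_def by (rule lowers_mexp[OF lowers_lin_comb])

lemma \<Psi>_check: "s \<in> polydisc \<Longrightarrow> \<Psi> s \<in> M_check W S hn"
  and \<Psi>_hol: "holomorphic_flag_map \<Psi> polydisc"
  and \<Psi>_cov: "z \<in> upper_half \<Longrightarrow> \<Psi> (covering_map z) = filt_act (T (- z)) (F z)"
  using adm unfolding admissible_with_extension_def T_def by blast+

lemma F_eq_\<Psi>: "z \<in> upper_half \<Longrightarrow> F z = filt_act (T z) (\<Psi> (covering_map z))"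
  by (simp add: \<Psi>_cov filt_act_mult T_inv)

lemma covering_norm: "cmod (covering_map z $ j) = exp (- 2 * pi * Im (z $ j))"
  by (simp add: covering_map_def)

lemma covering_surj:
  assumes "s \<in> polydisc" "\<And>j. s $ j \<noteq> 0"
  obtains z where "z \<in> upper_half" "covering_map z = s"
proof
  define z where "z = (\<chi> j. Ln (s $ j) / (2 * of_real pi * \<i>))"
  show cov: "covering_map z = s"
    using assms(2) by (simp add: covering_map_def z_def vec_eq_iff)
  show "z \<in> upper_half"
    unfolding upper_half_def
  proof clarify
    fix j
    have "exp (- 2 * pi * Im (z $ j)) < 1"
      unfolding covering_norm[symmetric] cov using assms(1) by (simp add: polydisc_def)
    then have "exp (- 2 * pi * Im (z $ j)) < exp 0" by simp
    then have "0 < (2 * pi) * Im (z $ j)" unfolding exp_less_cancel_iff by simp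
    then show "0 < Im (z $ j)" by (simp add: zero_less_mult_iff)
  qed
qed

text \<open>A base point at which the constant graded filtrations are read off.\<close>

definition zb :: "complex^('r::{finite,linorder})" where
  "zb = (\<chi> j. \<i>)"

lemma zb: "zb \<in> upper_half"
  by (simp add: zb_def upper_half_def)

lemma FGr_\<Psi>:
  assumes "z \<in> upper_half"
  shows "FGr W (\<Psi> (covering_map z)) p w = FGr W (F zb) p w"
  unfolding \<Psi>_cov[OF assms]
  using FGr_unip[OF T_unip[of "- z"] T_unip[of z] T_inv(1)] FGr_const[OF assms zb] by metis

lemma zero_polydisc: "0 \<in> polydisc"
  by (simp add: polydisc_def)

text \<open>\<open>FGr_limit\<close> is applied along a sequence running straight up in all
  half-planes, whose images under the covering map tend to the origin.\<close>

lemma FGr_\<Psi>0: "FGr W (\<Psi> 0) p w = FGr W (F zb) p w"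
proof -
  obtain A g where A: "open A" "0 \<in> A" "A \<subseteq> polydisc" "flag_lift \<Psi> A 0 g" "holomorphic_matrix_on g A"
    using \<Psi>_hol zero_polydisc unfolding holomorphic_flag_map_def by blast
  define z :: "nat \<Rightarrow> complex^('r::{finite,linorder})" where "z k = (\<chi> j. \<i> * of_real (real (Suc k)))" for k
  have zU: "z k \<in> upper_half" for k by (simp add: z_def upper_half_def)
  have lim: "(\<lambda>k. covering_map (z k)) \<longlonglongrightarrow> 0"
  proof (rule vec_tendstoI)
    fix j
    have "(\<lambda>k. exp (- 2 * pi * real (Suc k))) \<longlonglongrightarrow> 0"
    proof -
      have "(\<lambda>k. exp (- 2 * pi) ^ k) \<longlonglongrightarrow> 0" by (rule LIMSEQ_power_zero) simp
      then have "(\<lambda>k. exp (- 2 * pi) ^ Suc k) \<longlonglongrightarrow> 0" by (rule LIMSEQ_Suc)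
      moreover have "exp (- 2 * pi) ^ Suc k = exp (- 2 * pi * real (Suc k))" for k
        by (metis exp_of_nat_mult mult.commute)
      ultimately show ?thesis by (simp only:)
    qed
    then have "(\<lambda>k. cmod (covering_map (z k) $ j)) \<longlonglongrightarrow> 0"
      unfolding covering_norm by (simp add: z_def)
    then show "(\<lambda>k. covering_map (z k) $ j) \<longlonglongrightarrow> 0 $ j"
      by (simp add: tendsto_norm_zero_iff)
  qed
  then have "\<forall>\<^sub>F k in sequentially. covering_map (z k) \<in> A"
    using A(1,2) by (rule topological_tendstoD)
  then obtain K where K: "\<And>k. k \<ge> K \<Longrightarrow> covering_map (z k) \<in> A"
    unfolding eventually_sequentially by blast
  define s where "s k = covering_map (z (k + K))" for k
  have sA: "s k \<in> A" for k by (simp add: s_def K)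
  have slim: "s \<longlonglongrightarrow> 0" unfolding s_def[abs_def] by (rule LIMSEQ_ignore_initial_segment[OF lim])
  have g0: "g 0 = mat 1" and \<Psi>s: "\<And>s. s \<in> A \<Longrightarrow> invertible (g s) \<and> \<Psi> s = filt_act (g s) (\<Psi> 0)"
    using A(4) by (auto simp: flag_lift_def)
  obtain D where "(g has_derivative D) (at 0)"
    using A(2,5) unfolding holomorphic_matrix_on_def by blast
  then have "isCont g 0" by (rule has_derivative_continuous)
  then have "(\<lambda>k. g (s k)) \<longlonglongrightarrow> mat 1"
    using slim g0 isCont_tendsto_compose by metis
  moreover have "filt_act (g (s k)) (\<Psi> 0) = \<Psi> (s k)" for k using \<Psi>s[OF sA] by simp
  moreover have "FGr W (\<Psi> (s k)) p w = FGr W (F zb) p w" for k p w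
    unfolding s_def by (rule FGr_\<Psi>[OF zU])
  moreover have "\<Psi> (s k) \<in> M_check W S hn" for k
    using sA A(3) by (intro \<Psi>_check) blast
  ultimately show ?thesis
    using \<Psi>s[OF sA] by (intro FGr_limit[OF \<Psi>_check[OF zero_polydisc], of "\<lambda>k. g (s k)"]) simp_all
qed

text \<open>For a degenerating variation the limit is only guaranteed to lie in
  \<open>M_check\<close>. Here the graded quotients do not degenerate, so the limit is itself a
  polarized mixed Hodge structure and provides the reference frame.\<close>

lemma \<Psi>0_cls: "\<Psi> 0 \<in> classifying_space W S hn"
proof (rule classifying_space_cong[OF F_cls[OF zb]])
  show "finite_decreasing_filtration (\<Psi> 0)"
    using \<Psi>_check[OF zero_polydisc] by (simp add: M_check_def)
  show "FGr W (\<Psi> 0) = FGr W (F zb)"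
    by (intro ext FGr_\<Psi>0)
qed

lemma limit_coords:
  obtains d :: "'n \<Rightarrow> int \<times> int" and M G Gi where "polarized_coords W S d M (\<Psi> 0) G Gi"
proof -
  have "mixed_hodge_structure W (\<Psi> 0)" and pol: "graded_polarized W S (\<Psi> 0)"
    and filt: "finite_decreasing_filtration (\<Psi> 0)"
    using \<Psi>0_cls by (auto simp: classifying_space_def M_check_def)
  then obtain d :: "'n \<Rightarrow> int \<times> int" and M G Gi where "adapted d M W (\<Psi> 0) G Gi"
    using adapted_exists by blast
  then show ?thesis
    using pol filt polarized_space_axioms
    by (intro that polarized_coords.intro polarized_coords_axioms.intro)
qed

end


subsection \<open>Horizontality\<close>

definition mchol :: "(complex^'r::finite \<Rightarrow> complex^'n::finite^'n) \<Rightarrow> (complex^'r \<Rightarrow> complex^'n^'n) \<Rightarrow> complex^'r \<Rightarrow> bool" where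
  "mchol g D s \<longleftrightarrow> (\<forall>a b. chol (\<lambda>x. g x $ a $ b) (\<lambda>v. D v $ a $ b) s)"

lemma mchol_const: "mchol (\<lambda>_. A) (\<lambda>_. 0) s"
  by (simp add: mchol_def chol_const)

lemma mchol_add: "mchol g D s \<Longrightarrow> mchol h D' s \<Longrightarrow> mchol (\<lambda>x. g x + h x) (\<lambda>v. D v + D' v) s"
  by (simp add: mchol_def chol_add)

lemma mchol_mult:
  assumes "mchol g D s" "mchol h D' s"
  shows "mchol (\<lambda>x. g x ** h x) (\<lambda>v. g s ** D' v + D v ** h s) s"
  unfolding mchol_def
proof (intro allI)
  fix a b
  have "chol (\<lambda>x. \<Sum>k\<in>UNIV. g x $ a $ k * h x $ k $ b)
     (\<lambda>v. \<Sum>k\<in>UNIV. g s $ a $ k * D' v $ k $ b + D v $ a $ k * h s $ k $ b) s"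
    using assms by (intro chol_sum chol_mult) (simp_all add: mchol_def)
  then show "chol (\<lambda>x. (g x ** h x) $ a $ b) (\<lambda>v. (g s ** D' v + D v ** h s) $ a $ b) s"
    by (simp add: matrix_mult_nth sum.distrib)
qed

lemma mchol_mult_const:
  fixes A B :: "complex^'n::finite^'n"
  assumes "mchol g D s"
  shows "mchol (\<lambda>x. A ** g x ** B) (\<lambda>v. A ** D v ** B) s"
  using mchol_mult[OF mchol_mult[OF mchol_const assms] mchol_const, of A B] by simp

lemma mchol_lin_comb: "mchol (lin_comb N) (lin_comb N) s"
  unfolding mchol_def chol_def
proof (intro allI conjI)
  fix a b
  have bl: "bounded_linear (\<lambda>x. lin_comb N x $ a $ b)"
    by (rule linear_conv_bounded_linear[THEN iffD1], rule linearI)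
       (simp_all add: lin_comb_def algebra_simps sum.distrib scaleR_sum_right)
  then show "((\<lambda>x. lin_comb N x $ a $ b) has_derivative (\<lambda>v. lin_comb N v $ a $ b)) (at s)"
    by (rule bounded_linear_imp_has_derivative)
qed (simp add: lin_comb_def sum_distrib_left mult.assoc)

lemma mchol_mpow_ex: "mchol g D s \<Longrightarrow> \<exists>D. mchol (\<lambda>x. mpow (g x) k) D s"
proof (induction k)
  case 0
  then show ?case using mchol_const by auto
next
  case (Suc k)
  then obtain D' where "mchol (\<lambda>x. mpow (g x) k) D' s" by blast
  from mchol_mult[OF Suc.prems this] show ?case by (auto simp: mpow_Suc)
qed

lemma mchol_sum_ex:
  assumes "\<And>i. i \<in> I \<Longrightarrow> \<exists>D. mchol (f i) D s" "finite I"
  shows "\<exists>D. mchol (\<lambda>x. \<Sum>i\<in>I. f i x) D s"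
  using assms(2,1)
proof (induction I rule: finite_induct)
  case empty
  then show ?case using mchol_const[of 0 s] by auto
next
  case (insert i I)
  obtain D where D: "mchol (f i) D s" using insert.prems[of i] by blast
  obtain D' where D': "mchol (\<lambda>x. \<Sum>i\<in>I. f i x) D' s" using insert.IH insert.prems by blast
  show ?case unfolding sum.insert[OF insert.hyps] by (rule exI, rule mchol_add[OF D D'])
qed

lemma mchol_holomorphic:
  assumes "\<And>z. z \<in> A \<Longrightarrow> mchol g (D z) z"
  shows "holomorphic_matrix_on g A" "\<And>z. z \<in> A \<Longrightarrow> (g has_derivative D z) (at z)"
  using holomorphic_matrixI[of A g D] assms by (simp_all add: mchol_def)

lemma mchol_covering:
  assumes "mchol g D (covering_map z)"
  shows "mchol (\<lambda>w. g (covering_map w)) (\<lambda>v. D (\<chi> k. 2 * of_real pi * \<i> * covering_map z $ k * v $ k)) z"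
  unfolding mchol_def chol_def
proof (intro allI conjI)
  define L where "L v = (\<chi> k. 2 * of_real pi * \<i> * covering_map z $ k * v $ k)" for v
  have cov: "(covering_map has_derivative L) (at z)"
  proof (rule has_derivative_vec)
    fix k
    have "((\<lambda>w. exp (2 * of_real pi * \<i> * w $ k)) has_derivative
        (\<lambda>v. 2 * of_real pi * \<i> * exp (2 * of_real pi * \<i> * z $ k) * v $ k)) (at z)"
    proof -
      have "((\<lambda>x. exp (2 * of_real pi * \<i> * x)) has_field_derivative
          2 * of_real pi * \<i> * exp (2 * of_real pi * \<i> * z $ k)) (at (z $ k))"
        by (auto intro!: derivative_eq_intros)
      from has_derivative_compose[OF has_derivative_nth[OF has_derivative_ident] this[unfolded has_field_derivative_def]]
      show ?thesis by simp
    qed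
    then show "((\<lambda>x. covering_map x $ k) has_derivative (\<lambda>v. L v $ k)) (at z)"
      by (simp add: covering_map_def L_def)
  qed
  fix a b
  have D: "((\<lambda>x. g x $ a $ b) has_derivative (\<lambda>v. D v $ a $ b)) (at (covering_map z))"
    "\<And>c v. D (c *s v) $ a $ b = c * D v $ a $ b"
    using assms unfolding mchol_def chol_def by blast+
  show "((\<lambda>w. g (covering_map w) $ a $ b) has_derivative (\<lambda>v. D (\<chi> k. 2 * of_real pi * \<i> * covering_map z $ k * v $ k) $ a $ b)) (at z)"
    using has_derivative_compose[OF cov D(1)] by (simp only: L_def)
  fix c v
  have "L (c *s v) = c *s L v" by (simp add: L_def vec_eq_iff)
  then show "D (\<chi> k. 2 * of_real pi * \<i> * covering_map z $ k * (c *s v) $ k) $ a $ b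
    = c * D (\<chi> k. 2 * of_real pi * \<i> * covering_map z $ k * v $ k) $ a $ b"
    using D(2)[of c "L v"] by (simp only: L_def)
qed

context unipotent_admissible
begin

lemma T_mchol_ex: "\<exists>D. mchol T D z"
proof -
  obtain m where m: "\<And>X. lowers X \<Longrightarrow> mpow X m = 0" using lowers_nilpotent by blast
  have T: "T = (\<lambda>w. \<Sum>k<m. ((1 / fact k) *\<^sub>R mat 1) ** mpow (lin_comb N w) k)"
    by (rule ext) (simp add: T_def mexp_finite[OF m[OF lowers_lin_comb]] scaleR_mat_mult)
  show ?thesis
    unfolding T
  proof (rule mchol_sum_ex)
    fix k
    obtain D where "mchol (\<lambda>w. mpow (lin_comb N w) k) D z" using mchol_mpow_ex[OF mchol_lin_comb] by blast
    from mchol_mult[OF mchol_const this]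
    show "\<exists>D. mchol (\<lambda>w. ((1 / fact k) *\<^sub>R mat 1) ** mpow (lin_comb N w) k) D z" by blast
  qed simp
qed

lemma cmat_N_commute: "cmat (N i) ** lin_comb N z = lin_comb N z ** cmat (N i)"
  by (rule lin_comb_commute) (simp add: N_commute flip: cmat_mult)

lemma lin_comb_axis: "lin_comb N (\<tau> *s axis i 1) = (\<chi> a b. \<tau> * cmat (N i) $ a $ b)"
  by (simp add: lin_comb_def vec_eq_iff axis_def map_matrix_def if_distrib[where f = "\<lambda>x. x * _"] if_distrib[where f = "\<lambda>x. _ * x"] cong: if_cong)

text \<open>Along the \<open>i\<close>-th axis \<open>T\<close> is \<open>T z\<close> times a
  polynomial in the parameter whose linear coefficient is \<open>cmat (N i)\<close>.\<close>

lemma T_derivative: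
  assumes D: "mchol T D z"
  shows "D (axis i 1) = cmat (N i) ** T z"
proof -
  obtain m where m: "\<And>X. lowers X \<Longrightarrow> mpow X m = 0" using lowers_nilpotent by blast
  define X where "X = cmat (N i)"
  have comm: "lin_comb N (\<tau> *s axis i 1) ** lin_comb N z = lin_comb N z ** lin_comb N (\<tau> *s axis i 1)" for \<tau>
    by (rule lin_comb_commute[symmetric, THEN sym]) (rule cmat_N_commute[symmetric])
  have Tadd: "T (z + \<tau> *s axis i 1) = T z ** T (\<tau> *s axis i 1)" for \<tau>
    unfolding T_def lin_comb_add
    by (rule mexp_add[of _ _ m]) (simp_all add: comm m lowers_lin_comb flip: lin_comb_add)
  have pw: "mpow (lin_comb N (\<tau> *s axis i 1)) k = (\<chi> a b. \<tau> ^ k * mpow X k $ a $ b)" for \<tau> k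
  proof (induction k)
    case 0
    then show ?case by (simp add: vec_eq_iff)
  next
    case (Suc k)
    then show ?case
      by (simp add: mpow_Suc lin_comb_axis matrix_mult_nth X_def vec_eq_iff sum_distrib_left mult_ac)
  qed
  have Tax: "T (\<tau> *s axis i 1) $ a $ b = (\<Sum>k<Suc (Suc m). \<tau> ^ k * (mpow X k $ a $ b / fact k))" for \<tau> a b
  proof -
    have "mpow (lin_comb N (\<tau> *s axis i 1)) (Suc (Suc m)) = 0"
      by (rule mpow_zero_mono[OF m[OF lowers_lin_comb]]) simp
    then show ?thesis
      unfolding T_def mexp_finite[OF \<open>mpow _ _ = 0\<close>] pw sum_component vector_scaleR_component vec_lambda_beta
      by (intro sum.cong refl) (simp add: scaleR_conv_of_real)
  qed
  have "D (axis i 1) $ a $ b = (T z ** X) $ a $ b" for a b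
  proof -
    have "((\<lambda>\<tau>. T (z + \<tau> *s axis i 1) $ a $ b) has_field_derivative D (axis i 1) $ a $ b) (at 0)"
      by (rule axis_line) (use D in \<open>simp add: mchol_def\<close>)
    moreover have "((\<lambda>\<tau>. T (z + \<tau> *s axis i 1) $ a $ b) has_field_derivative (T z ** X) $ a $ b) (at 0)"
    proof -
      have d: "((\<lambda>\<tau>. T (\<tau> *s axis i 1) $ c $ b) has_field_derivative X $ c $ b) (at 0)" for c
      proof -
        have "((\<lambda>\<tau>. \<Sum>k<Suc (Suc m). \<tau> ^ k * (mpow X k $ c $ b / fact k)) has_field_derivative
            (\<Sum>k<Suc (Suc m). real k * 0 ^ (k - 1) * (mpow X k $ c $ b / fact k))) (at 0)"
          by (rule DERIV_sum) (auto intro!: derivative_eq_intros)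
        moreover have "(\<Sum>k<Suc (Suc m). real k * 0 ^ (k - 1) * (mpow X k $ c $ b / fact k)) = X $ c $ b"
          by (subst sum.lessThan_Suc_shift, subst sum.lessThan_Suc_shift) (simp add: mpow_Suc)
        ultimately show ?thesis unfolding Tax by simp
      qed
      have "((\<lambda>\<tau>. \<Sum>c\<in>UNIV. T z $ a $ c * T (\<tau> *s axis i 1) $ c $ b) has_field_derivative
          (\<Sum>c\<in>UNIV. T z $ a $ c * X $ c $ b)) (at 0)"
        by (intro DERIV_sum DERIV_cmult d)
      then show ?thesis by (simp add: Tadd matrix_mult_nth)
    qed
    ultimately show ?thesis by (rule DERIV_unique)
  qed
  then have "D (axis i 1) = T z ** X" by (simp add: vec_eq_iff)
  also have "\<dots> = X ** T z"
    unfolding T_def X_def by (rule mexp_commute[OF cmat_N_commute m[OF lowers_lin_comb], symmetric])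
  finally show ?thesis by (simp add: X_def)
qed

end

section \<open>The chart at the puncture and the limits of transversality\<close>

text \<open>Only points with nonzero coordinates lift to the half-planes. Closed conditions proved
  there extend to the whole polydisc by this approximation.\<close>

lemma polybox_approx:
  assumes s: "s \<in> polybox e" and e: "0 < e"
  obtains t :: "nat \<Rightarrow> complex^'r::finite" where "\<And>k. t k \<in> polybox e" "\<And>k j. t k $ j \<noteq> 0" "t \<longlonglongrightarrow> s"
proof
  define t where "t k = (\<chi> j. if s $ j = 0 then of_real (e / (real k + 2)) else s $ j)" for k
  show "t k \<in> polybox e" for k
    using s e by (auto simp: polybox_def t_def norm_divide divide_less_eq norm_of_real simp flip: of_real_add)
  show "t k $ j \<noteq> 0" for k j
  proof -
    have "e / (real k + 2) \<noteq> 0" using e by simp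
    then show ?thesis by (auto simp only: t_def vec_lambda_beta of_real_eq_0_iff split: if_splits)
  qed
  show "t \<longlonglongrightarrow> s"
  proof (rule vec_tendstoI)
    fix j
    have "(\<lambda>k. e / (real k + 2)) \<longlonglongrightarrow> 0"
    proof -
      have "(\<lambda>k. e * inverse (real (Suc (Suc k)))) \<longlonglongrightarrow> e * 0"
        by (intro tendsto_mult tendsto_const LIMSEQ_Suc[OF LIMSEQ_inverse_real_of_nat])
      then show ?thesis by (simp add: divide_inverse add.commute)
    qed
    then have "(\<lambda>k. complex_of_real (e / (real k + 2))) \<longlonglongrightarrow> of_real 0" by (rule tendsto_of_real)
    then show "(\<lambda>k. t k $ j) \<longlonglongrightarrow> s $ j"
      by (cases "s $ j = 0") (simp_all add: t_def)
  qed
qed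

lemma mchol_continuous: "mchol g D s \<Longrightarrow> isCont (\<lambda>x. g x $ a $ b) s"
  unfolding mchol_def using chol_continuous by blast

text \<open>\<open>C\<close> bounds the chart, its partial derivatives and its Lipschitz constants
  along coordinate lines simultaneously. The Lipschitz bound is what makes a segment short when one
  coordinate is killed.\<close>

locale limit_chart = unipotent_admissible W S hn N F \<Psi> + polarized_coords W S d M "\<Psi> 0" G Gi
  for W :: "'n::finite rfilt" and S hn
    and N :: "'r::{finite,linorder} \<Rightarrow> real^'n^'n" and F \<Psi> :: "complex^('r::{finite,linorder}) \<Rightarrow> 'n cfilt"
    and d :: "'n \<Rightarrow> int \<times> int" and M G Gi +
  fixes e C :: real and B :: "complex^('r::{finite,linorder}) \<Rightarrow> complex^'n^'n"
    and D :: "complex^('r::{finite,linorder}) \<Rightarrow> complex^('r::{finite,linorder}) \<Rightarrow> complex^'n^'n"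
  assumes e: "0 < e" and C: "0 \<le> C" and box: "(polybox e :: (complex^('r::{finite,linorder})) set) \<subseteq> polydisc" and B0: "B 0 = 0"
    and BD: "s \<in> polybox e \<Longrightarrow> mchol B (D s) s"
    and \<Psi>B: "s \<in> polybox e \<Longrightarrow> \<Psi> s = filt_act (G ** (mat 1 + B s) ** Gi) (\<Psi> 0)"
    and B_fst: "s \<in> polybox e \<Longrightarrow> supp (\<lambda>i j. fst (d i) < fst (d j)) (B s)"
    and B_bound: "s \<in> polybox e \<Longrightarrow> mnorm (B s) \<le> C"
    and D_bound: "s \<in> polybox e \<Longrightarrow> mnorm (D s (axis i 1)) \<le> C"
    and B_lipschitz: "s \<in> polybox e \<Longrightarrow> s' \<in> polybox e \<Longrightarrow> (\<And>k. k \<noteq> b \<Longrightarrow> s $ k = s' $ k) \<Longrightarrow>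
      mnorm (B s - B s') \<le> C * cmod (s $ b - s' $ b)"
begin

lemma zero_box: "0 \<in> polybox e"
  using e by (simp add: polybox_def)

lemma supp_closed:
  assumes "t \<longlonglongrightarrow> s" "\<And>k. supp R (X (t k))" "\<And>a b. (\<lambda>k. X (t k) $ a $ b) \<longlonglongrightarrow> Y $ a $ b"
  shows "supp R Y"
  unfolding supp_def
proof (intro allI impI, rule ccontr)
  fix i j assume "Y $ i $ j \<noteq> 0" "\<not> R i j"
  then have "X (t k) $ i $ j = 0" for k using assms(2) by (auto simp: supp_def)
  then have "(\<lambda>k. X (t k) $ i $ j) \<longlonglongrightarrow> 0" by simp
  then have "Y $ i $ j = 0" using assms(3)[of i j] LIMSEQ_unique by blast
  then show False using \<open>Y $ i $ j \<noteq> 0\<close> by simp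
qed

lemma B_limit:
  assumes "s \<in> polybox e" "t \<longlonglongrightarrow> s"
  shows "(\<lambda>k. B (t k) $ a $ b) \<longlonglongrightarrow> B s $ a $ b"
  by (rule isCont_tendsto_compose[OF mchol_continuous[OF BD[OF assms(1)]] assms(2)])

lemma B_minus:
  assumes s: "s \<in> polybox e"
  shows "supp (minus_part d) (B s)"
proof -
  have nz: "supp (minus_part d) (B t)" if t: "t \<in> polybox e" "\<And>j. t $ j \<noteq> 0" for t
  proof -
    obtain z where z: "z \<in> upper_half" "covering_map z = t"
      by (rule covering_surj[OF subsetD[OF box t(1)] t(2)])
    have "FGr W (filt_act (G ** (mat 1 + B t) ** Gi) (\<Psi> 0)) p w = FGr W (\<Psi> 0) p w" for p w
      using FGr_\<Psi>[OF z(1)] FGr_\<Psi>0 by (simp add: z(2) flip: \<Psi>B[OF t(1)])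
    then show ?thesis by (rule chart_nil[OF B_fst[OF t(1)]])
  qed
  obtain t where t: "\<And>k. t k \<in> polybox e" "\<And>k j. t k $ j \<noteq> 0" "t \<longlonglongrightarrow> s"
    by (rule polybox_approx[OF s e]) blast
  show ?thesis by (rule supp_closed[OF t(3), where X = B]) (rule nz[OF t(1,2)] B_limit[OF s t(3)])+
qed

lemma B_nil: "s \<in> polybox e \<Longrightarrow> supp (nilp d 1) (B s)"
  by (rule supp_mono[OF B_minus]) (auto simp: minus_part_def nilp_def)

text \<open>The inverse of \<open>mat 1 + B s\<close> as a finite geometric series, hence visibly
  continuous in \<open>s\<close>.\<close>

definition V :: "complex^('r::{finite,linorder}) \<Rightarrow> complex^'n^'n" where
  "V s = (\<Sum>k<depth d. (-1) ^ k *\<^sub>R mpow (B s) k)"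

lemma V_inv: "s \<in> polybox e \<Longrightarrow> (mat 1 + B s) ** V s = mat 1" "s \<in> polybox e \<Longrightarrow> V s ** (mat 1 + B s) = mat 1"
  unfolding V_def using nil_geometric[OF mpow_depth[OF B_nil order_refl]] by blast+

lemma V_supp: "s \<in> polybox e \<Longrightarrow> supp (\<lambda>i j. fst (d i) \<le> fst (d j)) (V s)"
proof -
  assume s: "s \<in> polybox e"
  have "supp (\<lambda>i j. fst (d i) \<le> fst (d j)) (mpow (B s) k)" for k
  proof (induction k)
    case 0
    then show ?case by (auto intro: supp_one)
  next
    case (Suc k)
    then show ?case unfolding mpow_Suc by (rule supp_mult_gen[OF B_fst[OF s]]) auto
  qed
  then show ?thesis unfolding V_def by (intro supp_sum supp_scaleR)
qed

lemma V_limit: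
  assumes "s \<in> polybox e" "t \<longlonglongrightarrow> s"
  shows "(\<lambda>k. V (t k) $ a $ b) \<longlonglongrightarrow> V s $ a $ b"
proof -
  have "(\<lambda>k. mpow (B (t k)) m $ a $ b) \<longlonglongrightarrow> mpow (B s) m $ a $ b" for m a b
  proof (induction m arbitrary: a b)
    case (Suc m)
    then show ?case unfolding mpow_Suc matrix_mult_nth
      by (intro tendsto_sum tendsto_mult B_limit[OF assms])
  qed simp
  then show ?thesis unfolding V_def sum_component vector_scaleR_component
    by (intro tendsto_sum tendsto_scaleR tendsto_const)
qed

definition nG :: "'r \<Rightarrow> complex^'n^'n" where
  "nG i = Gi ** cmat (N i) ** G"

text \<open>Griffiths transversality for the lift \<open>T w ** H (covering_map w) ** K\<close> of
  the period map, transported to the reference frame. The factor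
  \<open>2 * of_real pi * \<i> * s $ i\<close> is the derivative of the covering map.\<close>

lemma horizontal_nonzero:
  assumes s: "s \<in> polybox e" "\<And>j. s $ j \<noteq> 0"
  shows "supp (\<lambda>k l. fst (d l) - 1 \<le> fst (d k))
    (V s ** (nG i ** (mat 1 + B s) + D s ((2 * of_real pi * \<i> * s $ i) *s axis i 1)))"
proof -
  obtain z where z: "z \<in> upper_half" "covering_map z = s"
    by (rule covering_surj[OF subsetD[OF box s(1)] s(2)])
  define H where "H t = G ** (mat 1 + B t) ** Gi" for t
  define K where "K = G ** V s ** Gi ** T (- z)"
  define l where "l w = T w ** H (covering_map w) ** K" for w
  define A where "A = {w :: complex^('r::{finite,linorder}). \<forall>j. 0 < Im (w $ j) \<and> exp (- 2 * pi * Im (w $ j)) < e}"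
  have A_iff: "w \<in> A \<longleftrightarrow> w \<in> upper_half \<and> covering_map w \<in> polybox e" for w
    by (auto simp: A_def upper_half_def polybox_def covering_norm)
  have opA: "open A"
  proof -
    have "open {w :: complex^('r::{finite,linorder}). 0 < Im (w $ j) \<and> exp (- 2 * pi * Im (w $ j)) < e}" for j
      by (intro open_Collect_conj open_Collect_less continuous_intros)
    then have "open (\<Inter>j. {w :: complex^('r::{finite,linorder}). 0 < Im (w $ j) \<and> exp (- 2 * pi * Im (w $ j)) < e})"
      by (intro open_INT) auto
    moreover have "(\<Inter>j. {w :: complex^('r::{finite,linorder}). 0 < Im (w $ j) \<and> exp (- 2 * pi * Im (w $ j)) < e}) = A"
      by (auto simp: A_def)
    ultimately show ?thesis by simp
  qed
  have zA: "z \<in> A" using z s by (simp add: A_iff)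
  have subA: "A \<subseteq> upper_half" by (auto simp: A_iff)
  have HV: "H t ** (G ** V t ** Gi) = mat 1" "(G ** V t ** Gi) ** H t = mat 1" if "t \<in> polybox e" for t
    using V_inv[OF that] by (simp_all add: H_def mat_assoc mat_cancel GiG GGi)
  have KTH: "K ** (T z ** H s) = mat 1"
    using HV(2)[OF s(1)] by (simp add: K_def mat_assoc mat_cancel[OF T_inv(2)])
  have FH: "F w = filt_act (T w ** H (covering_map w)) (\<Psi> 0)" if "w \<in> A" for w
    using that \<Psi>B[of "covering_map w"] by (simp add: A_iff F_eq_\<Psi> filt_act_mult H_def)
  have fl: "flag_lift F A z l"
    unfolding flag_lift_def
  proof (intro conjI ballI)
    have "(T z ** H s) ** K = mat 1" using KTH matrix_left_right_inverse by blast
    then show "l z = mat 1" by (simp add: l_def z(2))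
    fix w assume w: "w \<in> A"
    have "invertible (T w)" "invertible (H (covering_map w))" "invertible K"
      using T_inv HV[of "covering_map w"] w KTH matrix_left_right_inverse unfolding invertible_def A_iff by blast+
    then show "invertible (l w)" unfolding l_def by (intro invertible_mult)
    have "l w ** (T z ** H s) = T w ** H (covering_map w)"
      using KTH by (simp add: l_def mat_assoc)
    then show "F w = filt_act (l w) (F z)"
      unfolding FH[OF w] FH[OF zA] filt_act_mult z(2) by simp
  qed
  obtain DT where DT: "\<And>w. mchol T (DT w) w" using T_mchol_ex by metis
  define DH where "DH w v = G ** D (covering_map w) (\<chi> k. 2 * of_real pi * \<i> * covering_map w $ k * v $ k) ** Gi" for w v
  have H_der: "mchol (\<lambda>w. H (covering_map w)) (DH w) w" if "w \<in> A" for w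
  proof -
    have cw: "covering_map w \<in> polybox e" using that by (simp add: A_iff)
    have "mchol (\<lambda>t. mat 1 + B t) (\<lambda>v. 0 + D (covering_map w) v) (covering_map w)"
      by (rule mchol_add[OF mchol_const BD[OF cw]])
    from mchol_mult_const[OF this, of G Gi] have "mchol H (\<lambda>v. G ** D (covering_map w) v ** Gi) (covering_map w)"
      by (simp add: H_def[abs_def])
    from mchol_covering[OF this] show ?thesis by (simp add: DH_def[abs_def])
  qed
  define Dl where "Dl w v = (T w ** DH w v + DT w v ** H (covering_map w)) ** K" for w v
  have l_der: "mchol l (Dl w) w" if w: "w \<in> A" for w
    using mchol_mult_const[OF mchol_mult[OF DT H_der[OF w]], of "mat 1" K]
    by (simp add: l_def[abs_def] Dl_def[abs_def])
  have hol: "holomorphic_matrix_on l A" "(l has_derivative Dl z) (at z)"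
    using mchol_holomorphic[of A l Dl] l_der zA by blast+
  have "\<forall>A g. open A \<and> z \<in> A \<and> A \<subseteq> upper_half \<and> flag_lift F A z g \<and> holomorphic_matrix_on g A \<longrightarrow>
    (\<forall>j p. \<forall>u\<in>F z p. frechet_derivative g (at z) (axis j 1) *v u \<in> F z (p - 1))"
    using F_hor z(1) unfolding horizontal_flag_map_def by (rule bspec)
  from this[rule_format, of A l] opA zA subA fl hol(1)
  have "frechet_derivative l (at z) (axis i 1) *v u \<in> F z (p - 1)" if "u \<in> F z p" for u p
    using that by simp
  moreover have "frechet_derivative l (at z) = Dl z"
    using frechet_derivative_at[OF hol(2)] by simp
  ultimately have hor: "Dl z (axis i 1) *v u \<in> F z (p - 1)" if "u \<in> F z p" for u p
    using that by simp
  define Q where "Q = D s ((2 * of_real pi * \<i> * s $ i) *s axis i 1)"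
  have "(\<chi> k. 2 * of_real pi * \<i> * s $ k * axis i 1 $ k) = (2 * of_real pi * \<i> * s $ i) *s axis i (1::complex)"
    by (auto simp: vec_eq_iff axis_def)
  then have DHz: "DH z (axis i 1) = G ** Q ** Gi" by (simp add: DH_def z(2) Q_def)
  have NT: "cmat (N i) ** T z = T z ** cmat (N i)"
  proof -
    obtain m where m: "\<And>X. lowers X \<Longrightarrow> mpow X m = 0" using lowers_nilpotent by blast
    show ?thesis unfolding T_def by (rule mexp_commute[OF cmat_N_commute m[OF lowers_lin_comb]])
  qed
  have DK: "Dl z (axis i 1) ** (T z ** H s) = T z ** (G ** (Q + nG i ** (mat 1 + B s)) ** Gi)"
  proof -
    have "Dl z (axis i 1) ** (T z ** H s) = T z ** (G ** Q ** Gi) + cmat (N i) ** T z ** H s"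
      using KTH by (simp add: Dl_def DHz T_derivative[OF DT] z(2) mat_assoc)
    then show ?thesis
      unfolding NT by (simp add: mat_ring H_def nG_def mat_assoc mat_cancel[OF GGi] GGi)
  qed
  show ?thesis
    unfolding Q_def[symmetric]
  proof (rule coord_supp)
    fix j
    define p where "p = fst (d j)"
    have Fz: "F z q = (*v) (T z ** H s ** G) ` coord {i. q \<le> fst (d i)}" for q
      unfolding FH[OF zA] z(2) filt_act_def F_eq image_image matrix_vector_mul_assoc ..
    have "(T z ** H s ** G) *v axis j 1 \<in> F z p" unfolding Fz by (rule imageI) (simp add: p_def)
    from hor[OF this] have "Dl z (axis i 1) *v ((T z ** H s ** G) *v axis j 1) \<in> F z (p - 1)" .
    also have "Dl z (axis i 1) *v ((T z ** H s ** G) *v axis j 1)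
       = (Dl z (axis i 1) ** (T z ** H s)) *v (G *v axis j 1)"
      by (simp add: matrix_vector_mul_assoc mat_assoc)
    also have "\<dots> = (T z ** G) *v ((Q + nG i ** (mat 1 + B s)) *v axis j 1)"
      unfolding DK by (simp add: matrix_vector_mul_assoc mat_assoc GiG)
    finally obtain x where x: "x \<in> coord {i. p - 1 \<le> fst (d i)}"
      "(T z ** G) *v ((Q + nG i ** (mat 1 + B s)) *v axis j 1) = (T z ** H s ** G) *v x"
      unfolding Fz by blast
    have "(Gi ** T (- z)) *v ((T z ** G) *v ((Q + nG i ** (mat 1 + B s)) *v axis j 1))
      = (Gi ** T (- z)) *v ((T z ** H s ** G) *v x)" by (simp only: x(2))
    then have "(Q + nG i ** (mat 1 + B s)) *v axis j 1 = (mat 1 + B s) *v x"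
      by (simp only: matrix_vector_mul_assoc) (simp add: mat_assoc mat_cancel[OF T_inv(2)] mat_cancel[OF GiG] GiG H_def)
    then have "V s *v ((Q + nG i ** (mat 1 + B s)) *v axis j 1) = V s *v ((mat 1 + B s) *v x)" by simp
    also have "\<dots> = x" by (simp add: matrix_vector_mul_assoc V_inv(2)[OF s(1)])
    finally have "V s ** (nG i ** (mat 1 + B s) + Q) *v axis j 1 = x"
      by (simp add: matrix_vector_mul_assoc add.commute)
    then show "V s ** (nG i ** (mat 1 + B s) + Q) *v axis j 1 \<in> coord {k. fst (d j) - 1 \<le> fst (d k)}"
      using x(1) by (simp add: p_def)
  qed
qed

text \<open>As \<open>s $ i\<close> tends to zero the derivative term disappears, because the
  partial derivatives of \<open>B\<close> stay bounded.\<close>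

lemma horizontal_zero:
  assumes s: "s \<in> polybox e" and si: "s $ i = 0"
  shows "supp (\<lambda>k l. fst (d l) - 1 \<le> fst (d k)) (V s ** (nG i ** (mat 1 + B s)))"
proof -
  obtain t where t: "\<And>k. t k \<in> polybox e" "\<And>k j. t k $ j \<noteq> 0" "t \<longlonglongrightarrow> s"
    by (rule polybox_approx[OF s e]) blast
  define Q where "Q t = D t ((2 * of_real pi * \<i> * t $ i) *s axis i 1)" for t
  have Qlim: "(\<lambda>k. Q (t k) $ a $ b) \<longlonglongrightarrow> 0" for a b
  proof (rule Lim_null_comparison)
    show "\<forall>\<^sub>F k in sequentially. norm (Q (t k) $ a $ b) \<le> 2 * pi * C * cmod (t k $ i)"
    proof (rule always_eventually, rule allI)
      fix k
      have "Q (t k) $ a $ b = 2 * of_real pi * \<i> * t k $ i * D (t k) (axis i 1) $ a $ b"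
        using BD[OF t(1)] unfolding Q_def mchol_def chol_def by blast
      then have "cmod (Q (t k) $ a $ b) = 2 * pi * cmod (t k $ i) * cmod (D (t k) (axis i 1) $ a $ b)"
        by (simp add: norm_mult)
      also have "\<dots> \<le> 2 * pi * cmod (t k $ i) * C"
        by (intro mult_left_mono order_trans[OF mnorm_entry D_bound[OF t(1)]]) auto
      finally show "norm (Q (t k) $ a $ b) \<le> 2 * pi * C * cmod (t k $ i)" by (simp add: mult_ac)
    qed
    have "(\<lambda>k. 2 * pi * C * cmod (t k $ i)) \<longlonglongrightarrow> 2 * pi * C * cmod (s $ i)"
      by (intro tendsto_mult_left tendsto_norm tendsto_vec_nth t(3))
    then show "(\<lambda>k. 2 * pi * C * cmod (t k $ i)) \<longlonglongrightarrow> 0" by (simp add: si)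
  qed
  show ?thesis
  proof (rule supp_closed[OF t(3), where X = "\<lambda>t. V t ** (nG i ** (mat 1 + B t) + Q t)"])
    show "supp (\<lambda>k l. fst (d l) - 1 \<le> fst (d k)) (V (t k) ** (nG i ** (mat 1 + B (t k)) + Q (t k)))" for k
      unfolding Q_def by (rule horizontal_nonzero[OF t(1,2)])
    fix a b
    have "(\<lambda>k. (V (t k) ** (nG i ** (mat 1 + B (t k)) + Q (t k))) $ a $ b) \<longlonglongrightarrow> (V s ** (nG i ** (mat 1 + B s) + 0)) $ a $ b"
      unfolding matrix_mult_nth vector_add_component zero_index
      by (intro tendsto_sum tendsto_mult tendsto_add tendsto_const V_limit[OF s t(3)] B_limit[OF s t(3)] Qlim)
    then show "(\<lambda>k. (V (t k) ** (nG i ** (mat 1 + B (t k)) + Q (t k))) $ a $ b) \<longlonglongrightarrow> (V s ** (nG i ** (mat 1 + B s))) $ a $ b"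
      by simp
  qed
qed

text \<open>\<open>horizontal_zero\<close> at the origin, where \<open>B\<close> vanishes.\<close>

lemma N_F0:
  assumes u: "u \<in> \<Psi> 0 p"
  shows "cmat (N i) *v u \<in> \<Psi> 0 (p - 1)"
proof -
  have "V 0 = mat 1" using V_inv(2)[OF zero_box] by (simp add: B0)
  then have "supp (\<lambda>k l. fst (d l) - 1 \<le> fst (d k)) (nG i)"
    using horizontal_zero[OF zero_box, of i] by (simp add: B0)
  moreover have "Gi *v u \<in> coord {i. p \<le> fst (d i)}" using u unfolding F_eq in_image_iff .
  ultimately have "nG i *v (Gi *v u) \<in> coord {i. p - 1 \<le> fst (d i)}"
    by (rule supp_coord) auto
  then show ?thesis
    unfolding F_eq in_image_iff by (simp add: nG_def matrix_vector_mul_assoc mat_assoc GGi)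
qed

sublocale orbit_coords W S d M "\<Psi> 0" G Gi N
  by unfold_locales (use N_commute N_W2 N_F0 in auto)

lemma nG_n: "nG = n"
  by (simp add: fun_eq_iff nG_def n_def)

text \<open>\<open>V s ** n i ** (mat 1 + B s)\<close> equals \<open>n i + V s ** R\<close> with the
  commutator \<open>R\<close>. By horizontality it lowers the first index by at most one, while
  \<open>R\<close> lowers it by at least two, so the correction vanishes.\<close>

lemma N_B_commute:
  assumes s: "s \<in> polybox e" and si: "s $ i = 0"
  shows "B s ** n i = n i ** B s"
proof -
  have n1: "supp (\<lambda>k l. fst (d l) = fst (d k) + 1) (n i)"
    by (rule supp_mono[OF n_supp]) auto
  define R where "R = n i ** B s - B s ** n i"
  have Rs: "supp (\<lambda>k l. fst (d k) < fst (d l) - 1) R"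
    unfolding R_def
    by (intro supp_diff supp_mult_gen[OF n1 B_fst[OF s]] supp_mult_gen[OF B_fst[OF s] n1]) auto
  have "V s ** (n i ** (mat 1 + B s)) = V s ** ((mat 1 + B s) ** n i + R)"
    by (simp add: R_def mat_ring)
  also have "\<dots> = n i + V s ** R"
    using V_inv(2)[OF s] by (simp add: mat_distrib_left matrix_mul_assoc)
  finally have "V s ** R = V s ** (n i ** (mat 1 + B s)) - n i" by simp
  moreover have "supp (\<lambda>k l. fst (d l) - 1 \<le> fst (d k)) \<dots>"
    using horizontal_zero[OF s si] unfolding nG_n by (intro supp_diff) (auto intro: supp_mono[OF n1])
  ultimately have "supp (\<lambda>k l. fst (d l) - 1 \<le> fst (d k)) (V s ** R)" by simp
  moreover have "supp (\<lambda>k l. fst (d k) < fst (d l) - 1) (V s ** R)"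
    by (rule supp_mult_gen[OF V_supp[OF s] Rs]) auto
  ultimately have "V s ** R = 0" by (rule supp_disjoint) auto
  then have "(mat 1 + B s) ** (V s ** R) = 0" by simp
  then have "R = 0" using V_inv(1)[OF s] by (simp add: matrix_mul_assoc)
  then show ?thesis by (simp add: R_def)
qed

section \<open>The path from the period map to the nilpotent orbit and its length\<close>

lemma T_E: "T z = G ** E z ** Gi"
  unfolding T_def by (rule mexp_eq)

definition cut :: "'r set \<Rightarrow> complex^('r::{finite,linorder}) \<Rightarrow> complex^('r::{finite,linorder})" where
  "cut Z z = (\<chi> j. if j \<in> Z then 0 else covering_map z $ j)"

text \<open>The corners of the path: coordinates in \<open>Z\<close> are set to zero in the chart,
  while the factor \<open>E z\<close> is left untouched. The empty set gives \<open>F z\<close> and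
  \<open>UNIV\<close> the nilpotent orbit.\<close>

definition point :: "'r set \<Rightarrow> complex^('r::{finite,linorder}) \<Rightarrow> 'n cfilt" where
  "point Z z = filt_act (G ** (E z ** (mat 1 + B (cut Z z))) ** Gi) (\<Psi> 0)"

lemma distance_estimate:
  obtains \<alpha> K k where "1 \<le> \<alpha>" "\<And>z. z \<in> upper_half \<Longrightarrow> (\<forall>i j. i \<le> j \<longrightarrow> Im (z $ j) \<le> Im (z $ i)) \<Longrightarrow>
    (\<forall>j. \<alpha> < Im (z $ j)) \<Longrightarrow> \<exists>L. std_path_length W S hn (F z) (nilpotent_orbit N (\<Psi> 0) z) L \<and>
      L \<le> K * (\<Sum>j\<in>UNIV. Im (z $ j) ^ k * exp (- 2 * pi * Im (z $ j)))"
proof -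
  obtain c where c: "0 \<le> c" and seg: "\<And>e A0 A1 B hn. \<Psi> 0 \<in> classifying_space W S hn \<Longrightarrow>
    supp (nilp d 1) (e - mat 1) \<Longrightarrow> supp (nilp d 1) A0 \<Longrightarrow> supp (nilp d 1) A1 \<Longrightarrow>
    (\<And>t::real. t \<in> {0..1} \<Longrightarrow> \<exists>g gi Hi. adapted d M W
        (filt_act (G ** (e ** (mat 1 + A0 + t *\<^sub>R (A1 - A0))) ** Gi) (\<Psi> 0)) (G ** g) (gi ** Gi) \<and>
      supp (nilp d 1) (g - mat 1) \<and> (e ** (mat 1 + A0 + t *\<^sub>R (A1 - A0))) ** Hi = mat 1 \<and>
      mnorm (gi ** (e ** (A1 - A0) ** Hi) ** g) \<le> B) \<Longrightarrow>
    \<exists>L. std_path_length W S hn (filt_act (G ** (e ** (mat 1 + A0)) ** Gi) (\<Psi> 0))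
        (filt_act (G ** (e ** (mat 1 + A1)) ** Gi) (\<Psi> 0)) L \<and> L \<le> c * B"
    using segment_length by blast
  \<comment> \<open>On a segment the chart matrix is bounded by the norm of \<open>A0\<close> plus
    that of \<open>A1 - A0\<close>, each of \<open>A0\<close> and \<open>A1\<close> being at most
    \<open>C\<close>.\<close>
  have "0 \<le> 3 * C" using C by simp
  then obtain C' k where C': "0 \<le> C'" and frame: "\<And>b z A. (\<And>j. b \<le> j \<Longrightarrow> 0 \<le> Im (z $ j) \<and> Im (z $ j) \<le> Im (z $ b)) \<Longrightarrow>
    1 \<le> Im (z $ b) \<Longrightarrow> supp (nilp d 1) A \<Longrightarrow> mnorm A \<le> 3 * C \<Longrightarrow>
    (\<And>i. i < b \<Longrightarrow> A ** n i = n i ** A) \<Longrightarrow>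
    \<exists>g gi Hi. adapted d M W (filt_act (G ** (E z ** (mat 1 + A)) ** Gi) (\<Psi> 0)) (G ** g) (gi ** Gi) \<and>
      supp (nilp d 1) (g - mat 1) \<and> (E z ** (mat 1 + A)) ** Hi = mat 1 \<and>
      (\<forall>\<delta>. mnorm (gi ** (E z ** \<delta> ** Hi) ** g) \<le> C' * Im (z $ b) ^ k * mnorm \<delta>)"
    using orbit_frame by blast
  \<comment> \<open>The second entry gives \<open>exp (- 2 * pi * y) < e\<close> for
    \<open>y > \<alpha>\<close>, so the chart is defined at \<open>covering_map z\<close>; the first
    gives the \<open>y \<ge> 1\<close> needed for \<open>orbit_frame\<close>.\<close>
  define \<alpha> where "\<alpha> = max 1 (- ln e / (2 * pi))"
  define K where "K = c * C' * C"
  show ?thesis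
  proof (rule that[of \<alpha> K k])
    show "1 \<le> \<alpha>" by (simp add: \<alpha>_def)
    fix z :: "complex^('r::{finite,linorder})"
    assume z: "z \<in> upper_half" and mono: "\<forall>i j. i \<le> j \<longrightarrow> Im (z $ j) \<le> Im (z $ i)"
      and big: "\<forall>j. \<alpha> < Im (z $ j)"
    have y1: "1 \<le> Im (z $ j)" for j using big[rule_format, of j] by (simp add: \<alpha>_def)
    have cov: "covering_map z \<in> polybox e"
      unfolding polybox_def
    proof clarify
      fix j
      have "- ln e / (2 * pi) < Im (z $ j)" using big[rule_format, of j] by (simp add: \<alpha>_def)
      then have "- 2 * pi * Im (z $ j) < ln e" by (simp add: field_simps)
      then have "exp (- 2 * pi * Im (z $ j)) < exp (ln e)" by (rule exp_less_mono)
      then show "cmod (covering_map z $ j) < e" unfolding covering_norm using e by simp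
    qed
    have cut: "cut Z z \<in> polybox e" for Z using cov e by (auto simp: polybox_def cut_def)
    define bd where "bd j = K * (Im (z $ j) ^ k * exp (- 2 * pi * Im (z $ j)))" for j
    have step: "\<exists>L. std_path_length W S hn (point Z z) (point (insert b Z) z) L \<and> L \<le> bd b"
      if Z: "\<And>i. i < b \<longleftrightarrow> i \<in> Z" for Z b
    proof -
      define A0 where "A0 = B (cut Z z)"
      define A1 where "A1 = B (cut (insert b Z) z)"
      have nil: "supp (nilp d 1) A0" "supp (nilp d 1) A1" unfolding A0_def A1_def by (rule B_nil[OF cut])+
      have comm: "A0 ** n i = n i ** A0" "A1 ** n i = n i ** A1" if "i < b" for i
      proof -
        have "i \<in> Z" using that Z by blast
        then have "cut Z z $ i = 0" "cut (insert b Z) z $ i = 0" by (simp_all add: cut_def)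
        then show "A0 ** n i = n i ** A0" "A1 ** n i = n i ** A1"
          unfolding A0_def A1_def by (auto simp only: intro!: N_B_commute[OF cut])
      qed
      have diff: "mnorm (A1 - A0) \<le> C * exp (- 2 * pi * Im (z $ b))"
      proof -
        have "b \<notin> Z" using Z by blast
        then have "cmod (cut (insert b Z) z $ b - cut Z z $ b) = exp (- 2 * pi * Im (z $ b))"
          by (simp add: cut_def covering_norm)
        then show ?thesis
          using B_lipschitz[OF cut cut, of b "insert b Z" Z] unfolding A0_def A1_def by (auto simp: cut_def)
      qed
      have "\<exists>g gi Hi. adapted d M W
          (filt_act (G ** (E z ** (mat 1 + A0 + t *\<^sub>R (A1 - A0))) ** Gi) (\<Psi> 0)) (G ** g) (gi ** Gi) \<and>
        supp (nilp d 1) (g - mat 1) \<and> (E z ** (mat 1 + A0 + t *\<^sub>R (A1 - A0))) ** Hi = mat 1 \<and>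
        mnorm (gi ** (E z ** (A1 - A0) ** Hi) ** g) \<le> C' * Im (z $ b) ^ k * (C * exp (- 2 * pi * Im (z $ b)))"
        if t: "t \<in> {0..1}" for t :: real
      proof -
        define A where "A = A0 + t *\<^sub>R (A1 - A0)"
        have An: "supp (nilp d 1) A" unfolding A_def by (intro supp_add supp_scaleR supp_diff nil)
        have Ab: "mnorm A \<le> 3 * C"
        proof -
          have "mnorm A \<le> mnorm A0 + \<bar>t\<bar> * mnorm (A1 - A0)"
            unfolding A_def using mnorm_add[of A0 "t *\<^sub>R (A1 - A0)"] by (simp add: mnorm_scaleR)
          also have "\<bar>t\<bar> * mnorm (A1 - A0) \<le> 1 * (mnorm A1 + mnorm A0)"
            using t by (intro mult_mono mnorm_diff) auto
          finally show ?thesis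
            using B_bound[OF cut, of Z] B_bound[OF cut, of "insert b Z"] by (simp add: A0_def A1_def)
        qed
        have Ac: "A ** n i = n i ** A" if "i < b" for i
          using comm[OF that] by (simp add: A_def mat_ring scaleR_mat_mult)
        have "0 \<le> Im (z $ j) \<and> Im (z $ j) \<le> Im (z $ b)" if "b \<le> j" for j
          using mono that y1[of j] by auto
        from frame[OF this y1 An Ab Ac] obtain g gi Hi where g: "adapted d M W (filt_act (G ** (E z ** (mat 1 + A)) ** Gi) (\<Psi> 0)) (G ** g) (gi ** Gi)"
          "supp (nilp d 1) (g - mat 1)" "(E z ** (mat 1 + A)) ** Hi = mat 1"
          "\<And>\<delta>. mnorm (gi ** (E z ** \<delta> ** Hi) ** g) \<le> C' * Im (z $ b) ^ k * mnorm \<delta>"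
          by blast
        have "C' * Im (z $ b) ^ k * mnorm (A1 - A0) \<le> C' * Im (z $ b) ^ k * (C * exp (- 2 * pi * Im (z $ b)))"
          using diff C' y1[of b] by (intro mult_left_mono) auto
        with g(4)[of "A1 - A0"] have "mnorm (gi ** (E z ** (A1 - A0) ** Hi) ** g) \<le> C' * Im (z $ b) ^ k * (C * exp (- 2 * pi * Im (z $ b)))"
          by linarith
        moreover have eq: "mat 1 + A0 + t *\<^sub>R (A1 - A0) = mat 1 + A" by (simp add: A_def add.assoc)
        ultimately show ?thesis
          unfolding eq using g(1-3) by (intro exI[of _ g] exI[of _ gi] exI[of _ Hi] conjI)
      qed
      from seg[OF \<Psi>0_cls E_unip nil this] show ?thesis
        unfolding point_def A0_def[symmetric] A1_def[symmetric] bd_def K_def by (simp add: mult_ac)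
    qed
    \<comment> \<open>The induction runs over initial segments of the index order, that is from the
      largest imaginary part down. \<open>std_path_length\<close> has no constructor for an empty
      path, so it starts with one segment.\<close>
    have path: "Z \<noteq> {} \<longrightarrow> (\<forall>i j. i \<le> j \<longrightarrow> j \<in> Z \<longrightarrow> i \<in> Z) \<longrightarrow>
      (\<exists>L. std_path_length W S hn (point {} z) (point Z z) L \<and> L \<le> (\<Sum>j\<in>Z. bd j))" for Z :: "'r set"
      using finite[of Z]
    proof (induction Z rule: finite_linorder_max_induct)
      case empty
      then show ?case by simp
    next
      case (insert b Z)
      show ?case
      proof (intro impI)
        assume down: "\<forall>i j. i \<le> j \<longrightarrow> j \<in> insert b Z \<longrightarrow> i \<in> insert b Z"
        have Z: "i < b \<longleftrightarrow> i \<in> Z" for i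
          using down insert.hyps(2) by (metis insertE insertI1 less_irrefl order_less_imp_le)
        obtain L where L: "std_path_length W S hn (point Z z) (point (insert b Z) z) L" "L \<le> bd b"
          using step[OF Z] by blast
        have bZ: "b \<notin> Z" using Z by blast
        show "\<exists>L. std_path_length W S hn (point {} z) (point (insert b Z) z) L \<and> L \<le> (\<Sum>j\<in>insert b Z. bd j)"
        proof (cases "Z = {}")
          case True
          then show ?thesis using L by auto
        next
          case False
          have "\<forall>i j. i \<le> j \<longrightarrow> j \<in> Z \<longrightarrow> i \<in> Z" using Z by (metis order_le_less_trans)
          then obtain L' where L': "std_path_length W S hn (point {} z) (point Z z) L'" "L' \<le> (\<Sum>j\<in>Z. bd j)"
            using insert.IH False by blast
          have "std_path_length W S hn (point {} z) (point (insert b Z) z) (L' + L)"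
            by (rule std_path_length.concat[OF L'(1) L(1)])
          moreover have "L' + L \<le> (\<Sum>j\<in>insert b Z. bd j)" using L' L bZ insert.hyps(1) by simp
          ultimately show ?thesis by blast
        qed
      qed
    qed
    have "point {} z = F z"
    proof -
      have "cut {} z = covering_map z" by (simp add: cut_def vec_eq_iff)
      then have "point {} z = filt_act (T z) (\<Psi> (covering_map z))"
        unfolding \<Psi>B[OF cov] filt_act_mult T_E point_def by (simp add: mat_assoc mat_cancel[OF GiG])
      then show ?thesis using F_eq_\<Psi>[OF z] by simp
    qed
    moreover have "point UNIV z = nilpotent_orbit N (\<Psi> 0) z"
    proof -
      have "cut UNIV z = 0" by (simp add: cut_def vec_eq_iff)
      then show ?thesis by (simp add: point_def B0 nilpotent_orbit_def flip: T_def T_E)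
    qed
    ultimately show "\<exists>L. std_path_length W S hn (F z) (nilpotent_orbit N (\<Psi> 0) z) L \<and>
      L \<le> K * (\<Sum>j\<in>UNIV. Im (z $ j) ^ k * exp (- 2 * pi * Im (z $ j)))"
      using path[of UNIV] by (simp add: bd_def sum_distrib_left)
  qed
qed

end

section \<open>Existence of the chart and the final estimate\<close>

lemma mnorm_le_sum:
  assumes "\<And>i j. cmod (X $ i $ j) \<le> c (i, j)"
  shows "mnorm (X :: complex^'n::finite^'n) \<le> (\<Sum>p\<in>UNIV. c p)"
proof -
  have "mnorm X \<le> (\<Sum>i\<in>UNIV. \<Sum>j\<in>UNIV. c (i, j))"
    unfolding mnorm_def by (intro sum_mono assms)
  then show ?thesis by (simp add: sum.cartesian_product flip: UNIV_Times_UNIV)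
qed

text \<open>A local holomorphic lift of \<open>\<Psi>\<close> at the origin is written in the frame
  \<open>G\<close>, normalized by \<open>flag_chart\<close>, and bounded entry by entry; the
  smallest radius and the sum of the bounds serve all entries.\<close>

lemma (in unipotent_admissible) limit_chart_exists:
  obtains d :: "'n \<Rightarrow> int \<times> int" and M G Gi e C B D where "limit_chart W S hn N F \<Psi> d M G Gi e C B D"
proof -
  obtain d :: "'n \<Rightarrow> int \<times> int" and M G Gi where pc: "polarized_coords W S d M (\<Psi> 0) G Gi"
    using limit_coords by blast
  interpret P: polarized_coords W S d M "\<Psi> 0" G Gi by (rule pc)
  obtain A g where A: "open A" "0 \<in> A" "A \<subseteq> polydisc" "flag_lift \<Psi> A 0 g" "holomorphic_matrix_on g A"
    using \<Psi>_hol zero_polydisc unfolding holomorphic_flag_map_def by blast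
  have g0: "g 0 = mat 1" and \<Psi>g: "\<And>s. s \<in> A \<Longrightarrow> invertible (g s)" "\<And>s. s \<in> A \<Longrightarrow> \<Psi> s = filt_act (g s) (\<Psi> 0)"
    using A(4) by (auto simp: flag_lift_def)
  define gt where "gt s = Gi ** g s ** G" for s
  have gt_chol: "\<exists>D. chol (\<lambda>s. gt s $ i $ j) D s" if s: "s \<in> A" for s i j
  proof -
    show ?thesis
    proof (rule holomorphic_matrix_chol[OF A(5)])
      fix D assume "\<And>z a b. z \<in> A \<Longrightarrow> chol (\<lambda>s. g s $ a $ b) (\<lambda>v. D z v $ a $ b) z"
      then have "mchol g (D s) s" using s by (simp add: mchol_def)
      from mchol_mult_const[OF this, of Gi G] show ?thesis by (auto simp: mchol_def gt_def)
    qed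
  qed
  have gt0: "gt 0 = mat 1" by (simp add: gt_def g0 P.GiG)
  have gt_inv: "invertible (gt s)" if "s \<in> A" for s
    unfolding gt_def using \<Psi>g(1)[OF that] P.GGi P.GiG
    by (intro invertible_mult) (auto simp: invertible_def)
  obtain U B where U: "open U" "0 \<in> U" "U \<subseteq> A" "B 0 = 0"
    and B_chol: "\<And>s i j. s \<in> U \<Longrightarrow> \<exists>D. chol (\<lambda>s. B s $ i $ j) D s"
    and B_supp: "\<And>s. s \<in> U \<Longrightarrow> supp (\<lambda>i j. fst (d i) < fst (d j)) (B s)"
    and B_img: "\<And>s p. s \<in> U \<Longrightarrow> (*v) (mat 1 + B s) ` coord {i. p \<le> fst (d i)} = (*v) (gt s) ` coord {i. p \<le> fst (d i)}"
    using flag_chart[of A gt d, OF A(1,2) gt_chol gt0 gt_inv] by blast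
  define D where "D s v = (\<chi> i j. (SOME D. chol (\<lambda>s. B s $ i $ j) D s) v)" for s v
  have D: "chol (\<lambda>s. B s $ i $ j) (\<lambda>v. D s v $ i $ j) s" if "s \<in> U" for s i j
    using someI_ex[OF B_chol[OF that, of i j]] by (simp add: D_def)
  have "\<forall>p. \<exists>e C. 0 < e \<and> 0 \<le> C \<and> polybox e \<subseteq> U \<and>
    (\<forall>s\<in>polybox e. cmod (B s $ fst p $ snd p) \<le> C) \<and>
    (\<forall>s\<in>polybox e. \<forall>i. cmod (D s (axis i 1) $ fst p $ snd p) \<le> C) \<and>
    (\<forall>s\<in>polybox e. \<forall>s'\<in>polybox e. \<forall>b. (\<forall>k. k \<noteq> b \<longrightarrow> s $ k = s' $ k) \<longrightarrow>
      cmod (B s $ fst p $ snd p - B s' $ fst p $ snd p) \<le> C * cmod (s $ b - s' $ b))"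
  proof
    fix p :: "'n \<times> 'n"
    show "\<exists>e C. 0 < e \<and> 0 \<le> C \<and> polybox e \<subseteq> U \<and>
      (\<forall>s\<in>polybox e. cmod (B s $ fst p $ snd p) \<le> C) \<and>
      (\<forall>s\<in>polybox e. \<forall>i. cmod (D s (axis i 1) $ fst p $ snd p) \<le> C) \<and>
      (\<forall>s\<in>polybox e. \<forall>s'\<in>polybox e. \<forall>b. (\<forall>k. k \<noteq> b \<longrightarrow> s $ k = s' $ k) \<longrightarrow>
        cmod (B s $ fst p $ snd p - B s' $ fst p $ snd p) \<le> C * cmod (s $ b - s' $ b))"
    proof (rule chol_bounds[OF U(1,2) D, of "fst p" "snd p"])
      fix e C
      assume "0 < e" "0 \<le> C" "polybox e \<subseteq> U"
        "\<And>s. s \<in> polybox e \<Longrightarrow> cmod (B s $ fst p $ snd p) \<le> C"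
        "\<And>s i. s \<in> polybox e \<Longrightarrow> cmod (D s (axis i 1) $ fst p $ snd p) \<le> C"
        "\<And>s s' b. s \<in> polybox e \<Longrightarrow> s' \<in> polybox e \<Longrightarrow> (\<And>k. k \<noteq> b \<Longrightarrow> s $ k = s' $ k) \<Longrightarrow>
          cmod (B s $ fst p $ snd p - B s' $ fst p $ snd p) \<le> C * cmod (s $ b - s' $ b)"
      then show ?thesis by (intro exI[of _ e] exI[of _ C] conjI ballI allI impI) simp_all
    qed
  qed
  then obtain ef Cf where ef: "\<And>p. 0 < ef p" "\<And>p. 0 \<le> Cf p" "\<And>p. polybox (ef p) \<subseteq> U"
    and bnd: "\<And>p s. s \<in> polybox (ef p) \<Longrightarrow> cmod (B s $ fst p $ snd p) \<le> Cf p"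
    and dbnd: "\<And>p s i. s \<in> polybox (ef p) \<Longrightarrow> cmod (D s (axis i 1) $ fst p $ snd p) \<le> Cf p"
    and lip: "\<And>p s s' b. s \<in> polybox (ef p) \<Longrightarrow> s' \<in> polybox (ef p) \<Longrightarrow> \<forall>k. k \<noteq> b \<longrightarrow> s $ k = s' $ k \<Longrightarrow>
      cmod (B s $ fst p $ snd p - B s' $ fst p $ snd p) \<le> Cf p * cmod (s $ b - s' $ b)"
    unfolding choice_iff by blast
  define e where "e = Min (range ef)"
  define C where "C = (\<Sum>p\<in>UNIV. Cf p)"
  have e: "0 < e" unfolding e_def using ef(1) by (subst Min_gr_iff) auto
  have sub: "s \<in> polybox (ef p)" if "s \<in> polybox e" for s :: "complex^('r::{finite,linorder})" and p
  proof -
    have "e \<le> ef p" unfolding e_def by (rule Min_le) auto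
    then show ?thesis using that by (auto simp: polybox_def intro: less_le_trans)
  qed
  have subU: "s \<in> U" if "s \<in> polybox e" for s using sub[OF that] ef(3) by blast
  have "limit_chart W S hn N F \<Psi> d M G Gi e C B D"
  proof
    show "0 < e" by (rule e)
    show "0 \<le> C" unfolding C_def by (intro sum_nonneg ef)
    show "polybox e \<subseteq> (polydisc :: (complex^('r::{finite,linorder})) set)" using subU U(3) A(3) by blast
    show "B 0 = 0" by (rule U(4))
    show "mchol B (D s) s" if "s \<in> polybox e" for s
      unfolding mchol_def using D[OF subU[OF that]] by blast
    show "\<Psi> s = filt_act (G ** (mat 1 + B s) ** Gi) (\<Psi> 0)" if "s \<in> polybox e" for s
    proof -
      have sU: "s \<in> U" by (rule subU[OF that])
      have img: "(*v) (X ** Y) ` Z = (*v) X ` (*v) Y ` Z" for X Y :: "complex^'n^'n" and Z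
        by (simp add: image_image matrix_vector_mul_assoc)
      have "g s ** G = G ** gt s" by (simp add: gt_def mat_assoc mat_cancel[OF P.GGi])
      then have "filt_act (g s) (\<Psi> 0) p = filt_act (G ** (mat 1 + B s) ** Gi) (\<Psi> 0) p" for p
        unfolding filt_act_def P.F_eq img[symmetric]
        by (simp add: mat_assoc P.GiG) (simp add: img B_img[OF sU])
      then have "filt_act (g s) (\<Psi> 0) = filt_act (G ** (mat 1 + B s) ** Gi) (\<Psi> 0)" by (intro ext)
      moreover have "s \<in> A" using sU U(3) by blast
      ultimately show ?thesis using \<Psi>g(2)[of s] by simp
    qed
    show "supp (\<lambda>i j. fst (d i) < fst (d j)) (B s)" if "s \<in> polybox e" for s
      by (rule B_supp[OF subU[OF that]])
    show "mnorm (B s) \<le> C" if "s \<in> polybox e" for s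
      unfolding C_def
    proof (rule mnorm_le_sum)
      show "cmod (B s $ a $ b) \<le> Cf (a, b)" for a b
        using bnd[where p = "(a, b)", OF sub[OF that]] by simp
    qed
    show "mnorm (D s (axis i 1)) \<le> C" if "s \<in> polybox e" for s i
      unfolding C_def
    proof (rule mnorm_le_sum)
      show "cmod (D s (axis i 1) $ a $ b) \<le> Cf (a, b)" for a b
        using dbnd[where p = "(a, b)", OF sub[OF that]] by simp
    qed
    show "mnorm (B s - B s') \<le> C * cmod (s $ b - s' $ b)"
      if "s \<in> polybox e" "s' \<in> polybox e" "\<And>k. k \<noteq> b \<Longrightarrow> s $ k = s' $ k" for s s' b
      unfolding C_def sum_distrib_right
    proof (rule mnorm_le_sum)
      show "cmod ((B s - B s') $ a $ c) \<le> Cf (a, c) * cmod (s $ b - s' $ b)" for a c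
        using lip[where p = "(a, c)", OF sub[OF that(1)] sub[OF that(2)], of b] that(3) by simp
    qed
  qed
  then show ?thesis by (rule that)
qed

theorem theorem4p2:
  fixes W :: "'n::finite rfilt"
    and S :: "'n forms"
    and hn :: "int \<Rightarrow> int \<Rightarrow> nat"
    and N :: "'r::{finite,linorder} \<Rightarrow> real^'n^'n"
    and F \<Psi> :: "complex ^ ('r::{finite,linorder}) \<Rightarrow> 'n cfilt"
  assumes "finite_increasing_filtration W"
    and "graded_forms W S"
    and "period_map W S hn N F"
    and "unipotent_variation W N F"
    and "admissible_with_extension W S hn N F \<Psi>"
  shows "\<exists>\<alpha> K. \<exists>\<beta> :: 'r \<Rightarrow> real. \<alpha> \<ge> 1 \<and>
    (\<forall>z\<in>upper_half.
       (\<forall>i j. i \<le> j \<longrightarrow> Im (z $ j) \<le> Im (z $ i)) \<longrightarrow> (\<forall>j. Im (z $ j) > \<alpha>) \<longrightarrow>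
       std_dist W S hn (F z) (nilpotent_orbit N (\<Psi> 0) z)
         \<le> ereal (K * (\<Sum>j\<in>UNIV. Im (z $ j) powr \<beta> j * exp (- 2 * pi * Im (z $ j)))))"
proof -
  interpret unipotent_admissible W S hn N F \<Psi>
    by unfold_locales (use assms in auto)
  obtain d :: "'n \<Rightarrow> int \<times> int" and M G Gi e C B D where "limit_chart W S hn N F \<Psi> d M G Gi e C B D"
    using limit_chart_exists by blast
  then interpret limit_chart W S hn N F \<Psi> d M G Gi e C B D .
  show ?thesis
  proof (rule distance_estimate, intro exI conjI ballI impI)
    fix \<alpha> K :: real and k
    assume \<alpha>: "1 \<le> \<alpha>" and est: "\<And>z. z \<in> upper_half \<Longrightarrow> (\<forall>i j. i \<le> j \<longrightarrow> Im (z $ j) \<le> Im (z $ i)) \<Longrightarrow>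
      (\<forall>j. \<alpha> < Im (z $ j)) \<Longrightarrow> \<exists>L. std_path_length W S hn (F z) (nilpotent_orbit N (\<Psi> 0) z) L \<and>
      L \<le> K * (\<Sum>j\<in>UNIV. Im (z $ j) ^ k * exp (- 2 * pi * Im (z $ j)))"
    show "1 \<le> \<alpha>" by (rule \<alpha>)
    fix z :: "complex^('r::{finite,linorder})"
    assume z: "z \<in> upper_half" "\<forall>i j. i \<le> j \<longrightarrow> Im (z $ j) \<le> Im (z $ i)" "\<forall>j. \<alpha> < Im (z $ j)"
    obtain L where L: "std_path_length W S hn (F z) (nilpotent_orbit N (\<Psi> 0) z) L"
      "L \<le> K * (\<Sum>j\<in>UNIV. Im (z $ j) ^ k * exp (- 2 * pi * Im (z $ j)))"
      using est[OF z] by blast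
    have "std_dist W S hn (F z) (nilpotent_orbit N (\<Psi> 0) z) \<le> ereal L"
      unfolding std_dist_def using L(1) by (intro Inf_lower) blast
    also have "\<dots> \<le> ereal (K * (\<Sum>j\<in>UNIV. Im (z $ j) ^ k * exp (- 2 * pi * Im (z $ j))))"
      using L(2) by simp
    \<comment> \<open>All \<open>\<beta> j\<close> are the single exponent \<open>k\<close> of
      \<open>orbit_frame\<close>; passing from powers to \<open>powr\<close> uses that the imaginary
      parts are positive.\<close>
    also have "(\<Sum>j\<in>UNIV. Im (z $ j) ^ k * exp (- 2 * pi * Im (z $ j)))
       = (\<Sum>j\<in>UNIV. Im (z $ j) powr (\<lambda>_. real k) j * exp (- 2 * pi * Im (z $ j)))"
    proof (rule sum.cong[OF refl])
      fix j
      have "0 < Im (z $ j)" using z(3)[rule_format, of j] \<alpha> by linarith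
      then show "Im (z $ j) ^ k * exp (- 2 * pi * Im (z $ j)) = Im (z $ j) powr (\<lambda>_. real k) j * exp (- 2 * pi * Im (z $ j))"
        by (simp add: powr_realpow)
    qed
    finally show "std_dist W S hn (F z) (nilpotent_orbit N (\<Psi> 0) z)
       \<le> ereal (K * (\<Sum>j\<in>UNIV. Im (z $ j) powr (\<lambda>_. real k) j * exp (- 2 * pi * Im (z $ j))))" .
  qed
qed

end
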